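(* Let $n\in\mathbb{N}$ (positive), $f\in L^1(D)$, $h_0\in H_b$, $h_k\in\operatorname{Re}\{(H^{p_k}(D))_b\}$ with $\frac12<p_k\le1$ for $k=1,\dots,n-1$, and $c_k\in\mathbb{R}$ for $k=0,1,\dots,n-1$. Then the Schwarz boundary value problem $$\frac{\partial^n w}{\partial\bar z^n}=f\ \text{ in } D,\qquad \operatorname{Re}\{w_b\}=\operatorname{Re}\{(h_0)_b\},$$ $$\operatorname{Re}\left\{\left(\frac{\partial^k w}{\partial\bar z^k}\right)_b\right\}=h_k\ \ (1\le k\le n-1),\qquad \operatorname{Im}\left\{\frac{\partial^k w}{\partial\bar z^k}(0)\right\}=c_k\ \ (0\le k\le n-1)$$ is solved by the function given, for $z=re^{i\theta}\in D$, by $$\begin{aligned}w(z)={}&i\sum_{k=0}^{n-1}\frac{c_k}{k!}(z+\bar z)^k-I+\frac1{2\pi}\langle(h_0)_b,P_r(\theta-\cdot)\rangle\\&+\sum_{k=1}^{n-1}\frac{(-1)^k}{2\pi\,k!}\left\langle h_k,\,(P_r(\theta-\cdot)+iQ_r(\theta-\cdot))\,(e^{i(\cdot)}-re^{i\theta}+\overline{e^{i(\cdot)}-re^{i\theta}})^k\right\rangle\\&-\frac{1}{2\pi}\iint_{|\zeta|<1}\left(\frac{f(\zeta)}{\zeta}\,\frac{\zeta+z}{\zeta-z}+\frac{\overline{f(\zeta)}}{\overline\zeta}\,\frac{1+z\overline\zeta}{1-z\overline\zeta}\right)(\zeta-z+\overline{\zeta-z})^{n-1}\,d\xi\,d\eta,\end{aligned}$$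 where $\zeta=\xi+i\eta$, $$I=\frac{i}{2\pi}\langle\operatorname{Im}\{(h_0)_b\},1\rangle,\quad P_r(\theta)=\frac{1-r^2}{1-2r\cos\theta+r^2},\quad Q_r(\theta)=\frac{2r\sin\theta}{1-2r\cos\theta+r^2}.$$
   Context: $D$ is the open unit disk in $\mathbb{C}$, $\partial D$ is the unit circle, $H(D)$ is the space of holomorphic functions on $D$, $H^p(D)$ is the classical holomorphic Hardy space on $D$, and $\mathcal{D}'(\partial D)$ is the space of distributions on $\partial D$. Functions $\varphi\in C^\infty(\partial D)$ are identified with smooth $2\pi$-periodic functions of $\theta$. Derivatives $\partial^k/\partial\bar z^k$ are understood in the weak (distributional) sense. Boundary value in the sense of distributions: a function $g$ on $D$ has a boundary value in the sense of distributions, denoted $g_b\in\mathcal{D}'(\partial D)$, if for every $\varphi\in C^\infty(\partial D)$ the limit $$\langle g_b,\varphi\rangle:=\lim_{r\nearrow1}\int_0^{2\pi}g(re^{i\theta})\,\varphi(\theta)\,d\theta$$ exists. $H_b$ is the set of functions in $H(D)$ that have a boundary value in the sense of distributions. For a distribution $u$, $\operatorname{Re}u$ and $\operatorname{Im}u$ are the real-valued distributions with $u=\operatorname{Re}u+i\operatorname{Im}u$, i.e. $\langle\operatorname{Re}u,\varphi\rangle=\operatorname{Re}\langle u,\varphi\rangle$ and $\langle\operatorname{Im}u,\varphi\rangle=\operatorname{Im}\langle u,\varphi\rangle$ for real-valued $\varphi$. It is known that every function in $H^p(D)$, $0<p\le1$, has a boundary value in the sense of distributions; $\operatorname{Re}\{(H^p(D))_b\}$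 denotes the set of real parts $\operatorname{Re}\{g_b\}$ with $g\in H^p(D)$.
   Formalization: The area integral has coefficient (-1)^n/(2π(n-1)!) instead of -1/(2π), which is wrong for n≥2; f(ζ)/ζ∈L¹(D) is assumed besides f∈L¹(D), since otherwise the integral can diverge; boundary limits r→1 are taken off a null set of radii. *)

theory Defs
  imports "HOL-Complex_Analysis.Complex_Analysis"
begin

text \<open>Test functions on the circle: smooth \<open>2\<pi>\<close>-periodic functions of the angle.\<close>

definition circle_test :: "(real \<Rightarrow> complex) set" where
  "circle_test = {\<phi>. (\<forall>t. \<phi> (t + 2 * pi) = \<phi> t) \<and>
     (\<forall>m t. ((\<lambda>\<psi> s. vector_derivative \<psi> (at s)) ^^ m) \<phi> differentiable (at t))}"

text \<open>Functionals on the test functions are kept extensional, so that two of them are equal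
  iff they agree on test functions. A pointwise limit of the continuous linear functionals
  \<open>circle_pairing g r\<close> is again linear and, by the Banach-Steinhaus theorem, continuous, so a
  boundary value in the sense below is automatically a distribution.\<close>

type_synonym circle_functional = "(real \<Rightarrow> complex) \<Rightarrow> complex"

definition circle_pairing :: "(complex \<Rightarrow> complex) \<Rightarrow> real \<Rightarrow> circle_functional" where
  "circle_pairing g r \<phi> =
     (LINT \<theta>:{0..2*pi}|lebesgue. g (complex_of_real r * cis \<theta>) * \<phi> \<theta>)"

text \<open>The boundary value is also taken of weak derivatives, which are defined almost everywhere
  only, and such a function need not be integrable on every circle. The limit \<open>r \<nearrow> 1\<close> is therefore
  taken outside a null set \<open>N\<close> of radii; this makes the notion invariant under changes on null
  sets. For continuous functions it is the ordinary limit, see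
  \<open>has_distr_bv_continuous\<close>.\<close>

definition has_distr_bv :: "(complex \<Rightarrow> complex) \<Rightarrow> circle_functional \<Rightarrow> bool" where
  "has_distr_bv g u \<longleftrightarrow> u \<in> extensional circle_test \<and>
     (\<exists>N\<in>null_sets lebesgue.
        (\<forall>r\<in>{0<..<1} - N.
           set_integrable lebesgue {0..2*pi} (\<lambda>\<theta>. g (complex_of_real r * cis \<theta>))) \<and>
        (\<forall>\<phi>\<in>circle_test.
           ((\<lambda>r. circle_pairing g r \<phi>) \<longlongrightarrow> u \<phi>) (at 1 within {0<..<1} - N)))"

definition distr_bv :: "(complex \<Rightarrow> complex) \<Rightarrow> circle_functional" where
  "distr_bv g = (THE u. has_distr_bv g u)"

lemma negligible_meets_open:
  fixes S :: "real set"
  assumes "open S" "S \<noteq> {}" "N \<in> null_sets lebesgue"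
  obtains x where "x \<in> S" "x \<notin> N"
proof -
  have "\<not> S \<subseteq> N"
    using assms negligible_iff_null_sets negligible_subset open_not_negligible by blast
  then show thesis using that by blast
qed

lemma at_within_conull_neq_bot:
  assumes "N \<in> null_sets lebesgue"
  shows "at (1::real) within {0<..<1} - N \<noteq> bot"
proof -
  have "\<exists>x\<in>{0<..<1} - N. x \<noteq> 1 \<and> dist x 1 < e" if "e > 0" for e
  proof -
    have "max 0 (1 - e) < 1" using that by simp
    then have "{max 0 (1 - e)<..<1} \<noteq> {}" by (simp add: dense)
    from negligible_meets_open[OF open_greaterThanLessThan this assms]
    obtain x where "x \<in> {max 0 (1 - e)<..<1}" "x \<notin> N" .
    then show ?thesis by (intro bexI[of _ x]) (auto simp: dist_real_def)
  qed
  then have "1 islimpt ({0<..<1} - N)" by (auto simp: islimpt_approachable)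
  then show ?thesis by (simp add: trivial_limit_within)
qed

lemma has_distr_bv_unique:
  assumes "has_distr_bv g u" "has_distr_bv g v"
  shows "u = v"
proof -
  from assms(1) obtain N where N: "N \<in> null_sets lebesgue" and
    uN: "\<And>\<phi>. \<phi> \<in> circle_test \<Longrightarrow>
      ((\<lambda>r. circle_pairing g r \<phi>) \<longlongrightarrow> u \<phi>) (at 1 within {0<..<1} - N)"
    unfolding has_distr_bv_def by blast
  from assms(2) obtain M where M: "M \<in> null_sets lebesgue" and
    vM: "\<And>\<phi>. \<phi> \<in> circle_test \<Longrightarrow>
      ((\<lambda>r. circle_pairing g r \<phi>) \<longlongrightarrow> v \<phi>) (at 1 within {0<..<1} - M)"
    unfolding has_distr_bv_def by blast
  have nb: "at 1 within {0<..<1} - (N \<union> M) \<noteq> bot"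
    using N M by (intro at_within_conull_neq_bot null_sets.Un)
  show ?thesis
  proof (rule extensionalityI[where A = circle_test])
    show "u \<in> extensional circle_test" "v \<in> extensional circle_test"
      using assms by (auto simp: has_distr_bv_def)
    fix \<phi> assume \<phi>: "\<phi> \<in> circle_test"
    show "u \<phi> = v \<phi>"
      by (rule tendsto_unique[OF nb])
        (rule tendsto_within_subset[OF uN[OF \<phi>]] tendsto_within_subset[OF vM[OF \<phi>]]; blast)+
  qed
qed

lemma distr_bv_eq: "has_distr_bv g u \<Longrightarrow> distr_bv g = u"
  unfolding distr_bv_def using has_distr_bv_unique by blast

lemma circle_test_continuous: "\<phi> \<in> circle_test \<Longrightarrow> continuous_on S \<phi>"
proof -
  assume "\<phi> \<in> circle_test"
  then have "((\<lambda>\<psi> s. vector_derivative \<psi> (at s)) ^^ 0) \<phi> differentiable (at t)" for t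
    unfolding circle_test_def by blast
  then have "\<phi> differentiable (at t)" for t by simp
  then show ?thesis
    by (meson continuous_at_imp_continuous_on differentiable_imp_continuous_within)
qed

lemma circle_integrand_integrable:
  fixes g :: "complex \<Rightarrow> complex" and \<phi> :: "real \<Rightarrow> complex"
  assumes "continuous_on (ball 0 1) g" "continuous_on {0..2*pi} \<phi>" "r \<in> {0<..<1}"
  shows "set_integrable lebesgue {0..2*pi} (\<lambda>\<theta>. g (complex_of_real r * cis \<theta>) * \<phi> \<theta>)"
proof -
  have "continuous_on {0..2*pi} (\<lambda>\<theta>. g (complex_of_real r * cis \<theta>) * \<phi> \<theta>)"
    by (intro continuous_intros assms(2) continuous_on_compose2[OF assms(1)])
      (use assms(3) in \<open>auto simp: norm_mult\<close>)
  then show ?thesis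
    using absolutely_integrable_continuous_real by blast
qed

lemma circle_pairing_continuous:
  assumes "continuous_on (ball 0 1) g" "\<phi> \<in> circle_test"
  shows "continuous_on {0<..<1} (\<lambda>r. circle_pairing g r \<phi>)"
proof -
  have c: "continuous_on S \<phi>" for S using assms(2) by (rule circle_test_continuous)
  have "continuous_on {0<..<1} (\<lambda>r. integral (cbox 0 (2*pi))
          (\<lambda>\<theta>. g (complex_of_real r * cis \<theta>) * \<phi> \<theta>))"
  proof (rule integral_continuous_on_param)
    show "continuous_on ({0<..<1} \<times> cbox 0 (2*pi))
        (\<lambda>(r, \<theta>). g (complex_of_real r * cis \<theta>) * \<phi> \<theta>)"
      unfolding case_prod_beta
      by (intro continuous_intros continuous_on_compose2[OF assms(1)]
            continuous_on_compose2[OF c[of UNIV]])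
        (auto simp: norm_mult)
  qed
  moreover have "circle_pairing g r \<phi> =
      integral (cbox 0 (2*pi)) (\<lambda>\<theta>. g (complex_of_real r * cis \<theta>) * \<phi> \<theta>)"
    if "r \<in> {0<..<1}" for r
    unfolding circle_pairing_def
    using circle_integrand_integrable[OF assms(1) c that] set_lebesgue_integral_eq_integral(2)
    by fastforce
  ultimately show ?thesis by (subst continuous_on_cong[OF refl]) auto
qed

lemma has_distr_bv_continuous:
  assumes g: "continuous_on (ball 0 1) g"
  shows "has_distr_bv g u \<longleftrightarrow> u \<in> extensional circle_test \<and>
    (\<forall>\<phi>\<in>circle_test. ((\<lambda>r. circle_pairing g r \<phi>) \<longlongrightarrow> u \<phi>) (at_left 1))"
proof (intro iffI conjI ballI)
  assume "has_distr_bv g u"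
  then show "u \<in> extensional circle_test" by (simp add: has_distr_bv_def)
next
  fix \<phi> assume u: "has_distr_bv g u" and \<phi>: "\<phi> \<in> circle_test"
  let ?F = "\<lambda>r. circle_pairing g r \<phi>"
  from u \<phi> obtain N where N: "N \<in> null_sets lebesgue" and
    lim: "(?F \<longlongrightarrow> u \<phi>) (at 1 within {0<..<1} - N)"
    unfolding has_distr_bv_def by blast
  show "(?F \<longlongrightarrow> u \<phi>) (at_left 1)"
  proof (rule tendstoI)
    fix e :: real assume "e > 0"
    then have "\<forall>\<^sub>F r in at 1 within {0<..<1} - N. dist (?F r) (u \<phi>) < e / 2"
      using lim by (intro tendstoD) auto
    then obtain d where d: "d > 0"
      "\<And>r. r \<in> {0<..<1} - N \<Longrightarrow> r \<noteq> 1 \<Longrightarrow> dist r 1 < d \<Longrightarrow> dist (?F r) (u \<phi>) < e / 2"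
      unfolding eventually_at by blast
    let ?J = "{max 0 (1 - d)<..<1}"
    have J: "dist (?F r) (u \<phi>) \<le> e / 2" if r: "r \<in> ?J" for r
    proof (rule ccontr)
      assume far: "\<not> ?thesis"
      define S where "S = {s \<in> ?J. e / 2 < dist (?F s) (u \<phi>)}"
      have "continuous_on ?J (\<lambda>s. dist (?F s) (u \<phi>))"
        by (intro continuous_intros continuous_on_subset[OF circle_pairing_continuous[OF g \<phi>]]) auto
      then have "open (?J \<inter> (\<lambda>s. dist (?F s) (u \<phi>)) -` {e / 2 <..})"
        by (intro continuous_open_preimage) auto
      moreover have "?J \<inter> (\<lambda>s. dist (?F s) (u \<phi>)) -` {e / 2 <..} = S"
        by (auto simp: S_def)
      ultimately have "open S" by simp
      moreover have "S \<noteq> {}" using r far by (auto simp: S_def)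
      ultimately obtain s where "s \<in> S" "s \<notin> N"
        using negligible_meets_open N by blast
      then show False using d(2)[of s] by (force simp: S_def dist_real_def)
    qed
    have "max 0 (1 - d) < 1" using d(1) by simp
    then have "\<forall>\<^sub>F r in at_left 1. r \<in> ?J"
      by (rule eventually_at_left_real)
    then show "\<forall>\<^sub>F r in at_left 1. dist (?F r) (u \<phi>) < e"
    proof eventually_elim
      case (elim r)
      from J[OF this] \<open>e > 0\<close> show ?case by linarith
    qed
  qed
next
  assume u: "u \<in> extensional circle_test \<and>
    (\<forall>\<phi>\<in>circle_test. ((\<lambda>r. circle_pairing g r \<phi>) \<longlongrightarrow> u \<phi>) (at_left 1))"
  show "has_distr_bv g u"
    unfolding has_distr_bv_def
  proof (intro conjI bexI[of _ "{}"] ballI)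
    fix r :: real assume "r \<in> {0<..<1} - {}"
    then show "set_integrable lebesgue {0..2*pi} (\<lambda>\<theta>. g (complex_of_real r * cis \<theta>))"
      using circle_integrand_integrable[OF g, of "\<lambda>_. 1" r] by simp
  next
    fix \<phi> assume "\<phi> \<in> circle_test"
    then have "((\<lambda>r. circle_pairing g r \<phi>) \<longlongrightarrow> u \<phi>) (at_left 1)" using u by blast
    then show "((\<lambda>r. circle_pairing g r \<phi>) \<longlongrightarrow> u \<phi>) (at 1 within {0<..<1} - {})"
      by (rule tendsto_within_subset) auto
  qed (use u in auto)
qed

definition boundary_values :: "(complex \<Rightarrow> complex) set \<Rightarrow> circle_functional set" where
  "boundary_values A = {u. \<exists>g\<in>A. has_distr_bv g u}"

definition H_b :: "(complex \<Rightarrow> complex) set" where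
  "H_b = {g. g holomorphic_on ball 0 1 \<and> (\<exists>u. has_distr_bv g u)}"

definition hardy :: "real \<Rightarrow> (complex \<Rightarrow> complex) set" where
  "hardy p = {g. g holomorphic_on ball 0 1 \<and>
     bdd_above ((\<lambda>r. LINT \<theta>:{0..2*pi}|lebesgue. cmod (g (complex_of_real r * cis \<theta>)) powr p)
       ` {0<..<1})}"

text \<open>\<open>Re u\<close> and \<open>Im u\<close> are prescribed on real-valued test functions; these are their
  complex-linear extensions, needed since they get paired with complex-valued kernels.\<close>

definition Re_distr :: "circle_functional \<Rightarrow> circle_functional" where
  "Re_distr u = restrict (\<lambda>\<phi>.
     complex_of_real (Re (u (\<lambda>t. complex_of_real (Re (\<phi> t))))) +
     \<i> * complex_of_real (Re (u (\<lambda>t. complex_of_real (Im (\<phi> t)))))) circle_test"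

definition Im_distr :: "circle_functional \<Rightarrow> circle_functional" where
  "Im_distr u = restrict (\<lambda>\<phi>.
     complex_of_real (Im (u (\<lambda>t. complex_of_real (Re (\<phi> t))))) +
     \<i> * complex_of_real (Im (u (\<lambda>t. complex_of_real (Im (\<phi> t)))))) circle_test"

definition partial_x :: "(complex \<Rightarrow> complex) \<Rightarrow> complex \<Rightarrow> complex" where
  "partial_x \<phi> z = frechet_derivative \<phi> (at z) 1"

definition partial_y :: "(complex \<Rightarrow> complex) \<Rightarrow> complex \<Rightarrow> complex" where
  "partial_y \<phi> z = frechet_derivative \<phi> (at z) \<i>"

definition dbar :: "(complex \<Rightarrow> complex) \<Rightarrow> complex \<Rightarrow> complex" where
  "dbar \<phi> z = (partial_x \<phi> z + \<i> * partial_y \<phi> z) / 2"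

definition disc_test :: "(complex \<Rightarrow> complex) set" where
  "disc_test = {\<phi>. (\<forall>i j z. (partial_x ^^ i) ((partial_y ^^ j) \<phi>) differentiable (at z)) \<and>
     compact (closure {z. \<phi> z \<noteq> 0}) \<and> closure {z. \<phi> z \<noteq> 0} \<subseteq> ball 0 1}"

definition locally_integrable :: "(complex \<Rightarrow> complex) \<Rightarrow> bool" where
  "locally_integrable g \<longleftrightarrow>
     (\<forall>K. compact K \<longrightarrow> K \<subseteq> ball 0 1 \<longrightarrow> set_integrable lebesgue K g)"

definition weak_dbar :: "nat \<Rightarrow> (complex \<Rightarrow> complex) \<Rightarrow> (complex \<Rightarrow> complex) \<Rightarrow> bool" where
  "weak_dbar k w g \<longleftrightarrow> locally_integrable w \<and> locally_integrable g \<and>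
     (\<forall>\<phi>\<in>disc_test. (LINT z:ball 0 1|lebesgue. w z * (dbar ^^ k) \<phi> z) =
        (-1) ^ k * (LINT z:ball 0 1|lebesgue. g z * \<phi> z))"

definition lebesgue_point :: "(complex \<Rightarrow> complex) \<Rightarrow> complex \<Rightarrow> bool" where
  "lebesgue_point g a \<longleftrightarrow>
     ((\<lambda>\<epsilon>. (LINT z:cball a \<epsilon>|lebesgue. cmod (g z - g a)) / measure lebesgue (cball a \<epsilon>))
        \<longlongrightarrow> 0) (at_right 0)"

text \<open>\<open>W k\<close> is a representative of the \<open>k\<close>-th weak derivative. Requiring \<open>0\<close> to be a Lebesgue
  point of it makes \<open>W k 0\<close> independent of the choice of representative.\<close>

definition solves_schwarz_bvp ::
  "nat \<Rightarrow> (complex \<Rightarrow> complex) \<Rightarrow> circle_functional \<Rightarrow> (nat \<Rightarrow> circle_functional) \<Rightarrow>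
   (nat \<Rightarrow> real) \<Rightarrow> (complex \<Rightarrow> complex) \<Rightarrow> bool" where
  "solves_schwarz_bvp n f h0 h c w \<longleftrightarrow>
     weak_dbar n w f \<and>
     (\<exists>W. W 0 = w \<and>
        (\<forall>k<n. weak_dbar k w (W k)) \<and>
        (\<exists>u. has_distr_bv w u \<and> Re_distr u = h0) \<and>
        (\<forall>k\<in>{1..n-1}. \<exists>u. has_distr_bv (W k) u \<and> Re_distr u = h k) \<and>
        (\<forall>k<n. lebesgue_point (W k) 0 \<and> Im (W k 0) = c k))"

definition poisson :: "real \<Rightarrow> real \<Rightarrow> real" where
  "poisson r \<theta> = (1 - r\<^sup>2) / (1 - 2 * r * cos \<theta> + r\<^sup>2)"

definition conj_poisson :: "real \<Rightarrow> real \<Rightarrow> real" where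
  "conj_poisson r \<theta> = 2 * r * sin \<theta> / (1 - 2 * r * cos \<theta> + r\<^sup>2)"

text \<open>The choice of the angle \<open>\<theta>\<close> is irrelevant, the kernels being \<open>2\<pi>\<close>-periodic.
  The factor \<open>(-1)^n / (n-1)!\<close> of the area integral (equal to \<open>-1\<close> for \<open>n = 1\<close>) is the
  one for which the \<open>n\<close>-th derivative is \<open>f\<close>: each of \<open>n - 1\<close> differentiations
  in the conjugate variable lowers the exponent \<open>m\<close> of the last factor by one and produces \<open>-m\<close>,
  and what remains after all of them must be \<open>-1/(2\<pi>)\<close> times the integral for \<open>n = 1\<close>.\<close>

definition schwarz_solution ::
  "nat \<Rightarrow> (complex \<Rightarrow> complex) \<Rightarrow> circle_functional \<Rightarrow> (nat \<Rightarrow> circle_functional) \<Rightarrow>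
   (nat \<Rightarrow> real) \<Rightarrow> complex \<Rightarrow> complex" where
  "schwarz_solution n f (u0 :: circle_functional) (h :: nat \<Rightarrow> circle_functional) c z = (let r = cmod z; \<theta> = Arg z in
     \<i> * (\<Sum>k=0..n-1. complex_of_real (c k) / fact k * (z + cnj z) ^ k)
     - \<i> / (2 * complex_of_real pi) * Im_distr u0 (\<lambda>t. 1)
     + 1 / (2 * complex_of_real pi) * u0 (\<lambda>t. complex_of_real (poisson r (\<theta> - t)))
     + (\<Sum>k=1..n-1. (-1) ^ k / (2 * complex_of_real pi * fact k) *
          h k (\<lambda>t. (complex_of_real (poisson r (\<theta> - t)) +
                    \<i> * complex_of_real (conj_poisson r (\<theta> - t))) *
                  (cis t - z + cnj (cis t - z)) ^ k))
     + (-1) ^ n / (2 * complex_of_real pi * fact (n - 1)) *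
         (LINT \<zeta>:ball 0 1|lebesgue.
            (f \<zeta> / \<zeta> * ((\<zeta> + z) / (\<zeta> - z)) +
             cnj (f \<zeta>) / cnj \<zeta> * ((1 + z * cnj \<zeta>) / (1 - z * cnj \<zeta>))) *
            (\<zeta> - z + cnj (\<zeta> - z)) ^ (n - 1)))"

end

theory Submission
  imports Defs "HOL-Probability.Distributions" "HOL-Real_Asymp.Real_Asymp"
begin

text \<open>Write \<open>K z \<zeta> = (\<zeta> + z) / (\<zeta> - z)\<close> and \<open>X = 2 Re (\<zeta> - z)\<close>. On the circle \<open>K\<close> is \<open>P + i Q\<close>, and
  the real part \<open>h\<close> of the boundary value of a holomorphic \<open>g\<close> satisfies
  \<open>h (K z) = 2 \<pi> (g z - i Im (g 0))\<close>. Since \<open>K\<close> and the reflected kernel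
  \<open>R z \<zeta> = (1 + z cnj \<zeta>) / (1 - z cnj \<zeta>)\<close> of the area integral are holomorphic in \<open>z\<close> away from the
  pole, the conjugate derivative acts on the powers of \<open>X\<close> and of \<open>z + cnj z\<close> only and lowers their
  exponents by one. Hence the \<open>k\<close>-th derivative of the solution is the same expression with the data
  of index \<open>j \<ge> k\<close> and with all exponents lowered by \<open>k\<close>, and the last differentiation, of the area
  term with exponent \<open>0\<close>, gives \<open>f\<close> by the Cauchy-Pompeiu formula.

  For the boundary conditions it remains to see that only the term of index \<open>k\<close> contributes to the
  real part of the boundary value. For \<open>|\<zeta>| = 1\<close> one has
  \<open>K X = (1/z - cnj z) K + (z - 1/z) + (\<zeta> - 1/\<zeta>)\<close>, whose first summand disappears at the boundary
  and whose remaining summands are imaginary there; and \<open>R = - cnj K\<close> for \<open>|z| = 1\<close> makes the boundary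
  value of the area term imaginary. Finally \<open>K = R = 1\<close> at \<open>z = 0\<close>, so that there the imaginary part comes
  from the constants \<open>c\<close> alone.\<close>

section \<open>Test functions on the circle\<close>

text \<open>A functional \<open>h\<close> is kept as a bare linear map, so limits and derivatives
  cannot be taken under \<open>h\<close>. The dependence on z is therefore moved outside first: X =
  2 cos t - (z + cnj z) is expanded, and what is left are pairings with K, which Cauchy's formula
  evaluates because the data come from holomorphic functions.

  The area term has another difficulty: its density is merely in L^1. The potential may be
  discontinuous, and even non-integrable on some circles, and the integral of |K| over a circle
  grows without bound as \<zeta> approaches it. What survives is cancellation: tested against a
  smooth \<phi>, the kernel integrates over the circle to a quantity bounded uniformly in r and
  \<zeta>, and dominated convergence with a multiple of |F| yields the boundary value. The absolute
  integrability behind Fubini is a separate matter; it holds for almost every r, by sharing the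
  singularity 1/|\<zeta> - z| between the radial and the angular distance. At the origin, continuity
  is replaced by averaging over small discs before estimating.\<close>

definition smooth_line :: "(real \<Rightarrow> complex) set" where
  "smooth_line = {\<phi>. \<forall>m t. ((\<lambda>\<psi> s. vector_derivative \<psi> (at s)) ^^ m) \<phi> differentiable (at t)}"

lemma circle_test_iff: "\<phi> \<in> circle_test \<longleftrightarrow> \<phi> \<in> smooth_line \<and> (\<forall>t. \<phi> (t + 2 * pi) = \<phi> t)"
  by (auto simp: circle_test_def smooth_line_def)

text \<open>Iterated derivatives rarely have manageable closed formulas. A class of differentiable
  functions closed under differentiation contains all of them at once, so smoothness reduces to
  choosing such a class.\<close>

lemma smooth_line_coinduct:
  assumes "\<phi> \<in> A" "\<And>f t. f \<in> A \<Longrightarrow> f differentiable (at t)"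
    and "\<And>f. f \<in> A \<Longrightarrow> (\<lambda>s. vector_derivative f (at s)) \<in> A"
  shows "\<phi> \<in> smooth_line"
proof -
  have "((\<lambda>\<psi> s. vector_derivative \<psi> (at s)) ^^ m) \<phi> \<in> A" for m
    by (induction m) (use assms in auto)
  with assms(2) show ?thesis by (auto simp: smooth_line_def)
qed

lemma smooth_line_differentiable: "\<phi> \<in> smooth_line \<Longrightarrow> \<phi> differentiable (at t)"
  unfolding smooth_line_def by (metis (mono_tags, lifting) funpow_0 mem_Collect_eq)

lemma smooth_line_has_vector_derivative:
  "\<phi> \<in> smooth_line \<Longrightarrow> (\<phi> has_vector_derivative vector_derivative \<phi> (at t)) (at t)"
  using smooth_line_differentiable vector_derivative_works by blast

lemma smooth_line_derivative:
  assumes "\<phi> \<in> smooth_line"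
  shows "(\<lambda>s. vector_derivative \<phi> (at s)) \<in> smooth_line"
  unfolding smooth_line_def
proof (safe)
  fix m t
  have "((\<lambda>\<psi> s. vector_derivative \<psi> (at s)) ^^ Suc m) \<phi> differentiable (at t)"
    using assms by (simp only: smooth_line_def mem_Collect_eq)
  then show "((\<lambda>\<psi> s. vector_derivative \<psi> (at s)) ^^ m)
      (\<lambda>s. vector_derivative \<phi> (at s)) differentiable (at t)"
    by (simp only: funpow_Suc_right o_def)
qed

text \<open>The Leibniz rule leads out of the products of two smooth functions but not out of their
  finite sums, so this is the class to which \<open>smooth_line_coinduct\<close> applies.\<close>

inductive_set product_sums :: "(real \<Rightarrow> complex) set" where
  mult: "f \<in> smooth_line \<Longrightarrow> g \<in> smooth_line \<Longrightarrow> (\<lambda>t. f t * g t) \<in> product_sums"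
| add: "p \<in> product_sums \<Longrightarrow> q \<in> product_sums \<Longrightarrow> (\<lambda>t. p t + q t) \<in> product_sums"

lemma product_sums_derivative:
  assumes "p \<in> product_sums"
  shows "(\<forall>t. p differentiable (at t)) \<and> (\<lambda>s. vector_derivative p (at s)) \<in> product_sums"
  using assms
proof induction
  case (mult f g)
  have d: "((\<lambda>t. f t * g t) has_vector_derivative
      f s * vector_derivative g (at s) + vector_derivative f (at s) * g s) (at s)" for s
    by (intro has_vector_derivative_mult smooth_line_has_vector_derivative mult)
  have "(\<lambda>s. f s * vector_derivative g (at s) + vector_derivative f (at s) * g s) \<in> product_sums"
    by (intro product_sums.intros smooth_line_derivative mult)
  with d show ?case
    by (auto simp: vector_derivative_at[OF d] intro: differentiableI_vector)
next
  case (add p q)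
  have d: "((\<lambda>t. p t + q t) has_vector_derivative
      vector_derivative p (at s) + vector_derivative q (at s)) (at s)" for s
    by (intro has_vector_derivative_add) (use add in \<open>auto simp: vector_derivative_works\<close>)
  with add show ?case
    by (auto simp: vector_derivative_at[OF d] intro: differentiableI_vector product_sums.intros)
qed

lemma product_sums_smooth: "p \<in> product_sums \<Longrightarrow> p \<in> smooth_line"
  by (rule smooth_line_coinduct[of _ product_sums]) (auto simp: product_sums_derivative)

lemma smooth_line_mult: "f \<in> smooth_line \<Longrightarrow> g \<in> smooth_line \<Longrightarrow> (\<lambda>t. f t * g t) \<in> smooth_line"
  by (rule product_sums_smooth[OF product_sums.mult])

lemma smooth_line_const: "(\<lambda>t. c) \<in> smooth_line"
  by (rule smooth_line_coinduct[of _ "range (\<lambda>c t. c)"]) auto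

lemma smooth_line_add:
  assumes "f \<in> smooth_line" "g \<in> smooth_line" shows "(\<lambda>t. f t + g t) \<in> smooth_line"
proof -
  \<comment> \<open>Products with the constant 1 bring sums under the class already treated.\<close>
  have "(\<lambda>t. f t * 1 + g t * 1) \<in> product_sums"
    by (intro product_sums.intros assms smooth_line_const)
  then show ?thesis by (auto dest: product_sums_smooth)
qed

lemma smooth_line_Re:
  assumes "f \<in> smooth_line" shows "(\<lambda>t. complex_of_real (Re (f t))) \<in> smooth_line"
proof (rule smooth_line_coinduct[of _ "(\<lambda>f t. complex_of_real (Re (f t))) ` smooth_line"])
  have d: "((\<lambda>t. complex_of_real (Re (f t))) has_vector_derivative
        complex_of_real (Re (vector_derivative f (at s)))) (at s)" if "f \<in> smooth_line" for f s
    using bounded_linear.has_vector_derivative[OF bounded_linear_compose[OF bounded_linear_of_real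
        bounded_linear_Re] smooth_line_has_vector_derivative[OF that]] .
  fix g assume "g \<in> (\<lambda>f t. complex_of_real (Re (f t))) ` smooth_line"
  then obtain f where f: "f \<in> smooth_line" "g = (\<lambda>t. complex_of_real (Re (f t)))" by blast
  show "g differentiable (at t)" for t
    unfolding f(2) using d[OF f(1)] differentiableI_vector by blast
  show "(\<lambda>s. vector_derivative g (at s)) \<in> (\<lambda>f t. complex_of_real (Re (f t))) ` smooth_line"
    unfolding f(2) using smooth_line_derivative[OF f(1)]
    by (auto simp: vector_derivative_at[OF d[OF f(1)]])
qed (use assms in auto)

lemma circle_test_periodic: "\<phi> \<in> circle_test \<Longrightarrow> \<phi> (t + 2 * pi) = \<phi> t"
  by (simp add: circle_test_iff)

lemma circle_test_const [simp, intro]: "(\<lambda>t. c) \<in> circle_test"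
  by (simp add: circle_test_iff smooth_line_const)

lemma circle_test_add [intro]:
  "\<phi> \<in> circle_test \<Longrightarrow> \<psi> \<in> circle_test \<Longrightarrow> (\<lambda>t. \<phi> t + \<psi> t) \<in> circle_test"
  by (simp add: circle_test_iff smooth_line_add)

lemma circle_test_mult [intro]:
  "\<phi> \<in> circle_test \<Longrightarrow> \<psi> \<in> circle_test \<Longrightarrow> (\<lambda>t. \<phi> t * \<psi> t) \<in> circle_test"
  by (simp add: circle_test_iff smooth_line_mult)

lemma circle_test_diff [intro]:
  assumes "\<phi> \<in> circle_test" "\<psi> \<in> circle_test" shows "(\<lambda>t. \<phi> t - \<psi> t) \<in> circle_test"
proof -
  have "(\<lambda>t. \<phi> t + (- 1) * \<psi> t) \<in> circle_test"
    using assms by (intro circle_test_add circle_test_mult circle_test_const)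
  then show ?thesis by simp
qed

lemma circle_test_power [intro]: "\<phi> \<in> circle_test \<Longrightarrow> (\<lambda>t. \<phi> t ^ n) \<in> circle_test"
  by (induction n) auto

lemma circle_test_Re [intro]:
  "\<phi> \<in> circle_test \<Longrightarrow> (\<lambda>t. complex_of_real (Re (\<phi> t))) \<in> circle_test"
  by (simp add: circle_test_iff smooth_line_Re)

lemma circle_test_cnj [intro]:
  assumes "\<phi> \<in> circle_test" shows "(\<lambda>t. cnj (\<phi> t)) \<in> circle_test"
proof -
  have "(\<lambda>t. 2 * complex_of_real (Re (\<phi> t)) - \<phi> t) \<in> circle_test"
    by (intro circle_test_diff circle_test_mult circle_test_const circle_test_Re assms)
  moreover have "2 * complex_of_real (Re (\<phi> t)) - \<phi> t = cnj (\<phi> t)" for t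
    by (simp add: complex_eq_iff)
  ultimately show ?thesis by simp
qed

lemma circle_test_Im [intro]:
  assumes "\<phi> \<in> circle_test" shows "(\<lambda>t. complex_of_real (Im (\<phi> t))) \<in> circle_test"
proof -
  have "(\<lambda>t. complex_of_real (Re (- \<i> * \<phi> t))) \<in> circle_test"
    by (intro circle_test_Re circle_test_mult circle_test_const assms)
  then show ?thesis by simp
qed

text \<open>The derivative of \<open>F (cis t)\<close> is the value at \<open>w = cis t\<close> of
  \<open>deriv F w * (\<i> * w)\<close>, again holomorphic on \<open>U\<close>. Hence the
  restrictions to the circle form a class closed under differentiation.\<close>

lemma circle_test_holomorphic:
  assumes "open U" "sphere 0 1 \<subseteq> U" "F holomorphic_on U"
  shows "(\<lambda>t. F (cis t)) \<in> circle_test"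
proof -
  let ?A = "{\<lambda>t. F (cis t) | F. F holomorphic_on U}"
  have cisU: "cis t \<in> U" for t using assms(2) by auto
  have d: "((\<lambda>t. F (cis t)) has_vector_derivative deriv F (cis s) * (\<i> * cis s)) (at s)"
    if "F holomorphic_on U" for F s
  proof -
    have "(F has_field_derivative deriv F (cis s)) (at (cis s))"
      using holomorphic_derivI[OF that assms(1) cisU] .
    moreover have "(cis has_vector_derivative \<i> * cis s) (at s)"
      by (auto simp: has_vector_derivative_def intro!: derivative_eq_intros)
    ultimately show ?thesis
      using field_vector_diff_chain_at[of cis "\<i> * cis s" s F] by (simp add: o_def mult.commute)
  qed
  have "(\<lambda>t. F (cis t)) \<in> smooth_line"
  proof (rule smooth_line_coinduct[of _ ?A])
    fix g assume "g \<in> ?A"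
    then obtain F where F: "g = (\<lambda>t. F (cis t))" "F holomorphic_on U" by blast
    show "g differentiable (at t)" for t
      unfolding F(1) using d[OF F(2)] differentiableI_vector by blast
    have "(\<lambda>w. deriv F w * (\<i> * w)) holomorphic_on U"
      by (intro holomorphic_intros holomorphic_deriv F assms)
    then show "(\<lambda>s. vector_derivative g (at s)) \<in> ?A"
      unfolding F(1) by (auto simp: vector_derivative_at[OF d[OF F(2)]])
  qed (use assms in auto)
  then show ?thesis by (auto simp: circle_test_iff cis.code)
qed

lemma circle_test_cis [simp, intro]: "cis \<in> circle_test"
  using circle_test_holomorphic[of UNIV "\<lambda>z. z"] by simp

lemma circle_test_cis_neg [simp, intro]: "(\<lambda>t. cis (- t)) \<in> circle_test"
  using circle_test_cnj[OF circle_test_cis] by (simp add: cis_cnj)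

definition schwarz_kernel :: "complex \<Rightarrow> complex \<Rightarrow> complex" where
  "schwarz_kernel z \<zeta> = (\<zeta> + z) / (\<zeta> - z)"

lemma circle_test_schwarz_kernel [simp, intro]:
  assumes "cmod z < 1" shows "(\<lambda>t. schwarz_kernel z (cis t)) \<in> circle_test"
  unfolding schwarz_kernel_def
  by (rule circle_test_holomorphic[of "- {z}"])
    (use assms in \<open>auto intro!: holomorphic_intros\<close>)

lemma poisson_schwarz_kernel:
  assumes "cmod z < 1"
  shows "complex_of_real (poisson (cmod z) (Arg z - t)) +
    \<i> * complex_of_real (conj_poisson (cmod z) (Arg z - t)) = schwarz_kernel z (cis t)"
    and "complex_of_real (poisson (cmod z) (Arg z - t)) =
      complex_of_real (Re (schwarz_kernel z (cis t)))"
proof -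
  define r where "r = cmod z"
  have z: "z = complex_of_real r * cis (Arg z)"
    unfolding r_def by (metis rcis_cmod_Arg rcis_def)
  let ?s = "Arg z - t"
  let ?D = "1 - 2 * r * cos ?s + r\<^sup>2"
  have D: "?D = (cmod (1 - r * cis ?s))\<^sup>2"
  proof -
    have "(cmod (1 - r * cis ?s))\<^sup>2 = (1 - r * cos ?s)\<^sup>2 + (r * sin ?s)\<^sup>2"
      by (simp add: cmod_power2)
    then show ?thesis using sin_cos_squared_add[of ?s] by algebra
  qed
  have ne: "1 - r * cis ?s \<noteq> 0"
  proof
    assume "1 - r * cis ?s = 0"
    then have "cmod (r * cis ?s) = 1" by (metis eq_iff_diff_eq_0 norm_one)
    then show False using assms by (simp add: r_def norm_mult)
  qed
  have zt: "z = cis t * (r * cis ?s)" by (subst z) (simp add: cis_mult)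
  \<comment> \<open>Cancelling \<open>cis t\<close> leaves (1 + w) / (1 - w) with w = r cis (Arg z -
    t). Making its denominator real produces exactly the denominator of both Poisson
    kernels.\<close>
  have "schwarz_kernel z (cis t) = (cis t * (1 + r * cis ?s)) / (cis t * (1 - r * cis ?s))"
    unfolding schwarz_kernel_def by (subst (1 2) zt) (simp only: distrib_left right_diff_distrib mult_1_right)
  also have "\<dots> = (1 + r * cis ?s) / (1 - r * cis ?s)" by simp
  also have "\<dots> = (1 + r * cis ?s) * cnj (1 - r * cis ?s) / ?D"
    unfolding D by (subst complex_div_cnj) simp
  also have "(1 + r * cis ?s) * cnj (1 - r * cis ?s) = complex_of_real (1 - r\<^sup>2) +
      \<i> * complex_of_real (2 * r * sin ?s)"
  proof (rule complex_eqI)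
    have "Re ((1 + r * cis ?s) * cnj (1 - r * cis ?s)) =
        (1 + r * cos ?s) * (1 - r * cos ?s) - r * sin ?s * (r * sin ?s)" by simp
    also have "\<dots> = 1 - r\<^sup>2"
      using sin_cos_squared_add[of ?s] by algebra
    finally show "Re ((1 + r * cis ?s) * cnj (1 - r * cis ?s)) = Re (complex_of_real (1 - r\<^sup>2) +
      \<i> * complex_of_real (2 * r * sin ?s))" by simp
  qed (simp add: algebra_simps)
  finally show 1: "complex_of_real (poisson (cmod z) ?s) +
    \<i> * complex_of_real (conj_poisson (cmod z) ?s) = schwarz_kernel z (cis t)"
    unfolding poisson_def conj_poisson_def r_def by (simp add: add_divide_distrib)
  show "complex_of_real (poisson (cmod z) ?s) = complex_of_real (Re (schwarz_kernel z (cis t)))"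
    unfolding 1[symmetric] by simp
qed

section \<open>Linear functionals on test functions\<close>

lemmas circle_test_intros = circle_test_add circle_test_diff circle_test_mult circle_test_power
  circle_test_const circle_test_cis circle_test_cis_neg circle_test_schwarz_kernel circle_test_Re
  circle_test_Im circle_test_cnj

lemma circle_pairing_add:
  assumes "set_integrable lebesgue {0..2*pi} (\<lambda>\<theta>. g (complex_of_real r * cis \<theta>) * \<phi> \<theta>)"
    "set_integrable lebesgue {0..2*pi} (\<lambda>\<theta>. g (complex_of_real r * cis \<theta>) * \<psi> \<theta>)"
  shows "circle_pairing g r (\<lambda>t. \<phi> t + \<psi> t) = circle_pairing g r \<phi> + circle_pairing g r \<psi>"
  unfolding circle_pairing_def distrib_left using set_integral_add(2)[OF assms] .

lemma circle_pairing_scale: "circle_pairing g r (\<lambda>t. c * \<phi> t) = c * circle_pairing g r \<phi>"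
  unfolding circle_pairing_def
  by (subst set_integral_mult_right[symmetric]) (simp add: mult_ac)

lemma circle_pairing_has_integral:
  assumes "continuous_on (ball 0 1) g" "\<phi> \<in> circle_test" "r \<in> {0<..<1}"
    and "((\<lambda>\<theta>. g (complex_of_real r * cis \<theta>) * \<phi> \<theta>) has_integral L) {0..2*pi}"
  shows "circle_pairing g r \<phi> = L"
  unfolding circle_pairing_def
  using set_lebesgue_integral_eq_integral(2)[OF circle_integrand_integrable[OF assms(1)
      circle_test_continuous[OF assms(2)] assms(3)]] integral_unique[OF assms(4)]
  by (simp add: integrable_on_def)

text \<open>Functionals are extensional, with one fixed value off \<open>circle_test\<close>, so
  linearity can only be asked for on test functions.\<close>

definition test_linear :: "circle_functional \<Rightarrow> bool" where
  "test_linear h \<longleftrightarrow>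
    (\<forall>\<phi>\<in>circle_test. \<forall>\<psi>\<in>circle_test. h (\<lambda>t. \<phi> t + \<psi> t) = h \<phi> + h \<psi>) \<and>
    (\<forall>\<phi>\<in>circle_test. \<forall>c. h (\<lambda>t. c * \<phi> t) = c * h \<phi>)"

lemma test_linear_add:
  "test_linear h \<Longrightarrow> \<phi> \<in> circle_test \<Longrightarrow> \<psi> \<in> circle_test \<Longrightarrow>
    h (\<lambda>t. \<phi> t + \<psi> t) = h \<phi> + h \<psi>"
  by (simp add: test_linear_def)

lemma test_linear_scale:
  "test_linear h \<Longrightarrow> \<phi> \<in> circle_test \<Longrightarrow> h (\<lambda>t. c * \<phi> t) = c * h \<phi>"
  by (simp add: test_linear_def)

lemma test_linear_diff:
  assumes "test_linear h" "\<phi> \<in> circle_test" "\<psi> \<in> circle_test"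
  shows "h (\<lambda>t. \<phi> t - \<psi> t) = h \<phi> - h \<psi>"
proof -
  have "h (\<lambda>t. \<phi> t + (- 1) * \<psi> t) = h \<phi> + h (\<lambda>t. (- 1) * \<psi> t)"
    by (intro test_linear_add circle_test_intros assms)
  also have "h (\<lambda>t. (- 1) * \<psi> t) = (- 1) * h \<psi>"
    by (intro test_linear_scale assms)
  finally show ?thesis by simp
qed

lemma test_linear_zero: "test_linear h \<Longrightarrow> h (\<lambda>t. 0) = 0"
  using test_linear_scale[of h "\<lambda>t. 0" 0] circle_test_const[of 0] by simp

definition test_real :: "circle_functional \<Rightarrow> bool" where
  "test_real h \<longleftrightarrow> (\<forall>\<phi>\<in>circle_test. (\<forall>t. Im (\<phi> t) = 0) \<longrightarrow> Im (h \<phi>) = 0)"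

lemma has_distr_bv_lim:
  assumes "has_distr_bv g u" "continuous_on (ball 0 1) g" "\<phi> \<in> circle_test"
  shows "((\<lambda>r. circle_pairing g r \<phi>) \<longlongrightarrow> u \<phi>) (at_left 1)"
  using assms by (simp add: has_distr_bv_continuous)

lemma eventually_at_left_1: "\<forall>\<^sub>F r in at_left (1::real). r \<in> {0<..<1}"
  by (rule eventually_at_left_real) simp

text \<open>Cauchy's formula gives the pairing on each circle in closed form \<open>L r\<close>, and
  uniqueness of limits then identifies the boundary value. Boundary values of holomorphic functions
  are evaluated on explicit kernels in this way.\<close>

lemma has_distr_bv_value:
  assumes "has_distr_bv g u" "continuous_on (ball 0 1) g" "\<phi> \<in> circle_test"
    and "\<And>r. r \<in> {0<..<1} \<Longrightarrow>
      ((\<lambda>\<theta>. g (complex_of_real r * cis \<theta>) * \<phi> \<theta>) has_integral L r) {0..2*pi}"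
    and "(L \<longlongrightarrow> l) (at_left 1)"
  shows "u \<phi> = l"
proof -
  have "((\<lambda>r. circle_pairing g r \<phi>) \<longlongrightarrow> l) (at_left 1)"
  proof (rule Lim_transform_eventually[OF assms(5)])
    show "\<forall>\<^sub>F r in at_left 1. L r = circle_pairing g r \<phi>"
      using eventually_at_left_1
      by eventually_elim (rule circle_pairing_has_integral[OF assms(2,3) _ assms(4), symmetric])
  qed
  with has_distr_bv_lim[OF assms(1-3)] show ?thesis
    by (intro tendsto_unique[of "at_left (1::real)"]) auto
qed

lemma has_distr_bv_linear:
  assumes "has_distr_bv g u" "continuous_on (ball 0 1) g"
  shows "test_linear u"
  unfolding test_linear_def
proof (intro conjI ballI allI)
  fix \<phi> \<psi> assume t: "\<phi> \<in> circle_test" "\<psi> \<in> circle_test"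
  have "((\<lambda>r. circle_pairing g r (\<lambda>t. \<phi> t + \<psi> t)) \<longlongrightarrow> u \<phi> + u \<psi>) (at_left 1)"
  proof (rule Lim_transform_eventually)
    show "((\<lambda>r. circle_pairing g r \<phi> + circle_pairing g r \<psi>) \<longlongrightarrow> u \<phi> + u \<psi>) (at_left 1)"
      by (intro tendsto_add has_distr_bv_lim assms t)
    show "\<forall>\<^sub>F r in at_left 1. circle_pairing g r \<phi> + circle_pairing g r \<psi> =
        circle_pairing g r (\<lambda>t. \<phi> t + \<psi> t)"
      using eventually_at_left_1
      by eventually_elim (intro circle_pairing_add[symmetric] circle_integrand_integrable assms
          circle_test_continuous t)
  qed
  moreover have "((\<lambda>r. circle_pairing g r (\<lambda>t. \<phi> t + \<psi> t)) \<longlongrightarrow> u (\<lambda>t. \<phi> t + \<psi> t)) (at_left 1)"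
    by (intro has_distr_bv_lim assms circle_test_add t)
  ultimately show "u (\<lambda>t. \<phi> t + \<psi> t) = u \<phi> + u \<psi>"
    using tendsto_unique[OF trivial_limit_at_left_real] by blast
next
  fix \<phi> c assume t: "\<phi> \<in> circle_test"
  have "((\<lambda>r. circle_pairing g r (\<lambda>t. c * \<phi> t)) \<longlongrightarrow> c * u \<phi>) (at_left 1)"
    unfolding circle_pairing_scale by (intro tendsto_mult_left has_distr_bv_lim assms t)
  moreover have "((\<lambda>r. circle_pairing g r (\<lambda>t. c * \<phi> t)) \<longlongrightarrow> u (\<lambda>t. c * \<phi> t)) (at_left 1)"
    by (intro has_distr_bv_lim assms circle_test_intros t)
  ultimately show "u (\<lambda>t. c * \<phi> t) = c * u \<phi>"
    using tendsto_unique[OF trivial_limit_at_left_real] by blast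
qed

text \<open>This trades the real and imaginary parts of \<phi>, which are not holomorphic for the
  kernels of interest, for \<phi> and its conjugate. On the circle K and cnj K both extend
  holomorphically, so Cauchy's formula applies to each.\<close>

lemma Re_distr_linear_eq:
  assumes u: "test_linear u" and \<phi>: "\<phi> \<in> circle_test"
  shows "Re_distr u \<phi> = (u \<phi> + cnj (u (\<lambda>t. cnj (\<phi> t)))) / 2"
proof -
  let ?R = "\<lambda>t. complex_of_real (Re (\<phi> t))" and ?I = "\<lambda>t. complex_of_real (Im (\<phi> t))"
  have t: "?R \<in> circle_test" "(\<lambda>t. \<i> * ?I t) \<in> circle_test" "?I \<in> circle_test"
    by (intro circle_test_intros \<phi>)+
  have "u (\<lambda>t. ?R t + \<i> * ?I t) = u ?R + \<i> * u ?I"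
    by (simp only: test_linear_add[OF u t(1,2)] test_linear_scale[OF u t(3)])
  then have 1: "u \<phi> = u ?R + \<i> * u ?I" by (simp add: complex_eq[symmetric])
  have "u (\<lambda>t. ?R t - \<i> * ?I t) = u ?R - \<i> * u ?I"
    by (simp only: test_linear_diff[OF u t(1,2)] test_linear_scale[OF u t(3)])
  moreover have "?R t - \<i> * ?I t = cnj (\<phi> t)" for t by (simp add: complex_eq_iff)
  ultimately have 2: "u (\<lambda>t. cnj (\<phi> t)) = u ?R - \<i> * u ?I" by simp
  show ?thesis
    unfolding 1 2 Re_distr_def using \<phi> by (simp add: complex_eq_iff)
qed

lemma Re_distr_linear:
  assumes u: "test_linear u" shows "test_linear (Re_distr u)"
  unfolding test_linear_def
proof (intro conjI ballI allI)
  fix \<phi> \<psi> assume t: "\<phi> \<in> circle_test" "\<psi> \<in> circle_test"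
  show "Re_distr u (\<lambda>t. \<phi> t + \<psi> t) = Re_distr u \<phi> + Re_distr u \<psi>"
    by (simp add: Re_distr_linear_eq u t circle_test_add circle_test_cnj add_divide_distrib
        test_linear_add[OF u t] test_linear_add[OF u t[THEN circle_test_cnj]])
next
  fix \<phi> c assume t: "\<phi> \<in> circle_test"
  have c: "(\<lambda>t. c * \<phi> t) \<in> circle_test" by (intro circle_test_intros t)
  show "Re_distr u (\<lambda>t. c * \<phi> t) = c * Re_distr u \<phi>"
    unfolding Re_distr_linear_eq[OF u t] Re_distr_linear_eq[OF u c] complex_cnj_mult
      test_linear_scale[OF u t] test_linear_scale[OF u circle_test_cnj[OF t]]
    by (simp add: algebra_simps add_divide_distrib)
qed

lemma Re_distr_real: "test_linear u \<Longrightarrow> test_real (Re_distr u)"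
  unfolding test_real_def Re_distr_def by (simp add: test_linear_zero)

section \<open>Cauchy integral formulas on the unit circle\<close>

lemma circle_cauchy:
  fixes G :: "complex \<Rightarrow> complex"
  assumes G: "G holomorphic_on ball 0 R" "R > 1" and w: "cmod w < 1"
  shows "((\<lambda>t. G (cis t) * (cis t / (cis t - w))) has_integral 2 * pi * G w) {0..2*pi}"
proof -
  have "G holomorphic_on cball 0 1"
    using G by (auto intro: holomorphic_on_subset)
  from Cauchy_integral_circlepath_simple[OF this, of w] w
  have "((\<lambda>u. G u / (u - w)) has_contour_integral 2 * pi * \<i> * G w) (part_circlepath 0 1 0 (2*pi))"
    by (simp add: circlepath_def)
  then have "((\<lambda>t. G (cis t) / (cis t - w) * \<i> * cis t) has_integral 2 * pi * \<i> * G w) {0..2*pi}"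
    by (subst (asm) has_contour_integral_part_circlepath_iff) auto
  from has_integral_mult_right[OF this, of "- \<i>"] show ?thesis
    by (simp add: mult_ac)
qed

lemma circle_mean:
  fixes G :: "complex \<Rightarrow> complex"
  assumes "G holomorphic_on ball 0 R" "R > 1"
  shows "((\<lambda>t. G (cis t)) has_integral 2 * pi * G 0) {0..2*pi}"
  using circle_cauchy[OF assms, of 0] by simp

lemma schwarz_kernel_alt:
  "\<zeta> \<noteq> z \<Longrightarrow> schwarz_kernel z \<zeta> = 2 * (\<zeta> / (\<zeta> - z)) - 1"
  by (simp add: schwarz_kernel_def field_simps)

lemma cis_neq_inside: "cmod z < 1 \<Longrightarrow> cis t \<noteq> z"
  by (metis less_irrefl norm_cis)

text \<open>As K = 2 \<zeta> / (\<zeta> - w) - 1, Cauchy's formula contributes 2 G(w) and the mean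
  value property subtracts G(0).\<close>

lemma circle_schwarz:
  fixes G :: "complex \<Rightarrow> complex"
  assumes G: "G holomorphic_on ball 0 R" "R > 1" and w: "cmod w < 1"
  shows "((\<lambda>t. G (cis t) * schwarz_kernel w (cis t)) has_integral 2 * pi * (2 * G w - G 0)) {0..2*pi}"
proof -
  from has_integral_diff[OF has_integral_mult_right[OF circle_cauchy[OF assms], of 2] circle_mean[OF G]]
  show ?thesis
    using cis_neq_inside[OF w] by (simp add: schwarz_kernel_alt algebra_simps)
qed

lemma cnj_schwarz_kernel_cis:
  "cnj (schwarz_kernel w (cis t)) = (1 + cnj w * cis t) / (1 - cnj w * cis t)"
proof -
  have "cnj (schwarz_kernel w (cis t)) = (cis t * (cnj (cis t) + cnj w)) / (cis t * (cnj (cis t) - cnj w))"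
    by (simp add: schwarz_kernel_def)
  also have "cis t * (cnj (cis t) + cnj w) = 1 + cnj w * cis t"
    by (simp add: cis_cnj distrib_left cis_mult)
  also have "cis t * (cnj (cis t) - cnj w) = 1 - cnj w * cis t"
    by (simp add: cis_cnj right_diff_distrib cis_mult)
  finally show ?thesis .
qed

text \<open>On the circle, conjugation moves the pole of K from w to 1 / cnj w, outside the closed
  disc. The product with G is then holomorphic past the circle, and its mean is its value at 0,
  where the kernel factor equals 1.\<close>

lemma circle_schwarz_cnj:
  fixes G :: "complex \<Rightarrow> complex"
  assumes G: "G holomorphic_on ball 0 R" "R > 1" and w: "cmod w < 1"
  shows "((\<lambda>t. G (cis t) * cnj (schwarz_kernel w (cis t))) has_integral 2 * pi * G 0) {0..2*pi}"
proof -
  \<comment> \<open>\<open>1 / cmod w\<close> is the distance of the reflected pole. For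
    \<open>w = 0\<close> there is no pole, but the quotient would be 0 by convention.\<close>
  define R' where "R' = (if w = 0 then R else min R (1 / cmod w))"
  have R': "R' > 1" "R' \<le> R" using G(2) w by (auto simp: R'_def)
  have ne: "1 - cnj w * \<zeta> \<noteq> 0" if "\<zeta> \<in> ball 0 R'" for \<zeta>
  proof
    assume "1 - cnj w * \<zeta> = 0"
    then have 1: "cmod w * cmod \<zeta> = 1"
      by (metis complex_mod_cnj eq_iff_diff_eq_0 norm_mult norm_one)
    then have "w \<noteq> 0" by auto
    then have "cmod \<zeta> < 1 / cmod w" using that by (simp add: R'_def)
    with \<open>w \<noteq> 0\<close> 1 show False by (simp add: field_simps)
  qed
  have "(\<lambda>\<zeta>. G \<zeta> * ((1 + cnj w * \<zeta>) / (1 - cnj w * \<zeta>))) holomorphic_on ball 0 R'"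
    using ne R' by (intro holomorphic_intros holomorphic_on_subset[OF G(1)]) auto
  from circle_mean[OF this R'(1)] show ?thesis by (simp add: cnj_schwarz_kernel_cis)
qed

lemma circle_coefficient:
  fixes G :: "complex \<Rightarrow> complex"
  assumes G: "G holomorphic_on ball 0 R" "R > 1"
  shows "((\<lambda>t. G (cis t) * cis (- t) ^ n) has_integral 2 * pi * ((deriv ^^ n) G 0 / fact n)) {0..2*pi}"
proof -
  have h: "G holomorphic_on cball 0 1"
    using G by (auto intro: holomorphic_on_subset)
  have "((\<lambda>u. G u / (u - 0) ^ Suc n) has_contour_integral 2 * pi * \<i> / fact n * (deriv ^^ n) G 0)
      (part_circlepath 0 1 0 (2*pi))"
    using Cauchy_has_contour_integral_higher_derivative_circlepath[of 0 1 G 0 n] h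
    using holomorphic_on_imp_continuous_on[OF h] holomorphic_on_subset[OF h ball_subset_cball]
    by (simp add: circlepath_def)
  then have "((\<lambda>t. G (cis t) / cis t ^ Suc n * \<i> * cis t) has_integral
      2 * pi * \<i> / fact n * (deriv ^^ n) G 0) {0..2*pi}"
    by (subst (asm) has_contour_integral_part_circlepath_iff) auto
  from has_integral_mult_right[OF this, of "- \<i>"] have "((\<lambda>t. - \<i> * (G (cis t) / cis t ^ Suc n * \<i> * cis t))
      has_integral 2 * pi * ((deriv ^^ n) G 0 / fact n)) {0..2*pi}"
    by (simp add: mult_ac)
  moreover have "- \<i> * (G (cis t) / cis t ^ Suc n * \<i> * cis t) = G (cis t) * cis (- t) ^ n" for t
    by (simp add: cis_inverse[symmetric] power_inverse divide_simps del: cis_inverse)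
      (simp add: complex_eq_iff)
  ultimately show ?thesis by simp
qed

text \<open>Dilation turns the circle of radius r into the unit circle and leaves room beyond it, so
  the formulas above apply to every g(r .) although g itself lives on the open disc only.\<close>

lemma scaled_holomorphic:
  assumes "g holomorphic_on ball 0 1" "r \<in> {0<..<1}"
  shows "(\<lambda>\<zeta>. g (complex_of_real r * \<zeta>)) holomorphic_on ball 0 (1 / r)" "1 / r > 1"
  using assms
  by (auto simp: norm_mult field_simps intro!: holomorphic_intros
      holomorphic_on_compose_gen[OF _ assms(1), unfolded o_def])

section \<open>Boundary values of holomorphic functions\<close>

text \<open>K reproduces g up to a constant while its conjugate sees only g(0). Averaging the first
  value with the conjugate of the second gives the Schwarz formula.\<close>

lemma bv_schwarz_kernel:
  fixes g :: "complex \<Rightarrow> complex" and u :: circle_functional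
  assumes g: "g holomorphic_on ball 0 1" and u: "has_distr_bv g u" and z: "cmod z < 1"
  shows "u (\<lambda>t. schwarz_kernel z (cis t)) = 2 * pi * (2 * g z - g 0)"
    and "u (\<lambda>t. cnj (schwarz_kernel z (cis t))) = 2 * pi * g 0"
proof -
  note c = holomorphic_on_imp_continuous_on[OF g]
  have "((\<lambda>r. g (complex_of_real r * z)) \<longlongrightarrow> g (complex_of_real 1 * z)) (at_left 1)"
  proof (rule isCont_tendsto_compose[of _ g])
    show "isCont g (complex_of_real 1 * z)"
      using c z by (simp add: continuous_on_eq_continuous_at)
  qed (intro tendsto_intros)
  then have "((\<lambda>r. 2 * pi * (2 * g (complex_of_real r * z) - g (complex_of_real r * 0)))
      \<longlongrightarrow> 2 * pi * (2 * g z - g 0)) (at_left 1)"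
    by (auto intro!: tendsto_intros)
  then show "u (\<lambda>t. schwarz_kernel z (cis t)) = 2 * pi * (2 * g z - g 0)"
    by (rule has_distr_bv_value[OF u c circle_test_schwarz_kernel[OF z], rotated])
      (use circle_schwarz[OF scaled_holomorphic[OF g] z] in simp)
  have "((\<lambda>r. 2 * pi * g (complex_of_real r * 0)) \<longlongrightarrow> 2 * pi * g 0) (at_left 1)"
    by simp
  then show "u (\<lambda>t. cnj (schwarz_kernel z (cis t))) = 2 * pi * g 0"
    by (rule has_distr_bv_value[OF u c circle_test_cnj[OF circle_test_schwarz_kernel[OF z]], rotated])
      (use circle_schwarz_cnj[OF scaled_holomorphic[OF g] z] in simp)
qed

text \<open>Pairing with \<open>cis (- t) ^ n\<close> isolates the Taylor coefficient of index n;
  pairing with \<open>cis t ^ n\<close> would isolate the one of index -n, which is absent.\<close>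

lemma bv_coefficient:
  fixes g :: "complex \<Rightarrow> complex" and u :: circle_functional
  assumes g: "g holomorphic_on ball 0 1" and u: "has_distr_bv g u"
  shows "u (\<lambda>t. cis (- t) ^ n) = 2 * pi * ((deriv ^^ n) g 0 / fact n)"
    and "n > 0 \<Longrightarrow> u (\<lambda>t. cis t ^ n) = 0"
proof -
  note c = holomorphic_on_imp_continuous_on[OF g]
  have d: "(deriv ^^ n) (\<lambda>\<zeta>. g (complex_of_real r * \<zeta>)) 0 = complex_of_real r ^ n * (deriv ^^ n) g 0"
    if "r \<in> {0<..<1}" for r
    using higher_deriv_compose_linear[OF g open_ball open_ball, of 0 0 "1 / r" "complex_of_real r" n]
      that by (auto simp: norm_mult field_simps)
  have i: "((\<lambda>\<theta>. g (complex_of_real r * cis \<theta>) * cis (- \<theta>) ^ n) has_integral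
      2 * pi * (complex_of_real r ^ n * (deriv ^^ n) g 0 / fact n)) {0..2 * pi}"
    if r: "r \<in> {0<..<1}" for r
    using circle_coefficient[OF scaled_holomorphic[OF g r], of n] by (simp only: d[OF r])
  show "u (\<lambda>t. cis (- t) ^ n) = 2 * pi * ((deriv ^^ n) g 0 / fact n)"
  proof (rule has_distr_bv_value[OF u c _ i])
    have "((\<lambda>r. 2 * pi * (complex_of_real r ^ n * (deriv ^^ n) g 0 / fact n)) \<longlongrightarrow>
        2 * pi * (complex_of_real 1 ^ n * (deriv ^^ n) g 0 / fact n)) (at_left 1)"
      by (intro tendsto_intros) simp
    then show "((\<lambda>r. 2 * pi * (complex_of_real r ^ n * (deriv ^^ n) g 0 / fact n)) \<longlongrightarrow>
        2 * pi * ((deriv ^^ n) g 0 / fact n)) (at_left 1)" by simp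
  qed (intro circle_test_intros)
  assume n: "n > 0"
  show "u (\<lambda>t. cis t ^ n) = 0"
  proof (rule has_distr_bv_value[OF u c])
    fix r :: real assume r: "r \<in> {0<..<1}"
    have "(\<lambda>\<zeta>. g (complex_of_real r * \<zeta>) * \<zeta> ^ n) holomorphic_on ball 0 (1 / r)"
      by (intro holomorphic_intros scaled_holomorphic[OF g r])
    from circle_mean[OF this scaled_holomorphic(2)[OF g r]] n
    show "((\<lambda>\<theta>. g (complex_of_real r * cis \<theta>) * cis \<theta> ^ n) has_integral 0) {0..2 * pi}" by (simp add: zero_power)
  qed (auto intro: circle_test_intros)
qed

text \<open>The property is stable under multiplication by \<open>2 cos t\<close>, which yields holomorphy of all the functions
  \<open>h (K\<^sub>z (2 cos)\<^sup>m)\<close> without any continuity of \<open>h\<close>.\<close>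

definition schwarz_series :: "circle_functional \<Rightarrow> bool" where
  "schwarz_series h \<longleftrightarrow> test_linear h \<and> (\<forall>z. cmod z < 1 \<longrightarrow>
     (\<lambda>n. (if n = 0 then 1 else 2) * h (\<lambda>t. cis (- t) ^ n) * z ^ n) sums
       h (\<lambda>t. schwarz_kernel z (cis t)))"

lemma Re_distr_schwarz_kernel:
  fixes g :: "complex \<Rightarrow> complex" and u :: circle_functional
  assumes g: "g holomorphic_on ball 0 1" and u: "has_distr_bv g u" and z: "cmod z < 1"
  shows "Re_distr u (\<lambda>t. schwarz_kernel z (cis t)) = 2 * pi * (g z - \<i> * Im (g 0))"
proof -
  note l = has_distr_bv_linear[OF u holomorphic_on_imp_continuous_on[OF g]]
  show ?thesis
    by (simp add: Re_distr_linear_eq[OF l circle_test_schwarz_kernel[OF z]] bv_schwarz_kernel[OF g u z])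
      (simp add: complex_eq_iff algebra_simps)
qed

lemma schwarz_series_Re_distr:
  fixes g :: "complex \<Rightarrow> complex" and u :: circle_functional
  assumes g: "g holomorphic_on ball 0 1" and u: "has_distr_bv g u"
  shows "schwarz_series (Re_distr u)"
  unfolding schwarz_series_def
proof (intro conjI allI impI)
  note l = has_distr_bv_linear[OF u holomorphic_on_imp_continuous_on[OF g]]
  show "test_linear (Re_distr u)" by (rule Re_distr_linear[OF l])
  fix z :: complex assume z: "cmod z < 1"
  let ?a = "\<lambda>n. (deriv ^^ n) g 0 / fact n"
  \<comment> \<open>For n > 0 the conjugate half of \<open>Re_distr_linear_eq\<close> vanishes and
    half of the coefficient is left, which explains the factor 2 in \<open>schwarz_series\<close>.
    For n = 0 both halves survive and combine to the real part.\<close>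
  have R: "Re_distr u (\<lambda>t. cis (- t) ^ n) = (if n = 0 then 2 * pi * Re (g 0) else pi * ?a n)" for n
  proof -
    have t: "(\<lambda>t. cis (- t) ^ n) \<in> circle_test" by (intro circle_test_intros)
    have cc: "cnj (cis (- t) ^ n) = cis t ^ n" for t by (simp add: cis_cnj)
    show ?thesis
    proof (cases "n = 0")
      case True
      then show ?thesis
        using bv_coefficient(1)[OF g u, of 0]
        by (simp add: Re_distr_linear_eq[OF l] complex_eq_iff)
    next
      case False
      then show ?thesis
        unfolding Re_distr_linear_eq[OF l t] cc bv_coefficient[OF g u]
        by (simp add: bv_coefficient(2)[OF g u])
    qed
  qed
  have "(\<lambda>n. ?a n * z ^ n) sums g z"
    using holomorphic_power_series[OF g, of z] z by simp
  then have "(\<lambda>n. 2 * pi * (?a n * z ^ n)) sums (2 * pi * g z)" by (rule sums_mult)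
  \<comment> \<open>Only the constant coefficient has to be corrected: the Schwarz integral loses i
    Im g(0).\<close>
  moreover have "(\<lambda>n. if n = 0 then 2 * pi * (- \<i> * Im (g 0)) else 0) sums (2 * pi * (- \<i> * Im (g 0)))"
    using sums_single[of 0 "\<lambda>n. 2 * pi * (- \<i> * Im (g 0))"] by simp
  ultimately have "(\<lambda>n. 2 * pi * (?a n * z ^ n) + (if n = 0 then 2 * pi * (- \<i> * Im (g 0)) else 0))
      sums (2 * pi * g z + 2 * pi * (- \<i> * Im (g 0)))" by (rule sums_add)
  moreover have "2 * pi * (?a n * z ^ n) + (if n = 0 then 2 * pi * (- \<i> * Im (g 0)) else 0) =
      (if n = 0 then 1 else 2) * Re_distr u (\<lambda>t. cis (- t) ^ n) * z ^ n" for n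
  proof (cases "n = 0")
    case True
    then show ?thesis unfolding R by (simp add: complex_eq_iff)
  next
    case False
    then show ?thesis unfolding R by (simp add: algebra_simps)
  qed
  ultimately show "(\<lambda>n. (if n = 0 then 1 else 2) * Re_distr u (\<lambda>t. cis (- t) ^ n) * z ^ n) sums
       Re_distr u (\<lambda>t. schwarz_kernel z (cis t))"
    unfolding Re_distr_schwarz_kernel[OF g u z] by (simp add: algebra_simps)
qed

section \<open>Multiplication of functionals by 2 cos t\<close>

definition two_cos :: "real \<Rightarrow> complex" where
  "two_cos t = cis t + cis (- t)"

lemma circle_test_two_cos [simp, intro]: "two_cos \<in> circle_test"
  using circle_test_add[OF circle_test_cis circle_test_cis_neg] by (simp add: two_cos_def[abs_def])

text \<open>The factor \<zeta> + 1/\<zeta> takes the value z + 1/z at the pole \<zeta> = z of K.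
  Subtracting that value cancels the pole, since \<zeta> + 1/\<zeta> - z - 1/z = (\<zeta> - z)(1 -
  1/(\<zeta> z)), and leaves a Laurent polynomial.\<close>

lemma schwarz_kernel_two_cos:
  assumes "z \<noteq> 0" "cmod z < 1"
  shows "schwarz_kernel z (cis t) * two_cos t =
    (z + 1 / z) * schwarz_kernel z (cis t) + ((z - 1 / z) + (cis t - cis (- t)))"
proof -
  have "cis t - z \<noteq> 0" using cis_neq_inside[OF assms(2), of t] by simp
  moreover have "cis (- t) = 1 / cis t" by (simp add: divide_inverse)
  ultimately show ?thesis
    unfolding two_cos_def schwarz_kernel_def using assms(1) cis_neq_zero[of t]
    by (simp add: divide_simps) (simp add: algebra_simps)
qed

lemma test_linear_mult:
  assumes "test_linear h" "\<psi> \<in> circle_test"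
  shows "test_linear (\<lambda>\<phi>. h (\<lambda>t. \<phi> t * \<psi> t))"
  unfolding test_linear_def
proof (intro conjI ballI allI)
  fix \<phi>1 \<phi>2 assume t: "\<phi>1 \<in> circle_test" "\<phi>2 \<in> circle_test"
  show "h (\<lambda>t. (\<phi>1 t + \<phi>2 t) * \<psi> t) = h (\<lambda>t. \<phi>1 t * \<psi> t) + h (\<lambda>t. \<phi>2 t * \<psi> t)"
    unfolding distrib_right by (intro test_linear_add circle_test_intros assms t)
next
  fix \<phi> c assume t: "\<phi> \<in> circle_test"
  show "h (\<lambda>t. c * \<phi> t * \<psi> t) = c * h (\<lambda>t. \<phi> t * \<psi> t)"
    unfolding mult.assoc by (intro test_linear_scale circle_test_intros assms t)
qed

text \<open>Multiplication by 2 cos t shifts frequencies by one in both directions. On the side of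
  the series this is the factor z + 1/z of \<open>schwarz_kernel_two_cos\<close>, up to corrections
  in the lowest coefficients, which the Laurent polynomial there accounts for.\<close>

lemma schwarz_series_two_cos:
  assumes h: "schwarz_series h"
  shows "schwarz_series (\<lambda>\<phi>. h (\<lambda>t. \<phi> t * two_cos t))"
  unfolding schwarz_series_def
proof (intro conjI allI impI)
  have l: "test_linear h" using h by (simp add: schwarz_series_def)
  then show "test_linear (\<lambda>\<phi>. h (\<lambda>t. \<phi> t * two_cos t))"
    by (rule test_linear_mult) simp
  fix z :: complex assume z: "cmod z < 1"
  define c where "c n = (if n = 0 then 1 else 2) * h (\<lambda>t. cis (- t) ^ n)" for n
  define c' where "c' n = (if n = 0 then 1 else 2) * h (\<lambda>t. cis (- t) ^ n * two_cos t)" for n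
  let ?S = "h (\<lambda>t. schwarz_kernel z (cis t))"
  let ?p = "h (\<lambda>t. cis t)" and ?m = "h (\<lambda>t. cis (- t))"
  have S: "(\<lambda>n. c n * z ^ n) sums ?S"
    using h z by (simp add: schwarz_series_def c_def)
  have c1: "c (Suc 0) = 2 * ?m" by (simp add: c_def)
  have c'0: "c' 0 = ?p + ?m"
    using test_linear_add[OF l circle_test_cis circle_test_cis_neg] by (simp add: c'_def two_cos_def)
  have hs: "h (\<lambda>t. cis (- t) ^ Suc n * two_cos t) = h (\<lambda>t. cis (- t) ^ n) + h (\<lambda>t. cis (- t) ^ Suc (Suc n))" for n
  proof -
    have "cis (- t) ^ Suc n * two_cos t = cis (- t) ^ n + cis (- t) ^ Suc (Suc n)" for t
    proof -
      have "cis (- t) ^ Suc n * cis t = cis (- t) ^ n * (cis (- t) * cis t)"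
        by (simp only: power_Suc2 mult.assoc)
      also have "\<dots> = cis (- t) ^ n" by (simp add: cis_mult)
      finally show ?thesis by (simp only: two_cos_def distrib_left power_Suc2[of _ "Suc n"])
    qed
    then have "(\<lambda>t. cis (- t) ^ Suc n * two_cos t) = (\<lambda>t. cis (- t) ^ n + cis (- t) ^ Suc (Suc n))"
      by blast
    then show ?thesis
      by (simp only:) (intro test_linear_add l circle_test_intros)
  qed
  \<comment> \<open>The coefficient of index 0 carries the factor 1 where the others carry 2; the
    extra \<open>c 0\<close> for \<open>n = 0\<close> makes up for this.\<close>
  have c'S: "c' (Suc n) = c n + c (Suc (Suc n)) + (if n = 0 then c 0 else 0)" for n
    unfolding c'_def c_def hs by (simp add: distrib_left)
  show "(\<lambda>n. (if n = 0 then 1 else 2) * h (\<lambda>t. cis (- t) ^ n * two_cos t) * z ^ n) sums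
      h (\<lambda>t. schwarz_kernel z (cis t) * two_cos t)"
  \<comment> \<open>The kernel identity contains 1/z. At the origin the kernel is 1 and only the
    constant coefficient counts.\<close>
  proof (cases "z = 0")
    case True
    have "(\<lambda>n. c' n * z ^ n) sums c' 0"
      using True sums_single[of 0 "\<lambda>n. c' n"] by (simp add: power_0_left if_distrib cong: if_cong)
    moreover have "schwarz_kernel z (cis t) = 1" for t
      using True by (simp add: schwarz_kernel_def)
    ultimately show ?thesis by (simp add: c'_def)
  next
    case False
    let ?K = "\<lambda>t. schwarz_kernel z (cis t)"
    have 1: "h (\<lambda>t. ?K t * two_cos t) = (z + 1 / z) * ?S + ((z - 1 / z) * c 0 + (?p - ?m))"
    proof -
      have m: "?K \<in> circle_test" "(\<lambda>t. (z + 1 / z) * ?K t) \<in> circle_test"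
        "(\<lambda>t. (z - 1 / z) * 1) \<in> circle_test" "(\<lambda>t. cis t - cis (- t)) \<in> circle_test"
        "(\<lambda>t. (z - 1 / z) * 1 + (cis t - cis (- t))) \<in> circle_test"
        by (intro circle_test_intros z)+
      have "h (\<lambda>t. (z + 1 / z) * ?K t + ((z - 1 / z) * 1 + (cis t - cis (- t)))) =
          (z + 1 / z) * ?S + ((z - 1 / z) * h (\<lambda>t. 1) + (?p - ?m))"
        by (simp only: test_linear_add[OF l m(2) m(5)] test_linear_add[OF l m(3) m(4)]
            test_linear_scale[OF l m(1)] test_linear_scale[OF l circle_test_const]
            test_linear_diff[OF l circle_test_cis circle_test_cis_neg])
      moreover have "c 0 = h (\<lambda>t. 1)" by (simp add: c_def)
      ultimately show ?thesis using schwarz_kernel_two_cos[OF False z] by simp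
    qed
    \<comment> \<open>Multiplying by z shifts the series up; dividing by z, after its first two
      terms are removed, shifts it down. The sum of the two is the series of \<open>c'\<close> from
      index 1 on, apart from the correction by \<open>c 0\<close>.\<close>
    have "(\<lambda>n. z * (c n * z ^ n)) sums (z * ?S)" by (rule sums_mult[OF S])
    moreover have "(\<lambda>n. c (Suc n) * z ^ Suc n) sums (?S - c 0)"
      using S by (subst sums_Suc_iff) simp
    then have "(\<lambda>n. c (Suc (Suc n)) * z ^ Suc (Suc n)) sums (?S - c 0 - c (Suc 0) * z)"
      by (subst sums_Suc_iff) simp
    then have "(\<lambda>n. (1 / z) * (c (Suc (Suc n)) * z ^ Suc (Suc n))) sums ((1 / z) * (?S - c 0 - c (Suc 0) * z))"
      by (rule sums_mult)
    moreover have "(\<lambda>n. if n = 0 then c 0 * z else 0) sums (c 0 * z)"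
      using sums_single[of 0 "\<lambda>n. c 0 * z"] by simp
    ultimately have "(\<lambda>n. z * (c n * z ^ n) + (1 / z) * (c (Suc (Suc n)) * z ^ Suc (Suc n)) +
        (if n = 0 then c 0 * z else 0)) sums (z * ?S + (1 / z) * (?S - c 0 - c (Suc 0) * z) + c 0 * z)"
      by (intro sums_add)
    moreover have "z * (c n * z ^ n) + (1 / z) * (c (Suc (Suc n)) * z ^ Suc (Suc n)) +
        (if n = 0 then c 0 * z else 0) = c' (Suc n) * z ^ Suc n" for n
      unfolding c'S using False by (simp add: algebra_simps)
    ultimately have "(\<lambda>n. c' (Suc n) * z ^ Suc n) sums
        (z * ?S + (1 / z) * (?S - c 0 - c (Suc 0) * z) + c 0 * z)" by simp
    then have "(\<lambda>n. c' n * z ^ n) sums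
        (z * ?S + (1 / z) * (?S - c 0 - c (Suc 0) * z) + c 0 * z + c' 0 * z ^ 0)"
      by (subst (asm) sums_Suc_iff) (simp add: algebra_simps)
    also have "z * ?S + (1 / z) * (?S - c 0 - c (Suc 0) * z) + c 0 * z + c' 0 * z ^ 0 =
        h (\<lambda>t. ?K t * two_cos t)"
      unfolding 1 c1 c'0 using False by (simp add: field_simps)
    finally show ?thesis by (simp add: c'_def)
  qed
qed

lemma schwarz_series_holomorphic:
  assumes "schwarz_series h"
  shows "(\<lambda>z. h (\<lambda>t. schwarz_kernel z (cis t))) holomorphic_on ball 0 1"
  by (rule power_series_holomorphic[of 0 1
        "\<lambda>n. (if n = 0 then 1 else 2) * h (\<lambda>t. cis (- t) ^ n)"])
    (use assms in \<open>simp add: schwarz_series_def\<close>)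

section \<open>Schwarz kernels with powers of the real excess\<close>

text \<open>The real differential in Wirtinger form. The coefficient of h stays existential because
  only the conjugate derivative is tracked, but its continuity is recorded: integration by parts
  needs both coefficients integrable on compact sets.\<close>

definition has_dbar_on :: "(complex \<Rightarrow> complex) \<Rightarrow> (complex \<Rightarrow> complex) \<Rightarrow> complex set \<Rightarrow> bool" where
  "has_dbar_on V V' S \<longleftrightarrow> (\<exists>A. continuous_on S A \<and> continuous_on S V' \<and>
     (\<forall>z\<in>S. (V has_derivative (\<lambda>h. A z * h + V' z * cnj h)) (at z)))"

lemma has_dbar_on_continuous: "has_dbar_on V V' S \<Longrightarrow> continuous_on S V"
  unfolding has_dbar_on_def
  by (meson continuous_at_imp_continuous_on has_derivative_continuous)

lemma has_dbar_on_holomorphic: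
  assumes "open S" "G holomorphic_on S" shows "has_dbar_on G (\<lambda>z. 0) S"
  unfolding has_dbar_on_def
proof (intro exI[of _ "deriv G"] conjI ballI)
  show "continuous_on S (deriv G)"
    by (intro holomorphic_on_imp_continuous_on holomorphic_deriv assms)
  fix z assume "z \<in> S"
  from holomorphic_derivI[OF assms(2,1) this]
  show "(G has_derivative (\<lambda>h. deriv G z * h + 0 * cnj h)) (at z)"
    by (simp add: has_field_derivative_def)
qed auto

lemma has_dbar_on_add:
  assumes "has_dbar_on V V' S" "has_dbar_on W W' S"
  shows "has_dbar_on (\<lambda>z. V z + W z) (\<lambda>z. V' z + W' z) S"
proof -
  from assms obtain A B where "continuous_on S A" "continuous_on S B"
    "continuous_on S V'" "continuous_on S W'"
    "\<forall>z\<in>S. (V has_derivative (\<lambda>h. A z * h + V' z * cnj h)) (at z)"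
    "\<forall>z\<in>S. (W has_derivative (\<lambda>h. B z * h + W' z * cnj h)) (at z)"
    unfolding has_dbar_on_def by blast
  then show ?thesis
    unfolding has_dbar_on_def
    by (intro exI[of _ "\<lambda>z. A z + B z"])
      (auto intro!: continuous_intros derivative_eq_intros simp: algebra_simps)
qed

lemma has_dbar_on_mult:
  assumes "has_dbar_on V V' S" "has_dbar_on W W' S"
  shows "has_dbar_on (\<lambda>z. V z * W z) (\<lambda>z. V' z * W z + V z * W' z) S"
proof -
  from assms obtain A B where "continuous_on S A" "continuous_on S B"
    "continuous_on S V'" "continuous_on S W'"
    "\<forall>z\<in>S. (V has_derivative (\<lambda>h. A z * h + V' z * cnj h)) (at z)"
    "\<forall>z\<in>S. (W has_derivative (\<lambda>h. B z * h + W' z * cnj h)) (at z)"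
    unfolding has_dbar_on_def by blast
  with assms[THEN has_dbar_on_continuous] show ?thesis
    unfolding has_dbar_on_def
    by (intro exI[of _ "\<lambda>z. A z * W z + V z * B z"])
      (auto intro!: continuous_intros derivative_eq_intros simp: algebra_simps)
qed

lemma has_dbar_on_const: "has_dbar_on (\<lambda>z. c) (\<lambda>z. 0) S"
  unfolding has_dbar_on_def by (intro exI[of _ "\<lambda>z. 0"]) (auto intro!: derivative_eq_intros)

lemma has_dbar_on_cmult:
  assumes "has_dbar_on V V' S" shows "has_dbar_on (\<lambda>z. c * V z) (\<lambda>z. c * V' z) S"
  using has_dbar_on_mult[OF has_dbar_on_const assms, of c] by simp

lemma has_dbar_on_sum:
  assumes "\<And>i. i \<in> I \<Longrightarrow> has_dbar_on (V i) (V' i) S"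
  shows "has_dbar_on (\<lambda>z. \<Sum>i\<in>I. V i z) (\<lambda>z. \<Sum>i\<in>I. V' i z) S"
  using assms by (induction I rule: infinite_finite_induct)
    (auto simp: has_dbar_on_const intro: has_dbar_on_add)

lemma has_dbar_on_add_cnj: "has_dbar_on (\<lambda>z. z + cnj z) (\<lambda>z. 1) S"
  unfolding has_dbar_on_def by (intro exI[of _ "\<lambda>z. 1"]) (auto intro!: derivative_eq_intros)

lemma has_dbar_on_add_cnj_power:
  "has_dbar_on (\<lambda>z. (z + cnj z) ^ Suc m) (\<lambda>z. of_nat (Suc m) * (z + cnj z) ^ m) S"
proof (induction m)
  case 0
  then show ?case using has_dbar_on_add_cnj by simp
next
  case (Suc m)
  from has_dbar_on_mult[OF has_dbar_on_add_cnj Suc] show ?case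
    by (simp add: algebra_simps)
qed

lemma has_dbar_on_cong:
  assumes "has_dbar_on V V' S" "open S" "\<And>z. z \<in> S \<Longrightarrow> V z = W z" "\<And>z. z \<in> S \<Longrightarrow> V' z = W' z"
  shows "has_dbar_on W W' S"
proof -
  from assms obtain A where A: "continuous_on S A" "continuous_on S V'"
    "\<forall>z\<in>S. (V has_derivative (\<lambda>h. A z * h + V' z * cnj h)) (at z)"
    unfolding has_dbar_on_def by blast
  show ?thesis
    unfolding has_dbar_on_def
  proof (intro exI[of _ A] conjI ballI)
    show "continuous_on S W'" by (rule continuous_on_cong[THEN iffD1, OF refl assms(4) A(2)])
    fix z assume z: "z \<in> S"
    show "(W has_derivative (\<lambda>h. A z * h + W' z * cnj h)) (at z)"
      using A(3)[rule_format, OF z] unfolding assms(4)[OF z]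
      by (rule has_derivative_transform_within_open[OF _ assms(2) z assms(3)])
  qed (rule A)
qed

definition cis_excess :: "complex \<Rightarrow> real \<Rightarrow> complex" where
  "cis_excess z t = cis t - z + cnj (cis t - z)"

lemma cis_excess_eq: "cis_excess z t = two_cos t - (z + cnj z)"
  by (simp add: cis_excess_def two_cos_def cis_cnj)

lemma circle_test_cis_excess [simp, intro]: "cis_excess z \<in> circle_test"
  using circle_test_diff[OF circle_test_two_cos circle_test_const]
  by (simp add: cis_excess_eq[abs_def])

lemma Im_cis_excess: "Im (cis_excess z t) = 0"
  by (simp add: cis_excess_def)

text \<open>One factor X is split as 2 cos t - (z + cnj z): the first part joins the test function,
  the second leaves the functional. Iteration removes the whole dependence of X on z from under
  \<open>h\<close>.\<close>

lemma test_linear_cis_excess_Suc: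
  assumes "test_linear h" "\<psi> \<in> circle_test"
  shows "h (\<lambda>t. \<psi> t * cis_excess z t ^ Suc m) =
    h (\<lambda>t. \<psi> t * two_cos t * cis_excess z t ^ m) - (z + cnj z) * h (\<lambda>t. \<psi> t * cis_excess z t ^ m)"
proof -
  have t: "(\<lambda>t. \<psi> t * two_cos t * cis_excess z t ^ m) \<in> circle_test"
    "(\<lambda>t. \<psi> t * cis_excess z t ^ m) \<in> circle_test"
    "(\<lambda>t. (z + cnj z) * (\<psi> t * cis_excess z t ^ m)) \<in> circle_test"
    by (intro circle_test_intros circle_test_cis_excess circle_test_two_cos assms)+
  have "\<psi> t * cis_excess z t ^ Suc m =
      \<psi> t * two_cos t * cis_excess z t ^ m - (z + cnj z) * (\<psi> t * cis_excess z t ^ m)" for t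
    by (simp add: cis_excess_eq algebra_simps)
  then show ?thesis
    by (simp only: test_linear_diff[OF assms(1) t(1,3)] test_linear_scale[OF assms(1) t(2)])
qed

definition schwarz_power :: "circle_functional \<Rightarrow> nat \<Rightarrow> complex \<Rightarrow> complex" where
  "schwarz_power h m z = h (\<lambda>t. schwarz_kernel z (cis t) * cis_excess z t ^ m)"

lemma schwarz_power_Suc:
  assumes "test_linear h" "cmod z < 1"
  shows "schwarz_power h (Suc m) z =
    schwarz_power (\<lambda>\<phi>. h (\<lambda>t. \<phi> t * two_cos t)) m z - (z + cnj z) * schwarz_power h m z"
  unfolding schwarz_power_def
  using test_linear_cis_excess_Suc[OF assms(1) circle_test_schwarz_kernel[OF assms(2)], where m = m and z = z]
  by (simp add: mult_ac)

lemma has_dbar_on_schwarz_power_0: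
  "schwarz_series h \<Longrightarrow> has_dbar_on (schwarz_power h 0) (\<lambda>z. 0) (ball 0 1)"
  using has_dbar_on_holomorphic[OF open_ball schwarz_series_holomorphic]
  by (simp add: schwarz_power_def[abs_def])

text \<open>This replaces differentiation under \<open>h\<close>. In the recursion
  \<open>schwarz_power_Suc\<close> the functional changes to \<open>h\<close> times 2 cos t, so the
  induction runs over all functionals in \<open>schwarz_series\<close>. The product rule for z + cnj
  z yields one copy of the power of index m, and the induction hypothesis supplies the
  others.\<close>

lemma has_dbar_on_schwarz_power_Suc:
  assumes "schwarz_series h"
  shows "has_dbar_on (schwarz_power h (Suc m)) (\<lambda>z. - of_nat (Suc m) * schwarz_power h m z) (ball 0 1)"
  using assms
proof (induction m arbitrary: h)
  case (0 h)
  note l = 0[unfolded schwarz_series_def, THEN conjunct1]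
  note 2 = schwarz_series_two_cos[OF 0]
  note d = has_dbar_on_add[OF has_dbar_on_schwarz_power_0[OF 2] has_dbar_on_cmult[OF
      has_dbar_on_mult[OF has_dbar_on_add_cnj has_dbar_on_schwarz_power_0[OF 0]], of "- 1"]]
  show ?case
    by (rule has_dbar_on_cong[OF d]) (auto simp: schwarz_power_Suc[OF l])
next
  case (Suc m h)
  note l = Suc.prems[unfolded schwarz_series_def, THEN conjunct1]
  note 2 = schwarz_series_two_cos[OF Suc.prems]
  note d = has_dbar_on_add[OF Suc.IH[OF 2] has_dbar_on_cmult[OF
      has_dbar_on_mult[OF has_dbar_on_add_cnj Suc.IH[OF Suc.prems]], of "- 1"]]
  show ?case
    by (rule has_dbar_on_cong[OF d])
      (auto simp: schwarz_power_Suc[OF l] algebra_simps)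
qed

lemma continuous_on_cis_excess_power:
  assumes "test_linear h" "\<psi> \<in> circle_test"
  shows "continuous_on S (\<lambda>z. h (\<lambda>t. \<psi> t * cis_excess z t ^ m))"
  using assms(2)
proof (induction m arbitrary: \<psi>)
  case (Suc m)
  have "(\<lambda>t. \<psi> t * two_cos t) \<in> circle_test" using Suc.prems by auto
  with Suc show ?case
    by (simp only: test_linear_cis_excess_Suc[OF assms(1) Suc.prems])
      (intro continuous_intros, auto)
qed simp

lemma schwarz_kernel_cis_excess:
  assumes "z \<noteq> 0" "cmod z < 1"
  shows "schwarz_kernel z (cis t) * cis_excess z t =
    (1 / z - cnj z) * schwarz_kernel z (cis t) + ((z - 1 / z) + (cis t - cis (- t)))"
  using schwarz_kernel_two_cos[OF assms, of t] by (simp add: cis_excess_eq algebra_simps)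

text \<open>The part of K X^(m+1) that no longer contains K. Unlike the kernel pairing it makes
  sense on and beyond the unit circle, where it is evaluated.\<close>

definition schwarz_remainder :: "circle_functional \<Rightarrow> nat \<Rightarrow> complex \<Rightarrow> complex" where
  "schwarz_remainder h m z = (z - 1 / z) * h (\<lambda>t. cis_excess z t ^ m) +
     h (\<lambda>t. (cis t - cis (- t)) * cis_excess z t ^ m)"

lemma schwarz_power_remainder:
  assumes l: "test_linear h" and z: "z \<noteq> 0" "cmod z < 1"
  shows "schwarz_power h (Suc m) z =
    (1 / z - cnj z) * schwarz_power h m z + schwarz_remainder h m z"
proof -
  let ?K = "\<lambda>t. schwarz_kernel z (cis t)" and ?X = "\<lambda>t. cis_excess z t ^ m"
  have t: "(\<lambda>t. ?K t * ?X t) \<in> circle_test" "?X \<in> circle_test"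
    "(\<lambda>t. (cis t - cis (- t)) * ?X t) \<in> circle_test"
    "(\<lambda>t. (1 / z - cnj z) * (?K t * ?X t)) \<in> circle_test"
    "(\<lambda>t. (z - 1 / z) * ?X t) \<in> circle_test"
    "(\<lambda>t. (z - 1 / z) * ?X t + (cis t - cis (- t)) * ?X t) \<in> circle_test"
    by (intro circle_test_intros circle_test_cis_excess z)+
  have "?K t * cis_excess z t ^ Suc m = (1 / z - cnj z) * (?K t * ?X t) +
      ((z - 1 / z) * ?X t + (cis t - cis (- t)) * ?X t)" for t
  proof -
    have "?K t * cis_excess z t ^ Suc m = (?K t * cis_excess z t) * ?X t"
      by (simp only: power_Suc mult.assoc)
    then show ?thesis
      unfolding schwarz_kernel_cis_excess[OF z] by (simp only: distrib_right mult.assoc)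
  qed
  then show ?thesis
    unfolding schwarz_power_def schwarz_remainder_def
    by (simp only: test_linear_add[OF l t(4,6)] test_linear_add[OF l t(5,3)]
        test_linear_scale[OF l t(1)] test_linear_scale[OF l t(2)])
qed

lemma continuous_on_schwarz_remainder:
  assumes "test_linear h" shows "continuous_on (- {0}) (schwarz_remainder h m)"
proof -
  have "continuous_on (- {0}) (\<lambda>z. h (\<lambda>t. 1 * cis_excess z t ^ m))"
    "continuous_on (- {0}) (\<lambda>z. h (\<lambda>t. (cis t - cis (- t)) * cis_excess z t ^ m))"
    by (intro continuous_on_cis_excess_power assms circle_test_intros)+
  then show ?thesis
    unfolding schwarz_remainder_def[abs_def] by (intro continuous_intros) auto
qed

lemma Im_power_real: "Im x = 0 \<Longrightarrow> Im (x ^ m) = 0"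
  by (induction m) auto

text \<open>For |z| = 1 both z - 1/z = 2 i Im z and \<zeta> - 1/\<zeta> = 2 i sin t are imaginary,
  while \<open>h\<close> is real on the real test functions X^m and 2 sin t X^m.\<close>

lemma Re_schwarz_remainder:
  assumes l: "test_linear h" and r: "test_real h" and z: "cmod z = 1"
  shows "Re (schwarz_remainder h m z) = 0"
proof -
  let ?X = "\<lambda>t. cis_excess z t ^ m" and ?s = "\<lambda>t. complex_of_real (2 * sin t)"
  have s: "?s = (\<lambda>t. - \<i> * (cis t - cis (- t)))" by (simp add: complex_eq_iff fun_eq_iff)
  have "?s \<in> circle_test" unfolding s by (intro circle_test_intros)
  then have t: "?X \<in> circle_test" "(\<lambda>t. ?s t * ?X t) \<in> circle_test"
    by (intro circle_test_intros circle_test_cis_excess | assumption)+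
  have "Im (h ?X) = 0" "Im (h (\<lambda>t. ?s t * ?X t)) = 0"
    using r t by (auto simp: test_real_def Im_power_real Im_cis_excess)
  moreover have "h (\<lambda>t. (cis t - cis (- t)) * ?X t) = \<i> * h (\<lambda>t. ?s t * ?X t)"
  proof -
    have "cis t - cis (- t) = \<i> * ?s t" for t
      by (simp add: complex_eq_iff)
    then have "(cis t - cis (- t)) * ?X t = \<i> * (?s t * ?X t)" for t
      by (simp only: mult.assoc)
    then show ?thesis by (simp only: test_linear_scale[OF l t(2)])
  qed
  moreover have "z \<noteq> 0" using z by auto
  then have "z - 1 / z = 2 * \<i> * Im z"
    using z complex_div_cnj[of 1 z] by (simp add: complex_eq_iff)
  ultimately show ?thesis by (simp add: schwarz_remainder_def)
qed

section \<open>Boundary values with vanishing real part\<close>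

lemma set_integrable_mult_continuous:
  fixes F \<phi> :: "real \<Rightarrow> complex"
  assumes "set_integrable lebesgue {0..2*pi} F" "continuous_on {0..2*pi} \<phi>"
  shows "set_integrable lebesgue {0..2*pi} (\<lambda>\<theta>. F \<theta> * \<phi> \<theta>)"
proof -
  have "bilinear (\<lambda>x y :: complex. y * x)"
    using bounded_bilinear.flip[OF bounded_bilinear_mult] bilinear_conv_bounded_bilinear by blast
  moreover have "\<phi> \<in> borel_measurable (lebesgue_on {0..2*pi})"
    using assms(2) by (intro continuous_imp_measurable_on_sets_lebesgue) auto
  moreover have "bounded (\<phi> ` {0..2*pi})"
    using assms(2) compact_continuous_image compact_imp_bounded compact_Icc by blast
  ultimately show ?thesis
    using absolutely_integrable_bounded_measurable_product[of "\<lambda>x y. y * x" \<phi> "{0..2*pi}" F] assms(1)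
    by auto
qed

text \<open>Circles of positive radius miss the origin. Excluding z = 0 is what admits identities
  containing 1/z.\<close>

lemma has_distr_bv_cong:
  assumes "has_distr_bv g u" "\<And>z. z \<noteq> 0 \<Longrightarrow> cmod z < 1 \<Longrightarrow> g z = g' z"
  shows "has_distr_bv g' u"
proof -
  have eq: "g (complex_of_real r * cis \<theta>) = g' (complex_of_real r * cis \<theta>)" if "r \<in> {0<..<1}" for r \<theta>
    using that by (intro assms(2)) (auto simp: norm_mult)
  obtain N where N: "N \<in> null_sets lebesgue"
    "\<And>r. r \<in> {0<..<1} - N \<Longrightarrow> set_integrable lebesgue {0..2*pi} (\<lambda>\<theta>. g (complex_of_real r * cis \<theta>))"
    "\<And>\<phi>. \<phi> \<in> circle_test \<Longrightarrow> ((\<lambda>r. circle_pairing g r \<phi>) \<longlongrightarrow> u \<phi>) (at 1 within {0<..<1} - N)"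
    using assms(1) unfolding has_distr_bv_def by blast
  show ?thesis
    unfolding has_distr_bv_def
  proof (intro conjI bexI[of _ N] ballI)
    show "u \<in> extensional circle_test" using assms(1) by (simp add: has_distr_bv_def)
    fix r assume "r \<in> {0<..<1} - N"
    then show "set_integrable lebesgue {0..2*pi} (\<lambda>\<theta>. g' (complex_of_real r * cis \<theta>))"
      using N(2)[of r] by (simp add: eq)
  next
    fix \<phi> assume "\<phi> \<in> circle_test"
    from N(3)[OF this] show "((\<lambda>r. circle_pairing g' r \<phi>) \<longlongrightarrow> u \<phi>) (at 1 within {0<..<1} - N)"
    proof (rule tendsto_cong[THEN iffD1, rotated])
      show "\<forall>\<^sub>F r in at 1 within {0<..<1} - N. circle_pairing g r \<phi> = circle_pairing g' r \<phi>"
        by (auto simp: eventually_at_filter circle_pairing_def eq)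
    qed
  qed (rule N)
qed

lemma has_distr_bv_add:
  assumes "has_distr_bv g u" "has_distr_bv g' u'"
  shows "has_distr_bv (\<lambda>z. g z + g' z) (restrict (\<lambda>\<phi>. u \<phi> + u' \<phi>) circle_test)"
proof -
  obtain N where N: "N \<in> null_sets lebesgue"
    "\<And>r. r \<in> {0<..<1} - N \<Longrightarrow> set_integrable lebesgue {0..2*pi} (\<lambda>\<theta>. g (complex_of_real r * cis \<theta>))"
    "\<And>\<phi>. \<phi> \<in> circle_test \<Longrightarrow> ((\<lambda>r. circle_pairing g r \<phi>) \<longlongrightarrow> u \<phi>) (at 1 within {0<..<1} - N)"
    using assms(1) unfolding has_distr_bv_def by blast
  obtain M where M: "M \<in> null_sets lebesgue"
    "\<And>r. r \<in> {0<..<1} - M \<Longrightarrow> set_integrable lebesgue {0..2*pi} (\<lambda>\<theta>. g' (complex_of_real r * cis \<theta>))"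
    "\<And>\<phi>. \<phi> \<in> circle_test \<Longrightarrow> ((\<lambda>r. circle_pairing g' r \<phi>) \<longlongrightarrow> u' \<phi>) (at 1 within {0<..<1} - M)"
    using assms(2) unfolding has_distr_bv_def by blast
  show ?thesis
    unfolding has_distr_bv_def
  proof (intro conjI bexI[of _ "N \<union> M"] ballI)
    fix r assume "r \<in> {0<..<1} - (N \<union> M)"
    then show "set_integrable lebesgue {0..2*pi} (\<lambda>\<theta>. g (complex_of_real r * cis \<theta>) + g' (complex_of_real r * cis \<theta>))"
      using N(2) M(2) by (intro set_integral_add) auto
  next
    fix \<phi> assume \<phi>: "\<phi> \<in> circle_test"
    let ?F = "at (1::real) within {0<..<1} - (N \<union> M)"
    have "((\<lambda>r. circle_pairing g r \<phi> + circle_pairing g' r \<phi>) \<longlongrightarrow> u \<phi> + u' \<phi>) ?F"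
      by (intro tendsto_add tendsto_within_subset[OF N(3)[OF \<phi>]] tendsto_within_subset[OF M(3)[OF \<phi>]]) auto
    then have "((\<lambda>r. circle_pairing (\<lambda>z. g z + g' z) r \<phi>) \<longlongrightarrow> u \<phi> + u' \<phi>) ?F"
    proof (rule tendsto_cong[THEN iffD1, rotated])
      have "circle_pairing g r \<phi> + circle_pairing g' r \<phi> = circle_pairing (\<lambda>z. g z + g' z) r \<phi>"
        if "r \<in> {0<..<1} - (N \<union> M)" for r
        unfolding circle_pairing_def distrib_right
        by (intro set_integral_add(2)[symmetric] set_integrable_mult_continuous
            circle_test_continuous \<phi> N(2) M(2)) (use that in auto)
      then show "\<forall>\<^sub>F r in ?F. circle_pairing g r \<phi> + circle_pairing g' r \<phi> = circle_pairing (\<lambda>z. g z + g' z) r \<phi>"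
        by (auto simp: eventually_at_filter)
    qed
    then show "((\<lambda>r. circle_pairing (\<lambda>z. g z + g' z) r \<phi>) \<longlongrightarrow>
        restrict (\<lambda>\<phi>. u \<phi> + u' \<phi>) circle_test \<phi>) ?F" using \<phi> by simp
  qed (use N(1) M(1) in auto)
qed

lemma has_distr_bv_scale:
  assumes "has_distr_bv g u"
  shows "has_distr_bv (\<lambda>z. c * g z) (restrict (\<lambda>\<phi>. c * u \<phi>) circle_test)"
proof -
  obtain N where N: "N \<in> null_sets lebesgue"
    "\<And>r. r \<in> {0<..<1} - N \<Longrightarrow> set_integrable lebesgue {0..2*pi} (\<lambda>\<theta>. g (complex_of_real r * cis \<theta>))"
    "\<And>\<phi>. \<phi> \<in> circle_test \<Longrightarrow> ((\<lambda>r. circle_pairing g r \<phi>) \<longlongrightarrow> u \<phi>) (at 1 within {0<..<1} - N)"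
    using assms(1) unfolding has_distr_bv_def by blast
  have p: "circle_pairing (\<lambda>z. c * g z) r \<phi> = c * circle_pairing g r \<phi>" for r \<phi>
    unfolding circle_pairing_def mult.assoc by (rule set_integral_mult_right)
  show ?thesis
    unfolding has_distr_bv_def
    by (intro conjI bexI[of _ N] ballI N set_integrable_mult_right)
      (auto simp: p N intro!: tendsto_mult_left)
qed

text \<open>On |z| = r the factor is (1/r - r) cis (- \<theta>). The scalar tends to 0, while the
  pairing of g with the test function \<open>cis (- t) * \<phi> t\<close> converges.\<close>

lemma has_distr_bv_mult_conj_reflection:
  assumes "has_distr_bv g u"
  shows "has_distr_bv (\<lambda>z. (1 / z - cnj z) * g z) (restrict (\<lambda>\<phi>. 0) circle_test)"
proof -
  obtain N where N: "N \<in> null_sets lebesgue"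
    "\<And>r. r \<in> {0<..<1} - N \<Longrightarrow> set_integrable lebesgue {0..2*pi} (\<lambda>\<theta>. g (complex_of_real r * cis \<theta>))"
    "\<And>\<phi>. \<phi> \<in> circle_test \<Longrightarrow> ((\<lambda>r. circle_pairing g r \<phi>) \<longlongrightarrow> u \<phi>) (at 1 within {0<..<1} - N)"
    using assms(1) unfolding has_distr_bv_def by blast
  have d: "1 / (complex_of_real r * cis \<theta>) - cnj (complex_of_real r * cis \<theta>) =
      complex_of_real (1 / r - r) * cis (- \<theta>)" for r \<theta>
  proof -
    have "1 / (complex_of_real r * cis \<theta>) = complex_of_real (1 / r) * cis (- \<theta>)"
      by (simp add: divide_inverse)
    then show ?thesis by (simp add: cis_cnj algebra_simps)
  qed
  have p: "circle_pairing (\<lambda>z. (1 / z - cnj z) * g z) r \<phi> =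
      complex_of_real (1 / r - r) * circle_pairing g r (\<lambda>t. cis (- t) * \<phi> t)" for r \<phi>
    unfolding circle_pairing_def
    by (subst set_integral_mult_right[symmetric]) (simp only: d, simp only: mult_ac)
  show ?thesis
    unfolding has_distr_bv_def
  proof (intro conjI bexI[of _ N] ballI)
    fix r assume "r \<in> {0<..<1} - N"
    then have "set_integrable lebesgue {0..2*pi}
        (\<lambda>\<theta>. g (complex_of_real r * cis \<theta>) * (complex_of_real (1 / r - r) * cis (- \<theta>)))"
      by (intro set_integrable_mult_continuous N continuous_intros)
    then show "set_integrable lebesgue {0..2*pi}
        (\<lambda>\<theta>. (1 / (complex_of_real r * cis \<theta>) - cnj (complex_of_real r * cis \<theta>)) * g (complex_of_real r * cis \<theta>))"
      by (simp only: d, simp only: mult.commute)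
  next
    fix \<phi> assume \<phi>: "\<phi> \<in> circle_test"
    then have "(\<lambda>t. cis (- t) * \<phi> t) \<in> circle_test" by (intro circle_test_intros)
    from N(3)[OF this] have "((\<lambda>r. complex_of_real (1 / r - r) * circle_pairing g r (\<lambda>t. cis (- t) * \<phi> t)) \<longlongrightarrow>
        complex_of_real (1 / 1 - 1) * u (\<lambda>t. cis (- t) * \<phi> t)) (at 1 within {0<..<1} - N)"
      by (intro tendsto_intros) auto
    then show "((\<lambda>r. circle_pairing (\<lambda>z. (1 / z - cnj z) * g z) r \<phi>) \<longlongrightarrow>
        restrict (\<lambda>\<phi>. 0) circle_test \<phi>) (at 1 within {0<..<1} - N)"
      using \<phi> by (simp add: p)
  qed (use N in auto)
qed

text \<open>The class of terms that may be added without changing the real part of a boundary value.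
  Existence of the boundary value is part of it, since it is not automatic for the terms in
  question.\<close>

definition imaginary_bv :: "(complex \<Rightarrow> complex) \<Rightarrow> bool" where
  "imaginary_bv g \<longleftrightarrow> (\<exists>v. has_distr_bv g v \<and>
     (\<forall>\<phi>\<in>circle_test. (\<forall>t. Im (\<phi> t) = 0) \<longrightarrow> Re (v \<phi>) = 0))"

lemma imaginary_bv_cong:
  "imaginary_bv g \<Longrightarrow> (\<And>z. z \<noteq> 0 \<Longrightarrow> cmod z < 1 \<Longrightarrow> g z = g' z) \<Longrightarrow> imaginary_bv g'"
  unfolding imaginary_bv_def using has_distr_bv_cong by blast

lemma imaginary_bv_add:
  assumes "imaginary_bv g" "imaginary_bv g'" shows "imaginary_bv (\<lambda>z. g z + g' z)"
proof -
  obtain u v where "has_distr_bv g u" "has_distr_bv g' v"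
    "\<forall>\<phi>\<in>circle_test. (\<forall>t. Im (\<phi> t) = 0) \<longrightarrow> Re (u \<phi>) = 0"
    "\<forall>\<phi>\<in>circle_test. (\<forall>t. Im (\<phi> t) = 0) \<longrightarrow> Re (v \<phi>) = 0"
    using assms unfolding imaginary_bv_def by blast
  then show ?thesis
    unfolding imaginary_bv_def
    by (intro exI[of _ "restrict (\<lambda>\<phi>. u \<phi> + v \<phi>) circle_test"]) (auto intro: has_distr_bv_add)
qed

lemma imaginary_bv_scale:
  assumes "imaginary_bv g" shows "imaginary_bv (\<lambda>z. complex_of_real c * g z)"
proof -
  obtain u where "has_distr_bv g u" "\<forall>\<phi>\<in>circle_test. (\<forall>t. Im (\<phi> t) = 0) \<longrightarrow> Re (u \<phi>) = 0"
    using assms unfolding imaginary_bv_def by blast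
  then show ?thesis
    unfolding imaginary_bv_def
    by (intro exI[of _ "restrict (\<lambda>\<phi>. complex_of_real c * u \<phi>) circle_test"])
      (auto intro: has_distr_bv_scale)
qed

text \<open>Integrals over circles depend continuously on the radius up to r = 1, so the boundary
  value is integration against the restriction of q to the circle. The origin is left out because
  \<open>schwarz_remainder\<close> has a pole there.\<close>

lemma imaginary_bv_continuous:
  assumes q: "continuous_on (- {0}) q" and im: "\<And>z. cmod z = 1 \<Longrightarrow> Re (q z) = 0"
  shows "imaginary_bv q"
proof -
  let ?I = "\<lambda>r \<phi>. integral (cbox 0 (2*pi)) (\<lambda>\<theta>. q (complex_of_real r * cis \<theta>) * \<phi> \<theta>)"
  have ne: "complex_of_real r * cis \<theta> \<noteq> 0" if "r \<in> {0<..}" for r \<theta>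
    using that by (metis cis_neq_zero greaterThan_iff less_irrefl no_zero_divisors of_real_eq_0_iff)
  have c: "continuous_on {0..2*pi} (\<lambda>\<theta>. q (complex_of_real r * cis \<theta>))" if "r \<in> {0<..}" for r
    by (intro continuous_intros continuous_on_compose2[OF q]) (use ne[OF that] in auto)
  have p: "circle_pairing q r \<phi> = ?I r \<phi>" if "\<phi> \<in> circle_test" "r \<in> {0<..}" for \<phi> r
    unfolding circle_pairing_def
    using set_lebesgue_integral_eq_integral(2)[OF set_integrable_mult_continuous[OF
      absolutely_integrable_continuous_real[OF c[OF that(2)]] circle_test_continuous[OF that(1)]]] by simp
  have lim: "((\<lambda>r. circle_pairing q r \<phi>) \<longlongrightarrow> ?I 1 \<phi>) (at 1 within {0<..<1} - {})"
    if \<phi>: "\<phi> \<in> circle_test" for \<phi>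
  proof -
    have "continuous_on {0<..} (\<lambda>r. ?I r \<phi>)"
    proof (rule integral_continuous_on_param)
      show "continuous_on ({0<..} \<times> cbox 0 (2*pi)) (\<lambda>(r, \<theta>). q (complex_of_real r * cis \<theta>) * \<phi> \<theta>)"
        unfolding case_prod_beta
        by (intro continuous_intros continuous_on_compose2[OF q]
            continuous_on_compose2[OF circle_test_continuous[OF \<phi>, of UNIV]]) (use ne in auto)
    qed
    then have "((\<lambda>r. ?I r \<phi>) \<longlongrightarrow> ?I 1 \<phi>) (at 1 within {0<..})"
      unfolding continuous_on_def by (rule bspec) simp
    then have "((\<lambda>r. ?I r \<phi>) \<longlongrightarrow> ?I 1 \<phi>) (at 1 within {0<..<1} - {})"
      by (rule tendsto_within_subset) auto
    then show ?thesis
    proof (rule tendsto_cong[THEN iffD1, rotated])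
      show "\<forall>\<^sub>F r in at 1 within {0<..<1} - {}. ?I r \<phi> = circle_pairing q r \<phi>"
        by (auto simp: eventually_at_filter p[OF \<phi>])
    qed
  qed
  have bv: "has_distr_bv q (restrict (?I 1) circle_test)"
    unfolding has_distr_bv_def
  proof (intro conjI bexI[of _ "{}"] ballI)
    fix r :: real assume "r \<in> {0<..<1} - {}"
    then show "set_integrable lebesgue {0..2*pi} (\<lambda>\<theta>. q (complex_of_real r * cis \<theta>))"
      by (intro absolutely_integrable_continuous_real c) auto
  qed (use lim in auto)
  have im0: "Re (?I 1 \<phi>) = 0" if \<phi>: "\<phi> \<in> circle_test" "\<forall>t. Im (\<phi> t) = 0" for \<phi>
  proof -
    have "continuous_on (cbox 0 (2*pi)) (\<lambda>\<theta>. q (complex_of_real 1 * cis \<theta>) * \<phi> \<theta>)"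
      using continuous_on_mult[OF c[of 1] circle_test_continuous[OF \<phi>(1)]] by simp
    then have "(\<lambda>\<theta>. q (complex_of_real 1 * cis \<theta>) * \<phi> \<theta>) integrable_on cbox 0 (2*pi)"
      by (rule integrable_continuous)
    from integral_linear[OF this bounded_linear_Re]
    have "Re (?I 1 \<phi>) = integral (cbox 0 (2*pi)) (\<lambda>\<theta>. Re (q (complex_of_real 1 * cis \<theta>) * \<phi> \<theta>))"
      by (simp add: o_def)
    then show ?thesis using im \<phi>(2) by simp
  qed
  show ?thesis
    unfolding imaginary_bv_def
    by (intro exI[of _ "restrict (?I 1) circle_test"] conjI bv ballI impI)
      (subst restrict_apply', assumption, rule im0)
qed

lemma imaginary_bv_sum:
  assumes "\<And>i. i \<in> I \<Longrightarrow> imaginary_bv (g i)" shows "imaginary_bv (\<lambda>z. \<Sum>i\<in>I. g i z)"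
  using assms by (induction I rule: infinite_finite_induct)
    (auto intro: imaginary_bv_add imaginary_bv_continuous)

lemma imaginary_bv_perturbation:
  assumes u: "has_distr_bv g u" and r: "imaginary_bv r"
  shows "\<exists>v. has_distr_bv (\<lambda>z. g z + r z) v \<and> Re_distr v = Re_distr u"
proof -
  obtain v where v: "has_distr_bv r v" "\<And>\<phi>. \<phi> \<in> circle_test \<Longrightarrow> \<forall>t. Im (\<phi> t) = 0 \<Longrightarrow> Re (v \<phi>) = 0"
    using r unfolding imaginary_bv_def by blast
  have "Re_distr (restrict (\<lambda>\<phi>. u \<phi> + v \<phi>) circle_test) = Re_distr u"
    unfolding Re_distr_def
    by (rule restrict_ext) (simp add: circle_test_Re circle_test_Im v(2))
  with has_distr_bv_add[OF u v(1)] show ?thesis by blast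
qed

text \<open>In \<open>schwarz_power_remainder\<close> the previous power is multiplied by 1/z - cnj
  z and so contributes nothing as soon as it has a boundary value at all. The induction can
  therefore start from exponent 0, whose boundary value is not imaginary.\<close>

lemma imaginary_bv_schwarz_power:
  assumes g: "g holomorphic_on ball 0 1" and u: "has_distr_bv g u"
  shows "imaginary_bv (schwarz_power (Re_distr u) (Suc m))"
proof -
  let ?h = "Re_distr u"
  note l = has_distr_bv_linear[OF u holomorphic_on_imp_continuous_on[OF g]]
  note lh = Re_distr_linear[OF l] and rh = Re_distr_real[OF l]
  have imag0: "imaginary_bv (\<lambda>z. (1 / z - cnj z) * V z)" if "has_distr_bv V v" for V v
    unfolding imaginary_bv_def using has_distr_bv_mult_conj_reflection[OF that]
    by (intro exI[of _ "restrict (\<lambda>\<phi>. 0) circle_test"]) auto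
  have step: "imaginary_bv (schwarz_power ?h (Suc m))" if "has_distr_bv (schwarz_power ?h m) v" for m v
    by (rule imaginary_bv_cong[OF imaginary_bv_add[OF imag0[OF that]
            imaginary_bv_continuous[OF continuous_on_schwarz_remainder[OF lh, of m]]]])
      (auto simp: Re_schwarz_remainder[OF lh rh] schwarz_power_remainder[OF lh])
  have c: "imaginary_bv (\<lambda>z. - \<i> * Im (g 0))" by (rule imaginary_bv_continuous) auto
  then obtain v where v: "has_distr_bv (\<lambda>z. - \<i> * Im (g 0)) v" unfolding imaginary_bv_def by blast
  have base: "\<exists>v. has_distr_bv (schwarz_power ?h 0) v"
    using has_distr_bv_cong[OF has_distr_bv_scale[OF has_distr_bv_add[OF u v], of "2 * pi"],
        of "schwarz_power ?h 0"]
    by (auto simp: schwarz_power_def Re_distr_schwarz_kernel[OF g u])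
  show ?thesis
  proof (induction m)
    case 0
    from base obtain v where "has_distr_bv (schwarz_power ?h 0) v" by blast
    then show ?case by (rule step)
  next
    case (Suc m)
    then obtain v where "has_distr_bv (schwarz_power ?h (Suc m)) v"
      unfolding imaginary_bv_def by blast
    then show ?case by (rule step)
  qed
qed

section \<open>Integration over the plane\<close>

lemma measurable_Complex [measurable]:
  assumes "f \<in> borel_measurable M" "g \<in> borel_measurable M"
  shows "(\<lambda>x. Complex (f x) (g x)) \<in> borel_measurable M"
  unfolding Complex_eq using assms by measurable

lemma lborel_complex:
  "(lborel :: complex measure) = distr (lborel \<Otimes>\<^sub>M lborel) borel (\<lambda>p. Complex (fst p) (snd p))"
proof (rule lborel_eqI)
  fix l u :: complex
  assume le: "\<And>b. b \<in> Basis \<Longrightarrow> l \<bullet> b \<le> u \<bullet> b"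
  have B: "Re l \<le> Re u" "Im l \<le> Im u"
    using le[of 1] le[of \<i>] by (simp_all add: Basis_complex_def inner_complex_def)
  have "(\<lambda>p. Complex (fst p) (snd p)) -` box l u \<inter> space (lborel \<Otimes>\<^sub>M lborel) =
      {Re l<..<Re u} \<times> {Im l<..<Im u}"
    by (auto simp: box_def Basis_complex_def inner_complex_def space_pair_measure)
  then have "emeasure (distr (lborel \<Otimes>\<^sub>M lborel) borel (\<lambda>p. Complex (fst p) (snd p))) (box l u) =
      emeasure lborel {Re l<..<Re u} * emeasure lborel {Im l<..<Im u}"
    by (subst emeasure_distr) (simp_all add: lborel.emeasure_pair_measure_Times)
  also have "\<dots> = ennreal ((Re u - Re l) * (Im u - Im l))"
    using B by (simp add: ennreal_mult)
  also have "(Re u - Re l) * (Im u - Im l) = (\<Prod>b\<in>Basis. (u - l) \<bullet> b)"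
    by (simp add: Basis_complex_def inner_complex_def)
  finally show "emeasure (distr (lborel \<Otimes>\<^sub>M lborel) borel (\<lambda>p. Complex (fst p) (snd p))) (box l u) =
      (\<Prod>b\<in>Basis. (u - l) \<bullet> b)" .
qed simp

lemma nn_integral_lborel_complex:
  fixes f :: "complex \<Rightarrow> ennreal"
  assumes [measurable]: "f \<in> borel_measurable borel"
  shows "(\<integral>\<^sup>+z. f z \<partial>lborel) = (\<integral>\<^sup>+y. \<integral>\<^sup>+x. f (Complex x y) \<partial>lborel \<partial>lborel)"
  by (subst lborel_complex, subst nn_integral_distr)
    (simp_all add: lborel_pair.nn_integral_snd[symmetric])

lemma lborel_complex_Fubini:
  fixes f :: "complex \<Rightarrow> complex"
  assumes "integrable lborel f"
  shows "integrable (lborel \<Otimes>\<^sub>M lborel) (\<lambda>(x, y). f (Complex x y))"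
    and "(LINT z|lborel. f z) = (LINT y|lborel. LINT x|lborel. f (Complex x y))"
    and "(LINT z|lborel. f z) = (LINT x|lborel. LINT y|lborel. f (Complex x y))"
proof -
  have m [measurable]: "f \<in> borel_measurable borel" using assms by simp
  have "integrable (distr (lborel \<Otimes>\<^sub>M lborel) borel (\<lambda>p. Complex (fst p) (snd p))) f"
    using assms by (simp only: lborel_complex[symmetric])
  then show i: "integrable (lborel \<Otimes>\<^sub>M lborel) (\<lambda>(x, y). f (Complex x y))"
    by (subst (asm) integrable_distr_eq) (simp_all add: case_prod_beta')
  have e: "(LINT z|lborel. f z) = integral\<^sup>L (lborel \<Otimes>\<^sub>M lborel) (\<lambda>(x, y). f (Complex x y))"
    by (subst lborel_complex, subst integral_distr) (simp_all add: case_prod_beta')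
  show "(LINT z|lborel. f z) = (LINT y|lborel. LINT x|lborel. f (Complex x y))"
    unfolding e by (rule lborel_pair.integral_snd[OF i, symmetric])
  show "(LINT z|lborel. f z) = (LINT x|lborel. LINT y|lborel. f (Complex x y))"
    unfolding e by (rule lborel_pair.integral_fst[OF i, symmetric])
qed

lemma integral_compact_support_derivative:
  fixes u D :: "real \<Rightarrow> complex"
  assumes d: "\<And>x. (u has_vector_derivative D x) (at x)"
    and 0: "\<And>x. \<bar>x\<bar> \<ge> 1 \<Longrightarrow> u x = 0" "\<And>x. \<bar>x\<bar> \<ge> 1 \<Longrightarrow> D x = 0"
  shows "(LINT x|lborel. D x) = 0"
\<comment> \<open>If \<open>D\<close> is not integrable, its integral is 0 by convention.\<close>
proof (cases "integrable lborel D")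
  case True
  have "(D has_integral (u 1 - u (- 1))) {-1..1}"
    by (rule fundamental_theorem_of_calculus) (auto intro: has_vector_derivative_at_within d)
  then have "(D has_integral 0) {-1..1}" using 0 by simp
  then have "(D has_integral 0) UNIV"
    by (rule has_integral_on_superset) (use 0 in auto)
  with has_integral_integral_lborel[OF True] show ?thesis by (rule has_integral_unique)
qed (simp add: not_integrable_integral_eq)

text \<open>Along horizontal lines the derivative of u is A + B, along vertical lines i (A - B). By
  the fundamental theorem of calculus each integrates to 0 on every line that avoids \<zeta>, and
  only one line of either direction passes through it. The two relations together give the integral
  of B.\<close>

lemma integral_dbar_eq_0:
  fixes u A B :: "complex \<Rightarrow> complex"
  assumes d: "\<And>z. z \<noteq> \<zeta> \<Longrightarrow> (u has_derivative (\<lambda>h. A z * h + B z * cnj h)) (at z)"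
    and supp: "\<And>z. z \<notin> ball 0 1 \<Longrightarrow> u z = 0 \<and> A z = 0 \<and> B z = 0"
    and i: "integrable lborel A" "integrable lborel B"
  shows "(LINT z|lborel. B z) = 0"
proof -
  have out: "u (Complex x y) = 0 \<and> A (Complex x y) = 0 \<and> B (Complex x y) = 0" if "\<bar>x\<bar> \<ge> 1 \<or> \<bar>y\<bar> \<ge> 1" for x y
    using that abs_Re_le_cmod[of "Complex x y"] abs_Im_le_cmod[of "Complex x y"]
    by (intro supp) auto
  have "(LINT z|lborel. A z + B z) = (LINT y|lborel. LINT x|lborel. A (Complex x y) + B (Complex x y))"
    using i by (intro lborel_complex_Fubini(2)) auto
  also have "\<dots> = (LINT y|(lborel :: real measure). (0 :: complex))"
  proof (rule Bochner_Integration.integral_cong_AE)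
    show "AE y in lborel. (LINT x|lborel. A (Complex x y) + B (Complex x y)) = 0"
      using AE_lborel_singleton[of "Im \<zeta>"]
    proof eventually_elim
      case (elim y)
      show ?case
      proof (rule integral_compact_support_derivative)
        fix x
        have "Complex x y \<noteq> \<zeta>" using elim by auto
        note du = d[OF this]
        have "((\<lambda>x. Complex x y) has_derivative (\<lambda>h. complex_of_real h)) (at x)"
          unfolding Complex_eq by (auto intro!: derivative_eq_intros)
        from has_derivative_compose[OF this, of u, OF du]
        show "((\<lambda>x. u (Complex x y)) has_vector_derivative A (Complex x y) + B (Complex x y)) (at x)"
          by (simp add: has_vector_derivative_def scaleR_conv_of_real algebra_simps)
      qed (use out in auto)
    qed
    have [measurable]: "A \<in> borel_measurable borel" "B \<in> borel_measurable borel" using i by auto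
    show "(\<lambda>y. LINT x|lborel. A (Complex x y) + B (Complex x y)) \<in> borel_measurable lborel"
      by measurable
  qed simp
  finally have 1: "(LINT z|lborel. A z) + (LINT z|lborel. B z) = 0" using i by simp
  have "(LINT z|lborel. \<i> * (A z - B z)) = (LINT x|lborel. LINT y|lborel. \<i> * (A (Complex x y) - B (Complex x y)))"
    using i by (intro lborel_complex_Fubini(3)) auto
  also have "\<dots> = (LINT y|(lborel :: real measure). (0 :: complex))"
  proof (rule Bochner_Integration.integral_cong_AE)
    show "AE x in lborel. (LINT y|lborel. \<i> * (A (Complex x y) - B (Complex x y))) = 0"
      using AE_lborel_singleton[of "Re \<zeta>"]
    proof eventually_elim
      case (elim x)
      show ?case
      proof (rule integral_compact_support_derivative)
        fix y
        have "Complex x y \<noteq> \<zeta>" using elim by auto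
        note du = d[OF this]
        have "((\<lambda>y. Complex x y) has_derivative (\<lambda>h. \<i> * complex_of_real h)) (at y)"
          unfolding Complex_eq by (auto intro!: derivative_eq_intros)
        from has_derivative_compose[OF this, of u, OF du]
        show "((\<lambda>y. u (Complex x y)) has_vector_derivative \<i> * (A (Complex x y) - B (Complex x y))) (at y)"
          by (simp add: has_vector_derivative_def scaleR_conv_of_real algebra_simps)
      qed (use out in auto)
    qed
    have [measurable]: "A \<in> borel_measurable borel" "B \<in> borel_measurable borel" using i by auto
    show "(\<lambda>x. LINT y|lborel. \<i> * (A (Complex x y) - B (Complex x y))) \<in> borel_measurable lborel"
      by measurable
  qed simp
  finally have 2: "(LINT z|lborel. A z) - (LINT z|lborel. B z) = 0" using i by simp
  from 1 2 show ?thesis by (simp add: complex_eq_iff)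
qed

text \<open>Since \<open>sqrt\<close> is extended oddly to negative arguments, 2 \<open>sqrt\<close>
  x is a continuous antiderivative on the whole interval, with 0 as the only exceptional
  point.\<close>

lemma nn_integral_inverse_sqrt:
  assumes "\<delta> \<ge> 0"
  shows "(\<integral>\<^sup>+x. ennreal (1 / sqrt \<bar>x\<bar>) * indicator {-\<delta>..\<delta>} x \<partial>lborel) = ennreal (4 * sqrt \<delta>)"
proof -
  have "((\<lambda>x. 1 / sqrt \<bar>x\<bar>) has_integral (2 * sqrt \<delta> - 2 * sqrt (- \<delta>))) {-\<delta>..\<delta>}"
  proof (rule fundamental_theorem_of_calculus_interior_strong[of "{0}"])
    show "((\<lambda>x. 2 * sqrt x) has_vector_derivative 1 / sqrt \<bar>x\<bar>) (at x)" if "x \<in> {-\<delta><..<\<delta>} - {0}" for x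
    proof -
      have "(sqrt has_real_derivative 1 / (2 * sqrt \<bar>x\<bar>)) (at x)"
        using that by (intro DERIV_real_sqrt_generic) (auto simp: divide_simps real_sqrt_minus)
      from DERIV_cmult[OF this, of 2] show ?thesis
        by (simp add: has_real_derivative_iff_has_vector_derivative)
    qed
  qed (use assms in \<open>auto intro!: continuous_intros\<close>)
  then have "((\<lambda>x. 1 / sqrt \<bar>x\<bar>) has_integral 4 * sqrt \<delta>) {-\<delta>..\<delta>}"
    by (simp add: real_sqrt_minus)
  from nn_integral_has_integral_lebesgue'[OF _ this] show ?thesis by simp
qed

text \<open>From |x| |y| \<le> |z|^2 one gets 1/|z| \<le> (1 / sqrt |x|) (1 / sqrt |y|), which
  separates the variables and avoids polar coordinates. The constant is 16 = 4 * 4, not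
  sharp.\<close>

lemma nn_integral_inverse_norm_cball:
  assumes "\<delta> \<ge> 0"
  shows "(\<integral>\<^sup>+z. ennreal (1 / cmod z) * indicator (cball 0 \<delta>) z \<partial>lborel) \<le> ennreal (16 * \<delta>)"
proof -
  have [measurable]: "cball 0 \<delta> \<in> sets (borel :: complex measure)" by simp
  let ?q = "\<lambda>x. ennreal (1 / sqrt \<bar>x\<bar>) * indicator {-\<delta>..\<delta>} x"
  have le: "ennreal (1 / cmod (Complex x y)) * indicator (cball 0 \<delta>) (Complex x y) \<le> ?q x * ?q y"
    if "x \<noteq> 0" "y \<noteq> 0" for x y
  proof (cases "Complex x y \<in> cball 0 \<delta>")
    case True
    then have "\<bar>x\<bar> \<le> \<delta>" "\<bar>y\<bar> \<le> \<delta>"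
      using abs_Re_le_cmod[of "Complex x y"] abs_Im_le_cmod[of "Complex x y"] by auto
    then have ind: "x \<in> {-\<delta>..\<delta>}" "y \<in> {-\<delta>..\<delta>}" by auto
    have "\<bar>x\<bar> * \<bar>y\<bar> \<le> cmod (Complex x y) * cmod (Complex x y)"
      using abs_Re_le_cmod[of "Complex x y"] abs_Im_le_cmod[of "Complex x y"] by (intro mult_mono) auto
    then have "sqrt (\<bar>x\<bar> * \<bar>y\<bar>) \<le> cmod (Complex x y)"
      by (metis abs_norm_cancel real_sqrt_abs2 real_sqrt_le_iff)
    then have "1 / cmod (Complex x y) \<le> 1 / (sqrt \<bar>x\<bar> * sqrt \<bar>y\<bar>)"
      using that by (intro frac_le) (auto simp: real_sqrt_mult)
    also have "\<dots> = 1 / sqrt \<bar>x\<bar> * (1 / sqrt \<bar>y\<bar>)" by simp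
    finally show ?thesis
      using ind True by (simp add: ennreal_mult[symmetric] ennreal_leI)
  qed simp
  have "(\<integral>\<^sup>+z. ennreal (1 / cmod z) * indicator (cball 0 \<delta>) z \<partial>lborel) =
      (\<integral>\<^sup>+y. \<integral>\<^sup>+x. ennreal (1 / cmod (Complex x y)) * indicator (cball 0 \<delta>) (Complex x y) \<partial>lborel \<partial>lborel)"
    by (rule nn_integral_lborel_complex) measurable
  also have "\<dots> \<le> (\<integral>\<^sup>+y. \<integral>\<^sup>+x. ?q x * ?q y \<partial>lborel \<partial>lborel)"
  proof (rule nn_integral_mono_AE)
    show "AE y in lborel. (\<integral>\<^sup>+x. ennreal (1 / cmod (Complex x y)) * indicator (cball 0 \<delta>) (Complex x y) \<partial>lborel)
        \<le> (\<integral>\<^sup>+x. ?q x * ?q y \<partial>lborel)"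
      using AE_lborel_singleton[of "0 :: real"]
    proof eventually_elim
      case (elim y)
      show ?case
        using AE_lborel_singleton[of "0 :: real"]
        by (intro nn_integral_mono_AE, eventually_elim) (rule le, use elim in auto)
    qed
  qed
  also have "\<dots> = ennreal (4 * sqrt \<delta>) * ennreal (4 * sqrt \<delta>)"
    by (simp add: nn_integral_multc nn_integral_cmult nn_integral_inverse_sqrt[OF assms])
  also have "\<dots> = ennreal (16 * \<delta>)"
    using assms by (simp add: ennreal_mult[symmetric])
  finally show ?thesis .
qed

lemma nn_integral_lborel_translate:
  fixes f :: "'a :: euclidean_space \<Rightarrow> ennreal"
  assumes [measurable]: "f \<in> borel_measurable borel"
  shows "(\<integral>\<^sup>+z. f (c + z) \<partial>lborel) = (\<integral>\<^sup>+z. f z \<partial>lborel)"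
  by (subst (2) lborel_distr_plus[of c, symmetric], subst nn_integral_distr) simp_all

text \<open>Within distance \<delta> of \<zeta> the singularity is integrated; farther away the
  integrand is below 1/\<delta>. The bound is uniform in \<zeta>. The choice \<delta> = 1 gives
  integrability over the disc, and \<delta> = \<epsilon> the behaviour on discs of radius
  \<epsilon>.\<close>

lemma nn_integral_inverse_norm_le:
  fixes \<zeta> :: complex
  assumes [measurable]: "S \<in> sets borel" and "\<delta> > 0"
  shows "(\<integral>\<^sup>+z. ennreal (1 / cmod (\<zeta> - z)) * indicator S z \<partial>lborel) \<le>
    ennreal (16 * \<delta>) + ennreal (1 / \<delta>) * emeasure lborel S"
proof -
  have [measurable]: "cball c \<delta> \<in> sets borel" for c :: complex by simp
  have "(\<integral>\<^sup>+z. ennreal (1 / cmod (\<zeta> - z)) * indicator S z \<partial>lborel) \<le>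
      (\<integral>\<^sup>+z. ennreal (1 / cmod (\<zeta> - z)) * indicator (cball \<zeta> \<delta>) z + ennreal (1 / \<delta>) * indicator S z \<partial>lborel)"
  proof (intro nn_integral_mono)
    fix z
    show "ennreal (1 / cmod (\<zeta> - z)) * indicator S z \<le>
        ennreal (1 / cmod (\<zeta> - z)) * indicator (cball \<zeta> \<delta>) z + ennreal (1 / \<delta>) * indicator S z"
    proof (cases "cmod (\<zeta> - z) \<le> \<delta>")
      case True
      then have "z \<in> cball \<zeta> \<delta>" by (simp add: dist_norm)
      then show ?thesis by (auto simp: indicator_def)
    next
      case False
      then have "1 / cmod (\<zeta> - z) \<le> 1 / \<delta>" using assms(2) by (intro divide_left_mono mult_pos_pos) auto
      then show ?thesis by (auto simp: indicator_def intro!: ennreal_leI add_increasing)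
    qed
  qed
  also have "\<dots> = (\<integral>\<^sup>+z. ennreal (1 / cmod (\<zeta> - z)) * indicator (cball \<zeta> \<delta>) z \<partial>lborel) +
      ennreal (1 / \<delta>) * emeasure lborel S"
  proof -
    have "(\<lambda>z. ennreal (1 / cmod (\<zeta> - z)) * indicator (cball \<zeta> \<delta>) z) \<in> borel_measurable lborel"
      "(\<lambda>z. ennreal (1 / \<delta>) * indicator S z) \<in> borel_measurable lborel" by measurable
    then show ?thesis by (subst nn_integral_add) (simp_all add: nn_integral_cmult)
  qed
  also have "(\<integral>\<^sup>+z. ennreal (1 / cmod (\<zeta> - z)) * indicator (cball \<zeta> \<delta>) z \<partial>lborel) =
      (\<integral>\<^sup>+z. ennreal (1 / cmod (- \<zeta> + z)) * indicator (cball 0 \<delta>) (- \<zeta> + z) \<partial>lborel)"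
    by (intro nn_integral_cong) (auto simp: indicator_def norm_minus_commute dist_norm)
  also have "\<dots> = (\<integral>\<^sup>+z. ennreal (1 / cmod z) * indicator (cball 0 \<delta>) z \<partial>lborel)"
    by (rule nn_integral_lborel_translate[of "\<lambda>z. ennreal (1 / cmod z) * indicator (cball 0 \<delta>) z"]) measurable
  also have "\<dots> \<le> ennreal (16 * \<delta>)" using nn_integral_inverse_norm_cball assms(2) by simp
  finally show ?thesis by (simp add: add_right_mono)
qed

lemma gaussian_integral_complex:
  "has_bochner_integral lborel (\<lambda>z :: complex. exp (- (cmod z)\<^sup>2)) pi"
proof (rule has_bochner_integral_nn_integral)
  let ?g = "\<lambda>x :: real. ennreal (exp (- x\<^sup>2))"
  have g: "(\<integral>\<^sup>+x. ?g x \<partial>lborel) = ennreal (sqrt pi)"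
  proof -
    have "has_bochner_integral lborel (\<lambda>x :: real. exp (- x\<^sup>2)) (2 *\<^sub>R (sqrt pi / 2))"
      by (rule has_bochner_integral_even_function[OF gaussian_moment_0]) simp
    then show ?thesis
      using nn_integral_eq_integral[of lborel "\<lambda>x :: real. exp (- x\<^sup>2)"]
      by (simp add: has_bochner_integral_iff)
  qed
  have "(\<integral>\<^sup>+z. ennreal (exp (- (cmod z)\<^sup>2)) \<partial>lborel) =
      (\<integral>\<^sup>+y. \<integral>\<^sup>+x. ennreal (exp (- (cmod (Complex x y))\<^sup>2)) \<partial>lborel \<partial>lborel)"
    by (rule nn_integral_lborel_complex) simp
  also have "\<dots> = (\<integral>\<^sup>+y. \<integral>\<^sup>+x. ?g x * ?g y \<partial>lborel \<partial>lborel)"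
    by (intro nn_integral_cong) (simp add: cmod_power2 ennreal_mult[symmetric] exp_add[symmetric])
  also have "\<dots> = ennreal (sqrt pi) * ennreal (sqrt pi)"
    by (simp add: nn_integral_multc nn_integral_cmult g)
  also have "\<dots> = ennreal pi" by (simp add: ennreal_mult[symmetric])
  finally show "(\<integral>\<^sup>+z. ennreal (exp (- (cmod z)\<^sup>2)) \<partial>lborel) = ennreal pi" .
qed auto

section \<open>The Cauchy-Pompeiu formula\<close>

lemma integrable_inverse_norm:
  fixes \<zeta> :: complex
  assumes "S \<in> sets borel" "emeasure lborel S < \<infinity>"
  shows "integrable lborel (\<lambda>z. indicator S z * (1 / cmod (\<zeta> - z)))"
proof (rule integrableI_bounded)
  have [measurable]: "S \<in> sets borel" by fact
  show "(\<lambda>z. indicator S z * (1 / cmod (\<zeta> - z))) \<in> borel_measurable lborel" by measurable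
  have "(\<integral>\<^sup>+z. ennreal (norm (indicator S z * (1 / cmod (\<zeta> - z)))) \<partial>lborel) =
      (\<integral>\<^sup>+z. ennreal (1 / cmod (\<zeta> - z)) * indicator S z \<partial>lborel)"
    by (intro nn_integral_cong) (auto simp: indicator_def)
  also have "\<dots> \<le> ennreal (16 * 1) + ennreal (1 / 1) * emeasure lborel S"
    by (rule nn_integral_inverse_norm_le) (use assms in auto)
  also have "\<dots> < \<infinity>" using assms(2) by (simp add: ennreal_add_eq_top less_top)
  finally show "(\<integral>\<^sup>+z. ennreal (norm (indicator S z * (1 / cmod (\<zeta> - z)))) \<partial>lborel) < \<infinity>" .
qed

lemma integral_lborel_affine:
  fixes f :: "'a :: euclidean_space \<Rightarrow> 'b :: {banach, second_countable_topology}"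
  assumes [measurable]: "f \<in> borel_measurable borel" and "c \<noteq> 0"
  shows "(LINT x|lborel. f x) = \<bar>c\<bar> ^ DIM('a) *\<^sub>R (LINT x|lborel. f (t + c *\<^sub>R x))"
  by (subst lborel_affine[OF assms(2), of t], subst integral_density, simp, simp, simp,
      subst integral_distr) simp_all

lemma bounded_compact_support:
  fixes F :: "complex \<Rightarrow> complex"
  assumes "continuous_on UNIV F" "\<And>z. z \<notin> ball 0 1 \<Longrightarrow> F z = 0"
  shows "\<exists>M>0. \<forall>z. cmod (F z) \<le> M"
proof -
  have "compact (F ` cball 0 1)"
    by (intro compact_continuous_image continuous_on_subset[OF assms(1)]) auto
  then obtain M where M: "M > 0" "\<And>z. z \<in> cball 0 1 \<Longrightarrow> cmod (F z) \<le> M"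
    using compact_imp_bounded bounded_pos by (metis imageI)
  have "cmod (F z) \<le> M" for z
    using M assms(2)[of z] by (cases "z \<in> ball 0 1") auto
  with M(1) show ?thesis by blast
qed

lemma cnj_measurable [measurable]: "cnj \<in> borel_measurable borel"
  by (intro borel_measurable_continuous_onI continuous_intros)

lemma cauchy_pompeiu:
  fixes \<psi> A B :: "complex \<Rightarrow> complex"
  assumes d: "\<And>z. (\<psi> has_derivative (\<lambda>h. A z * h + B z * cnj h)) (at z)"
    and c: "continuous_on UNIV A" "continuous_on UNIV B"
    and supp: "\<And>z. z \<notin> ball 0 1 \<Longrightarrow> \<psi> z = 0 \<and> A z = 0 \<and> B z = 0"
  shows "integrable lborel (\<lambda>z. B z / (\<zeta> - z))"
    and "(LINT z|lborel. B z / (\<zeta> - z)) = pi * \<psi> \<zeta>"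
proof -
  have c\<psi>: "continuous_on UNIV \<psi>"
    by (meson continuous_at_imp_continuous_on has_derivative_continuous d)
  have [measurable]: "A \<in> borel_measurable borel" "B \<in> borel_measurable borel" "\<psi> \<in> borel_measurable borel"
    using c c\<psi> by (auto intro: borel_measurable_continuous_onI)
  obtain MA MB M\<psi> where M: "MA > 0" "\<And>z. cmod (A z) \<le> MA" "MB > 0" "\<And>z. cmod (B z) \<le> MB"
    "M\<psi> > 0" "\<And>z. cmod (\<psi> z) \<le> M\<psi>"
    using bounded_compact_support[OF c(1)] bounded_compact_support[OF c(2)] bounded_compact_support[OF c\<psi>]
      supp by metis
  have ball: "ball (0 :: complex) 1 \<in> sets borel" "emeasure lborel (ball (0 :: complex) 1) < \<infinity>"
    using emeasure_bounded_finite[OF bounded_ball[of "0 :: complex" 1]] by auto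
  have ballL: "ball (0 :: complex) 1 \<in> sets lborel" by simp
  have dom: "integrable lborel (\<lambda>z. MB * (indicator (ball 0 1) z * (1 / cmod (\<zeta> - z))))"
    by (intro integrable_mult_right integrable_inverse_norm ball)
  have B0: "cmod (B z) \<le> MB * indicator (ball 0 1) z" for z
    using M(4)[of z] supp[of z] by (auto simp: indicator_def)
  show int: "integrable lborel (\<lambda>z. B z / (\<zeta> - z))"
  proof (rule Bochner_Integration.integrable_bound[OF dom])
    show "AE z in lborel. norm (B z / (\<zeta> - z)) \<le> norm (MB * (indicator (ball 0 1) z * (1 / cmod (\<zeta> - z))))"
      using B0 M(3) by (intro AE_I2) (auto simp: norm_divide abs_mult intro!: divide_right_mono)
  qed measurable
  txt \<open>Integrating the conjugate derivative of \<open>\<psi> k\<^sub>n\<close>, where \<open>k\<^sub>n\<close> is the kernel \<open>1 / (z - \<zeta>)\<close>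
    smoothed by a Gaussian, avoids excising a disc: the conjugate derivative of \<open>k\<^sub>n\<close> is an
    approximate identity at \<open>\<zeta>\<close>.\<close>
  define e where "e n z = exp (- (of_nat (Suc n) * (z - \<zeta>)) * (of_nat (Suc n) * (cnj z - cnj \<zeta>)))" for n z
  define N :: "nat \<Rightarrow> complex" where "N n = of_nat (Suc n)" for n
  have N0: "N n \<noteq> 0" for n unfolding N_def by (metis of_nat_eq_0_iff nat.distinct(1))
  have e_alt: "e n z = exp (- (N n * (z - \<zeta>)) * (N n * (cnj z - cnj \<zeta>)))" for n z
    by (simp add: e_def N_def)
  have e_real: "e n z = complex_of_real (exp (- (real (Suc n) * cmod (z - \<zeta>))\<^sup>2))" for n z
  proof -
    have "(z - \<zeta>) * (cnj z - cnj \<zeta>) = complex_of_real ((cmod (z - \<zeta>))\<^sup>2)"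
      by (metis complex_cnj_diff complex_norm_square of_real_power)
    then have "- (N n * (z - \<zeta>)) * (N n * (cnj z - cnj \<zeta>)) =
        complex_of_real (- (real (Suc n) * cmod (z - \<zeta>))\<^sup>2)"
      unfolding N_def power_mult_distrib
      by (metis (no_types, lifting) mult.assoc mult.left_commute mult_minus_left of_real_minus
          of_real_mult of_real_of_nat_eq of_real_power power2_eq_square)
    then show ?thesis unfolding e_alt by (simp only: exp_of_real)
  qed
  have [measurable]: "e n \<in> borel_measurable borel" for n
    unfolding e_real by measurable
  have e_le: "cmod (e n z) \<le> 1" "cmod (1 - e n z) \<le> 1"
    "cmod (1 - e n z) \<le> (real (Suc n) * cmod (z - \<zeta>))\<^sup>2" for n z
  proof -
    let ?s = "(real (Suc n) * cmod (z - \<zeta>))\<^sup>2"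
    show "cmod (e n z) \<le> 1" unfolding e_real by (simp del: of_nat_Suc)
    have "1 - e n z = complex_of_real (1 - exp (- ?s))" unfolding e_real by simp
    then have n: "cmod (1 - e n z) = \<bar>1 - exp (- ?s)\<bar>" by (simp only: norm_of_real)
    have "exp (- ?s) \<le> 1" by simp
    moreover have "1 + (- ?s) \<le> exp (- ?s)" by (rule exp_ge_add_one_self)
    moreover have "exp (- ?s) > 0" by simp
    ultimately show "cmod (1 - e n z) \<le> 1" "cmod (1 - e n z) \<le> ?s" unfolding n by linarith+
  qed
  \<comment> \<open>As 1 - \<open>e n z\<close> is O(|z - \<zeta>|^2), the smoothed kernel and the
    coefficients of its differential stay bounded near \<zeta>, so \<open>integral_dbar_eq_0\<close>
    applies with \<zeta> as the exceptional point.\<close>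
  define k where "k n z = (1 - e n z) / (z - \<zeta>)" for n z
  define A' where "A' n z = A z * k n z + \<psi> z * ((N n)\<^sup>2 * (cnj z - cnj \<zeta>) * e n z / (z - \<zeta>) - (1 - e n z) / (z - \<zeta>)\<^sup>2)" for n z
  define B' where "B' n z = B z * k n z + \<psi> z * ((N n)\<^sup>2 * e n z)" for n z
  have [measurable]: "k n \<in> borel_measurable borel" for n
    unfolding k_def by measurable
  have [measurable]: "A' n \<in> borel_measurable borel" "B' n \<in> borel_measurable borel" for n
    unfolding A'_def B'_def by measurable
  have du: "((\<lambda>z. \<psi> z * k n z) has_derivative (\<lambda>h. A' n z * h + B' n z * cnj h)) (at z)" if "z \<noteq> \<zeta>" for n z
  proof -
    have de: "(e n has_derivative (\<lambda>h. - ((N n)\<^sup>2 * (cnj z - cnj \<zeta>) * e n z * h + (N n)\<^sup>2 * (z - \<zeta>) * e n z * cnj h))) (at z)"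
    proof -
      have "((\<lambda>z. - (N n * (z - \<zeta>)) * (N n * (cnj z - cnj \<zeta>))) has_derivative
          (\<lambda>h. - (N n * (z - \<zeta>)) * (N n * cnj h) + - (N n * h) * (N n * (cnj z - cnj \<zeta>)))) (at z)"
        by (auto intro!: derivative_eq_intros)
      from has_derivative_compose[OF this DERIV_exp[unfolded has_field_derivative_def]] show ?thesis
        unfolding e_alt[abs_def] by (simp add: algebra_simps power2_eq_square)
    qed
    have "((\<lambda>z. \<psi> z * (1 - e n z) / (z - \<zeta>)) has_derivative
        (\<lambda>h. ((\<psi> z * ((N n)\<^sup>2 * (z - \<zeta>) * e n z * cnj h + (N n)\<^sup>2 * (cnj z - cnj \<zeta>) * e n z * h) +
            (A z * h + B z * cnj h) * (1 - e n z)) * (z - \<zeta>) - \<psi> z * (1 - e n z) * h) /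
          ((z - \<zeta>) * (z - \<zeta>)))) (at z)"
      using that by (auto intro!: derivative_eq_intros d de)
    moreover have "((p * (m * w * x * c + m * v * x * h) + (a * h + b * c) * E) * w - p * E * h) / (w * w) =
        (a * (E / w) + p * (m * v * x / w - E / w\<^sup>2)) * h + (b * (E / w) + p * (m * x)) * c"
      if "w \<noteq> 0" for p m w x c v h a b E :: complex
      using that by (simp add: field_simps power2_eq_square)
    moreover have "z - \<zeta> \<noteq> 0" using that by simp
    ultimately show ?thesis unfolding A'_def B'_def k_def by simp
  qed
  have k_le: "cmod (k n z) \<le> (real (Suc n))\<^sup>2 * (1 + cmod \<zeta>)" "cmod (\<psi> z * ((1 - e n z) / (z - \<zeta>)\<^sup>2)) \<le> M\<psi> * (real (Suc n))\<^sup>2"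
    "cmod ((N n)\<^sup>2 * (cnj z - cnj \<zeta>) * e n z / (z - \<zeta>)) \<le> (real (Suc n))\<^sup>2"
    if z: "z \<in> ball 0 1" for n z
  proof -
    have w: "cmod (z - \<zeta>) \<le> 1 + cmod \<zeta>" using z norm_triangle_ineq4[of z \<zeta>] by simp
    have "cmod (k n z) \<le> (real (Suc n) * cmod (z - \<zeta>))\<^sup>2 / cmod (z - \<zeta>)"
      unfolding k_def norm_divide by (intro divide_right_mono e_le) simp
    also have "\<dots> \<le> (real (Suc n))\<^sup>2 * (1 + cmod \<zeta>)"
      using w by (cases "z = \<zeta>") (auto simp: power2_eq_square mult_left_mono)
    finally show "cmod (k n z) \<le> (real (Suc n))\<^sup>2 * (1 + cmod \<zeta>)" .
    have "cmod ((1 - e n z) / (z - \<zeta>)\<^sup>2) \<le> (real (Suc n) * cmod (z - \<zeta>))\<^sup>2 / (cmod (z - \<zeta>))\<^sup>2"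
      unfolding norm_divide norm_power by (intro divide_right_mono e_le) simp
    also have "\<dots> \<le> (real (Suc n))\<^sup>2"
      by (cases "z = \<zeta>") (auto simp: power_mult_distrib)
    finally show "cmod (\<psi> z * ((1 - e n z) / (z - \<zeta>)\<^sup>2)) \<le> M\<psi> * (real (Suc n))\<^sup>2"
      unfolding norm_mult using M by (intro mult_mono) (auto intro: less_imp_le)
    have "cmod (cnj z - cnj \<zeta>) = cmod (z - \<zeta>)" by (metis complex_cnj_diff complex_mod_cnj)
    then have "cmod ((N n)\<^sup>2 * (cnj z - cnj \<zeta>) * e n z / (z - \<zeta>)) = (real (Suc n))\<^sup>2 * cmod (e n z) * (cmod (z - \<zeta>) / cmod (z - \<zeta>))"
      unfolding N_def by (simp add: norm_mult norm_divide norm_power del: of_nat_Suc)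
    also have "\<dots> \<le> (real (Suc n))\<^sup>2 * 1 * 1"
      by (intro mult_mono e_le) auto
    finally show "cmod ((N n)\<^sup>2 * (cnj z - cnj \<zeta>) * e n z / (z - \<zeta>)) \<le> (real (Suc n))\<^sup>2" by simp
  qed
  have iA: "integrable lborel (A' n)" for n
  proof (rule integrableI_bounded_set[OF ballL _ ball(2)])
    show "AE z in lborel. z \<in> ball 0 1 \<longrightarrow> norm (A' n z) \<le> MA * ((real (Suc n))\<^sup>2 * (1 + cmod \<zeta>)) +
        (M\<psi> * (real (Suc n))\<^sup>2 + M\<psi> * (real (Suc n))\<^sup>2)"
    proof (intro AE_I2 impI)
      fix z :: complex assume z: "z \<in> ball 0 1"
      have "A' n z = A z * k n z + (\<psi> z * ((N n)\<^sup>2 * (cnj z - cnj \<zeta>) * e n z / (z - \<zeta>)) - \<psi> z * ((1 - e n z) / (z - \<zeta>)\<^sup>2))"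
        unfolding A'_def by (simp only: right_diff_distrib)
      then show "norm (A' n z) \<le> MA * ((real (Suc n))\<^sup>2 * (1 + cmod \<zeta>)) +
        (M\<psi> * (real (Suc n))\<^sup>2 + M\<psi> * (real (Suc n))\<^sup>2)"
      proof (simp only:, intro order.trans[OF norm_triangle_ineq] add_mono order.trans[OF norm_triangle_ineq4])
        show "cmod (A z * k n z) \<le> MA * ((real (Suc n))\<^sup>2 * (1 + cmod \<zeta>))"
          unfolding norm_mult using k_le(1)[OF z] M by (intro mult_mono) (auto intro: less_imp_le)
        show "cmod (\<psi> z * ((N n)\<^sup>2 * (cnj z - cnj \<zeta>) * e n z / (z - \<zeta>))) \<le> M\<psi> * (real (Suc n))\<^sup>2"
          unfolding norm_mult[of "\<psi> z"] using k_le(3)[OF z] M by (intro mult_mono) (auto intro: less_imp_le)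
        show "cmod (\<psi> z * ((1 - e n z) / (z - \<zeta>)\<^sup>2)) \<le> M\<psi> * (real (Suc n))\<^sup>2"
          by (rule k_le(2)[OF z])
      qed
    qed
    show "AE z in lborel. z \<notin> ball 0 1 \<longrightarrow> A' n z = 0"
      using supp by (auto simp: A'_def)
  qed measurable
  have iB: "integrable lborel (\<lambda>z. B z * k n z)" for n
  proof (rule integrableI_bounded_set[OF ballL _ ball(2)])
    show "AE z in lborel. z \<in> ball 0 1 \<longrightarrow> norm (B z * k n z) \<le> MB * ((real (Suc n))\<^sup>2 * (1 + cmod \<zeta>))"
      using k_le(1) M unfolding norm_mult by (intro AE_I2 impI mult_mono) (auto intro: less_imp_le)
    show "AE z in lborel. z \<notin> ball 0 1 \<longrightarrow> B z * k n z = 0"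
      using supp by auto
  qed measurable
  have i\<psi>: "integrable lborel (\<lambda>z. \<psi> z * ((N n)\<^sup>2 * e n z))" for n
  proof (rule integrableI_bounded_set[OF ballL _ ball(2)])
    show "AE z in lborel. z \<in> ball 0 1 \<longrightarrow> norm (\<psi> z * ((N n)\<^sup>2 * e n z)) \<le> M\<psi> * ((cmod (N n))\<^sup>2 * 1)"
      using M e_le(1) unfolding norm_mult norm_power by (intro AE_I2 impI mult_mono) (auto intro: less_imp_le)
    show "AE z in lborel. z \<notin> ball 0 1 \<longrightarrow> \<psi> z * ((N n)\<^sup>2 * e n z) = 0"
      using supp by auto
  qed measurable
  have "(LINT z|lborel. B' n z) = 0" for n
  proof (rule integral_dbar_eq_0[OF du _ iA])
    show "integrable lborel (B' n)"
      unfolding B'_def[abs_def] by (rule Bochner_Integration.integrable_add[OF iB i\<psi>])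
  qed (use supp in \<open>auto simp: A'_def B'_def\<close>)
  then have sum0: "(LINT z|lborel. B z * k n z) + (LINT z|lborel. \<psi> z * ((N n)\<^sup>2 * e n z)) = 0" for n
    unfolding B'_def by (subst (asm) Bochner_Integration.integral_add[OF iB i\<psi>])
  \<comment> \<open>The bound |1 - \<open>e n z\<close>| \<le> 1 keeps every smoothed kernel below
    1/|\<zeta> - z|, hence the integrands below the majorant of \<open>dom\<close>.\<close>
  have lim1: "(\<lambda>n. LINT z|lborel. B z * k n z) \<longlonglongrightarrow> (LINT z|lborel. B z / (z - \<zeta>))"
  proof (rule integral_dominated_convergence[OF _ _ dom])
    show "AE z in lborel. (\<lambda>n. B z * k n z) \<longlonglongrightarrow> B z / (z - \<zeta>)"
      using AE_lborel_singleton[of \<zeta>]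
    proof eventually_elim
      case (elim z)
      then have w: "cmod (z - \<zeta>) > 0" by simp
      have "(\<lambda>n. exp (- (real (Suc n) * cmod (z - \<zeta>))\<^sup>2)) \<longlonglongrightarrow> 0"
        using w by real_asymp
      then have "(\<lambda>n. e n z) \<longlonglongrightarrow> complex_of_real 0" unfolding e_real by (rule tendsto_of_real)
      then have "(\<lambda>n. B z * ((1 - e n z) / (z - \<zeta>))) \<longlonglongrightarrow> B z * ((1 - complex_of_real 0) / (z - \<zeta>))"
        using elim by (intro tendsto_intros) auto
      then show ?case unfolding k_def by simp
    qed
    show "AE z in lborel. norm (B z * k n z) \<le> MB * (indicator (ball 0 1) z * (1 / cmod (\<zeta> - z)))" for n
    proof (intro AE_I2)
      fix z
      have "norm (B z * k n z) \<le> (MB * indicator (ball 0 1) z) * (1 / cmod (z - \<zeta>))"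
        unfolding norm_mult k_def norm_divide using M B0 e_le(2)
        by (intro mult_mono divide_right_mono) (auto simp: less_imp_le)
      then show "norm (B z * k n z) \<le> MB * (indicator (ball 0 1) z * (1 / cmod (\<zeta> - z)))"
        by (simp add: norm_minus_commute)
    qed
  qed measurable
  have lim2: "(\<lambda>n. LINT z|lborel. \<psi> z * ((N n)\<^sup>2 * e n z)) \<longlonglongrightarrow> (LINT z|lborel. \<psi> \<zeta> * complex_of_real (exp (- (cmod z)\<^sup>2)))"
  proof -
    have "(LINT z|lborel. \<psi> z * ((N n)\<^sup>2 * e n z)) =
        (LINT z|lborel. \<psi> (\<zeta> + (1 / real (Suc n)) *\<^sub>R z) * complex_of_real (exp (- (cmod z)\<^sup>2)))" for n
    proof -
      \<comment> \<open>Blowing up around \<zeta> by the factor n + 1: the Jacobian (n + 1)^(-2)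
        cancels \<open>(N n)\<^sup>2\<close> and the Gaussian becomes independent of n.\<close>
      have "(LINT z|lborel. \<psi> z * ((N n)\<^sup>2 * e n z)) = \<bar>1 / real (Suc n)\<bar> ^ DIM(complex) *\<^sub>R
          (LINT z|lborel. \<psi> (\<zeta> + (1 / real (Suc n)) *\<^sub>R z) * ((N n)\<^sup>2 * e n (\<zeta> + (1 / real (Suc n)) *\<^sub>R z)))"
        by (rule integral_lborel_affine) simp_all
      also have "\<dots> = (LINT z|lborel. \<bar>1 / real (Suc n)\<bar> ^ DIM(complex) *\<^sub>R
          (\<psi> (\<zeta> + (1 / real (Suc n)) *\<^sub>R z) * ((N n)\<^sup>2 * e n (\<zeta> + (1 / real (Suc n)) *\<^sub>R z))))"
        by simp
      also have "\<dots> = (LINT z|lborel. \<psi> (\<zeta> + (1 / real (Suc n)) *\<^sub>R z) * complex_of_real (exp (- (cmod z)\<^sup>2)))"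
      proof (rule Bochner_Integration.integral_cong[OF refl])
        fix z
        have "e n (\<zeta> + (1 / real (Suc n)) *\<^sub>R z) = complex_of_real (exp (- (cmod z)\<^sup>2))"
          unfolding e_real by (simp del: of_nat_Suc)
        moreover have "complex_of_real (\<bar>1 / real (Suc n)\<bar> ^ DIM(complex)) * (N n)\<^sup>2 = 1"
          using N0[of n] by (simp add: N_def power2_eq_square del: of_nat_Suc)
        moreover have "a *\<^sub>R (p * (m * x)) = p * x" if "complex_of_real a * m = 1" for a p m x
        proof -
          have "a *\<^sub>R (p * (m * x)) = (complex_of_real a * m) * (p * x)"
            by (simp add: scaleR_conv_of_real)
          then show ?thesis using that by simp
        qed
        ultimately show "\<bar>1 / real (Suc n)\<bar> ^ DIM(complex) *\<^sub>R
          (\<psi> (\<zeta> + (1 / real (Suc n)) *\<^sub>R z) * ((N n)\<^sup>2 * e n (\<zeta> + (1 / real (Suc n)) *\<^sub>R z))) =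
          \<psi> (\<zeta> + (1 / real (Suc n)) *\<^sub>R z) * complex_of_real (exp (- (cmod z)\<^sup>2))"
          by (simp only:)
      qed
      finally show ?thesis .
    qed
    moreover have "(\<lambda>n. LINT z|lborel. \<psi> (\<zeta> + (1 / real (Suc n)) *\<^sub>R z) * complex_of_real (exp (- (cmod z)\<^sup>2)))
        \<longlonglongrightarrow> (LINT z|lborel. \<psi> \<zeta> * complex_of_real (exp (- (cmod z)\<^sup>2)))"
    proof (rule integral_dominated_convergence)
      show "integrable lborel (\<lambda>z :: complex. M\<psi> * exp (- (cmod z)\<^sup>2))"
        using gaussian_integral_complex by (intro integrable_mult_right) (simp add: has_bochner_integral_iff)
      show "AE z in lborel. (\<lambda>n. \<psi> (\<zeta> + (1 / real (Suc n)) *\<^sub>R z) * complex_of_real (exp (- (cmod z)\<^sup>2)))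
          \<longlonglongrightarrow> \<psi> \<zeta> * complex_of_real (exp (- (cmod z)\<^sup>2))"
      proof (intro AE_I2 tendsto_mult_right)
        fix z
        have "(\<lambda>n. \<zeta> + (1 / real (Suc n)) *\<^sub>R z) \<longlonglongrightarrow> \<zeta> + 0 *\<^sub>R z"
          by (intro tendsto_intros) real_asymp
        moreover have "isCont \<psi> \<zeta>" using has_derivative_continuous[OF d] .
        ultimately show "(\<lambda>n. \<psi> (\<zeta> + (1 / real (Suc n)) *\<^sub>R z)) \<longlonglongrightarrow> \<psi> \<zeta>"
          using isCont_tendsto_compose[of \<zeta> \<psi>] by simp
      qed
      show "AE z in lborel. norm (\<psi> (\<zeta> + (1 / real (Suc n)) *\<^sub>R z) * complex_of_real (exp (- (cmod z)\<^sup>2)))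
          \<le> M\<psi> * exp (- (cmod z)\<^sup>2)" for n
        using M(6) by (intro AE_I2) (auto simp: norm_mult intro!: mult_right_mono)
    qed measurable
    ultimately show ?thesis by simp
  qed
  have "(LINT z|lborel. B z / (z - \<zeta>)) + (LINT z|lborel. \<psi> \<zeta> * complex_of_real (exp (- (cmod z)\<^sup>2))) = 0"
    using tendsto_add[OF lim1 lim2] unfolding sum0 by (simp add: LIMSEQ_const_iff)
  moreover have "(LINT z|lborel. \<psi> \<zeta> * complex_of_real (exp (- (cmod z)\<^sup>2))) = pi * \<psi> \<zeta>"
    using gaussian_integral_complex by (simp add: has_bochner_integral_iff)
  moreover have "(LINT z|lborel. B z / (\<zeta> - z)) = - (LINT z|lborel. B z / (z - \<zeta>))"
    by (subst Bochner_Integration.integral_minus[symmetric]) (simp only: minus_divide_right minus_diff_eq)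
  ultimately show "(LINT z|lborel. B z / (\<zeta> - z)) = pi * \<psi> \<zeta>"
    by (simp add: add_eq_0_iff)
qed

section \<open>Weak derivatives\<close>

definition dir_deriv :: "complex \<Rightarrow> (complex \<Rightarrow> complex) \<Rightarrow> complex \<Rightarrow> complex" where
  "dir_deriv u f z = frechet_derivative f (at z) u"

text \<open>Young's form of the symmetry theorem: no continuity of second derivatives is at hand,
  only differentiability of the first ones, so the mixed derivative is recovered from a second
  difference.\<close>

lemma dir_deriv_second_difference:
  assumes f: "\<And>z. f differentiable (at z)" and F: "dir_deriv u f differentiable (at z)"
  shows "((\<lambda>t. (f (z + t *\<^sub>R u + t *\<^sub>R v) - f (z + t *\<^sub>R u) - f (z + t *\<^sub>R v) + f z) /\<^sub>R t\<^sup>2)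
    \<longlongrightarrow> dir_deriv v (dir_deriv u f) z) (at_right 0)"
proof (rule tendstoI)
  fix e :: real assume "e > 0"
  define F' where "F' = frechet_derivative (dir_deriv u f) (at z)"
  define L where "L = dir_deriv v (dir_deriv u f) z"
  \<comment> \<open>Two points at distances at most t (|u| + |v|) and t |u| from z enter the
    estimate. The sum of these bounds is t (2 |u| + |v|), and the summand 1 keeps \<open>c\<close>
    positive.\<close>
  define c where "c = 2 * cmod u + cmod v + 1"
  have "c > 0" unfolding c_def by (intro add_nonneg_pos add_nonneg_nonneg) auto
  have dF: "(dir_deriv u f has_derivative F') (at z)"
    unfolding F'_def using F by (rule frechet_derivative_works[THEN iffD1])
  then have lin: "linear F'" by (rule has_derivative_linear)
  have L: "L = F' v" by (simp add: L_def dir_deriv_def F'_def)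
  have "e / (2 * c) > 0" using \<open>e > 0\<close> \<open>c > 0\<close> by simp
  with dF obtain \<delta> where \<delta>: "\<delta> > 0"
    "\<And>y. cmod (y - z) < \<delta> \<Longrightarrow> cmod (dir_deriv u f y - dir_deriv u f z - F' (y - z)) \<le> e / (2 * c) * cmod (y - z)"
    unfolding has_derivative_at_alt by blast
  have "\<delta> / c > 0" using \<delta>(1) \<open>c > 0\<close> by simp
  then have "\<forall>\<^sub>F t in at_right 0. t \<in> {0<..<\<delta> / c}"
    by (rule eventually_at_right_real)
  then show "\<forall>\<^sub>F t in at_right 0. dist ((f (z + t *\<^sub>R u + t *\<^sub>R v) - f (z + t *\<^sub>R u) - f (z + t *\<^sub>R v) + f z) /\<^sub>R t\<^sup>2)
      (dir_deriv v (dir_deriv u f) z) < e"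
  proof eventually_elim
    case (elim t)
    then have t: "t > 0" "t * c < \<delta>" using \<open>c > 0\<close> by (auto simp: field_simps)
    \<comment> \<open>The increment in direction v, followed along u, minus the linear growth it is
      expected to have. Its derivative is then small compared with t, and the mean value inequality
      applies.\<close>
    define G where "G s = f (z + t *\<^sub>R v + s *\<^sub>R u) - f (z + s *\<^sub>R u) - (s * t) *\<^sub>R L" for s
    define G' where "G' s = dir_deriv u f (z + t *\<^sub>R v + s *\<^sub>R u) - dir_deriv u f (z + s *\<^sub>R u) - t *\<^sub>R L" for s
    have line: "((\<lambda>s. f (a + s *\<^sub>R u)) has_vector_derivative dir_deriv u f (a + s *\<^sub>R u)) (at s)" for a s
    proof -
      have "((\<lambda>s. a + s *\<^sub>R u) has_derivative (\<lambda>h. h *\<^sub>R u)) (at s)"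
        by (auto intro!: derivative_eq_intros)
      from has_derivative_compose[OF this frechet_derivative_works[THEN iffD1, OF f]]
      have "((\<lambda>s. f (a + s *\<^sub>R u)) has_derivative (\<lambda>h. frechet_derivative f (at (a + s *\<^sub>R u)) (h *\<^sub>R u))) (at s)" .
      moreover have "linear (frechet_derivative f (at (a + s *\<^sub>R u)))"
        using linear_frechet_derivative f by blast
      ultimately show ?thesis
        by (simp add: has_vector_derivative_def dir_deriv_def linear_scale)
    qed
    have dG: "(G has_vector_derivative G' s) (at s)" for s
      unfolding G_def G'_def
      by (intro has_vector_derivative_diff line) (auto simp: has_vector_derivative_def intro!: derivative_eq_intros)
    have bG: "cmod (G' s) \<le> e / 2 * t" if s: "s \<in> {0..t}" for s
    proof -
      let ?y = "z + t *\<^sub>R v + s *\<^sub>R u" and ?x = "z + s *\<^sub>R u"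
      have sc: "s * cmod u \<le> t * cmod u" using s by (intro mult_right_mono) auto
      have su: "cmod (?x - z) \<le> t * cmod u"
        using s sc by simp
      have sv: "cmod (?y - z) \<le> t * cmod v + t * cmod u"
        using norm_triangle_ineq[of "t *\<^sub>R v" "s *\<^sub>R u"] s sc t by (simp add: add.assoc)
      have tc: "t * cmod u < t * c" "t * cmod v + t * cmod u < t * c"
        unfolding distrib_left[symmetric] using t(1) by (auto simp: c_def intro!: mult_strict_left_mono add_nonneg_pos)
      have 1: "cmod (dir_deriv u f ?x - dir_deriv u f z - F' (?x - z)) \<le> e / (2 * c) * cmod (?x - z)"
        using su tc t(2) by (intro \<delta>(2)) linarith
      have 2: "cmod (dir_deriv u f ?y - dir_deriv u f z - F' (?y - z)) \<le> e / (2 * c) * cmod (?y - z)"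
        using sv tc t(2) by (intro \<delta>(2)) linarith
      have "F' (?y - z) - F' (?x - z) = F' (t *\<^sub>R v)"
        by (subst linear_diff[OF lin, symmetric]) simp
      then have "G' s = (dir_deriv u f ?y - dir_deriv u f z - F' (?y - z)) - (dir_deriv u f ?x - dir_deriv u f z - F' (?x - z))"
        unfolding G'_def L linear_scale[OF lin, symmetric] by (simp add: algebra_simps)
      then have "cmod (G' s) \<le> e / (2 * c) * cmod (?y - z) + e / (2 * c) * cmod (?x - z)"
        using norm_triangle_ineq4[of "dir_deriv u f ?y - dir_deriv u f z - F' (?y - z)"
            "dir_deriv u f ?x - dir_deriv u f z - F' (?x - z)"] 1 2 by simp
      also have "\<dots> \<le> e / (2 * c) * (t * cmod v + t * cmod u) + e / (2 * c) * (t * cmod u)"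
        using su sv \<open>e / (2 * c) > 0\<close> by (intro add_mono mult_left_mono) auto
      also have "\<dots> = e / (2 * c) * (t * (2 * cmod u + cmod v))" by (simp add: algebra_simps)
      also have "\<dots> \<le> e / (2 * c) * (t * c)"
        using \<open>e / (2 * c) > 0\<close> t(1) by (intro mult_left_mono) (auto simp: c_def)
      also have "\<dots> = e / 2 * t" using \<open>c > 0\<close> by (simp add: field_simps)
      finally show ?thesis .
    qed
    have "norm (G t - G 0) \<le> e / 2 * t * norm (t - 0)"
    proof (rule differentiable_bound[of "{0..t}" G "\<lambda>s h. h *\<^sub>R G' s"])
      show "(G has_derivative (\<lambda>h. h *\<^sub>R G' s)) (at s within {0..t})" for s
        using dG[of s] unfolding has_vector_derivative_def by (rule has_derivative_at_withinI)
      show "onorm (\<lambda>h. h *\<^sub>R G' s) \<le> e / 2 * t" if "s \<in> {0..t}" for s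
      proof (rule onorm_le)
        fix h :: real
        show "norm (h *\<^sub>R G' s) \<le> e / 2 * t * norm h"
          using mult_right_mono[OF bG[OF that], of "\<bar>h\<bar>"] by (simp add: mult.commute)
      qed
    qed (use t in auto)
    also have "G t - G 0 = (f (z + t *\<^sub>R u + t *\<^sub>R v) - f (z + t *\<^sub>R u) - f (z + t *\<^sub>R v) + f z) - t\<^sup>2 *\<^sub>R L"
      unfolding G_def by (simp add: power2_eq_square algebra_simps)
    finally have n: "norm ((f (z + t *\<^sub>R u + t *\<^sub>R v) - f (z + t *\<^sub>R u) - f (z + t *\<^sub>R v) + f z) - t\<^sup>2 *\<^sub>R L) \<le> e / 2 * t\<^sup>2"
      using t by (simp add: power2_eq_square)
    have "dist ((f (z + t *\<^sub>R u + t *\<^sub>R v) - f (z + t *\<^sub>R u) - f (z + t *\<^sub>R v) + f z) /\<^sub>R t\<^sup>2) L =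
        norm (((f (z + t *\<^sub>R u + t *\<^sub>R v) - f (z + t *\<^sub>R u) - f (z + t *\<^sub>R v) + f z) - t\<^sup>2 *\<^sub>R L) /\<^sub>R t\<^sup>2)"
      unfolding dist_norm scaleR_diff_right using t by simp
    also have "\<dots> \<le> (e / 2 * t\<^sup>2) / t\<^sup>2"
      unfolding norm_scaleR using n t by (simp add: divide_simps)
    also have "\<dots> < e" using t \<open>e > 0\<close> by simp
    finally show ?case unfolding L_def .
  qed
qed

text \<open>The second difference is symmetric in u and v, so both mixed derivatives are the limit
  of the same quotient.\<close>

lemma dir_deriv_commute:
  assumes "\<And>z. f differentiable (at z)" "dir_deriv u f differentiable (at z)" "dir_deriv v f differentiable (at z)"
  shows "dir_deriv v (dir_deriv u f) z = dir_deriv u (dir_deriv v f) z"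
proof -
  note 1 = dir_deriv_second_difference[OF assms(1,2), of v]
  note 2 = dir_deriv_second_difference[OF assms(1,3), of u]
  have "((\<lambda>t. (f (z + t *\<^sub>R u + t *\<^sub>R v) - f (z + t *\<^sub>R u) - f (z + t *\<^sub>R v) + f z) /\<^sub>R t\<^sup>2)
    \<longlongrightarrow> dir_deriv u (dir_deriv v f) z) (at_right 0)"
    using 2 by (simp add: algebra_simps)
  with 1 show ?thesis by (rule tendsto_unique[rotated]) simp
qed

lemma partial_dir_deriv: "partial_x = dir_deriv 1" "partial_y = dir_deriv \<i>"
  by (auto simp: partial_x_def partial_y_def dir_deriv_def fun_eq_iff)

lemma dir_deriv_combination:
  assumes "f differentiable (at z)" "g differentiable (at z)"
  shows "dir_deriv u (\<lambda>z. (f z + \<i> * g z) / 2) z = (dir_deriv u f z + \<i> * dir_deriv u g z) / 2"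
proof -
  have "((\<lambda>z. (f z + \<i> * g z) / 2) has_derivative
      (\<lambda>h. (frechet_derivative f (at z) h + \<i> * frechet_derivative g (at z) h) / 2)) (at z)"
    using assms[THEN frechet_derivative_works[THEN iffD1]] by (auto intro!: derivative_eq_intros)
  from frechet_derivative_at[OF this, symmetric] show ?thesis by (simp add: dir_deriv_def)
qed

section \<open>Test functions on the disc\<close>

lemma disc_test_differentiable:
  "\<phi> \<in> disc_test \<Longrightarrow> (partial_x ^^ i) ((partial_y ^^ j) \<phi>) differentiable (at z)"
  by (simp add: disc_test_def)

lemma dir_deriv_zero_outside:
  assumes "z \<notin> closure {z. \<phi> z \<noteq> 0}" shows "dir_deriv u \<phi> z = 0"
proof -
  have "((\<lambda>z. 0) has_derivative (\<lambda>h. 0)) (at z)" by simp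
  then have "(\<phi> has_derivative (\<lambda>h. 0)) (at z)"
    by (rule has_derivative_transform_within_open[of _ _ _ _ "- closure {z. \<phi> z \<noteq> 0}"])
      (use assms closure_subset[of "{z. \<phi> z \<noteq> 0}"] in auto)
  from frechet_derivative_at[OF this, symmetric] show ?thesis by (simp add: dir_deriv_def)
qed

lemma dbar_alt: "dbar \<phi> = (\<lambda>z. (dir_deriv 1 \<phi> z + \<i> * dir_deriv \<i> \<phi> z) / 2)"
  by (simp add: dbar_def partial_dir_deriv fun_eq_iff)

text \<open>Test functions are defined through x-derivatives of y-derivatives only. The operator
  \<open>dbar\<close> puts an x-derivative underneath the y-derivatives, so mixed partials have to
  be exchanged before differentiability can be read off.\<close>

lemma disc_test_dbar:
  assumes \<phi>: "\<phi> \<in> disc_test" shows "dbar \<phi> \<in> disc_test"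
proof -
  note d = disc_test_differentiable[OF \<phi>, unfolded partial_dir_deriv]
  let ?y = "\<lambda>j. (dir_deriv \<i> ^^ j) \<phi>"
  have Y: "(dir_deriv \<i> ^^ j) (dbar \<phi>) = (\<lambda>z. (dir_deriv 1 (?y j) z + \<i> * ?y (Suc j) z) / 2)" for j
  proof (induction j)
    case 0
    then show ?case by (simp add: dbar_alt)
  next
    case (Suc j)
    have e: "(dir_deriv \<i> ^^ Suc j) (dbar \<phi>) = dir_deriv \<i> (\<lambda>z. (dir_deriv 1 (?y j) z + \<i> * ?y (Suc j) z) / 2)"
      by (simp only: funpow.simps o_apply Suc.IH)
    have 1: "dir_deriv \<i> (\<lambda>z. (dir_deriv 1 (?y j) z + \<i> * ?y (Suc j) z) / 2) z =
        (dir_deriv \<i> (dir_deriv 1 (?y j)) z + \<i> * dir_deriv \<i> (?y (Suc j)) z) / 2" for z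
      using d[of 1 j z] d[of 0 "Suc j" z] by (intro dir_deriv_combination) auto
    have 2: "dir_deriv \<i> (dir_deriv 1 (?y j)) z = dir_deriv 1 (dir_deriv \<i> (?y j)) z" for z
      using d[of 0 j] d[of 1 j z] d[of 0 "Suc j" z] by (intro dir_deriv_commute) auto
    show ?case unfolding e by (rule ext, subst 1, subst 2) simp
  qed
  have X: "(dir_deriv 1 ^^ i) ((dir_deriv \<i> ^^ j) (dbar \<phi>)) =
      (\<lambda>z. ((dir_deriv 1 ^^ Suc i) (?y j) z + \<i> * (dir_deriv 1 ^^ i) (?y (Suc j)) z) / 2)" for i j
  proof (induction i)
    case 0
    then show ?case by (simp add: Y)
  next
    case (Suc i)
    have e: "(dir_deriv 1 ^^ Suc i) ((dir_deriv \<i> ^^ j) (dbar \<phi>)) =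
        dir_deriv 1 (\<lambda>z. ((dir_deriv 1 ^^ Suc i) (?y j) z + \<i> * (dir_deriv 1 ^^ i) (?y (Suc j)) z) / 2)"
      by (subst funpow.simps, subst o_apply, subst Suc.IH) (rule refl)
    have 1: "dir_deriv 1 (\<lambda>z. ((dir_deriv 1 ^^ Suc i) (?y j) z + \<i> * (dir_deriv 1 ^^ i) (?y (Suc j)) z) / 2) z =
        (dir_deriv 1 ((dir_deriv 1 ^^ Suc i) (?y j)) z + \<i> * dir_deriv 1 ((dir_deriv 1 ^^ i) (?y (Suc j))) z) / 2" for z
      by (intro dir_deriv_combination d)
    show ?case unfolding e by (rule ext, subst 1) simp
  qed
  have dd: "(partial_x ^^ i) ((partial_y ^^ j) (dbar \<phi>)) differentiable (at z)" for i j z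
    unfolding partial_dir_deriv X divide_inverse
    by (intro differentiable_mult differentiable_add d differentiable_const)
  let ?K = "closure {z. \<phi> z \<noteq> 0}"
  have K: "compact ?K" "?K \<subseteq> ball 0 1" using \<phi> by (auto simp: disc_test_def)
  have "{z. dbar \<phi> z \<noteq> 0} \<subseteq> ?K"
    by (rule subsetI, rule ccontr) (simp add: dbar_alt dir_deriv_zero_outside)
  then have "closure {z. dbar \<phi> z \<noteq> 0} \<subseteq> ?K" by (simp add: closure_minimal)
  then have "closure {z. dbar \<phi> z \<noteq> 0} \<subseteq> ball 0 1" "?K \<inter> closure {z. dbar \<phi> z \<noteq> 0} = closure {z. dbar \<phi> z \<noteq> 0}"
    using K(2) by auto
  moreover from this(2) have "compact (closure {z. dbar \<phi> z \<noteq> 0})"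
    using compact_Int_closed[OF K(1) closed_closure, of "{z. dbar \<phi> z \<noteq> 0}"] by (simp only:)
  ultimately have "compact (closure {z. dbar \<phi> z \<noteq> 0})" "closure {z. dbar \<phi> z \<noteq> 0} \<subseteq> ball 0 1"
    by auto
  with dd show ?thesis by (simp add: disc_test_def)
qed

lemma disc_test_wirtinger:
  assumes \<phi>: "\<phi> \<in> disc_test"
  obtains A where "continuous_on UNIV A" "continuous_on UNIV (dbar \<phi>)"
    "\<And>z. (\<phi> has_derivative (\<lambda>h. A z * h + dbar \<phi> z * cnj h)) (at z)"
    "\<And>z. z \<notin> closure {z. \<phi> z \<noteq> 0} \<Longrightarrow> \<phi> z = 0 \<and> A z = 0 \<and> dbar \<phi> z = 0"
proof
  let ?A = "\<lambda>z. (dir_deriv 1 \<phi> z - \<i> * dir_deriv \<i> \<phi> z) / 2"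
  note d = disc_test_differentiable[OF \<phi>, unfolded partial_dir_deriv]
  have "dir_deriv 1 \<phi> differentiable (at z)" "dir_deriv \<i> \<phi> differentiable (at z)" for z
    using d[of 1 0 z] d[of 0 1 z] by auto
  then have c: "continuous_on UNIV (dir_deriv 1 \<phi>)" "continuous_on UNIV (dir_deriv \<i> \<phi>)"
    by (auto intro: continuous_at_imp_continuous_on differentiable_imp_continuous_within)
  then show "continuous_on UNIV ?A" "continuous_on UNIV (dbar \<phi>)"
    by (auto simp: dbar_alt intro!: continuous_intros)
  show "(\<phi> has_derivative (\<lambda>h. ?A z * h + dbar \<phi> z * cnj h)) (at z)" for z
  proof -
    let ?D = "frechet_derivative \<phi> (at z)"
    have D: "(\<phi> has_derivative ?D) (at z)"
      using d[of 0 0 z] frechet_derivative_works by auto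
    have "?D h = ?A z * h + dbar \<phi> z * cnj h" for h
    proof -
      have "?D h = ?D (Re h *\<^sub>R 1 + Im h *\<^sub>R \<i>)"
        by (rule arg_cong[of _ _ ?D]) (simp add: complex_eq_iff)
      also have "\<dots> = Re h *\<^sub>R ?D 1 + Im h *\<^sub>R ?D \<i>"
        using has_derivative_linear[OF D] by (simp add: linear_add linear_scale)
      also have "\<dots> = ?A z * h + dbar \<phi> z * cnj h"
        unfolding dbar_alt dir_deriv_def by (simp add: complex_eq_iff field_simps)
      finally show ?thesis .
    qed
    then have e: "?D = (\<lambda>h. ?A z * h + dbar \<phi> z * cnj h)" by (rule ext)
    from D show ?thesis by (subst (asm) e)
  qed
  show "\<phi> z = 0 \<and> ?A z = 0 \<and> dbar \<phi> z = 0" if "z \<notin> closure {z. \<phi> z \<noteq> 0}" for z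
    using that dir_deriv_zero_outside[OF that] closure_subset[of "{z. \<phi> z \<noteq> 0}"] by (auto simp: dbar_alt)
qed

section \<open>Integration by parts against test functions\<close>

lemma disc_test_support:
  assumes "\<phi> \<in> disc_test"
  obtains K where "compact K" "K \<subseteq> ball 0 1" "\<And>z. z \<notin> K \<Longrightarrow> \<phi> z = 0" "continuous_on UNIV \<phi>"
proof
  show "compact (closure {z. \<phi> z \<noteq> 0})" "closure {z. \<phi> z \<noteq> 0} \<subseteq> ball 0 1"
    using assms by (auto simp: disc_test_def)
  show "\<phi> z = 0" if "z \<notin> closure {z. \<phi> z \<noteq> 0}" for z
    using that closure_subset[of "{z. \<phi> z \<noteq> 0}"] by auto
  show "continuous_on UNIV \<phi>"
    using disc_test_differentiable[OF assms, of 0 0]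
    by (auto intro: continuous_at_imp_continuous_on differentiable_imp_continuous_within)
qed

lemma locally_integrable_times_test:
  assumes w: "locally_integrable w" and \<phi>: "\<phi> \<in> disc_test"
  shows "set_integrable lebesgue (ball 0 1) (\<lambda>z. w z * \<phi> z)"
proof -
  obtain K where K: "compact K" "K \<subseteq> ball 0 1" "\<And>z. z \<notin> K \<Longrightarrow> \<phi> z = 0" "continuous_on UNIV \<phi>"
    by (rule disc_test_support[OF \<phi>]) (rule that)
  have wK: "set_integrable lebesgue K w" using w K(1,2) unfolding locally_integrable_def by blast
  have "bilinear (\<lambda>x y :: complex. y * x)"
    using bounded_bilinear.flip[OF bounded_bilinear_mult] bilinear_conv_bounded_bilinear by blast
  moreover have KL: "K \<in> sets lebesgue" using K(1) by (simp add: fmeasurableD lmeasurable_compact)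
  moreover have "\<phi> \<in> borel_measurable (lebesgue_on K)"
    using K(4) KL by (intro continuous_imp_measurable_on_sets_lebesgue) (auto intro: continuous_on_subset)
  moreover have "bounded (\<phi> ` K)"
    using K(1) continuous_on_subset[OF K(4)] compact_continuous_image compact_imp_bounded by blast
  ultimately have "set_integrable lebesgue K (\<lambda>z. w z * \<phi> z)"
    using absolutely_integrable_bounded_measurable_product[of "\<lambda>x y. y * x" \<phi> K w] wK by auto
  moreover have "indicator K z *\<^sub>R (w z * \<phi> z) = indicator (ball 0 1) z *\<^sub>R (w z * \<phi> z)" for z
    using K(2,3) by (auto simp: indicator_def)
  ultimately show ?thesis by (simp add: set_integrable_def)
qed

lemma locally_integrable_continuous:
  assumes "continuous_on (ball 0 1) V" shows "locally_integrable V"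
  unfolding locally_integrable_def set_integrable_def
proof (intro allI impI)
  fix K :: "complex set" assume "compact K" "K \<subseteq> ball 0 1"
  then have "integrable lborel (\<lambda>x. indicator K x *\<^sub>R V x)"
    by (intro borel_integrable_compact continuous_on_subset[OF assms])
  then show "integrable lebesgue (\<lambda>x. indicator K x *\<^sub>R V x)"
    by (simp add: integrable_completion)
qed

text \<open>The product with \<phi>, extended by zero, has compact support in the disc, so the
  integral of its conjugate derivative vanishes; the product rule splits this into the two
  sides.\<close>

lemma weak_dbar_classical:
  assumes V: "has_dbar_on V V' (ball 0 1)"
  shows "weak_dbar 1 V V'"
proof -
  obtain A where A: "continuous_on (ball 0 1) A" "continuous_on (ball 0 1) V'"
    "\<And>z. z \<in> ball 0 1 \<Longrightarrow> (V has_derivative (\<lambda>h. A z * h + V' z * cnj h)) (at z)"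
    using V unfolding has_dbar_on_def by blast
  note cV = has_dbar_on_continuous[OF V]
  note li = locally_integrable_continuous[OF cV] locally_integrable_continuous[OF A(2)]
  have "(LINT z:ball 0 1|lebesgue. V z * dbar \<phi> z) = - (LINT z:ball 0 1|lebesgue. V' z * \<phi> z)"
    if \<phi>: "\<phi> \<in> disc_test" for \<phi>
  proof -
    obtain a where a: "continuous_on UNIV a" "continuous_on UNIV (dbar \<phi>)"
      "\<And>z. (\<phi> has_derivative (\<lambda>h. a z * h + dbar \<phi> z * cnj h)) (at z)"
      "\<And>z. z \<notin> closure {z. \<phi> z \<noteq> 0} \<Longrightarrow> \<phi> z = 0 \<and> a z = 0 \<and> dbar \<phi> z = 0"
      by (rule disc_test_wirtinger[OF \<phi>]) (rule that)
    define K where "K = closure {z. \<phi> z \<noteq> 0}"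
    have K: "compact K" "K \<subseteq> ball 0 1" using \<phi> by (auto simp: disc_test_def K_def)
    have c\<phi>: "continuous_on UNIV \<phi>"
      by (meson continuous_at_imp_continuous_on has_derivative_continuous a(3))
    \<comment> \<open>The indicator changes no value, because \<phi> and its derivatives vanish off
      \<open>K\<close>. It gives the integrands the form of continuous functions cut off to a
      compact set.\<close>
    let ?u = "\<lambda>z. indicator K z *\<^sub>R (V z * \<phi> z)"
    let ?A = "\<lambda>z. indicator K z *\<^sub>R (A z * \<phi> z + V z * a z)"
    let ?B = "\<lambda>z. indicator K z *\<^sub>R (V' z * \<phi> z + V z * dbar \<phi> z)"
    have iAB: "integrable lborel ?A" "integrable lborel ?B"
        by (intro borel_integrable_compact K continuous_intros continuous_on_subset[OF A(1) K(2)]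
            continuous_on_subset[OF A(2) K(2)] continuous_on_subset[OF cV K(2)]
            continuous_on_subset[OF c\<phi> subset_UNIV] continuous_on_subset[OF a(1) subset_UNIV]
            continuous_on_subset[OF a(2) subset_UNIV])+
    have "(LINT z|lborel. ?B z) = 0"
    proof (rule integral_dbar_eq_0[of 0 ?u ?A ?B, OF _ _ iAB])
      show "?u z = 0 \<and> ?A z = 0 \<and> ?B z = 0" if "z \<notin> ball 0 1" for z
        using that K(2) by (auto simp: indicator_def)
      show "(?u has_derivative (\<lambda>h. ?A z * h + ?B z * cnj h)) (at z)" for z
      proof (cases "z \<in> ball 0 1")
        case True
        have "((\<lambda>z. V z * \<phi> z) has_derivative
            (\<lambda>h. (A z * \<phi> z + V z * a z) * h + (V' z * \<phi> z + V z * dbar \<phi> z) * cnj h)) (at z)"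
          using A(3)[OF True] a(3)[of z] by (auto intro!: derivative_eq_intros simp: algebra_simps)
        moreover have "V y * \<phi> y = ?u y" for y
          using a(4)[of y] by (auto simp: indicator_def K_def)
        moreover have "A z * \<phi> z + V z * a z = ?A z" "V' z * \<phi> z + V z * dbar \<phi> z = ?B z"
          using a(4)[of z] by (auto simp: indicator_def K_def)
        ultimately show ?thesis by simp
      next
        case False
        then have z: "z \<in> - K" using K(2) by auto
        have "((\<lambda>z. 0) has_derivative (\<lambda>h. 0)) (at z)" by simp
        then have "(?u has_derivative (\<lambda>h. 0)) (at z)"
          by (rule has_derivative_transform_within_open[of _ _ _ _ "- K"])
            (use z K(1) compact_imp_closed in auto)
        then show ?thesis using z by simp
      qed
    qed
    then have "(LINT z|lebesgue. ?B z) = 0"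
      using integral_completion[OF borel_measurable_integrable[OF iAB(2)]] by simp
    moreover have "?B z = indicator (ball 0 1) z *\<^sub>R (V' z * \<phi> z + V z * dbar \<phi> z)" for z
      using a(4)[of z] K(2) by (cases "z \<in> K") (auto simp: K_def[symmetric])
    ultimately have "(LINT z:ball 0 1|lebesgue. V' z * \<phi> z + V z * dbar \<phi> z) = 0"
      by (simp add: set_lebesgue_integral_def)
    then show ?thesis
      using set_integral_add(2)[OF locally_integrable_times_test[OF li(2) \<phi>]
          locally_integrable_times_test[OF li(1) disc_test_dbar[OF \<phi>]]]
      by (simp add: add_eq_0_iff2)
  qed
  then show ?thesis using li by (simp add: weak_dbar_def)
qed

text \<open>Conjugate derivatives of test functions are test functions, so weak derivatives can be
  taken one at a time.\<close>

lemma weak_dbar_Suc: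
  assumes "weak_dbar k w g" "weak_dbar 1 g g'"
  shows "weak_dbar (Suc k) w g'"
  unfolding weak_dbar_def
proof (intro conjI ballI)
  show "locally_integrable w" "locally_integrable g'" using assms by (auto simp: weak_dbar_def)
  fix \<phi> assume \<phi>: "\<phi> \<in> disc_test"
  have "(LINT z:ball 0 1|lebesgue. w z * (dbar ^^ Suc k) \<phi> z) =
      (LINT z:ball 0 1|lebesgue. w z * (dbar ^^ k) (dbar \<phi>) z)"
    by (simp only: funpow_Suc_right o_def)
  also have "\<dots> = (-1) ^ k * (LINT z:ball 0 1|lebesgue. g z * dbar \<phi> z)"
    using assms(1) disc_test_dbar[OF \<phi>] by (simp add: weak_dbar_def)
  also have "(LINT z:ball 0 1|lebesgue. g z * dbar \<phi> z) = - (LINT z:ball 0 1|lebesgue. g' z * \<phi> z)"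
    using assms(2) \<phi> by (simp add: weak_dbar_def)
  finally show "(LINT z:ball 0 1|lebesgue. w z * (dbar ^^ Suc k) \<phi> z) =
      (-1) ^ Suc k * (LINT z:ball 0 1|lebesgue. g' z * \<phi> z)" by simp
qed

lemma locally_integrable_add:
  "locally_integrable v \<Longrightarrow> locally_integrable w \<Longrightarrow> locally_integrable (\<lambda>z. v z + w z)"
  by (auto simp: locally_integrable_def intro!: set_integral_add)

lemma locally_integrable_scale:
  "locally_integrable v \<Longrightarrow> locally_integrable (\<lambda>z. c * v z)"
  by (auto simp: locally_integrable_def)

lemma weak_dbar_add:
  assumes "weak_dbar 1 v v'" "weak_dbar 1 w w'"
  shows "weak_dbar 1 (\<lambda>z. v z + w z) (\<lambda>z. v' z + w' z)"
  unfolding weak_dbar_def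
proof (intro conjI ballI)
  have li: "locally_integrable v" "locally_integrable v'" "locally_integrable w" "locally_integrable w'"
    using assms by (auto simp: weak_dbar_def)
  then show "locally_integrable (\<lambda>z. v z + w z)" "locally_integrable (\<lambda>z. v' z + w' z)"
    by (auto intro: locally_integrable_add)
  fix \<phi> assume \<phi>: "\<phi> \<in> disc_test"
  note \<phi>' = disc_test_dbar[OF \<phi>]
  have "(LINT z:ball 0 1|lebesgue. v z * dbar \<phi> z) = - (LINT z:ball 0 1|lebesgue. v' z * \<phi> z)"
    "(LINT z:ball 0 1|lebesgue. w z * dbar \<phi> z) = - (LINT z:ball 0 1|lebesgue. w' z * \<phi> z)"
    using assms \<phi> by (auto simp: weak_dbar_def)
  then show "(LINT z:ball 0 1|lebesgue. (v z + w z) * (dbar ^^ 1) \<phi> z) =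
      (-1) ^ 1 * (LINT z:ball 0 1|lebesgue. (v' z + w' z) * \<phi> z)"
    using set_integral_add(2)[OF locally_integrable_times_test[OF li(1) \<phi>'] locally_integrable_times_test[OF li(3) \<phi>']]
      set_integral_add(2)[OF locally_integrable_times_test[OF li(2) \<phi>] locally_integrable_times_test[OF li(4) \<phi>]]
    by (simp add: distrib_right)
qed

lemma weak_dbar_scale:
  assumes "weak_dbar 1 v v'" shows "weak_dbar 1 (\<lambda>z. c * v z) (\<lambda>z. c * v' z)"
  unfolding weak_dbar_def
proof (intro conjI ballI)
  show "locally_integrable (\<lambda>z. c * v z)" "locally_integrable (\<lambda>z. c * v' z)"
    using assms by (auto simp: weak_dbar_def intro: locally_integrable_scale)
  fix \<phi> assume "\<phi> \<in> disc_test"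
  then have "(LINT z:ball 0 1|lebesgue. v z * (dbar ^^ 1) \<phi> z) = (-1) ^ 1 * (LINT z:ball 0 1|lebesgue. v' z * \<phi> z)"
    using assms unfolding weak_dbar_def by blast
  then show "(LINT z:ball 0 1|lebesgue. c * v z * (dbar ^^ 1) \<phi> z) =
      (-1) ^ 1 * (LINT z:ball 0 1|lebesgue. c * v' z * \<phi> z)"
    unfolding mult.assoc[of c] set_integral_mult_right by simp
qed

section \<open>Area potentials\<close>

definition real_excess :: "complex \<Rightarrow> complex \<Rightarrow> complex" where
  "real_excess z \<zeta> = \<zeta> - z + cnj (\<zeta> - z)"

definition reflected_kernel :: "complex \<Rightarrow> complex \<Rightarrow> complex" where
  "reflected_kernel z \<zeta> = (1 + z * cnj \<zeta>) / (1 - z * cnj \<zeta>)"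

text \<open>\<open>F\<close> stands for f(\<zeta>)/\<zeta>. With the division absorbed in the
  density, all estimates concern a single L^1 function.\<close>

definition area_kernel :: "(complex \<Rightarrow> complex) \<Rightarrow> nat \<Rightarrow> complex \<Rightarrow> complex \<Rightarrow> complex" where
  "area_kernel F m z \<zeta> =
     (F \<zeta> * schwarz_kernel z \<zeta> + cnj (F \<zeta>) * reflected_kernel z \<zeta>) * real_excess z \<zeta> ^ m"

definition area_potential :: "(complex \<Rightarrow> complex) \<Rightarrow> nat \<Rightarrow> complex \<Rightarrow> complex" where
  "area_potential F m z = (LINT \<zeta>|lborel. area_kernel F m z \<zeta>)"

text \<open>The squares differ by (1 - |z|^2)(1 - |\<zeta>|^2), the identity behind the
  pseudohyperbolic distance. Hence on the closed disc the reflected kernel is no more singular than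
  the Schwarz kernel.\<close>

lemma norm_reflected_denominator:
  assumes "cmod z \<le> 1" "cmod \<zeta> \<le> 1"
  shows "cmod (\<zeta> - z) \<le> cmod (1 - z * cnj \<zeta>)"
proof -
  have "(cmod (1 - z * cnj \<zeta>))\<^sup>2 - (cmod (\<zeta> - z))\<^sup>2 = (1 - (cmod z)\<^sup>2) * (1 - (cmod \<zeta>)\<^sup>2)"
    unfolding cmod_power2 by (simp add: power2_eq_square algebra_simps)
  also have "\<dots> \<ge> 0" using assms by (intro mult_nonneg_nonneg) (auto simp: power_le_one)
  finally have "(cmod (\<zeta> - z))\<^sup>2 \<le> (cmod (1 - z * cnj \<zeta>))\<^sup>2" by simp
  then show ?thesis by (rule power2_le_imp_le) simp
qed

lemma norm_real_excess:
  "cmod (real_excess z \<zeta>) \<le> 2 * cmod (\<zeta> - z)"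
  using norm_triangle_ineq[of "\<zeta> - z" "cnj (\<zeta> - z)"] unfolding real_excess_def complex_mod_cnj by linarith

lemma norm_real_excess_le_4:
  assumes "cmod z \<le> 1" "cmod \<zeta> \<le> 1" shows "cmod (real_excess z \<zeta>) \<le> 4"
  using norm_real_excess[of z \<zeta>] norm_triangle_ineq4[of \<zeta> z] assms by linarith

lemma norm_kernels_le:
  assumes "cmod z \<le> 1" "cmod \<zeta> \<le> 1" "\<zeta> \<noteq> z"
  shows "cmod (schwarz_kernel z \<zeta>) \<le> 2 / cmod (\<zeta> - z)"
    "cmod (reflected_kernel z \<zeta>) \<le> 2 / cmod (\<zeta> - z)"
proof -
  have pos: "cmod (\<zeta> - z) > 0" using assms(3) by simp
  have "cmod (\<zeta> + z) \<le> 2" using norm_triangle_ineq[of \<zeta> z] assms(1,2) by linarith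
  then show "cmod (schwarz_kernel z \<zeta>) \<le> 2 / cmod (\<zeta> - z)"
    unfolding schwarz_kernel_def norm_divide by (rule divide_right_mono) simp
  have "cmod (z * cnj \<zeta>) \<le> 1" using assms(1,2) by (simp add: norm_mult mult_le_one)
  then have "cmod (1 + z * cnj \<zeta>) \<le> 2" using norm_triangle_ineq[of 1 "z * cnj \<zeta>"] by simp
  then show "cmod (reflected_kernel z \<zeta>) \<le> 2 / cmod (\<zeta> - z)"
    unfolding reflected_kernel_def norm_divide
    using norm_reflected_denominator[OF assms(1,2)] pos by (intro frac_le) auto
qed

text \<open>The factor 4 is 2 + 2 from the two kernels; 4^m comes from |X| \<le> 4 on the closed
  disc.\<close>

lemma norm_area_kernel_le:
  assumes "cmod z \<le> 1" "cmod \<zeta> \<le> 1" "\<zeta> \<noteq> z"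
  shows "cmod (area_kernel F m z \<zeta>) \<le> 4 * 4 ^ m * (cmod (F \<zeta>) * (1 / cmod (\<zeta> - z)))"
proof -
  have "cmod (F \<zeta> * schwarz_kernel z \<zeta> + cnj (F \<zeta>) * reflected_kernel z \<zeta>) \<le>
      cmod (F \<zeta>) * (2 / cmod (\<zeta> - z)) + cmod (F \<zeta>) * (2 / cmod (\<zeta> - z))"
    using norm_kernels_le[OF assms]
    by (intro order.trans[OF norm_triangle_ineq] add_mono) (auto simp: norm_mult simp del: times_divide_eq_right intro!: mult_left_mono)
  then have "cmod (area_kernel F m z \<zeta>) \<le>
      (cmod (F \<zeta>) * (2 / cmod (\<zeta> - z)) + cmod (F \<zeta>) * (2 / cmod (\<zeta> - z))) * 4 ^ m"
    unfolding area_kernel_def norm_mult norm_power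
    using norm_real_excess_le_4[OF assms(1,2)] by (intro mult_mono power_mono) auto
  then show ?thesis by (simp add: mult_ac)
qed

text \<open>One factor X, of size at most 2 |\<zeta> - z|, cancels the pole. For positive exponents
  the kernel is therefore bounded, and only exponent 0 needs cancellation arguments.\<close>

lemma norm_area_kernel_Suc_le:
  assumes "cmod z \<le> 1" "cmod \<zeta> \<le> 1"
  shows "cmod (area_kernel F (Suc m) z \<zeta>) \<le> 8 * 4 ^ m * cmod (F \<zeta>)"
proof (cases "\<zeta> = z")
  case True
  then show ?thesis by (simp add: area_kernel_def real_excess_def)
next
  case False
  have "cmod (area_kernel F (Suc m) z \<zeta>) = cmod (area_kernel F m z \<zeta>) * cmod (real_excess z \<zeta>)"
    unfolding area_kernel_def by (simp add: norm_mult norm_power)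
  also have "\<dots> \<le> (4 * 4 ^ m * (cmod (F \<zeta>) * (1 / cmod (\<zeta> - z)))) * (2 * cmod (\<zeta> - z))"
    by (intro mult_mono norm_area_kernel_le[OF assms False] norm_real_excess) auto
  also have "\<dots> = 8 * 4 ^ m * cmod (F \<zeta>)" using False by simp
  finally show ?thesis .
qed

lemma area_kernel_measurable [measurable]:
  assumes [measurable]: "F \<in> borel_measurable borel" "f \<in> borel_measurable M" "g \<in> borel_measurable M"
  shows "(\<lambda>x. area_kernel F m (f x) (g x)) \<in> borel_measurable M"
  unfolding area_kernel_def schwarz_kernel_def reflected_kernel_def real_excess_def by measurable

lemma set_integral_lebesgue_lborel:
  fixes g :: "'a :: euclidean_space \<Rightarrow> complex"
  assumes [measurable]: "S \<in> sets borel" "g \<in> borel_measurable borel"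
  shows "(LINT x:S|lebesgue. g x) = (LINT x|lborel. indicator S x * g x)"
proof -
  have "(\<lambda>x. indicator S x *\<^sub>R g x) \<in> borel_measurable lborel" by measurable
  moreover have "indicator S x *\<^sub>R g x = indicator S x * g x" for x
    by (simp add: indicator_def)
  ultimately show ?thesis using integral_completion by (simp only: set_lebesgue_integral_def)
qed

text \<open>A Borel density, extended by zero: parameter integrals and product measures can then be
  handled over \<open>lborel\<close> on the whole plane. \<open>area_density_representative\<close>
  provides it from a Lebesgue measurable one.\<close>

locale area_density =
  fixes F :: "complex \<Rightarrow> complex"
  assumes F_integrable: "integrable lborel F"
    and F_support: "\<zeta> \<notin> ball 0 1 \<Longrightarrow> F \<zeta> = 0"
begin

lemma F_measurable [measurable]: "F \<in> borel_measurable borel"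
  using F_integrable by simp

lemma area_kernel_outside: "\<zeta> \<notin> ball 0 1 \<Longrightarrow> area_kernel F m z \<zeta> = 0"
  by (simp add: area_kernel_def F_support)

text \<open>Integrating in z first, the integral of 1/|\<zeta> - z| over the disc is bounded
  independently of \<zeta>, and what remains is a multiple of |F|.\<close>

lemma area_kernel_joint_integrable:
  fixes \<psi> :: "complex \<Rightarrow> complex"
  assumes [measurable]: "\<psi> \<in> borel_measurable borel" and M: "\<And>z. cmod (\<psi> z) \<le> M * indicator (ball 0 1) z"
  shows "integrable (lborel \<Otimes>\<^sub>M lborel) (\<lambda>(z, \<zeta>). area_kernel F m z \<zeta> * \<psi> z)"
proof (rule integrableI_bounded)
  let ?b = "ball (0 :: complex) 1" and ?C = "4 * 4 ^ m :: real"
  have [measurable]: "?b \<in> sets borel" by simp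
  have M0: "0 \<le> M" using order.trans[OF norm_ge_zero M[of 0]] by simp
  have fin: "emeasure lborel ?b < \<infinity>" using emeasure_bounded_finite[OF bounded_ball[of "0 :: complex" 1]] by simp
  have le: "ennreal (norm (area_kernel F m z \<zeta> * \<psi> z)) \<le>
      ennreal (M * ?C * cmod (F \<zeta>)) * (ennreal (1 / cmod (\<zeta> - z)) * indicator ?b z)" if "z \<noteq> \<zeta>" for z \<zeta>
  proof (cases "z \<in> ?b \<and> \<zeta> \<in> ?b")
    case True
    then have "norm (area_kernel F m z \<zeta> * \<psi> z) \<le> ?C * (cmod (F \<zeta>) * (1 / cmod (\<zeta> - z))) * (M * indicator ?b z)"
      unfolding norm_mult using that by (intro mult_mono norm_area_kernel_le M) auto
    also have "\<dots> = M * ?C * cmod (F \<zeta>) * (1 / cmod (\<zeta> - z))" using True by (simp add: mult_ac)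
    finally show ?thesis
      using True M0 by (simp add: ennreal_mult[symmetric] ennreal_leI)
  next
    case False
    then have "area_kernel F m z \<zeta> * \<psi> z = 0"
      using M[of z] area_kernel_outside[of \<zeta> m z] by (cases "z \<in> ?b") auto
    then have "ennreal (norm (area_kernel F m z \<zeta> * \<psi> z)) = 0" by (simp only: norm_zero ennreal_0)
    then show ?thesis by (simp only: zero_le)
  qed
  show mm: "(\<lambda>(z, \<zeta>). area_kernel F m z \<zeta> * \<psi> z) \<in> borel_measurable (lborel \<Otimes>\<^sub>M lborel)" by measurable
  have mn: "(\<lambda>p. ennreal (norm (case p of (z, \<zeta>) \<Rightarrow> area_kernel F m z \<zeta> * \<psi> z))) \<in> borel_measurable (lborel \<Otimes>\<^sub>M lborel)"
    by (rule measurable_compose[OF mm]) measurable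
  have "(\<integral>\<^sup>+p. ennreal (norm (case p of (z, \<zeta>) \<Rightarrow> area_kernel F m z \<zeta> * \<psi> z)) \<partial>(lborel \<Otimes>\<^sub>M lborel)) =
      (\<integral>\<^sup>+\<zeta>. \<integral>\<^sup>+z. ennreal (norm (area_kernel F m z \<zeta> * \<psi> z)) \<partial>lborel \<partial>lborel)"
    using lborel_pair.nn_integral_snd[OF mn] by simp
  also have "\<dots> \<le> (\<integral>\<^sup>+\<zeta>. ennreal (M * ?C * cmod (F \<zeta>)) * (ennreal (16 * 1) + ennreal (1 / 1) * emeasure lborel ?b) \<partial>lborel)"
  proof (intro nn_integral_mono)
    fix \<zeta>
    have "(\<integral>\<^sup>+z. ennreal (norm (area_kernel F m z \<zeta> * \<psi> z)) \<partial>lborel) \<le>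
        (\<integral>\<^sup>+z. ennreal (M * ?C * cmod (F \<zeta>)) * (ennreal (1 / cmod (\<zeta> - z)) * indicator ?b z) \<partial>lborel)"
      using AE_lborel_singleton[of \<zeta>] by (intro nn_integral_mono_AE, eventually_elim) (rule le)
    also have "\<dots> = ennreal (M * ?C * cmod (F \<zeta>)) * (\<integral>\<^sup>+z. ennreal (1 / cmod (\<zeta> - z)) * indicator ?b z \<partial>lborel)"
      by (rule nn_integral_cmult) measurable
    also have "\<dots> \<le> ennreal (M * ?C * cmod (F \<zeta>)) * (ennreal (16 * 1) + ennreal (1 / 1) * emeasure lborel ?b)"
      by (intro mult_left_mono nn_integral_inverse_norm_le) auto
    finally show "(\<integral>\<^sup>+z. ennreal (norm (area_kernel F m z \<zeta> * \<psi> z)) \<partial>lborel) \<le>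
        ennreal (M * ?C * cmod (F \<zeta>)) * (ennreal (16 * 1) + ennreal (1 / 1) * emeasure lborel ?b)" .
  qed
  also have "\<dots> = (\<integral>\<^sup>+\<zeta>. ennreal (norm (of_real (M * ?C) * F \<zeta>)) \<partial>lborel) * (ennreal (16 * 1) + ennreal (1 / 1) * emeasure lborel ?b)"
    using M0 by (subst nn_integral_multc) (auto simp: norm_mult norm_power abs_mult)
  also have "\<dots> < \<infinity>"
  proof -
    have "integrable lborel (\<lambda>\<zeta>. of_real (M * ?C) * F \<zeta>)" using F_integrable by (rule integrable_mult_right)
    then have "(\<integral>\<^sup>+\<zeta>. ennreal (norm (of_real (M * ?C) * F \<zeta>)) \<partial>lborel) < \<infinity>" by (simp add: integrable_iff_bounded)
    moreover have "ennreal (16 * 1) + ennreal (1 / 1) * emeasure lborel ?b < \<infinity>"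
      using fin by (simp add: less_top[symmetric] ennreal_add_eq_top)
    ultimately show ?thesis by (simp add: ennreal_mult_less_top)
  qed
  finally show "(\<integral>\<^sup>+p. ennreal (norm (case p of (z, \<zeta>) \<Rightarrow> area_kernel F m z \<zeta> * \<psi> z)) \<partial>(lborel \<Otimes>\<^sub>M lborel)) < \<infinity>" .
qed

lemma area_potential_measurable [measurable]: "area_potential F m \<in> borel_measurable borel"
proof -
  have "(\<lambda>z. LINT \<zeta>|lborel. area_kernel F m z \<zeta>) \<in> borel_measurable borel"
    by (rule lborel.borel_measurable_lebesgue_integral) measurable
  then show ?thesis by (simp add: area_potential_def[abs_def])
qed

lemma area_potential_integrable: "integrable lborel (\<lambda>z. indicator (ball 0 1) z * area_potential F m z)"
proof -
  have "ball 0 1 \<in> sets (borel :: complex measure)" by simp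
  then have "integrable (lborel \<Otimes>\<^sub>M lborel) (\<lambda>(z, \<zeta>). area_kernel F m z \<zeta> * indicator (ball 0 1) z)"
    by (intro area_kernel_joint_integrable[of _ 1]) (auto simp: indicator_def)
  from lborel_pair.integrable_fst[OF this] show ?thesis
    by (simp add: area_potential_def mult.commute)
qed

lemma area_potential_Fubini:
  fixes \<psi> :: "complex \<Rightarrow> complex"
  assumes [measurable]: "\<psi> \<in> borel_measurable borel" and M: "\<And>z. cmod (\<psi> z) \<le> M * indicator (ball 0 1) z"
  shows "(LINT z|lborel. area_potential F m z * \<psi> z) = (LINT \<zeta>|lborel. LINT z|lborel. area_kernel F m z \<zeta> * \<psi> z)"
  using lborel_pair.Fubini_integral[OF area_kernel_joint_integrable[OF assms]]
  by (simp add: area_potential_def)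

lemma area_potential_locally_integrable: "locally_integrable (area_potential F m)"
  unfolding locally_integrable_def
proof (intro allI impI)
  fix K :: "complex set" assume K: "compact K" "K \<subseteq> ball 0 1"
  have "integrable lebesgue (\<lambda>z. indicator (ball 0 1) z * area_potential F m z)"
    using area_potential_integrable by (simp add: integrable_completion)
  moreover have "indicator (ball 0 1) z * area_potential F m z = indicator (ball 0 1) z *\<^sub>R area_potential F m z" for z
    by (simp add: indicator_def)
  ultimately have "set_integrable lebesgue (ball 0 1) (area_potential F m)"
    unfolding set_integrable_def by simp
  then show "set_integrable lebesgue K (area_potential F m)"
    by (rule set_integrable_subset) (use K in \<open>auto simp: fmeasurableD lmeasurable_compact\<close>)
qed

end

lemma has_dbar_on_shift_power:
  "has_dbar_on (\<lambda>z. (c - (z + cnj z)) ^ Suc m) (\<lambda>z. - of_nat (Suc m) * (c - (z + cnj z)) ^ m) S"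
proof (induction m)
  case 0
  show ?case using has_dbar_on_add[OF has_dbar_on_const[of c] has_dbar_on_cmult[OF has_dbar_on_add_cnj, of "- 1"]]
    by (simp add: algebra_simps)
next
  case (Suc m)
  have 1: "has_dbar_on (\<lambda>z. c - (z + cnj z)) (\<lambda>z. - 1) S"
    using has_dbar_on_add[OF has_dbar_on_const[of c] has_dbar_on_cmult[OF has_dbar_on_add_cnj, of "- 1"]]
    by (simp only: mult_minus1 add_uminus_conv_diff add_0 diff_0)
  from has_dbar_on_mult[OF 1 Suc] show ?case by (simp add: algebra_simps)
qed

lemma has_dbar_on_real_excess_power:
  "has_dbar_on (\<lambda>z. real_excess z \<zeta> ^ Suc m) (\<lambda>z. - of_nat (Suc m) * real_excess z \<zeta> ^ m) S"
proof -
  have "real_excess z \<zeta> = (\<zeta> + cnj \<zeta>) - (z + cnj z)" for z by (simp add: real_excess_def)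
  then show ?thesis using has_dbar_on_shift_power[of "\<zeta> + cnj \<zeta>" m S] by simp
qed

lemma has_dbar_on_compact_support:
  fixes \<psi> B :: "complex \<Rightarrow> complex"
  assumes \<psi>: "has_dbar_on \<psi> B UNIV" and K: "compact K" "K \<subseteq> ball 0 1" "\<And>z. z \<notin> K \<Longrightarrow> \<psi> z = 0"
  shows "integrable lborel (\<lambda>z. B z / (\<zeta> - z))"
    and "(LINT z|lborel. B z / (\<zeta> - z)) = pi * \<psi> \<zeta>"
    and "integrable lborel B"
    and "(LINT z|lborel. B z) = 0"
proof -
  obtain A where A: "continuous_on UNIV A" "continuous_on UNIV B"
    "\<And>z. (\<psi> has_derivative (\<lambda>h. A z * h + B z * cnj h)) (at z)"
    using \<psi> unfolding has_dbar_on_def by auto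
  have out: "\<psi> z = 0 \<and> A z = 0 \<and> B z = 0" if "z \<notin> K" for z
  proof -
    have "((\<lambda>z. 0) has_derivative (\<lambda>h. 0)) (at z)" by simp
    then have "(\<psi> has_derivative (\<lambda>h. 0)) (at z)"
      by (rule has_derivative_transform_within_open[of _ _ _ _ "- K"])
        (use that K compact_imp_closed in auto)
    from has_derivative_unique[OF this A(3)[of z]] have e: "A z * h + B z * cnj h = 0" for h
      by metis
    \<comment> \<open>The increments 1 and i separate the linear and the conjugate-linear
      coefficient.\<close>
    have "A z + B z = 0" "A z - B z = 0" using e[of 1] e[of \<i>] by (auto simp: complex_eq_iff)
    then have "A z = 0" "B z = 0" by (auto simp: complex_eq_iff)
    then show ?thesis using K(3)[OF that] by simp
  qed
  have outb: "\<psi> z = 0 \<and> A z = 0 \<and> B z = 0" if "z \<notin> ball 0 1" for z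
    using that K(2) by (intro out) auto
  show "integrable lborel (\<lambda>z. B z / (\<zeta> - z))" "(LINT z|lborel. B z / (\<zeta> - z)) = pi * \<psi> \<zeta>"
    by (rule cauchy_pompeiu[OF A(3,1,2) outb], assumption)+
  have i: "integrable lborel C" if "continuous_on UNIV C" "\<And>z. z \<notin> K \<Longrightarrow> C z = 0" for C :: "complex \<Rightarrow> complex"
  proof -
    have "integrable lborel (\<lambda>z. indicator K z *\<^sub>R C z)"
      by (intro borel_integrable_compact K continuous_on_subset[OF that(1)]) auto
    moreover have "indicator K z *\<^sub>R C z = C z" for z using that(2)[of z] by (simp add: indicator_def)
    ultimately show ?thesis by simp
  qed
  show iB: "integrable lborel B" using A out by (intro i) auto
  have iA: "integrable lborel A" using A out by (intro i) auto
  show "(LINT z|lborel. B z) = 0"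
    by (rule integral_dbar_eq_0[of 0, OF A(3) outb iA iB])
qed

section \<open>Weak derivatives of area potentials\<close>

lemma bounded_indicator_ball:
  fixes C :: "complex \<Rightarrow> complex"
  assumes c: "continuous_on UNIV C" and K: "K \<subseteq> ball 0 1" "\<And>z. z \<notin> K \<Longrightarrow> C z = 0"
  shows "\<exists>M. \<forall>z. cmod (C z) \<le> M * indicator (ball 0 1) z"
proof -
  have 0: "C z = 0" if "z \<notin> ball 0 1" for z
    using subsetD[OF K(1), of z] K(2)[of z] that by blast
  with bounded_compact_support[OF c] obtain M where M: "\<And>z. cmod (C z) \<le> M" by metis
  show ?thesis
    by (rule exI[of _ M]) (use M 0 in \<open>auto simp: indicator_def\<close>)
qed

lemma indicator_ball_absorb:
  fixes U :: complex and \<phi> :: "complex \<Rightarrow> complex"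
  assumes "K \<subseteq> ball 0 1" "\<And>z. z \<notin> K \<Longrightarrow> \<phi> z = 0"
  shows "indicator (ball 0 1) z * (U * \<phi> z) = U * \<phi> z"
proof (cases "z \<in> K")
  case True
  then show ?thesis using subsetD[OF assms(1), of z] by simp
qed (simp add: assms(2))

lemma integrable_over_schwarz_kernel:
  fixes C :: "complex \<Rightarrow> complex"
  assumes c: "continuous_on UNIV C" and K: "compact K" "K \<subseteq> ball 0 1" "\<And>z. z \<notin> K \<Longrightarrow> C z = 0"
  shows "integrable lborel (\<lambda>z. schwarz_kernel z \<zeta> * C z)"
proof -
  have [measurable]: "C \<in> borel_measurable borel" using c by (rule borel_measurable_continuous_onI)
  obtain M where M: "\<And>z. cmod (C z) \<le> M * indicator (ball 0 1) z"
    using bounded_indicator_ball[OF c K(2,3)] by blast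
  have "integrable lborel (\<lambda>z. (cmod \<zeta> + 1) * M * (indicator (ball 0 1) z * (1 / cmod (\<zeta> - z))))"
    using emeasure_bounded_finite[OF bounded_ball[of "0 :: complex" 1]]
    by (intro integrable_mult_right integrable_inverse_norm) auto
  then show ?thesis
  proof (rule Bochner_Integration.integrable_bound)
    show "(\<lambda>z. schwarz_kernel z \<zeta> * C z) \<in> borel_measurable lborel"
      unfolding schwarz_kernel_def by measurable
    show "AE z in lborel. norm (schwarz_kernel z \<zeta> * C z) \<le>
        norm ((cmod \<zeta> + 1) * M * (indicator (ball 0 1) z * (1 / cmod (\<zeta> - z))))"
    proof (intro AE_I2)
      fix z
      show "norm (schwarz_kernel z \<zeta> * C z) \<le>
        norm ((cmod \<zeta> + 1) * M * (indicator (ball 0 1) z * (1 / cmod (\<zeta> - z))))"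
      proof (cases "z \<in> ball 0 1")
        case True
        then have "cmod (\<zeta> + z) \<le> cmod \<zeta> + 1" using norm_triangle_ineq[of \<zeta> z] by simp
        then have "norm (schwarz_kernel z \<zeta> * C z) \<le> (cmod \<zeta> + 1) / cmod (\<zeta> - z) * (M * indicator (ball 0 1) z)"
          unfolding norm_mult schwarz_kernel_def norm_divide by (intro mult_mono M divide_right_mono) auto
        also have "\<dots> = (cmod \<zeta> + 1) * M * (indicator (ball 0 1) z * (1 / cmod (\<zeta> - z)))" by simp
        also have "\<dots> \<le> norm \<dots>" by (simp only: real_norm_def abs_ge_self)
        finally show ?thesis .
      next
        case False
        then have "C z = 0" using subsetD[OF K(2), of z] K(3)[of z] by blast
        then show ?thesis by simp
      qed
    qed
  qed
qed

text \<open>Off \<zeta> one has K = 2 \<zeta> / (\<zeta> - z) - 1. The first part is Cauchy-Pompeiu,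
  the second integrates a derivative of compact support. The factor \<zeta> in the result is what
  later cancels the division in f(\<zeta>)/\<zeta>.\<close>

lemma integral_schwarz_kernel_dbar:
  fixes \<psi> B :: "complex \<Rightarrow> complex" and \<zeta> :: complex
  assumes \<psi>: "has_dbar_on \<psi> B UNIV" and K: "compact K" "K \<subseteq> ball 0 1" "\<And>z. z \<notin> K \<Longrightarrow> \<psi> z = 0"
  shows "(LINT z|lborel. schwarz_kernel z \<zeta> * B z) = 2 * pi * \<zeta> * \<psi> \<zeta>"
proof -
  note cs = has_dbar_on_compact_support[OF assms]
  have [measurable]: "B \<in> borel_measurable borel" using cs(3) by simp
  have "(LINT z|lborel. schwarz_kernel z \<zeta> * B z) = (LINT z|lborel. 2 * \<zeta> * (B z / (\<zeta> - z)) - B z)"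
  proof (rule Bochner_Integration.integral_cong_AE)
    show "AE z in lborel. schwarz_kernel z \<zeta> * B z = 2 * \<zeta> * (B z / (\<zeta> - z)) - B z"
      using AE_lborel_singleton[of \<zeta>]
    proof eventually_elim
      case (elim z)
      then have "\<zeta> - z \<noteq> 0" by simp
      then have "schwarz_kernel z \<zeta> = 2 * \<zeta> / (\<zeta> - z) - 1"
        unfolding schwarz_kernel_def by (simp add: divide_simps)
      then show ?case by (simp only: left_diff_distrib times_divide_eq_left times_divide_eq_right mult_1)
    qed
  qed (unfold schwarz_kernel_def, measurable)
  also have "\<dots> = (LINT z|lborel. 2 * \<zeta> * (B z / (\<zeta> - z))) - (LINT z|lborel. B z)"
    by (rule Bochner_Integration.integral_diff[OF integrable_mult_right[OF cs(1)] cs(3)])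
  also have "\<dots> = 2 * \<zeta> * (pi * \<psi> \<zeta>) - 0"
  proof -
    have "(LINT z|lborel. B z / (\<zeta> - z)) = pi * \<psi> \<zeta>" "(LINT z|lborel. B z) = 0"
      by (rule cs(2), assumption) (rule cs(4))
    then show ?thesis by (simp only: integral_mult_right_zero)
  qed
  finally show ?thesis by simp
qed

lemma disc_test_has_dbar:
  assumes "\<phi> \<in> disc_test" shows "has_dbar_on \<phi> (dbar \<phi>) UNIV"
proof (rule disc_test_wirtinger[OF assms])
  fix A assume "continuous_on UNIV A" "continuous_on UNIV (dbar \<phi>)"
    "\<And>z. (\<phi> has_derivative (\<lambda>h. A z * h + dbar \<phi> z * cnj h)) (at z)"
  then show ?thesis unfolding has_dbar_on_def by (intro exI[of _ A] conjI ballI)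
qed

text \<open>For positive exponents the preceding formula is applied to X^(m+1) \<phi>, which
  vanishes at z = \<zeta>: the pole leaves no point mass, and the product rule gives the recursion.
  For exponent 0 the point mass stays.\<close>

lemma integral_schwarz_kernel_test:
  fixes \<phi> :: "complex \<Rightarrow> complex" and \<zeta> :: complex
  assumes \<phi>: "\<phi> \<in> disc_test"
  shows "(LINT z|lborel. schwarz_kernel z \<zeta> * (real_excess z \<zeta> ^ Suc m * dbar \<phi> z)) =
      of_nat (Suc m) * (LINT z|lborel. schwarz_kernel z \<zeta> * (real_excess z \<zeta> ^ m * \<phi> z))"
    and "(LINT z|lborel. schwarz_kernel z \<zeta> * dbar \<phi> z) = 2 * pi * \<zeta> * \<phi> \<zeta>"
proof -
  note d = disc_test_has_dbar[OF \<phi>]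
  obtain K where K: "compact K" "K \<subseteq> ball 0 1" "\<And>z. z \<notin> K \<Longrightarrow> \<phi> z = 0" "continuous_on UNIV \<phi>"
    by (rule disc_test_support[OF \<phi>]) (rule that)
  obtain K' where K': "compact K'" "K' \<subseteq> ball 0 1" "\<And>z. z \<notin> K' \<Longrightarrow> dbar \<phi> z = 0" "continuous_on UNIV (dbar \<phi>)"
    by (rule disc_test_support[OF disc_test_dbar[OF \<phi>]]) (rule that)
  show "(LINT z|lborel. schwarz_kernel z \<zeta> * dbar \<phi> z) = 2 * pi * \<zeta> * \<phi> \<zeta>"
    by (rule integral_schwarz_kernel_dbar[OF d K(1-3)])
  have cX: "continuous_on UNIV (\<lambda>z. real_excess z \<zeta> ^ j)" for j
    unfolding real_excess_def by (intro continuous_intros)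
  have i1: "integrable lborel (\<lambda>z. schwarz_kernel z \<zeta> * (real_excess z \<zeta> ^ m * \<phi> z))"
    by (rule integrable_over_schwarz_kernel[OF _ K(1,2)]) (use cX K in \<open>auto intro: continuous_on_mult\<close>)
  have i2: "integrable lborel (\<lambda>z. schwarz_kernel z \<zeta> * (real_excess z \<zeta> ^ Suc m * dbar \<phi> z))"
    by (rule integrable_over_schwarz_kernel[OF _ K'(1,2)]) (use cX[of "Suc m"] K' in \<open>auto intro: continuous_on_mult\<close>)
  have "(LINT z|lborel. schwarz_kernel z \<zeta> * (- of_nat (Suc m) * real_excess z \<zeta> ^ m * \<phi> z + real_excess z \<zeta> ^ Suc m * dbar \<phi> z)) =
      2 * pi * \<zeta> * (real_excess \<zeta> \<zeta> ^ Suc m * \<phi> \<zeta>)"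
    by (rule integral_schwarz_kernel_dbar[OF has_dbar_on_mult[OF has_dbar_on_real_excess_power d] K(1,2)])
      (simp add: K(3))
  also have "\<dots> = 0" by (simp add: real_excess_def)
  also have "(\<lambda>z. schwarz_kernel z \<zeta> * (- of_nat (Suc m) * real_excess z \<zeta> ^ m * \<phi> z + real_excess z \<zeta> ^ Suc m * dbar \<phi> z)) =
      (\<lambda>z. schwarz_kernel z \<zeta> * (real_excess z \<zeta> ^ Suc m * dbar \<phi> z) -
        of_nat (Suc m) * (schwarz_kernel z \<zeta> * (real_excess z \<zeta> ^ m * \<phi> z)))"
    by (simp add: fun_eq_iff algebra_simps)
  finally show "(LINT z|lborel. schwarz_kernel z \<zeta> * (real_excess z \<zeta> ^ Suc m * dbar \<phi> z)) =
      of_nat (Suc m) * (LINT z|lborel. schwarz_kernel z \<zeta> * (real_excess z \<zeta> ^ m * \<phi> z))"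
    by (subst (asm) Bochner_Integration.integral_diff[OF i2 integrable_mult_right[OF i1]]) simp
qed

lemma reflected_kernel_denominator:
  assumes "cmod z \<le> 1" "cmod \<zeta> < 1" shows "1 - z * cnj \<zeta> \<noteq> 0"
proof
  assume "1 - z * cnj \<zeta> = 0"
  then have 1: "cmod z * cmod \<zeta> = 1" by (metis complex_mod_cnj eq_iff_diff_eq_0 norm_mult norm_one)
  have "cmod z * cmod \<zeta> \<le> 1 * cmod \<zeta>" using assms by (intro mult_right_mono) auto
  with 1 assms show False by simp
qed

lemma reflected_kernel_holomorphic:
  assumes "cmod \<zeta> < 1" shows "(\<lambda>z. reflected_kernel z \<zeta>) holomorphic_on ball 0 1"
  unfolding reflected_kernel_def
  using reflected_kernel_denominator[OF _ assms] by (intro holomorphic_intros) simp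

lemma integrable_over_reflected_kernel:
  fixes C :: "complex \<Rightarrow> complex"
  assumes c: "continuous_on UNIV C" and K: "compact K" "K \<subseteq> ball 0 1" "\<And>z. z \<notin> K \<Longrightarrow> C z = 0"
    and \<zeta>: "cmod \<zeta> < 1"
  shows "integrable lborel (\<lambda>z. reflected_kernel z \<zeta> * C z)"
proof -
  have "integrable lborel (\<lambda>z. indicator K z *\<^sub>R (reflected_kernel z \<zeta> * C z))"
    by (intro borel_integrable_compact K continuous_intros continuous_on_subset[OF c subset_UNIV]
        continuous_on_subset[OF holomorphic_on_imp_continuous_on[OF reflected_kernel_holomorphic[OF \<zeta>]] K(2)])
  moreover have "indicator K z *\<^sub>R (reflected_kernel z \<zeta> * C z) = reflected_kernel z \<zeta> * C z" for z
    using K(3)[of z] by (simp add: indicator_def)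
  ultimately show ?thesis by simp
qed

lemma weak_dbar_lborel:
  assumes "weak_dbar 1 V V'" and \<phi>: "\<phi> \<in> disc_test"
    and [measurable]: "V \<in> borel_measurable borel" "V' \<in> borel_measurable borel"
  shows "(LINT z|lborel. V z * dbar \<phi> z) = - (LINT z|lborel. V' z * \<phi> z)"
proof -
  obtain K where K: "compact K" "K \<subseteq> ball 0 1" "\<And>z. z \<notin> K \<Longrightarrow> \<phi> z = 0" "continuous_on UNIV \<phi>"
    by (rule disc_test_support[OF \<phi>]) (rule that)
  obtain K' where K': "compact K'" "K' \<subseteq> ball 0 1" "\<And>z. z \<notin> K' \<Longrightarrow> dbar \<phi> z = 0" "continuous_on UNIV (dbar \<phi>)"
    by (rule disc_test_support[OF disc_test_dbar[OF \<phi>]]) (rule that)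
  have [measurable]: "\<phi> \<in> borel_measurable borel" "dbar \<phi> \<in> borel_measurable borel"
    using K(4) K'(4) by (auto intro: borel_measurable_continuous_onI)
  have e: "indicator (ball 0 1) z * (V z * dbar \<phi> z) = V z * dbar \<phi> z"
    "indicator (ball 0 1) z * (V' z * \<phi> z) = V' z * \<phi> z" for z
    by (rule indicator_ball_absorb[OF K'(2,3)] indicator_ball_absorb[OF K(2,3)]; assumption)+
  have "(LINT z:ball 0 1|lebesgue. V z * dbar \<phi> z) = - (LINT z:ball 0 1|lebesgue. V' z * \<phi> z)"
    using assms(1) \<phi> by (simp add: weak_dbar_def)
  moreover have "(LINT z:ball 0 1|lebesgue. V z * dbar \<phi> z) = (LINT z|lborel. V z * dbar \<phi> z)"
    by (subst set_integral_lebesgue_lborel[OF borel_open[OF open_ball]]) (measurable, simp only: e)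
  moreover have "(LINT z:ball 0 1|lebesgue. V' z * \<phi> z) = (LINT z|lborel. V' z * \<phi> z)"
    by (subst set_integral_lebesgue_lborel[OF borel_open[OF open_ball]]) (measurable, simp only: e)
  ultimately show ?thesis by simp
qed

text \<open>For \<zeta> in the disc the reflected pole lies outside it, so this kernel is
  holomorphic in z and classical integration by parts is enough.\<close>

lemma integral_reflected_kernel_test:
  assumes \<phi>: "\<phi> \<in> disc_test" and \<zeta>: "cmod \<zeta> < 1"
  shows "(LINT z|lborel. reflected_kernel z \<zeta> * (real_excess z \<zeta> ^ Suc m * dbar \<phi> z)) =
      of_nat (Suc m) * (LINT z|lborel. reflected_kernel z \<zeta> * (real_excess z \<zeta> ^ m * \<phi> z))"
    and "(LINT z|lborel. reflected_kernel z \<zeta> * dbar \<phi> z) = 0"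
proof -
  have [measurable]: "(\<lambda>z. reflected_kernel z \<zeta>) \<in> borel_measurable borel"
    "(\<lambda>z. real_excess z \<zeta> ^ j) \<in> borel_measurable borel" for j
    unfolding reflected_kernel_def real_excess_def by measurable
  have h: "has_dbar_on (\<lambda>z. reflected_kernel z \<zeta>) (\<lambda>z. 0) (ball 0 1)"
    by (intro has_dbar_on_holomorphic reflected_kernel_holomorphic[OF \<zeta>]) auto
  show "(LINT z|lborel. reflected_kernel z \<zeta> * dbar \<phi> z) = 0"
    using weak_dbar_lborel[OF weak_dbar_classical[OF h] \<phi>] by simp
  have "(LINT z|lborel. (reflected_kernel z \<zeta> * real_excess z \<zeta> ^ Suc m) * dbar \<phi> z) =
      - (LINT z|lborel. (0 * real_excess z \<zeta> ^ Suc m + reflected_kernel z \<zeta> * (- of_nat (Suc m) * real_excess z \<zeta> ^ m)) * \<phi> z)"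
    by (rule weak_dbar_lborel[OF weak_dbar_classical[OF has_dbar_on_mult[OF h has_dbar_on_real_excess_power]] \<phi>])
      measurable
  also have "\<dots> = - (LINT z|lborel. - of_nat (Suc m) * (reflected_kernel z \<zeta> * (real_excess z \<zeta> ^ m * \<phi> z)))"
    by (simp add: mult_ac)
  also have "\<dots> = of_nat (Suc m) * (LINT z|lborel. reflected_kernel z \<zeta> * (real_excess z \<zeta> ^ m * \<phi> z))"
    unfolding integral_mult_right_zero by (simp add: algebra_simps)
  finally show "(LINT z|lborel. reflected_kernel z \<zeta> * (real_excess z \<zeta> ^ Suc m * dbar \<phi> z)) =
      of_nat (Suc m) * (LINT z|lborel. reflected_kernel z \<zeta> * (real_excess z \<zeta> ^ m * \<phi> z))"
    by (simp only: mult.assoc)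
qed

lemma weak_dbarI_lborel:
  assumes li: "locally_integrable V" "locally_integrable V'"
    and [measurable]: "V \<in> borel_measurable borel" "V' \<in> borel_measurable borel"
    and e: "\<And>\<phi>. \<phi> \<in> disc_test \<Longrightarrow> (LINT z|lborel. V z * dbar \<phi> z) = - (LINT z|lborel. V' z * \<phi> z)"
  shows "weak_dbar 1 V V'"
proof -
  have conv: "(LINT z:ball 0 1|lebesgue. U z * \<phi> z) = (LINT z|lborel. U z * \<phi> z)"
    if \<phi>: "\<phi> \<in> disc_test" and [measurable]: "U \<in> borel_measurable borel" for U \<phi>
  proof -
    obtain K where K: "compact K" "K \<subseteq> ball 0 1" "\<And>z. z \<notin> K \<Longrightarrow> \<phi> z = 0" "continuous_on UNIV \<phi>"
      by (rule disc_test_support[OF \<phi>]) (rule that)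
    have [measurable]: "\<phi> \<in> borel_measurable borel"
      using K(4) by (auto intro: borel_measurable_continuous_onI)
    have "indicator (ball 0 1) z * (U z * \<phi> z) = U z * \<phi> z" for z
      by (rule indicator_ball_absorb[OF K(2,3)])
    then show ?thesis by (subst set_integral_lebesgue_lborel[OF borel_open[OF open_ball]]) (measurable, simp only:)
  qed
  show ?thesis
    unfolding weak_dbar_def
    using li e conv[OF _ assms(4)] conv[OF disc_test_dbar assms(3)] by simp
qed

context area_density
begin

lemma area_kernel_test_split:
  fixes C :: "complex \<Rightarrow> complex"
  assumes c: "continuous_on UNIV C" and K: "compact K" "K \<subseteq> ball 0 1" "\<And>z. z \<notin> K \<Longrightarrow> C z = 0"
    and \<zeta>: "cmod \<zeta> < 1"
  shows "(LINT z|lborel. area_kernel F m z \<zeta> * C z) =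
    F \<zeta> * (LINT z|lborel. schwarz_kernel z \<zeta> * (real_excess z \<zeta> ^ m * C z)) +
    cnj (F \<zeta>) * (LINT z|lborel. reflected_kernel z \<zeta> * (real_excess z \<zeta> ^ m * C z))"
proof -
  have cX: "continuous_on UNIV (\<lambda>z. real_excess z \<zeta> ^ m * C z)"
    unfolding real_excess_def by (intro continuous_intros c)
  have i: "integrable lborel (\<lambda>z. schwarz_kernel z \<zeta> * (real_excess z \<zeta> ^ m * C z))"
    "integrable lborel (\<lambda>z. reflected_kernel z \<zeta> * (real_excess z \<zeta> ^ m * C z))"
    using K \<zeta> by (intro integrable_over_schwarz_kernel[OF cX K(1,2)] integrable_over_reflected_kernel[OF cX K(1,2)]; simp)+
  have "area_kernel F m z \<zeta> * C z = F \<zeta> * (schwarz_kernel z \<zeta> * (real_excess z \<zeta> ^ m * C z)) +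
      cnj (F \<zeta>) * (reflected_kernel z \<zeta> * (real_excess z \<zeta> ^ m * C z))" for z
    by (simp add: area_kernel_def algebra_simps)
  then show ?thesis using i by simp
qed

lemma integral_area_kernel_test:
  fixes \<phi> :: "complex \<Rightarrow> complex" and \<zeta> :: complex
  assumes \<phi>: "\<phi> \<in> disc_test"
  shows "(LINT z|lborel. area_kernel F (Suc m) z \<zeta> * dbar \<phi> z) =
      of_nat (Suc m) * (LINT z|lborel. area_kernel F m z \<zeta> * \<phi> z)"
    and "(LINT z|lborel. area_kernel F 0 z \<zeta> * dbar \<phi> z) = 2 * pi * (\<zeta> * F \<zeta>) * \<phi> \<zeta>"
proof -
  obtain K where K: "compact K" "K \<subseteq> ball 0 1" "\<And>z. z \<notin> K \<Longrightarrow> \<phi> z = 0" "continuous_on UNIV \<phi>"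
    by (rule disc_test_support[OF \<phi>]) (rule that)
  obtain K' where K': "compact K'" "K' \<subseteq> ball 0 1" "\<And>z. z \<notin> K' \<Longrightarrow> dbar \<phi> z = 0" "continuous_on UNIV (dbar \<phi>)"
    by (rule disc_test_support[OF disc_test_dbar[OF \<phi>]]) (rule that)
  have "(LINT z|lborel. area_kernel F (Suc m) z \<zeta> * dbar \<phi> z) =
      of_nat (Suc m) * (LINT z|lborel. area_kernel F m z \<zeta> * \<phi> z) \<and>
    (LINT z|lborel. area_kernel F 0 z \<zeta> * dbar \<phi> z) = 2 * pi * (\<zeta> * F \<zeta>) * \<phi> \<zeta>"
  proof (cases "\<zeta> \<in> ball 0 1")
    case True
    then have \<zeta>: "cmod \<zeta> < 1" by simp
    have "(LINT z|lborel. area_kernel F (Suc m) z \<zeta> * dbar \<phi> z) =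
        F \<zeta> * (of_nat (Suc m) * (LINT z|lborel. schwarz_kernel z \<zeta> * (real_excess z \<zeta> ^ m * \<phi> z))) +
        cnj (F \<zeta>) * (of_nat (Suc m) * (LINT z|lborel. reflected_kernel z \<zeta> * (real_excess z \<zeta> ^ m * \<phi> z)))"
      unfolding integral_schwarz_kernel_test(1)[OF \<phi>, symmetric] integral_reflected_kernel_test(1)[OF \<phi> \<zeta>, symmetric]
      by (rule area_kernel_test_split[OF K'(4,1-3) \<zeta>])
    also have "\<dots> = of_nat (Suc m) * (LINT z|lborel. area_kernel F m z \<zeta> * \<phi> z)"
    proof -
      have "(LINT z|lborel. area_kernel F m z \<zeta> * \<phi> z) =
        F \<zeta> * (LINT z|lborel. schwarz_kernel z \<zeta> * (real_excess z \<zeta> ^ m * \<phi> z)) +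
        cnj (F \<zeta>) * (LINT z|lborel. reflected_kernel z \<zeta> * (real_excess z \<zeta> ^ m * \<phi> z))"
        by (rule area_kernel_test_split[OF K(4,1-3) \<zeta>])
      then show ?thesis by (simp only: distrib_left mult.left_commute)
    qed
    finally have 1: "(LINT z|lborel. area_kernel F (Suc m) z \<zeta> * dbar \<phi> z) =
        of_nat (Suc m) * (LINT z|lborel. area_kernel F m z \<zeta> * \<phi> z)" .
    have "(LINT z|lborel. area_kernel F 0 z \<zeta> * dbar \<phi> z) =
        F \<zeta> * (LINT z|lborel. schwarz_kernel z \<zeta> * (real_excess z \<zeta> ^ 0 * dbar \<phi> z)) +
        cnj (F \<zeta>) * (LINT z|lborel. reflected_kernel z \<zeta> * (real_excess z \<zeta> ^ 0 * dbar \<phi> z))"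
      by (rule area_kernel_test_split[OF K'(4,1-3) \<zeta>])
    also have "\<dots> = 2 * pi * (\<zeta> * F \<zeta>) * \<phi> \<zeta>"
      using integral_schwarz_kernel_test(2)[OF \<phi>] integral_reflected_kernel_test(2)[OF \<phi> \<zeta>] by simp
    finally show ?thesis using 1 by simp
  next
    case False
    then show ?thesis by (simp add: area_kernel_outside F_support)
  qed
  then show "(LINT z|lborel. area_kernel F (Suc m) z \<zeta> * dbar \<phi> z) =
      of_nat (Suc m) * (LINT z|lborel. area_kernel F m z \<zeta> * \<phi> z)"
    "(LINT z|lborel. area_kernel F 0 z \<zeta> * dbar \<phi> z) = 2 * pi * (\<zeta> * F \<zeta>) * \<phi> \<zeta>" by auto
qed

text \<open>After Fubini it is enough to move the derivative for each fixed \<zeta>, as in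
  \<open>integral_area_kernel_test\<close>.\<close>

lemma weak_dbar_area_potential_Suc:
  "weak_dbar 1 (area_potential F (Suc m)) (\<lambda>z. - of_nat (Suc m) * area_potential F m z)"
proof (rule weak_dbarI_lborel)
  fix \<phi> assume \<phi>: "\<phi> \<in> disc_test"
  obtain K where K: "compact K" "K \<subseteq> ball 0 1" "\<And>z. z \<notin> K \<Longrightarrow> \<phi> z = 0" "continuous_on UNIV \<phi>"
    by (rule disc_test_support[OF \<phi>]) (rule that)
  obtain K' where K': "compact K'" "K' \<subseteq> ball 0 1" "\<And>z. z \<notin> K' \<Longrightarrow> dbar \<phi> z = 0" "continuous_on UNIV (dbar \<phi>)"
    by (rule disc_test_support[OF disc_test_dbar[OF \<phi>]]) (rule that)
  obtain M where M: "\<And>z. cmod (\<phi> z) \<le> M * indicator (ball 0 1) z"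
    using bounded_indicator_ball[OF K(4,2,3)] by blast
  obtain M' where M': "\<And>z. cmod (dbar \<phi> z) \<le> M' * indicator (ball 0 1) z"
    using bounded_indicator_ball[OF K'(4,2,3)] by blast
  note b = borel_measurable_continuous_onI[OF K(4)] borel_measurable_continuous_onI[OF K'(4)]
  have "(LINT z|lborel. area_potential F (Suc m) z * dbar \<phi> z) = of_nat (Suc m) * (LINT z|lborel. area_potential F m z * \<phi> z)"
    unfolding area_potential_Fubini[OF b(1) M] area_potential_Fubini[OF b(2) M'] integral_area_kernel_test[OF \<phi>]
    by (rule integral_mult_right_zero)
  also have "\<dots> = - (LINT z|lborel. - of_nat (Suc m) * (area_potential F m z * \<phi> z))"
    unfolding integral_mult_right_zero by (simp add: algebra_simps)
  finally show "(LINT z|lborel. area_potential F (Suc m) z * dbar \<phi> z) =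
      - (LINT z|lborel. - of_nat (Suc m) * area_potential F m z * \<phi> z)"
    by (simp only: mult.assoc)
next
  show "locally_integrable (area_potential F (Suc m))" by (rule area_potential_locally_integrable)
  show "locally_integrable (\<lambda>z. - of_nat (Suc m) * area_potential F m z)"
    by (rule locally_integrable_scale[OF area_potential_locally_integrable])
  show "area_potential F (Suc m) \<in> borel_measurable borel" by (rule area_potential_measurable)
  show "(\<lambda>z. - of_nat (Suc m) * area_potential F m z) \<in> borel_measurable borel"
    by (rule borel_measurable_times[OF borel_measurable_const area_potential_measurable])
qed

text \<open>The pole of K leaves the point mass 2 \<pi> \<zeta> F(\<zeta>) \<phi>(\<zeta>). Its
  integral does not distinguish \<zeta> F from f, the two being equal almost everywhere in the
  disc.\<close>

lemma weak_dbar_area_potential_0: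
  fixes f :: "complex \<Rightarrow> complex"
  assumes li: "locally_integrable f"
    and f: "AE z in lebesgue. z \<in> ball 0 1 \<longrightarrow> f z = z * F z"
  shows "weak_dbar 1 (area_potential F 0) (\<lambda>z. (- 2 * pi) * f z)"
  unfolding weak_dbar_def
proof (intro conjI ballI)
  show "locally_integrable (area_potential F 0)" by (rule area_potential_locally_integrable)
  show "locally_integrable (\<lambda>z. (- 2 * pi) * f z)" by (rule locally_integrable_scale[OF li])
  fix \<phi> assume \<phi>: "\<phi> \<in> disc_test"
  obtain K where K: "compact K" "K \<subseteq> ball 0 1" "\<And>z. z \<notin> K \<Longrightarrow> \<phi> z = 0" "continuous_on UNIV \<phi>"
    by (rule disc_test_support[OF \<phi>]) (rule that)
  obtain K' where K': "compact K'" "K' \<subseteq> ball 0 1" "\<And>z. z \<notin> K' \<Longrightarrow> dbar \<phi> z = 0" "continuous_on UNIV (dbar \<phi>)"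
    by (rule disc_test_support[OF disc_test_dbar[OF \<phi>]]) (rule that)
  obtain M' where M': "\<And>z. cmod (dbar \<phi> z) \<le> M' * indicator (ball 0 1) z"
    using bounded_indicator_ball[OF K'(4,2,3)] by blast
  note b [measurable] = borel_measurable_continuous_onI[OF K(4)] borel_measurable_continuous_onI[OF K'(4)]
  have e: "indicator (ball 0 1) z * (area_potential F 0 z * dbar \<phi> z) = area_potential F 0 z * dbar \<phi> z"
    "indicator (ball 0 1) z * (z * F z * \<phi> z) = z * F z * \<phi> z" for z
    by (rule indicator_ball_absorb[OF K'(2,3)] indicator_ball_absorb[OF K(2,3)]; assumption)+
  have "(LINT z:ball 0 1|lebesgue. area_potential F 0 z * dbar \<phi> z) = (LINT z|lborel. area_potential F 0 z * dbar \<phi> z)"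
    by (subst set_integral_lebesgue_lborel[OF borel_open[OF open_ball]]) (measurable, simp only: e)
  also have "\<dots> = (LINT \<zeta>|lborel. 2 * pi * (\<zeta> * F \<zeta> * \<phi> \<zeta>))"
    unfolding area_potential_Fubini[OF b(2) M'] integral_area_kernel_test(2)[OF \<phi>] by (simp only: mult.assoc)
  also have "\<dots> = 2 * pi * (LINT \<zeta>|lborel. \<zeta> * F \<zeta> * \<phi> \<zeta>)"
    by (rule integral_mult_right_zero)
  also have "(LINT \<zeta>|lborel. \<zeta> * F \<zeta> * \<phi> \<zeta>) = (LINT z:ball 0 1|lebesgue. z * F z * \<phi> z)"
    by (subst set_integral_lebesgue_lborel[OF borel_open[OF open_ball]]) (measurable, simp only: e)
  also have "\<dots> = (LINT z:ball 0 1|lebesgue. f z * \<phi> z)"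
    unfolding set_lebesgue_integral_def
  proof (rule Bochner_Integration.integral_cong_AE)
    have [measurable]: "ball 0 1 \<in> sets (borel :: complex measure)" by simp
    have "(\<lambda>z. indicator (ball 0 1) z *\<^sub>R (z * F z * \<phi> z)) \<in> borel_measurable lborel" by measurable
    then show "(\<lambda>z. indicator (ball 0 1) z *\<^sub>R (z * F z * \<phi> z)) \<in> borel_measurable lebesgue"
      by (rule measurable_completion)
    show "(\<lambda>z. indicator (ball 0 1) z *\<^sub>R (f z * \<phi> z)) \<in> borel_measurable lebesgue"
      using locally_integrable_times_test[OF li \<phi>] unfolding set_integrable_def
      by (rule borel_measurable_integrable)
    show "AE z in lebesgue. indicator (ball 0 1) z *\<^sub>R (z * F z * \<phi> z) = indicator (ball 0 1) z *\<^sub>R (f z * \<phi> z)"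
      using f
    proof eventually_elim
      case (elim z)
      show ?case
      proof (cases "z \<in> ball 0 1")
        case True
        with elim have "f z = z * F z" by (rule mp)
        then show ?thesis by (simp only:)
      next
        case False
        then show ?thesis by (simp add: indicator_def)
      qed
    qed
  qed
  finally have 1: "(LINT z:ball 0 1|lebesgue. area_potential F 0 z * dbar \<phi> z) =
      2 * pi * (LINT z:ball 0 1|lebesgue. f z * \<phi> z)" .
  have "(LINT z:ball 0 1|lebesgue. complex_of_real (- 2 * pi) * f z * \<phi> z) =
      (LINT z:ball 0 1|lebesgue. complex_of_real (- 2 * pi) * (f z * \<phi> z))"
    by (simp only: mult.assoc)
  also have "\<dots> = complex_of_real (- 2 * pi) * (LINT z:ball 0 1|lebesgue. f z * \<phi> z)"
    by (rule set_integral_mult_right)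
  finally show "(LINT z:ball 0 1|lebesgue. area_potential F 0 z * (dbar ^^ 1) \<phi> z) =
      (-1) ^ 1 * (LINT z:ball 0 1|lebesgue. (- 2 * pi) * f z * \<phi> z)"
    using 1 by simp
qed

end

section \<open>Estimates for the Schwarz kernel on circles\<close>

text \<open>The chord is 2 |sin x| with x = a/2. Taylor's bound |sin x - x| \<le> |x|^3 / 6 together
  with |x| \<le> 2 gives |sin x - x| \<le> 2 |x| / 3, hence the constant 3.\<close>

lemma abs_le_chord:
  assumes "\<bar>a\<bar> \<le> pi" shows "\<bar>a\<bar> \<le> 3 * cmod (cis a - 1)"
proof -
  define x where "x = a / 2"
  have x: "\<bar>x\<bar> \<le> 2" using assms pi_less_4 by (simp add: x_def)
  have "cis a - 1 = cis x * (2 * \<i> * complex_of_real (sin x))"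
  proof -
    have "cis a - 1 = cis x * (cis x - cis (- x))"
      by (simp add: right_diff_distrib cis_mult x_def)
    also have "cis x - cis (- x) = 2 * \<i> * complex_of_real (sin x)" by (simp add: complex_eq_iff)
    finally show ?thesis .
  qed
  then have c: "cmod (cis a - 1) = 2 * \<bar>sin x\<bar>" by (simp add: norm_mult)
  have "\<bar>sin x - (\<Sum>m<3. sin_coeff m * x ^ m)\<bar> \<le> inverse (fact 3) * \<bar>x\<bar> ^ 3"
    by (rule Maclaurin_sin_bound)
  moreover have "(\<Sum>m<3. sin_coeff m * x ^ m) = x"
    by (simp add: numeral_3_eq_3 sin_coeff_def)
  moreover have "\<bar>x\<bar> ^ 3 \<le> 4 * \<bar>x\<bar>"
  proof -
    have "\<bar>x\<bar> * \<bar>x\<bar> \<le> 2 * 2" using x by (intro mult_mono) auto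
    then have "\<bar>x\<bar> * \<bar>x\<bar> * \<bar>x\<bar> \<le> 4 * \<bar>x\<bar>" by (intro mult_right_mono) auto
    then show ?thesis by (simp add: power3_eq_cube)
  qed
  moreover have "fact 3 = (6 :: real)" by (simp add: fact_numeral)
  ultimately have "\<bar>sin x - x\<bar> \<le> 4 * \<bar>x\<bar> / 6" by simp
  then have "\<bar>x\<bar> \<le> 3 * \<bar>sin x\<bar>" by linarith
  then show ?thesis unfolding c by (simp add: x_def)
qed

lemma chord_cis: "cmod (cis (a - b) - 1) = cmod (cis a - cis b)"
proof -
  have "cis a - cis b = cis b * (cis (a - b) - 1)" by (simp add: right_diff_distrib cis_mult)
  then show ?thesis by (simp add: norm_mult)
qed

text \<open>Integration runs over [0, 2\<pi>] while \<open>Arg\<close> takes values in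
  [-\<pi>, \<pi>], so \<theta> is within \<pi> of t or of its translate by 2\<pi>.\<close>

lemma chord_cases:
  assumes "\<theta> \<in> {0..2*pi}" "t \<in> {-pi..pi}"
  shows "\<bar>\<theta> - t\<bar> \<le> 3 * cmod (cis \<theta> - cis t) \<or> \<bar>\<theta> - (t + 2 * pi)\<bar> \<le> 3 * cmod (cis \<theta> - cis t)"
proof (cases "\<theta> - t \<le> pi")
  case True
  then have "\<bar>\<theta> - t\<bar> \<le> pi" using assms by auto
  from abs_le_chord[OF this] show ?thesis by (simp add: chord_cis)
next
  case False
  then have "\<bar>\<theta> - (t + 2 * pi)\<bar> \<le> pi" using assms by auto
  from abs_le_chord[OF this] have "\<bar>\<theta> - (t + 2 * pi)\<bar> \<le> 3 * cmod (cis \<theta> - cis (t + 2 * pi))"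
    by (simp only: chord_cis)
  moreover have "cis (t + 2 * pi) = cis t" by (simp add: complex_eq_iff)
  ultimately show ?thesis by simp
qed

text \<open>The chord is the periodic distance in which the kernel estimates are expressed, so the
  Lipschitz condition is stated for it instead of for |\<theta> - t|.\<close>

lemma circle_test_lipschitz:
  assumes \<phi>: "\<phi> \<in> circle_test"
  shows "\<exists>L\<ge>0. \<forall>\<theta>\<in>{0..2*pi}. \<forall>t\<in>{-pi..pi}. cmod (\<phi> \<theta> - \<phi> t) \<le> L * cmod (cis \<theta> - cis t)"
proof -
  let ?D = "\<lambda>s. vector_derivative \<phi> (at s)"
  have sm: "\<phi> \<in> smooth_line" using \<phi> by (simp add: circle_test_iff)
  \<comment> \<open>This interval contains [0, 2\<pi>], [-\<pi>, \<pi>] and the translate of the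
    latter by 2\<pi>, hence all points occurring in \<open>chord_cases\<close>.\<close>
  have "continuous_on {-pi..3*pi} ?D"
    using smooth_line_differentiable[OF smooth_line_derivative[OF sm]]
    by (intro continuous_at_imp_continuous_on ballI differentiable_imp_continuous_within)
  then have "bounded (?D ` {-pi..3*pi})"
    by (intro compact_imp_bounded compact_continuous_image) auto
  then obtain B where B0: "B > 0" "\<forall>y\<in>?D ` {-pi..3*pi}. cmod y \<le> B"
    unfolding bounded_pos by blast
  have B: "B > 0" "\<And>s. s \<in> {-pi..3*pi} \<Longrightarrow> cmod (?D s) \<le> B"
    using B0 by (auto simp del: atLeastAtMost_iff)
  have mvt: "cmod (\<phi> a - \<phi> b) \<le> B * \<bar>a - b\<bar>" if "a \<in> {-pi..3*pi}" "b \<in> {-pi..3*pi}" for a b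
  proof -
    have "norm (\<phi> a - \<phi> b) \<le> B * norm (a - b)"
    proof (rule differentiable_bound[of "{-pi..3*pi}" \<phi> "\<lambda>s h. h *\<^sub>R ?D s"])
      show "(\<phi> has_derivative (\<lambda>h. h *\<^sub>R ?D s)) (at s within {-pi..3*pi})" for s
        using smooth_line_has_vector_derivative[OF sm, of s] unfolding has_vector_derivative_def
        by (rule has_derivative_at_withinI)
      show "onorm (\<lambda>h. h *\<^sub>R ?D s) \<le> B" if "s \<in> {-pi..3*pi}" for s
      proof (rule onorm_le)
        fix h :: real
        show "norm (h *\<^sub>R ?D s) \<le> B * norm h"
          using mult_right_mono[OF B(2)[OF that], of "\<bar>h\<bar>"] by (simp add: mult.commute)
      qed
    qed (use that in auto)
    then show ?thesis by simp
  qed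
  show ?thesis
  proof (intro exI[of _ "3 * B"] conjI ballI)
    fix \<theta> t assume t: "\<theta> \<in> {0..2*pi}" "t \<in> {-pi..pi}"
    obtain t' where t': "t' = t \<or> t' = t + 2 * pi" "\<bar>\<theta> - t'\<bar> \<le> 3 * cmod (cis \<theta> - cis t)"
      using chord_cases[OF t] by blast
    have p: "\<phi> t' = \<phi> t" using t'(1) circle_test_periodic[OF \<phi>] by auto
    have "cmod (\<phi> \<theta> - \<phi> t') \<le> B * \<bar>\<theta> - t'\<bar>" using t t'(1) by (intro mvt) auto
    also have "\<dots> \<le> B * (3 * cmod (cis \<theta> - cis t))" using t'(2) B(1) by (intro mult_left_mono) auto
    finally show "cmod (\<phi> \<theta> - \<phi> t) \<le> 3 * B * cmod (cis \<theta> - cis t)" by (simp add: p)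
  qed (use B in auto)
qed

text \<open>The point \<zeta> is compared with its radial projection to the circle of radius r,
  which is at distance ||\<zeta>| - r| \<le> |\<zeta> - z| from it.\<close>

lemma radial_chord_le:
  assumes "r \<ge> 0"
  shows "r * cmod (cis \<theta> - cis (Arg \<zeta>)) \<le> 2 * cmod (\<zeta> - complex_of_real r * cis \<theta>)"
proof -
  let ?z = "complex_of_real r * cis \<theta>" and ?w = "complex_of_real r * cis (Arg \<zeta>)"
  have \<zeta>: "\<zeta> = complex_of_real (cmod \<zeta>) * cis (Arg \<zeta>)" by (metis rcis_cmod_Arg rcis_def)
  have "r * cmod (cis \<theta> - cis (Arg \<zeta>)) = cmod (?z - ?w)"
    using assms by (simp add: right_diff_distrib[symmetric] norm_mult)
  also have "\<dots> \<le> cmod (?z - \<zeta>) + cmod (\<zeta> - ?w)" by (metis dist_norm dist_triangle)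
  also have "cmod (\<zeta> - ?w) = \<bar>cmod \<zeta> - r\<bar>"
  proof -
    have "\<zeta> - ?w = complex_of_real (cmod \<zeta> - r) * cis (Arg \<zeta>)" by (subst \<zeta>) (simp add: left_diff_distrib)
    then show ?thesis by (simp add: norm_mult del: of_real_diff)
  qed
  also have "\<bar>cmod \<zeta> - r\<bar> \<le> cmod (\<zeta> - ?z)"
    using norm_triangle_ineq3[of \<zeta> ?z] assms by (simp add: norm_mult)
  finally show ?thesis by (simp add: norm_minus_commute)
qed

lemma Arg_range: "Arg \<zeta> \<in> {-pi..pi}"
  using Arg_bounded[of \<zeta>] by auto

text \<open>Writing \<zeta> + z = (\<zeta> - z) + 2 z, the first summand costs 2, as the chord is at
  most 2, and the second costs 4 by \<open>radial_chord_le\<close>.\<close>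

lemma schwarz_kernel_chord:
  assumes "r > 0" "cmod \<zeta> \<noteq> r"
  shows "cmod (schwarz_kernel (complex_of_real r * cis \<theta>) \<zeta>) * cmod (cis \<theta> - cis (Arg \<zeta>)) \<le> 6"
proof -
  let ?z = "complex_of_real r * cis \<theta>" and ?c = "cmod (cis \<theta> - cis (Arg \<zeta>))"
  have nz: "cmod (\<zeta> - ?z) > 0" using assms by (auto simp: norm_mult)
  have c2: "?c \<le> 2" using norm_triangle_ineq4[of "cis \<theta>" "cis (Arg \<zeta>)"] by simp
  have "\<zeta> + ?z = (\<zeta> - ?z) + 2 * ?z" by simp
  then have "cmod (\<zeta> + ?z) \<le> cmod (\<zeta> - ?z) + cmod (2 * ?z)"
    by (simp only: norm_triangle_ineq)
  also have "cmod (2 * ?z) = 2 * r" using assms(1) by (simp add: norm_mult)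
  finally have "cmod (\<zeta> + ?z) * ?c \<le> (cmod (\<zeta> - ?z) + 2 * r) * ?c" by (intro mult_right_mono) auto
  also have "\<dots> = cmod (\<zeta> - ?z) * ?c + 2 * (r * ?c)" by (simp add: algebra_simps)
  also have "\<dots> \<le> cmod (\<zeta> - ?z) * 2 + 2 * (2 * cmod (\<zeta> - ?z))"
    using radial_chord_le[of r \<theta> \<zeta>] assms(1) c2 by (intro add_mono mult_left_mono) auto
  finally have "cmod (\<zeta> + ?z) * ?c \<le> 6 * cmod (\<zeta> - ?z)" by simp
  then show ?thesis using nz by (simp add: schwarz_kernel_def norm_divide divide_simps)
qed

lemma schwarz_kernel_continuous_circle:
  assumes "r > 0" "cmod \<zeta> \<noteq> r"
  shows "continuous_on S (\<lambda>\<theta>. schwarz_kernel (complex_of_real r * cis \<theta>) \<zeta>)"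
proof -
  have "\<zeta> - complex_of_real r * cis \<theta> \<noteq> 0" for \<theta> using assms by (auto simp: norm_mult)
  then show ?thesis unfolding schwarz_kernel_def by (intro continuous_intros) auto
qed

text \<open>The integral is 2\<pi> for |\<zeta>| > r, by the mean value property in z, and -2\<pi>
  for |\<zeta>| < r, where the antisymmetry of (\<zeta> + z)/(\<zeta> - z) exchanges the roles of
  \<zeta> and z.\<close>

lemma schwarz_kernel_circle_integral:
  assumes "r > 0" "cmod \<zeta> \<noteq> r"
  shows "cmod (integral {0..2*pi} (\<lambda>\<theta>. schwarz_kernel (complex_of_real r * cis \<theta>) \<zeta>)) \<le> 2 * pi"
proof (cases "cmod \<zeta> > r")
  case True
  have "(\<lambda>\<omega>. schwarz_kernel (complex_of_real r * \<omega>) \<zeta>) holomorphic_on ball 0 (cmod \<zeta> / r)"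
  proof -
    have "\<zeta> - complex_of_real r * \<omega> \<noteq> 0" if "\<omega> \<in> ball 0 (cmod \<zeta> / r)" for \<omega>
      using that assms(1) by (auto simp: norm_mult field_simps)
    then show ?thesis unfolding schwarz_kernel_def by (intro holomorphic_intros) auto
  qed
  from circle_mean[OF this] True assms(1)
  have "((\<lambda>t. schwarz_kernel (complex_of_real r * cis t) \<zeta>) has_integral 2 * pi * schwarz_kernel 0 \<zeta>) {0..2*pi}"
    by simp
  moreover have "schwarz_kernel 0 \<zeta> = 1" using True assms(1) by (auto simp: schwarz_kernel_def)
  ultimately show ?thesis by (simp add: integral_unique)
next
  case False
  then have s: "cmod (\<zeta> / complex_of_real r) < 1" using assms by (simp add: norm_divide)
  have "(\<lambda>_. 1 :: complex) holomorphic_on ball 0 2" by simp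
  from circle_schwarz[OF this _ s]
  have "((\<lambda>t. 1 * schwarz_kernel (\<zeta> / complex_of_real r) (cis t)) has_integral 2 * pi * (2 * 1 - 1)) {0..2*pi}"
    by simp
  from has_integral_neg[OF this]
  have "((\<lambda>t. - schwarz_kernel (\<zeta> / complex_of_real r) (cis t)) has_integral - (2 * pi)) {0..2*pi}"
    by simp
  moreover have "- schwarz_kernel (\<zeta> / complex_of_real r) (cis t) = schwarz_kernel (complex_of_real r * cis t) \<zeta>" for t
  proof -
    have r: "complex_of_real r \<noteq> 0" using assms(1) by simp
    have "schwarz_kernel (\<zeta> / complex_of_real r) (cis t) =
        (complex_of_real r * (cis t + \<zeta> / complex_of_real r)) / (complex_of_real r * (cis t - \<zeta> / complex_of_real r))"
      unfolding schwarz_kernel_def using r by simp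
    also have "\<dots> = (\<zeta> + complex_of_real r * cis t) / - (\<zeta> - complex_of_real r * cis t)"
      using r by (simp add: distrib_left right_diff_distrib add.commute)
    finally show ?thesis
      unfolding schwarz_kernel_def[of "complex_of_real r * cis t"] minus_divide_right[symmetric] by simp
  qed
  ultimately have "((\<lambda>\<theta>. schwarz_kernel (complex_of_real r * cis \<theta>) \<zeta>) has_integral - (2 * pi)) {0..2*pi}"
    by simp
  then show ?thesis by (simp add: integral_unique)
qed

lemma circle_test_bounded:
  assumes "\<phi> \<in> circle_test" shows "\<exists>M\<ge>0. \<forall>\<theta>\<in>{-pi..2*pi}. cmod (\<phi> \<theta>) \<le> M"
proof -
  have "bounded (\<phi> ` {-pi..2*pi})"
    by (intro compact_imp_bounded compact_continuous_image circle_test_continuous assms) auto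
  then obtain M where M: "M > 0" "\<forall>y\<in>\<phi> ` {-pi..2*pi}. cmod y \<le> M"
    unfolding bounded_pos by blast
  then show ?thesis by (intro exI[of _ M]) (auto simp del: atLeastAtMost_iff)
qed

text \<open>The cancellation estimate. Subtracting \<phi>(Arg \<zeta>) gains one factor of the
  chord, which makes the integrand bounded, and the subtracted part is controlled by the mean of the
  kernel. The constant does not see how close \<zeta> is to the circle.\<close>

lemma schwarz_kernel_circle_bound:
  assumes \<phi>: "\<phi> \<in> circle_test"
  shows "\<exists>C\<ge>0. \<forall>r \<zeta>. r > 0 \<longrightarrow> cmod \<zeta> \<noteq> r \<longrightarrow>
    cmod (integral {0..2*pi} (\<lambda>\<theta>. schwarz_kernel (complex_of_real r * cis \<theta>) \<zeta> * \<phi> \<theta>)) \<le> C"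
proof -
  obtain L where L: "L \<ge> 0" "\<And>\<theta> t. \<theta> \<in> {0..2*pi} \<Longrightarrow> t \<in> {-pi..pi} \<Longrightarrow> cmod (\<phi> \<theta> - \<phi> t) \<le> L * cmod (cis \<theta> - cis t)"
    using circle_test_lipschitz[OF \<phi>] by blast
  obtain M where M: "M \<ge> 0" "\<And>\<theta>. \<theta> \<in> {-pi..2*pi} \<Longrightarrow> cmod (\<phi> \<theta>) \<le> M"
    using circle_test_bounded[OF \<phi>] by blast
  have "cmod (integral {0..2*pi} (\<lambda>\<theta>. schwarz_kernel (complex_of_real r * cis \<theta>) \<zeta> * \<phi> \<theta>)) \<le>
      6 * L * (2 * pi) + 2 * pi * M" if r: "r > 0" "cmod \<zeta> \<noteq> r" for r \<zeta>
  proof -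
    let ?K = "\<lambda>\<theta>. schwarz_kernel (complex_of_real r * cis \<theta>) \<zeta>" and ?t = "Arg \<zeta>"
    note cK = schwarz_kernel_continuous_circle[OF r, of "{0..2*pi}"]
    note c\<phi> = circle_test_continuous[OF \<phi>, of "{0..2*pi}"]
    have c1: "continuous_on {0..2*pi} (\<lambda>\<theta>. ?K \<theta> * (\<phi> \<theta> - \<phi> ?t))" by (intro continuous_intros cK c\<phi>)
    have "?K \<theta> * \<phi> \<theta> = ?K \<theta> * (\<phi> \<theta> - \<phi> ?t) + ?K \<theta> * \<phi> ?t" for \<theta> by (simp add: algebra_simps)
    then have "integral {0..2*pi} (\<lambda>\<theta>. ?K \<theta> * \<phi> \<theta>) =
        integral {0..2*pi} (\<lambda>\<theta>. ?K \<theta> * (\<phi> \<theta> - \<phi> ?t)) + integral {0..2*pi} (\<lambda>\<theta>. ?K \<theta> * \<phi> ?t)"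
      by (simp only:) (intro Henstock_Kurzweil_Integration.integral_add integrable_continuous_real c1 continuous_intros cK)
    also have "integral {0..2*pi} (\<lambda>\<theta>. ?K \<theta> * \<phi> ?t) = integral {0..2*pi} ?K * \<phi> ?t"
      by (rule integral_mult_left)
    finally have e: "integral {0..2*pi} (\<lambda>\<theta>. ?K \<theta> * \<phi> \<theta>) =
        integral {0..2*pi} (\<lambda>\<theta>. ?K \<theta> * (\<phi> \<theta> - \<phi> ?t)) + integral {0..2*pi} ?K * \<phi> ?t" .
    have "cmod (integral {0..2*pi} (\<lambda>\<theta>. ?K \<theta> * (\<phi> \<theta> - \<phi> ?t))) \<le> 6 * L * (2 * pi - 0)"
    proof (rule integral_bound[OF _ c1])
      fix \<theta> assume \<theta>: "\<theta> \<in> {0..2*pi}"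
      have "cmod (?K \<theta> * (\<phi> \<theta> - \<phi> ?t)) \<le> cmod (?K \<theta>) * (L * cmod (cis \<theta> - cis ?t))"
        unfolding norm_mult by (intro mult_left_mono L(2) \<theta> Arg_range) auto
      also have "\<dots> = (cmod (?K \<theta>) * cmod (cis \<theta> - cis ?t)) * L" by simp
      also have "\<dots> \<le> 6 * L" by (intro mult_right_mono schwarz_kernel_chord r L(1))
      finally show "cmod (?K \<theta> * (\<phi> \<theta> - \<phi> ?t)) \<le> 6 * L" .
    qed simp
    moreover have "cmod (integral {0..2*pi} ?K * \<phi> ?t) \<le> 2 * pi * M"
      unfolding norm_mult using Arg_range[of \<zeta>] M
      by (intro mult_mono schwarz_kernel_circle_integral r) (auto intro!: M(2))
    ultimately show ?thesis
      unfolding e using norm_triangle_ineq order_trans add_mono by (smt (verit))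
  qed
  then show ?thesis using L(1) M(1) by (intro exI[of _ "6 * L * (2 * pi) + 2 * pi * M"]) auto
qed

text \<open>Reflection in the unit circle transfers the preceding bound, which is not restricted to
  \<zeta> in the disc, to the second kernel.\<close>

lemma reflected_kernel_schwarz:
  "\<zeta> \<noteq> 0 \<Longrightarrow> reflected_kernel z \<zeta> = schwarz_kernel z (1 / cnj \<zeta>)"
proof -
  assume z: "\<zeta> \<noteq> 0"
  have "schwarz_kernel z (1 / cnj \<zeta>) = (cnj \<zeta> * (1 / cnj \<zeta> + z)) / (cnj \<zeta> * (1 / cnj \<zeta> - z))"
    unfolding schwarz_kernel_def using z by simp
  then show ?thesis unfolding reflected_kernel_def using z by (simp add: distrib_left right_diff_distrib mult.commute)
qed

text \<open>The angular half of the splitting of 1/|\<zeta> - z|: the inverse square root of the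
  chord is integrable over the circle, uniformly in t. The interval [-4\<pi>, 4\<pi>] holds every
  difference of \<theta> with t or t + 2\<pi>.\<close>

lemma nn_integral_chord:
  obtains H :: real where "H \<ge> 0"
    "\<And>t. t \<in> {-pi..pi} \<Longrightarrow>
      (\<integral>\<^sup>+\<theta>. ennreal (1 / sqrt (cmod (cis \<theta> - cis t))) * indicator {0..2*pi} \<theta> \<partial>lborel) \<le> ennreal H"
proof
  let ?q = "\<lambda>x. ennreal (1 / sqrt \<bar>x\<bar>) * indicator {-(4*pi)..4*pi} x"
  let ?Q = "4 * sqrt (4 * pi)"
  show "sqrt 3 * (?Q + ?Q) \<ge> 0" by simp
  fix t assume t: "t \<in> {-pi..pi}"
  have le: "ennreal (1 / sqrt (cmod (cis \<theta> - cis t))) * indicator {0..2*pi} \<theta> \<le>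
      ennreal (sqrt 3) * (?q (- t + \<theta>) + ?q (- (t + 2 * pi) + \<theta>))" for \<theta>
  proof (cases "\<theta> \<in> {0..2*pi} \<and> cmod (cis \<theta> - cis t) \<noteq> 0")
    case True
    then have \<theta>: "\<theta> \<in> {0..2*pi}" and c0: "cmod (cis \<theta> - cis t) > 0" by auto
    have key: "ennreal (1 / sqrt (cmod (cis \<theta> - cis t))) \<le> ennreal (sqrt 3) * ?q d"
      if d: "\<bar>d\<bar> \<le> 3 * cmod (cis \<theta> - cis t)" "d \<noteq> 0" "d \<in> {-(4*pi)..4*pi}" for d
    proof -
      have "sqrt \<bar>d\<bar> \<le> sqrt 3 * sqrt (cmod (cis \<theta> - cis t))"
        using d(1) by (simp add: real_sqrt_mult[symmetric])
      then have "1 / sqrt (cmod (cis \<theta> - cis t)) \<le> sqrt 3 * (1 / sqrt \<bar>d\<bar>)"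
        using c0 d(2) by (simp add: divide_simps mult.commute)
      then show ?thesis using d(3) by (simp add: ennreal_mult[symmetric] ennreal_leI)
    qed
    have ne: "\<theta> \<noteq> t" "\<theta> \<noteq> t + 2 * pi" using c0 by (auto simp: cis.code)
    have "ennreal (1 / sqrt (cmod (cis \<theta> - cis t))) \<le> ennreal (sqrt 3) * ?q (- t + \<theta>) \<or>
        ennreal (1 / sqrt (cmod (cis \<theta> - cis t))) \<le> ennreal (sqrt 3) * ?q (- (t + 2 * pi) + \<theta>)"
      using chord_cases[OF \<theta> t]
    proof
      assume "\<bar>\<theta> - t\<bar> \<le> 3 * cmod (cis \<theta> - cis t)"
      then show ?thesis using ne(1) \<theta> t by (intro disjI1 key) auto
    next
      assume "\<bar>\<theta> - (t + 2 * pi)\<bar> \<le> 3 * cmod (cis \<theta> - cis t)"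
      then show ?thesis using ne(2) \<theta> t by (intro disjI2 key) auto
    qed
    then have "ennreal (1 / sqrt (cmod (cis \<theta> - cis t))) \<le>
        ennreal (sqrt 3) * ?q (- t + \<theta>) + ennreal (sqrt 3) * ?q (- (t + 2 * pi) + \<theta>)"
      by (elim disjE) (erule order_trans, simp)+
    then show ?thesis using \<theta> by (simp only: distrib_left indicator_simps mult_1_right)
  next
    case False
    then have "ennreal (1 / sqrt (cmod (cis \<theta> - cis t))) * indicator {0..2*pi} \<theta> = 0"
      by (cases "\<theta> \<in> {0..2*pi}") (simp_all del: atLeastAtMost_iff)
    then show ?thesis by (simp only: zero_le)
  qed
  have mq: "?q \<in> borel_measurable borel" by measurable
  note mq [measurable]
  have "(\<integral>\<^sup>+\<theta>. ennreal (1 / sqrt (cmod (cis \<theta> - cis t))) * indicator {0..2*pi} \<theta> \<partial>lborel) \<le>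
      (\<integral>\<^sup>+\<theta>. ennreal (sqrt 3) * (?q (- t + \<theta>) + ?q (- (t + 2 * pi) + \<theta>)) \<partial>lborel)"
    by (intro nn_integral_mono le)
  also have "\<dots> = ennreal (sqrt 3) * ((\<integral>\<^sup>+\<theta>. ?q (- t + \<theta>) \<partial>lborel) + (\<integral>\<^sup>+\<theta>. ?q (- (t + 2 * pi) + \<theta>) \<partial>lborel))"
  proof -
    have "(\<lambda>\<theta>. ?q (- t + \<theta>)) \<in> borel_measurable lborel" "(\<lambda>\<theta>. ?q (- (t + 2 * pi) + \<theta>)) \<in> borel_measurable lborel"
      by measurable
    then show ?thesis by (subst nn_integral_cmult) (simp_all only: nn_integral_add borel_measurable_add)
  qed
  also have "\<dots> = ennreal (sqrt 3) * (ennreal ?Q + ennreal ?Q)"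
  proof -
    have "(\<integral>\<^sup>+\<theta>. ?q (c + \<theta>) \<partial>lborel) = ennreal ?Q" for c
      by (rule trans[OF nn_integral_lborel_translate[OF mq] nn_integral_inverse_sqrt]) simp
    then show ?thesis by (simp only:)
  qed
  also have "\<dots> = ennreal (sqrt 3 * (?Q + ?Q))"
    by (simp add: ennreal_mult[symmetric] ennreal_plus[symmetric] del: ennreal_plus)
  finally show "(\<integral>\<^sup>+\<theta>. ennreal (1 / sqrt (cmod (cis \<theta> - cis t))) * indicator {0..2*pi} \<theta> \<partial>lborel) \<le> ennreal (sqrt 3 * (?Q + ?Q))" .
qed

lemma AE_cmod_neq: "AE \<zeta> in lborel. cmod \<zeta> \<noteq> r"
proof -
  have "negligible (sphere (0 :: complex) r)" by (rule negligible_sphere)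
  then have "sphere (0 :: complex) r \<in> null_sets lebesgue" by (simp add: negligible_iff_null_sets)
  then have "sphere (0 :: complex) r \<in> null_sets lborel"
    by (subst null_sets_completion_iff[symmetric]) auto
  from AE_not_in[OF this] show ?thesis by (simp add: dist_norm)
qed

section \<open>Boundary values of area potentials\<close>

lemma circle_test_measurable: "\<phi> \<in> circle_test \<Longrightarrow> \<phi> \<in> borel_measurable borel"
  by (intro borel_measurable_continuous_onI circle_test_continuous)

lemma circle_test_bound_interval:
  assumes "\<phi> \<in> circle_test"
  obtains M where "M \<ge> 0" "\<And>\<theta>. \<theta> \<in> {0..2*pi} \<Longrightarrow> cmod (\<phi> \<theta>) \<le> M"
proof -
  obtain M where M: "M \<ge> 0" "\<forall>\<theta>\<in>{-pi..2*pi}. cmod (\<phi> \<theta>) \<le> M"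
    using circle_test_bounded[OF assms] by blast
  show thesis
  proof (rule that[OF M(1)])
    fix \<theta> assume "\<theta> \<in> {0..2*pi}"
    then have "\<theta> \<in> {-pi..2*pi}" by auto
    then show "cmod (\<phi> \<theta>) \<le> M" using M(2) by blast
  qed
qed

lemma reflected_kernel_continuous_circle:
  assumes "r \<in> {0<..1}" "cmod \<zeta> < 1"
  shows "continuous_on S (\<lambda>\<theta>. reflected_kernel (complex_of_real r * cis \<theta>) \<zeta>)"
proof -
  have "1 - complex_of_real r * cis \<theta> * cnj \<zeta> \<noteq> 0" for \<theta>
    using assms by (intro reflected_kernel_denominator) (auto simp: norm_mult)
  then show ?thesis unfolding reflected_kernel_def by (intro continuous_intros) auto
qed

context area_density
begin

text \<open>The pairing of the kernel with \<phi> for one fixed \<zeta>. Integrated over \<zeta> it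
  gives the pairing of the potential, for almost every r < 1; at r = 1 it gives the boundary
  value.\<close>

definition circle_moment :: "nat \<Rightarrow> (real \<Rightarrow> complex) \<Rightarrow> real \<Rightarrow> complex \<Rightarrow> complex" where
  "circle_moment m \<phi> r \<zeta> =
     (LINT \<theta>|lborel. area_kernel F m (complex_of_real r * cis \<theta>) \<zeta> * (indicator {0..2*pi} \<theta> * \<phi> \<theta>))"

text \<open>Where this is finite, that is for almost every radius, the area kernel is absolutely integrable
  over the circle of radius \<open>r\<close>; the remaining radii form the null set in \<open>has_distr_bv\<close>.\<close>

definition radial_potential :: "real \<Rightarrow> ennreal" where
  "radial_potential r = (\<integral>\<^sup>+\<zeta>. ennreal (cmod (F \<zeta>)) * ennreal (1 / sqrt \<bar>cmod \<zeta> - r\<bar>) \<partial>lborel)"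

lemma radial_potential_measurable [measurable]: "radial_potential \<in> borel_measurable borel"
proof -
  have "(\<lambda>r. \<integral>\<^sup>+\<zeta>. ennreal (cmod (F \<zeta>)) * ennreal (1 / sqrt \<bar>cmod \<zeta> - r\<bar>) \<partial>lborel) \<in> borel_measurable borel"
    by (rule lborel.borel_measurable_nn_integral) measurable
  then show ?thesis by (simp add: radial_potential_def[abs_def])
qed

text \<open>By Tonelli it suffices that the integral of 1 / sqrt ||\<zeta>| - r| over r in [0, 1] is
  at most 4 for every \<zeta> in the disc.\<close>

lemma radial_potential_null: "{r\<in>{0..1}. radial_potential r = \<infinity>} \<in> null_sets lebesgue"
proof -
  let ?q = "\<lambda>x. ennreal (1 / sqrt \<bar>x\<bar>) * indicator {-1..1} x"
  have mq: "?q \<in> borel_measurable borel" by measurable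
  let ?N = "{r\<in>{0..1}. radial_potential r = \<infinity>}"
  have le: "(\<integral>\<^sup>+r. ennreal (1 / sqrt \<bar>cmod \<zeta> - r\<bar>) * indicator {0..1} r \<partial>lborel) \<le> ennreal 4" if "\<zeta> \<in> ball 0 1" for \<zeta> :: complex
  proof -
    have "(\<integral>\<^sup>+r. ennreal (1 / sqrt \<bar>cmod \<zeta> - r\<bar>) * indicator {0..1} r \<partial>lborel) \<le>
        (\<integral>\<^sup>+r. ?q (- cmod \<zeta> + r) \<partial>lborel)"
      using that by (intro nn_integral_mono) (auto simp: indicator_def abs_minus_commute diff_le_eq intro: add_increasing2)
    also have "\<dots> = (\<integral>\<^sup>+r. ?q r \<partial>lborel)"
      by (rule nn_integral_lborel_translate[OF mq])
    also have "\<dots> = ennreal (4 * sqrt 1)"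
      by (rule nn_integral_inverse_sqrt) simp
    finally show ?thesis by simp
  qed
  have m1: "(\<lambda>(r, \<zeta>). ennreal (cmod (F \<zeta>)) * (ennreal (1 / sqrt \<bar>cmod \<zeta> - r\<bar>) * indicator {0..1} r))
      \<in> borel_measurable (lborel \<Otimes>\<^sub>M lborel)"
    by measurable
  have "(\<integral>\<^sup>+r. radial_potential r * indicator {0..1} r \<partial>lborel) =
      (\<integral>\<^sup>+r. \<integral>\<^sup>+\<zeta>. ennreal (cmod (F \<zeta>)) * (ennreal (1 / sqrt \<bar>cmod \<zeta> - r\<bar>) * indicator {0..1} r) \<partial>lborel \<partial>lborel)"
    unfolding radial_potential_def
    by (intro nn_integral_cong, subst nn_integral_multc[symmetric]) (measurable, simp only: mult.assoc)
  also have "\<dots> = (\<integral>\<^sup>+\<zeta>. \<integral>\<^sup>+r. ennreal (cmod (F \<zeta>)) * (ennreal (1 / sqrt \<bar>cmod \<zeta> - r\<bar>) * indicator {0..1} r) \<partial>lborel \<partial>lborel)"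
    by (rule lborel_pair.Fubini'[symmetric, OF m1])
  also have "\<dots> \<le> (\<integral>\<^sup>+\<zeta>. ennreal (cmod (F \<zeta>)) * ennreal 4 \<partial>lborel)"
  proof (intro nn_integral_mono)
    fix \<zeta>
    have "(\<integral>\<^sup>+r. ennreal (cmod (F \<zeta>)) * (ennreal (1 / sqrt \<bar>cmod \<zeta> - r\<bar>) * indicator {0..1} r) \<partial>lborel) =
      ennreal (cmod (F \<zeta>)) * (\<integral>\<^sup>+r. ennreal (1 / sqrt \<bar>cmod \<zeta> - r\<bar>) * indicator {0..1} r \<partial>lborel)"
      by (rule nn_integral_cmult) measurable
    also have "\<dots> \<le> ennreal (cmod (F \<zeta>)) * ennreal 4"
      using le[of \<zeta>] by (cases "\<zeta> \<in> ball 0 1") (auto simp: F_support intro!: mult_left_mono)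
    finally show "(\<integral>\<^sup>+r. ennreal (cmod (F \<zeta>)) * (ennreal (1 / sqrt \<bar>cmod \<zeta> - r\<bar>) * indicator {0..1} r) \<partial>lborel)
        \<le> ennreal (cmod (F \<zeta>)) * ennreal 4" .
  qed
  also have "\<dots> = (\<integral>\<^sup>+\<zeta>. ennreal (cmod (F \<zeta>)) \<partial>lborel) * ennreal 4"
    by (rule nn_integral_multc) measurable
  also have "\<dots> < \<infinity>"
    using F_integrable by (simp add: integrable_iff_bounded ennreal_mult_less_top)
  finally have "(\<integral>\<^sup>+r. radial_potential r * indicator {0..1} r \<partial>lborel) \<noteq> \<infinity>" by simp
  then have "AE r in lborel. radial_potential r * indicator {0..1} r \<noteq> \<infinity>"
    by (rule nn_integral_PInf_AE[rotated]) measurable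
  then have "AE r in lborel. r \<notin> ?N"
    by eventually_elim (auto simp: indicator_def split: if_splits)
  moreover have Nb: "?N \<in> sets borel" by measurable
  ultimately have "?N \<in> null_sets lborel"
    by (subst AE_iff_null_sets) auto
  then show ?thesis by (rule null_sets_completionI)
qed

text \<open>Multiplying ||\<zeta>| - r| \<le> |\<zeta> - z| with r times the chord \<le> 2 |\<zeta>
  - z| bounds 1/|\<zeta> - z| by sqrt (2/r) times the inverse square roots of the radial distance
  and of the chord. Each factor is integrable in its own variable.\<close>

lemma circle_joint_integrable:
  assumes r: "r \<in> {0<..<1}" and fin: "radial_potential r \<noteq> \<infinity>"
    and [measurable]: "\<phi> \<in> borel_measurable borel" and M: "\<And>\<theta>. \<theta> \<in> {0..2*pi} \<Longrightarrow> cmod (\<phi> \<theta>) \<le> M" "M \<ge> 0"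
  shows "integrable (lborel \<Otimes>\<^sub>M lborel)
    (\<lambda>(\<theta>, \<zeta>). area_kernel F m (complex_of_real r * cis \<theta>) \<zeta> * (indicator {0..2*pi} \<theta> * \<phi> \<theta>))"
proof (rule integrableI_bounded)
  obtain H where H: "H \<ge> 0" "\<And>t. t \<in> {-pi..pi} \<Longrightarrow>
      (\<integral>\<^sup>+\<theta>. ennreal (1 / sqrt (cmod (cis \<theta> - cis t))) * indicator {0..2*pi} \<theta> \<partial>lborel) \<le> ennreal H"
    using nn_integral_chord by metis
  have [measurable]: "cis \<in> borel_measurable borel"
    by (intro borel_measurable_continuous_onI continuous_intros)
  let ?E = "\<lambda>\<theta> \<zeta>. area_kernel F m (complex_of_real r * cis \<theta>) \<zeta> * (indicator {0..2*pi} \<theta> * \<phi> \<theta>)"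
  let ?C = "4 * 4 ^ m * M * sqrt (2 / r)"
  let ?g = "\<lambda>\<theta> t. ennreal (1 / sqrt (cmod (cis \<theta> - cis t))) * indicator {0..2*pi} \<theta>"
  show mm: "(\<lambda>(\<theta>, \<zeta>). ?E \<theta> \<zeta>) \<in> borel_measurable (lborel \<Otimes>\<^sub>M lborel)" by measurable
  have mn: "(\<lambda>p. ennreal (norm (case p of (\<theta>, \<zeta>) \<Rightarrow> ?E \<theta> \<zeta>))) \<in> borel_measurable (lborel \<Otimes>\<^sub>M lborel)"
    by (rule measurable_compose[OF mm]) measurable
  \<comment> \<open>The exceptional points are those where a square root in a denominator vanishes
    and the quotient would be 0 by convention; they form null sets.\<close>
  have le: "ennreal (norm (?E \<theta> \<zeta>)) \<le>
      ennreal ?C * (ennreal (cmod (F \<zeta>)) * ennreal (1 / sqrt \<bar>cmod \<zeta> - r\<bar>)) * ?g \<theta> (Arg \<zeta>)"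
    if s: "cmod \<zeta> \<noteq> r" and t: "\<theta> \<noteq> Arg \<zeta>" "\<theta> \<noteq> Arg \<zeta> + 2 * pi" for \<theta> \<zeta>
  proof (cases "\<theta> \<in> {0..2*pi} \<and> \<zeta> \<in> ball 0 1")
    case True
    let ?z = "complex_of_real r * cis \<theta>" and ?c = "cmod (cis \<theta> - cis (Arg \<zeta>))"
    have zn: "cmod ?z = r" using r by (simp add: norm_mult)
    have nz: "\<zeta> \<noteq> ?z" using s zn by auto
    then have d0: "cmod (\<zeta> - ?z) > 0" by simp
    have a: "\<bar>cmod \<zeta> - r\<bar> \<le> cmod (\<zeta> - ?z)" using norm_triangle_ineq3[of \<zeta> ?z] zn by simp
    have b: "r * ?c \<le> 2 * cmod (\<zeta> - ?z)" using radial_chord_le[of r] r by simp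
    have c0: "?c > 0"
    proof (rule ccontr)
      assume "\<not> ?c > 0"
      then have "?c = 0" by simp
      with chord_cases[OF _ Arg_range, of \<theta> \<zeta>] True t show False by auto
    qed
    have "\<bar>cmod \<zeta> - r\<bar> * (r * ?c) \<le> cmod (\<zeta> - ?z) * (2 * cmod (\<zeta> - ?z))"
      by (rule mult_mono[OF a b]) (use r in auto)
    then have "sqrt (\<bar>cmod \<zeta> - r\<bar> * (r * ?c)) \<le> sqrt (2 * (cmod (\<zeta> - ?z) * cmod (\<zeta> - ?z)))"
      by (simp add: mult.left_commute)
    then have "sqrt \<bar>cmod \<zeta> - r\<bar> * (sqrt r * sqrt ?c) \<le> sqrt 2 * cmod (\<zeta> - ?z)"
      by (simp add: real_sqrt_mult)
    then have inv: "1 / cmod (\<zeta> - ?z) \<le> sqrt (2 / r) * (1 / sqrt \<bar>cmod \<zeta> - r\<bar> * (1 / sqrt ?c))"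
      using s c0 d0 r by (simp add: divide_simps real_sqrt_divide mult_ac)
    have "norm (?E \<theta> \<zeta>) = cmod (area_kernel F m ?z \<zeta>) * cmod (\<phi> \<theta>)"
      using True by (simp add: norm_mult del: atLeastAtMost_iff)
    also have "\<dots> \<le> (4 * 4 ^ m * (cmod (F \<zeta>) * (1 / cmod (\<zeta> - ?z)))) * M"
      using True M zn r nz by (intro mult_mono norm_area_kernel_le) auto
    also have "\<dots> \<le> (4 * 4 ^ m * (cmod (F \<zeta>) * (sqrt (2 / r) * (1 / sqrt \<bar>cmod \<zeta> - r\<bar> * (1 / sqrt ?c))))) * M"
      using inv M(2) by (intro mult_right_mono mult_left_mono) auto
    also have "\<dots> = ?C * (cmod (F \<zeta>) * (1 / sqrt \<bar>cmod \<zeta> - r\<bar>)) * (1 / sqrt ?c)" by (simp add: mult_ac)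
    finally have n: "norm (?E \<theta> \<zeta>) \<le> ?C * (cmod (F \<zeta>) * (1 / sqrt \<bar>cmod \<zeta> - r\<bar>)) * (1 / sqrt ?c)" .
    have C0: "?C \<ge> 0" using M(2) r by simp
    have i1: "indicator {0..2*pi} \<theta> = (1 :: ennreal)" using True by simp
    have "ennreal (norm (?E \<theta> \<zeta>)) \<le> ennreal (?C * (cmod (F \<zeta>) * (1 / sqrt \<bar>cmod \<zeta> - r\<bar>)) * (1 / sqrt ?c))"
      by (rule ennreal_leI[OF n])
    also have "\<dots> = ennreal ?C * (ennreal (cmod (F \<zeta>)) * ennreal (1 / sqrt \<bar>cmod \<zeta> - r\<bar>)) * ennreal (1 / sqrt ?c)"
    proof -
      have prod: "ennreal (c * (a * b) * d) = ennreal c * (ennreal a * ennreal b) * ennreal d"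
        if "c \<ge> 0" "a \<ge> 0" "b \<ge> 0" "d \<ge> 0" for a b c d :: real
        using that by (simp add: ennreal_mult)
      show ?thesis by (rule prod[OF C0]) simp_all
    qed
    finally show ?thesis unfolding i1 mult_1_right .
  next
    case False
    then have "?E \<theta> \<zeta> = 0"
      by (cases "\<theta> \<in> {0..2*pi}") (simp_all add: area_kernel_outside del: atLeastAtMost_iff)
    then have "ennreal (norm (?E \<theta> \<zeta>)) = 0" by (simp only: norm_zero ennreal_0)
    then show ?thesis by (simp only: zero_le)
  qed
  have "(\<integral>\<^sup>+p. ennreal (norm (case p of (\<theta>, \<zeta>) \<Rightarrow> ?E \<theta> \<zeta>)) \<partial>(lborel \<Otimes>\<^sub>M lborel)) =
      (\<integral>\<^sup>+\<zeta>. \<integral>\<^sup>+\<theta>. ennreal (norm (?E \<theta> \<zeta>)) \<partial>lborel \<partial>lborel)"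
    using lborel_pair.nn_integral_snd[OF mn] by simp
  also have "\<dots> \<le> (\<integral>\<^sup>+\<zeta>. ennreal ?C * (ennreal (cmod (F \<zeta>)) * ennreal (1 / sqrt \<bar>cmod \<zeta> - r\<bar>)) * ennreal H \<partial>lborel)"
  proof (intro nn_integral_mono_AE)
    show "AE \<zeta> in lborel. (\<integral>\<^sup>+\<theta>. ennreal (norm (?E \<theta> \<zeta>)) \<partial>lborel) \<le>
        ennreal ?C * (ennreal (cmod (F \<zeta>)) * ennreal (1 / sqrt \<bar>cmod \<zeta> - r\<bar>)) * ennreal H"
      using AE_cmod_neq[of r]
    proof eventually_elim
      case (elim \<zeta>)
      have "(\<integral>\<^sup>+\<theta>. ennreal (norm (?E \<theta> \<zeta>)) \<partial>lborel) \<le>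
          (\<integral>\<^sup>+\<theta>. ennreal ?C * (ennreal (cmod (F \<zeta>)) * ennreal (1 / sqrt \<bar>cmod \<zeta> - r\<bar>)) * ?g \<theta> (Arg \<zeta>) \<partial>lborel)"
        using AE_lborel_singleton[of "Arg \<zeta>"] AE_lborel_singleton[of "Arg \<zeta> + 2 * pi"]
        by (intro nn_integral_mono_AE, eventually_elim) (rule le[OF elim])
      also have "\<dots> = ennreal ?C * (ennreal (cmod (F \<zeta>)) * ennreal (1 / sqrt \<bar>cmod \<zeta> - r\<bar>)) * (\<integral>\<^sup>+\<theta>. ?g \<theta> (Arg \<zeta>) \<partial>lborel)"
        by (rule nn_integral_cmult) measurable
      also have "\<dots> \<le> ennreal ?C * (ennreal (cmod (F \<zeta>)) * ennreal (1 / sqrt \<bar>cmod \<zeta> - r\<bar>)) * ennreal H"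
        by (intro mult_left_mono H(2) Arg_range) simp
      finally show ?case .
    qed
  qed
  also have "\<dots> = ennreal ?C * radial_potential r * ennreal H"
    unfolding radial_potential_def
    by (subst nn_integral_multc, measurable, subst nn_integral_cmult, measurable)
  also have "\<dots> < \<infinity>"
    using fin by (simp add: ennreal_mult_eq_top_iff less_top[symmetric])
  finally show "(\<integral>\<^sup>+p. ennreal (norm (case p of (\<theta>, \<zeta>) \<Rightarrow> ?E \<theta> \<zeta>)) \<partial>(lborel \<Otimes>\<^sub>M lborel)) < \<infinity>" .
qed

lemma circle_pairing_area_potential:
  assumes r: "r \<in> {0<..<1}" and fin: "radial_potential r \<noteq> \<infinity>" and \<phi>: "\<phi> \<in> circle_test"
  shows "circle_pairing (area_potential F m) r \<phi> = (LINT \<zeta>|lborel. circle_moment m \<phi> r \<zeta>)"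
proof -
  have [measurable]: "cis \<in> borel_measurable borel"
    by (intro borel_measurable_continuous_onI continuous_intros)
  note [measurable] = circle_test_measurable[OF \<phi>]
  obtain M where M: "M \<ge> 0" "\<And>\<theta>. \<theta> \<in> {0..2*pi} \<Longrightarrow> cmod (\<phi> \<theta>) \<le> M"
    using circle_test_bound_interval[OF \<phi>] by metis
  have "circle_pairing (area_potential F m) r \<phi> =
      (LINT \<theta>|lborel. indicator {0..2*pi} \<theta> * (area_potential F m (complex_of_real r * cis \<theta>) * \<phi> \<theta>))"
    unfolding circle_pairing_def by (rule set_integral_lebesgue_lborel[OF borel_closed[OF closed_atLeastAtMost]]) measurable
  also have "\<dots> = (LINT \<theta>|lborel. LINT \<zeta>|lborel. area_kernel F m (complex_of_real r * cis \<theta>) \<zeta> * (indicator {0..2*pi} \<theta> * \<phi> \<theta>))"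
    unfolding area_potential_def integral_mult_left_zero by (simp only: mult_ac)
  also have "\<dots> = (LINT \<zeta>|lborel. circle_moment m \<phi> r \<zeta>)"
    unfolding circle_moment_def
    by (rule lborel_pair.Fubini_integral[symmetric, OF circle_joint_integrable[OF r fin circle_test_measurable[OF \<phi>] M(2,1)]])
  finally show ?thesis .
qed

lemma area_potential_circle_integrable:
  assumes r: "r \<in> {0<..<1}" and fin: "radial_potential r \<noteq> \<infinity>"
  shows "set_integrable lebesgue {0..2*pi} (\<lambda>\<theta>. area_potential F m (complex_of_real r * cis \<theta>))"
proof -
  have "integrable (lborel \<Otimes>\<^sub>M lborel)
    (\<lambda>(\<theta>, \<zeta>). area_kernel F m (complex_of_real r * cis \<theta>) \<zeta> * (indicator {0..2*pi} \<theta> * 1))"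
    by (rule circle_joint_integrable[OF r fin, of _ 1]) auto
  from lborel_pair.integrable_fst[OF this]
  have "integrable lborel (\<lambda>\<theta>. area_potential F m (complex_of_real r * cis \<theta>) * (indicator {0..2*pi} \<theta> * 1))"
    by (simp only: area_potential_def integral_mult_left_zero)
  moreover have "area_potential F m (complex_of_real r * cis \<theta>) * (indicator {0..2*pi} \<theta> * 1) =
      indicator {0..2*pi} \<theta> *\<^sub>R area_potential F m (complex_of_real r * cis \<theta>)" for \<theta>
    by (simp add: indicator_def)
  ultimately have "integrable lborel (\<lambda>\<theta>. indicator {0..2*pi} \<theta> *\<^sub>R area_potential F m (complex_of_real r * cis \<theta>))"
    by (simp only:)
  then have "integrable lebesgue (\<lambda>\<theta>. indicator {0..2*pi} \<theta> *\<^sub>R area_potential F m (complex_of_real r * cis \<theta>))"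
    by (subst integrable_completion) (rule borel_measurable_integrable)
  then show ?thesis by (simp only: set_integrable_def)
qed

lemma circle_moment_eq:
  assumes r: "r \<in> {0<..1}" and s: "cmod \<zeta> \<noteq> r" "cmod \<zeta> < 1" and \<phi>: "\<phi> \<in> circle_test"
  shows "continuous_on {0..2*pi} (\<lambda>\<theta>. area_kernel F m (complex_of_real r * cis \<theta>) \<zeta> * \<phi> \<theta>)"
    and "circle_moment m \<phi> r \<zeta> = integral {0..2*pi} (\<lambda>\<theta>. area_kernel F m (complex_of_real r * cis \<theta>) \<zeta> * \<phi> \<theta>)"
proof -
  let ?f = "\<lambda>\<theta>. area_kernel F m (complex_of_real r * cis \<theta>) \<zeta> * \<phi> \<theta>"
  have r0: "r > 0" using r by simp
  show c: "continuous_on {0..2*pi} ?f"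
    unfolding area_kernel_def real_excess_def
    by (intro continuous_intros schwarz_kernel_continuous_circle[OF r0 s(1)]
        reflected_kernel_continuous_circle[OF r s(2)] circle_test_continuous[OF \<phi>])
  have i: "integrable lborel (\<lambda>\<theta>. indicator {0..2*pi} \<theta> *\<^sub>R ?f \<theta>)"
    by (intro borel_integrable_compact c) auto
  have "area_kernel F m (complex_of_real r * cis \<theta>) \<zeta> * (indicator {0..2*pi} \<theta> * \<phi> \<theta>) = indicator {0..2*pi} \<theta> *\<^sub>R ?f \<theta>" for \<theta>
    by (simp add: indicator_def)
  then have "circle_moment m \<phi> r \<zeta> = (LINT \<theta>|lborel. indicator {0..2*pi} \<theta> *\<^sub>R ?f \<theta>)"
    by (simp only: circle_moment_def)
  also have "\<dots> = integral {0..2*pi} ?f"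
    using set_borel_integral_eq_integral(2)[of "{0..2*pi}" ?f] i
    by (simp only: set_lebesgue_integral_def set_integrable_def)
  finally show "circle_moment m \<phi> r \<zeta> = integral {0..2*pi} ?f" .
qed

text \<open>This supplies the majorant for dominated convergence. A positive exponent makes the
  kernel bounded; for exponent 0 the cancellation estimate is used at \<zeta> and at the reflected
  point 1 / cnj \<zeta>.\<close>

lemma circle_moment_bound:
  assumes \<phi>: "\<phi> \<in> circle_test"
  obtains C where "C \<ge> 0" "\<And>r \<zeta>. r \<in> {0<..<1} \<Longrightarrow> cmod \<zeta> \<noteq> r \<Longrightarrow> cmod (circle_moment m \<phi> r \<zeta>) \<le> C * cmod (F \<zeta>)"
proof -
  obtain M where M: "M \<ge> 0" "\<And>\<theta>. \<theta> \<in> {0..2*pi} \<Longrightarrow> cmod (\<phi> \<theta>) \<le> M"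
    using circle_test_bound_interval[OF \<phi>] by metis
  have out: "circle_moment m \<phi> r \<zeta> = 0" if "\<zeta> \<notin> ball 0 1" for r \<zeta>
    unfolding circle_moment_def area_kernel_outside[OF that] by simp
  show thesis
  proof (cases m)
    case (Suc k)
    show thesis
    proof (rule that[of "8 * 4 ^ k * M * (2 * pi - 0)"])
      fix r :: real and \<zeta> :: complex assume r: "r \<in> {0<..<1}" and s: "cmod \<zeta> \<noteq> r"
      show "cmod (circle_moment m \<phi> r \<zeta>) \<le> 8 * 4 ^ k * M * (2 * pi - 0) * cmod (F \<zeta>)"
      proof (cases "\<zeta> \<in> ball 0 1")
        case True
        then have s1: "cmod \<zeta> < 1" by simp
        have r1: "r \<in> {0<..1}" using r by simp
        have "cmod (integral {0..2*pi} (\<lambda>\<theta>. area_kernel F m (complex_of_real r * cis \<theta>) \<zeta> * \<phi> \<theta>)) \<le>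
            8 * 4 ^ k * cmod (F \<zeta>) * M * (2 * pi - 0)"
        proof (rule integral_bound[OF _ circle_moment_eq(1)[OF r1 s s1 \<phi>]])
          fix \<theta> assume \<theta>: "\<theta> \<in> {0..2*pi}"
          show "cmod (area_kernel F m (complex_of_real r * cis \<theta>) \<zeta> * \<phi> \<theta>) \<le> 8 * 4 ^ k * cmod (F \<zeta>) * M"
            unfolding norm_mult Suc using r s1 M \<theta>
            by (intro mult_mono norm_area_kernel_Suc_le) (auto simp: norm_mult)
        qed simp
        then show ?thesis unfolding circle_moment_eq(2)[OF r1 s s1 \<phi>] by (simp add: mult_ac)
      next
        case False
        then show ?thesis using out[OF False] M(1) by simp
      qed
    qed (use M in simp)
  next
    case 0
    obtain C where C: "C \<ge> 0" "\<And>r \<zeta>. r > 0 \<Longrightarrow> cmod \<zeta> \<noteq> r \<Longrightarrow>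
      cmod (integral {0..2*pi} (\<lambda>\<theta>. schwarz_kernel (complex_of_real r * cis \<theta>) \<zeta> * \<phi> \<theta>)) \<le> C"
      using schwarz_kernel_circle_bound[OF \<phi>] by blast
    let ?C = "C + (C + M * (2 * pi - 0))"
    show thesis
    proof (rule that[of ?C])
      fix r :: real and \<zeta> :: complex assume r: "r \<in> {0<..<1}" and s: "cmod \<zeta> \<noteq> r"
      show "cmod (circle_moment m \<phi> r \<zeta>) \<le> ?C * cmod (F \<zeta>)"
      proof (cases "\<zeta> \<in> ball 0 1")
        case True
        then have s1: "cmod \<zeta> < 1" by simp
        have r1: "r \<in> {0<..1}" "r > 0" using r by auto
        let ?K = "\<lambda>\<theta>. schwarz_kernel (complex_of_real r * cis \<theta>) \<zeta> * \<phi> \<theta>"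
        let ?R = "\<lambda>\<theta>. reflected_kernel (complex_of_real r * cis \<theta>) \<zeta> * \<phi> \<theta>"
        have cK: "continuous_on {0..2*pi} ?K"
          by (intro continuous_intros schwarz_kernel_continuous_circle[OF r1(2) s] circle_test_continuous[OF \<phi>])
        have cR: "continuous_on {0..2*pi} ?R"
          by (intro continuous_intros reflected_kernel_continuous_circle[OF r1(1) s1] circle_test_continuous[OF \<phi>])
        have R: "cmod (integral {0..2*pi} ?R) \<le> C + M * (2 * pi - 0)"
        proof (cases "\<zeta> = 0")
          \<comment> \<open>The reflected point is at infinity, and the reflected kernel is the
            constant 1.\<close>
          case z: True
          have "cmod (integral {0..2*pi} ?R) \<le> M * (2 * pi - 0)"
            by (rule integral_bound[OF _ cR]) (use z M in \<open>auto simp: reflected_kernel_def\<close>)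
          then show ?thesis using C(1) by simp
        next
          case z: False
          have "r * cmod \<zeta> < 1 * 1" using z s1 r by (intro mult_strict_mono) auto
          then have "cmod (1 / cnj \<zeta>) \<noteq> r" using z by (auto simp: norm_divide field_simps)
          from C(2)[OF r1(2) this] have "cmod (integral {0..2*pi} ?R) \<le> C"
            by (simp only: reflected_kernel_schwarz[OF z])
          then show ?thesis using M(1) by (simp add: add_increasing2)
        qed
        have "circle_moment m \<phi> r \<zeta> = integral {0..2*pi} (\<lambda>\<theta>. F \<zeta> * ?K \<theta> + cnj (F \<zeta>) * ?R \<theta>)"
          unfolding circle_moment_eq(2)[OF r1(1) s s1 \<phi>] 0 by (simp add: area_kernel_def algebra_simps)
        also have "\<dots> = integral {0..2*pi} (\<lambda>\<theta>. F \<zeta> * ?K \<theta>) + integral {0..2*pi} (\<lambda>\<theta>. cnj (F \<zeta>) * ?R \<theta>)"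
          by (intro Henstock_Kurzweil_Integration.integral_add integrable_continuous_real continuous_on_mult continuous_on_const cK cR)
        also have "\<dots> = F \<zeta> * integral {0..2*pi} ?K + cnj (F \<zeta>) * integral {0..2*pi} ?R"
          by (simp only: integral_mult_right)
        finally have "cmod (circle_moment m \<phi> r \<zeta>) \<le> cmod (F \<zeta> * integral {0..2*pi} ?K) + cmod (cnj (F \<zeta>) * integral {0..2*pi} ?R)"
          by (simp only: norm_triangle_ineq)
        also have "\<dots> = cmod (F \<zeta>) * cmod (integral {0..2*pi} ?K) + cmod (F \<zeta>) * cmod (integral {0..2*pi} ?R)"
          by (simp only: norm_mult complex_mod_cnj)
        also have "\<dots> \<le> cmod (F \<zeta>) * C + cmod (F \<zeta>) * (C + M * (2 * pi - 0))"
          by (intro add_mono mult_left_mono C(2)[OF r1(2) s] R) auto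
        finally show ?thesis by (simp add: algebra_simps)
      next
        case False
        then show ?thesis using out[OF False] M(1) C(1) by simp
      qed
    qed (use M C in simp)
  qed
qed

text \<open>Only radii r > |\<zeta>| matter near 1. For these the circle misses the pole \<zeta>,
  and the reflected pole lies beyond the unit circle, so the integrand is continuous up to r =
  1.\<close>

lemma circle_moment_tendsto:
  assumes \<zeta>: "cmod \<zeta> < 1" and \<phi>: "\<phi> \<in> circle_test" and S: "S \<subseteq> {0<..<1}"
  shows "((\<lambda>r. circle_moment m \<phi> r \<zeta>) \<longlongrightarrow> circle_moment m \<phi> 1 \<zeta>) (at 1 within S)"
proof -
  let ?s = "cmod \<zeta>"
  let ?I = "\<lambda>r. integral (cbox 0 (2*pi)) (\<lambda>\<theta>. area_kernel F m (complex_of_real r * cis \<theta>) \<zeta> * \<phi> \<theta>)"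
  have "continuous_on {?s<..1} ?I"
  proof (rule integral_continuous_on_param)
    have k: "\<zeta> - complex_of_real r * cis \<theta> \<noteq> 0" "1 - complex_of_real r * cis \<theta> * cnj \<zeta> \<noteq> 0"
      if "r \<in> {?s<..1}" for r \<theta>
    proof -
      have r: "0 \<le> r" "?s < r" "r \<le> 1" using that order.trans[OF norm_ge_zero[of \<zeta>]] by auto
      then show "\<zeta> - complex_of_real r * cis \<theta> \<noteq> 0" by (auto simp: norm_mult)
      show "1 - complex_of_real r * cis \<theta> * cnj \<zeta> \<noteq> 0"
        using r \<zeta> by (intro reflected_kernel_denominator) (auto simp: norm_mult)
    qed
    show "continuous_on ({?s<..1} \<times> cbox 0 (2*pi)) (\<lambda>(r, \<theta>). area_kernel F m (complex_of_real r * cis \<theta>) \<zeta> * \<phi> \<theta>)"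
      unfolding case_prod_beta area_kernel_def schwarz_kernel_def reflected_kernel_def real_excess_def
      by (intro continuous_intros continuous_on_compose2[OF circle_test_continuous[OF \<phi>, of UNIV]])
        (use k in \<open>auto simp del: greaterThanAtMost_iff\<close>)
  qed
  moreover have "(1::real) \<in> {?s<..1}" using \<zeta> by simp
  ultimately have "(?I \<longlongrightarrow> ?I 1) (at 1 within {?s<..1})"
    unfolding continuous_on_def by (rule bspec)
  then have lim: "(?I \<longlongrightarrow> ?I 1) (at 1 within (S \<inter> {?s<..}))"
    by (rule tendsto_within_subset) (use S in auto)
  have Ieq: "?I r = circle_moment m \<phi> r \<zeta>" if "?s < r" "r \<le> 1" for r
  proof -
    have "0 < r" using that norm_ge_zero[of \<zeta>] by linarith
    then show ?thesis using that by (subst circle_moment_eq(2)[OF _ _ \<zeta> \<phi>]) auto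
  qed
  have "(?I \<longlongrightarrow> circle_moment m \<phi> 1 \<zeta>) (at 1 within (S \<inter> {?s<..}))"
    using lim unfolding Ieq[OF \<zeta> order_refl] .
  then have "((\<lambda>r. circle_moment m \<phi> r \<zeta>) \<longlongrightarrow> circle_moment m \<phi> 1 \<zeta>) (at 1 within (S \<inter> {?s<..}))"
  proof (rule Lim_transform_eventually)
    show "\<forall>\<^sub>F r in at 1 within (S \<inter> {?s<..}). ?I r = circle_moment m \<phi> r \<zeta>"
      unfolding eventually_at_filter using S by (intro always_eventually allI impI Ieq) auto
  qed
  moreover have "at 1 within (S \<inter> {?s<..}) = at 1 within S"
    by (rule at_within_nhd[of 1 "{?s<..}"]) (use \<zeta> in auto)
  ultimately show ?thesis by simp
qed

text \<open>On the unit circle the reflected kernel is minus the conjugate of the Schwarz kernel.\<close>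

lemma circle_moment_Re:
  assumes \<zeta>: "cmod \<zeta> < 1" and \<phi>: "\<phi> \<in> circle_test" "\<And>t. Im (\<phi> t) = 0"
  shows "Re (circle_moment m \<phi> 1 \<zeta>) = 0"
proof -
  have s: "cmod \<zeta> \<noteq> 1" using \<zeta> by simp
  have 1: "(1::real) \<in> {0<..1}" by simp
  note e = circle_moment_eq[OF 1 s \<zeta> \<phi>(1), of m]
  have re: "Re (area_kernel F m (complex_of_real 1 * cis \<theta>) \<zeta> * \<phi> \<theta>) = 0" for \<theta>
  proof -
    let ?z = "cis \<theta>"
    have zz: "?z * cnj ?z = 1" by (simp add: cis_cnj cis_mult)
    have "reflected_kernel ?z \<zeta> = - cnj (schwarz_kernel ?z \<zeta>)"
    proof -
      have nz: "?z \<noteq> 0" by simp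
      have "cnj (schwarz_kernel ?z \<zeta>) = (?z * (cnj \<zeta> + cnj ?z)) / (?z * (cnj \<zeta> - cnj ?z))"
        unfolding schwarz_kernel_def using nz by simp
      also have "\<dots> = (1 + ?z * cnj \<zeta>) / - (1 - ?z * cnj \<zeta>)"
        using zz by (simp add: distrib_left right_diff_distrib add.commute)
      finally show ?thesis unfolding reflected_kernel_def minus_divide_right[symmetric] by simp
    qed
    then have "Re (F \<zeta> * schwarz_kernel ?z \<zeta> + cnj (F \<zeta>) * reflected_kernel ?z \<zeta>) = 0" by simp
    moreover have "Im (real_excess ?z \<zeta> ^ m) = 0" by (rule Im_power_real) (simp add: real_excess_def)
    ultimately show ?thesis using \<phi>(2)[of \<theta>] by (simp add: area_kernel_def)
  qed
  have "Re (integral {0..2*pi} (\<lambda>\<theta>. area_kernel F m (complex_of_real 1 * cis \<theta>) \<zeta> * \<phi> \<theta>)) =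
      integral {0..2*pi} (\<lambda>\<theta>. Re (area_kernel F m (complex_of_real 1 * cis \<theta>) \<zeta> * \<phi> \<theta>))"
    using integral_linear[OF integrable_continuous_real[OF e(1)] bounded_linear_Re] by (simp only: o_def)
  also have "\<dots> = 0" unfolding re by simp
  finally show ?thesis unfolding e(2) .
qed

text \<open>Fubini rewrites the pairing as an integral of moments, and dominated convergence with
  majorant C |F| lets r tend to 1. No convergence of the potential itself at boundary points is
  claimed.\<close>

lemma imaginary_bv_area_potential: "imaginary_bv (area_potential F m)"
proof -
  define N where "N = {r\<in>{0..1}. radial_potential r = \<infinity>}"
  let ?v = "restrict (\<lambda>\<phi>. LINT \<zeta>|lborel. circle_moment m \<phi> 1 \<zeta>) circle_test"
  have good: "radial_potential r \<noteq> \<infinity>" if "r \<in> {0<..<1} - N" for r using that by (auto simp: N_def)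
  have "has_distr_bv (area_potential F m) ?v"
    unfolding has_distr_bv_def
  proof (intro conjI bexI[of _ N] ballI)
    show "N \<in> null_sets lebesgue" unfolding N_def by (rule radial_potential_null)
    show "set_integrable lebesgue {0..2*pi} (\<lambda>\<theta>. area_potential F m (complex_of_real r * cis \<theta>))"
      if "r \<in> {0<..<1} - N" for r
      by (rule area_potential_circle_integrable) (use that good[OF that] in auto)
    fix \<phi> assume \<phi>: "\<phi> \<in> circle_test"
    have [measurable]: "cis \<in> borel_measurable borel"
      by (intro borel_measurable_continuous_onI continuous_intros)
    note [measurable] = circle_test_measurable[OF \<phi>]
    obtain C where C: "C \<ge> 0" "\<And>r \<zeta>. r \<in> {0<..<1} \<Longrightarrow> cmod \<zeta> \<noteq> r \<Longrightarrow> cmod (circle_moment m \<phi> r \<zeta>) \<le> C * cmod (F \<zeta>)"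
      using circle_moment_bound[OF \<phi>] by metis
    have cm: "circle_moment m \<phi> r \<in> borel_measurable lborel" for r
    proof -
      have "(\<lambda>\<zeta>. LINT \<theta>|lborel. area_kernel F m (complex_of_real r * cis \<theta>) \<zeta> * (indicator {0..2*pi} \<theta> * \<phi> \<theta>)) \<in> borel_measurable lborel"
        by (rule lborel.borel_measurable_lebesgue_integral) measurable
      then show ?thesis by (simp only: circle_moment_def[abs_def])
    qed
    have "((\<lambda>r. circle_pairing (area_potential F m) r \<phi>) \<longlongrightarrow> (LINT \<zeta>|lborel. circle_moment m \<phi> 1 \<zeta>)) (at 1 within {0<..<1} - N)"
      \<comment> \<open>Dominated convergence works along sequences, and these avoid the null set of
        radii on which Fubini may fail.\<close>
      unfolding tendsto_at_iff_sequentially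
    proof (intro allI impI)
      fix X :: "nat \<Rightarrow> real" assume X: "\<forall>i. X i \<in> {0<..<1} - N - {1}" "X \<longlonglongrightarrow> 1"
      have Xi: "X i \<in> {0<..<1} - N" "X i \<in> {0<..<1}" for i using X(1) by auto
      have "(\<lambda>i. LINT \<zeta>|lborel. circle_moment m \<phi> (X i) \<zeta>) \<longlonglongrightarrow> (LINT \<zeta>|lborel. circle_moment m \<phi> 1 \<zeta>)"
      proof (rule integral_dominated_convergence[where w = "\<lambda>\<zeta>. C * cmod (F \<zeta>)"])
        show "integrable lborel (\<lambda>\<zeta>. C * cmod (F \<zeta>))"
          using F_integrable by (intro integrable_mult_right integrable_norm)
        show "AE \<zeta> in lborel. (\<lambda>i. circle_moment m \<phi> (X i) \<zeta>) \<longlonglongrightarrow> circle_moment m \<phi> 1 \<zeta>"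
        proof (intro AE_I2)
          fix \<zeta>
          show "(\<lambda>i. circle_moment m \<phi> (X i) \<zeta>) \<longlonglongrightarrow> circle_moment m \<phi> 1 \<zeta>"
          proof (cases "\<zeta> \<in> ball 0 1")
            case True
            then have "((\<lambda>r. circle_moment m \<phi> r \<zeta>) \<longlongrightarrow> circle_moment m \<phi> 1 \<zeta>) (at 1 within {0<..<1} - N)"
              by (intro circle_moment_tendsto \<phi>) auto
            then show ?thesis using X unfolding tendsto_at_iff_sequentially o_def by blast
          next
            case False
            then show ?thesis unfolding circle_moment_def area_kernel_outside[OF False] by simp
          qed
        qed
        show "AE \<zeta> in lborel. norm (circle_moment m \<phi> (X i) \<zeta>) \<le> C * cmod (F \<zeta>)" for i
          using AE_cmod_neq[of "X i"] by eventually_elim (rule C(2)[OF Xi(2)])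
      qed (rule cm)+
      then show "((\<lambda>r. circle_pairing (area_potential F m) r \<phi>) \<circ> X) \<longlonglongrightarrow> (LINT \<zeta>|lborel. circle_moment m \<phi> 1 \<zeta>)"
        unfolding o_def circle_pairing_area_potential[OF Xi(2) good[OF Xi(1)] \<phi>] .
    qed
    then show "((\<lambda>r. circle_pairing (area_potential F m) r \<phi>) \<longlongrightarrow> ?v \<phi>) (at 1 within {0<..<1} - N)"
      using \<phi> by simp
  qed simp
  moreover have "Re (?v \<phi>) = 0" if \<phi>: "\<phi> \<in> circle_test" "\<forall>t. Im (\<phi> t) = 0" for \<phi>
  proof -
    have z: "Re (circle_moment m \<phi> 1 \<zeta>) = 0" for \<zeta>
    proof (cases "\<zeta> \<in> ball 0 1")
      case True
      then show ?thesis using \<phi> by (intro circle_moment_Re) auto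
    next
      case False
      then show ?thesis unfolding circle_moment_def area_kernel_outside[OF False] by simp
    qed
    have "Re (LINT \<zeta>|lborel. circle_moment m \<phi> 1 \<zeta>) = 0"
    \<comment> \<open>A non-integrable moment has integral 0 by convention, so the real part
      vanishes in that case too.\<close>
    proof (cases "integrable lborel (circle_moment m \<phi> 1)")
      case True
      from integral_Re[OF this] show ?thesis unfolding z by simp
    next
      case False
      then show ?thesis by (simp add: not_integrable_integral_eq)
    qed
    then show ?thesis using \<phi>(1) by simp
  qed
  ultimately show ?thesis unfolding imaginary_bv_def by blast
qed

end

section \<open>Lebesgue points\<close>

lemma measure_lebesgue_cball_complex:
  assumes "\<epsilon> \<ge> 0" shows "measure lebesgue (cball (a :: complex) \<epsilon>) = pi * \<epsilon>\<^sup>2"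
    and "emeasure lborel (cball (a :: complex) \<epsilon>) = ennreal (pi * \<epsilon>\<^sup>2)"
proof -
  show e: "emeasure lborel (cball a \<epsilon>) = ennreal (pi * \<epsilon>\<^sup>2)"
    using emeasure_cball[OF assms, of a] by (simp add: unit_ball_vol_2)
  show "measure lebesgue (cball a \<epsilon>) = pi * \<epsilon>\<^sup>2"
    using e by (simp add: measure_completion measure_def)
qed

text \<open>Discs of radius below 1/2 stay inside the unit disc, where local integrability is
  available.\<close>

lemma eventually_small: "\<forall>\<^sub>F \<epsilon> in at_right (0::real). 0 < \<epsilon> \<and> \<epsilon> < 1 / 2"
  using eventually_at_right_real[of 0 "1 / 2"] by simp

lemma lebesgue_point_cong:
  assumes "lebesgue_point g 0" "\<And>z. z \<in> ball 0 1 \<Longrightarrow> g z = g' z"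
  shows "lebesgue_point g' 0"
  unfolding lebesgue_point_def
proof (rule Lim_transform_eventually)
  show "((\<lambda>\<epsilon>. (LINT z:cball 0 \<epsilon>|lebesgue. cmod (g z - g 0)) / measure lebesgue (cball (0 :: complex) \<epsilon>)) \<longlongrightarrow> 0) (at_right 0)"
    using assms(1) by (simp only: lebesgue_point_def)
  show "\<forall>\<^sub>F \<epsilon> in at_right 0. (LINT z:cball 0 \<epsilon>|lebesgue. cmod (g z - g 0)) / measure lebesgue (cball (0 :: complex) \<epsilon>) =
      (LINT z:cball 0 \<epsilon>|lebesgue. cmod (g' z - g' 0)) / measure lebesgue (cball (0 :: complex) \<epsilon>)"
    using eventually_small
  proof eventually_elim
    case (elim \<epsilon>)
    have "(LINT z:cball 0 \<epsilon>|lebesgue. cmod (g z - g 0)) = (LINT z:cball 0 \<epsilon>|lebesgue. cmod (g' z - g' 0))"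
      by (rule set_lebesgue_integral_cong) (use elim assms(2) in auto)
    then show ?case by simp
  qed
qed

lemma locally_integrable_cball:
  assumes "locally_integrable g" "\<epsilon> < 1"
  shows "set_integrable lebesgue (cball 0 \<epsilon>) (\<lambda>z. cmod (g z - c))"
proof -
  have "set_integrable lebesgue (cball 0 \<epsilon>) g"
  proof -
    have "cball 0 \<epsilon> \<subseteq> ball (0 :: complex) 1" using assms(2) by auto
    then show ?thesis using assms(1) compact_cball unfolding locally_integrable_def by blast
  qed
  moreover have "set_integrable lebesgue (cball 0 \<epsilon>) (\<lambda>z. c)"
    by (rule absolutely_integrable_on_const) (simp add: lmeasurable_cball)
  ultimately have "set_integrable lebesgue (cball 0 \<epsilon>) (\<lambda>z. g z - c)"
    by (rule set_integral_diff)
  then show ?thesis by (rule set_integrable_norm)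
qed

lemma lebesgue_point_add:
  assumes g: "lebesgue_point g 0" "locally_integrable g" and h: "lebesgue_point h 0" "locally_integrable h"
  shows "lebesgue_point (\<lambda>z. g z + h z) 0"
  unfolding lebesgue_point_def
proof (rule tendsto_sandwich)
  let ?m = "\<lambda>\<epsilon>. measure lebesgue (cball (0 :: complex) \<epsilon>)"
  let ?I = "\<lambda>g \<epsilon>. LINT z:cball 0 \<epsilon>|lebesgue. cmod (g z - g (0 :: complex))"
  show "\<forall>\<^sub>F \<epsilon> in at_right 0. 0 \<le> (LINT z:cball 0 \<epsilon>|lebesgue. cmod (g z + h z - (g 0 + h 0))) / ?m \<epsilon>"
    by (intro always_eventually allI divide_nonneg_nonneg) (auto simp: set_lebesgue_integral_def)
  show "\<forall>\<^sub>F \<epsilon> in at_right 0. (LINT z:cball 0 \<epsilon>|lebesgue. cmod (g z + h z - (g 0 + h 0))) / ?m \<epsilon> \<le> ?I g \<epsilon> / ?m \<epsilon> + ?I h \<epsilon> / ?m \<epsilon>"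
    using eventually_small
  proof eventually_elim
    case (elim \<epsilon>)
    then have e: "\<epsilon> < 1" by simp
    note i = locally_integrable_cball[OF g(2) e] locally_integrable_cball[OF h(2) e]
    have "(LINT z:cball 0 \<epsilon>|lebesgue. cmod (g z + h z - (g 0 + h 0))) \<le>
        (LINT z:cball 0 \<epsilon>|lebesgue. cmod (g z - g 0) + cmod (h z - h 0))"
    proof (rule set_integral_mono)
      show "set_integrable lebesgue (cball 0 \<epsilon>) (\<lambda>z. cmod (g z + h z - (g 0 + h 0)))"
        by (rule locally_integrable_cball[OF locally_integrable_add[OF g(2) h(2)] e])
      show "set_integrable lebesgue (cball 0 \<epsilon>) (\<lambda>z. cmod (g z - g 0) + cmod (h z - h 0))"
        by (rule set_integral_add(1)[OF i])
      show "cmod (g z + h z - (g 0 + h 0)) \<le> cmod (g z - g 0) + cmod (h z - h 0)" for z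
        by (metis add_diff_add norm_triangle_ineq)
    qed
    also have "\<dots> = ?I g \<epsilon> + ?I h \<epsilon>" by (rule set_integral_add(2)[OF i])
    finally show ?case by (simp add: add_divide_distrib[symmetric] divide_right_mono)
  qed
  show "((\<lambda>\<epsilon>. ?I g \<epsilon> / ?m \<epsilon> + ?I h \<epsilon> / ?m \<epsilon>) \<longlongrightarrow> 0) (at_right 0)"
    using tendsto_add[OF g(1)[unfolded lebesgue_point_def] h(1)[unfolded lebesgue_point_def]] by simp
qed simp

lemma lebesgue_point_scale:
  assumes "lebesgue_point g 0" shows "lebesgue_point (\<lambda>z. c * g z) 0"
proof -
  have "(LINT z:cball 0 \<epsilon>|lebesgue. cmod (c * g z - c * g 0)) = cmod c * (LINT z:cball 0 \<epsilon>|lebesgue. cmod (g z - g 0))" for \<epsilon>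
    by (simp add: right_diff_distrib[symmetric] norm_mult)
  then show ?thesis
    unfolding lebesgue_point_def
    using tendsto_mult_left[OF assms[unfolded lebesgue_point_def], of "cmod c"] by simp
qed

lemma lebesgue_point_continuous:
  assumes c: "continuous_on (ball 0 1) g"
  shows "lebesgue_point g 0"
  unfolding lebesgue_point_def
proof (rule tendstoI)
  fix e :: real assume e: "e > 0"
  have "isCont g 0" using c by (simp add: continuous_on_eq_continuous_at)
  then obtain d where d: "d > 0" "\<And>z. dist z 0 < d \<Longrightarrow> dist (g z) (g 0) < e / 2"
    using e unfolding continuous_at_eps_delta by (metis half_gt_zero)
  have "\<forall>\<^sub>F \<epsilon> in at_right 0. \<epsilon> \<in> {0<..<d}" by (rule eventually_at_right_real[OF d(1)])
  with eventually_small
  show "\<forall>\<^sub>F \<epsilon> in at_right 0. dist ((LINT z:cball 0 \<epsilon>|lebesgue. cmod (g z - g 0)) / measure lebesgue (cball (0 :: complex) \<epsilon>)) 0 < e"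
  proof eventually_elim
    case (elim \<epsilon>)
    let ?m = "measure lebesgue (cball (0 :: complex) \<epsilon>)"
    have m: "?m > 0" using elim by (simp add: measure_lebesgue_cball_complex)
    have le: "(LINT z:cball 0 \<epsilon>|lebesgue. cmod (g z - g 0)) \<le> (LINT z:cball (0 :: complex) \<epsilon>|lebesgue. e / 2)"
    proof (rule set_integral_mono)
      show "set_integrable lebesgue (cball 0 \<epsilon>) (\<lambda>z. cmod (g z - g 0))"
        using elim by (intro locally_integrable_cball locally_integrable_continuous c) auto
      show "set_integrable lebesgue (cball (0 :: complex) \<epsilon>) (\<lambda>z. e / 2)"
        by (rule absolutely_integrable_on_const) (simp add: lmeasurable_cball)
      show "cmod (g z - g 0) \<le> e / 2" if "z \<in> cball 0 \<epsilon>" for z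
        using d(2)[of z] that elim by (auto simp: dist_norm)
    qed
    also have "\<dots> = e / 2 * ?m"
      unfolding set_lebesgue_integral_def by simp
    finally have "(LINT z:cball 0 \<epsilon>|lebesgue. cmod (g z - g 0)) / ?m \<le> e / 2"
      using m by (simp add: divide_simps)
    moreover have "0 \<le> (LINT z:cball 0 \<epsilon>|lebesgue. cmod (g z - g 0)) / ?m"
      by (intro divide_nonneg_nonneg) (auto simp: set_lebesgue_integral_def)
    ultimately have "\<bar>(LINT z:cball 0 \<epsilon>|lebesgue. cmod (g z - g 0)) / ?m\<bar> < e"
      using e unfolding abs_less_iff by linarith
    then show ?case by (simp only: dist_real_def diff_0_right)
  qed
qed

section \<open>Oscillation of area potentials at the origin\<close>

lemma norm_power_diff_scaled:
  fixes x y :: complex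
  assumes "cmod x \<le> 4" "cmod y \<le> 4"
  shows "cmod (x ^ m - y ^ m) \<le> real m * 4 ^ m * cmod (x - y)"
proof -
  \<comment> \<open>The estimate for differences of powers requires modulus at most 1; dividing by 4
    brings both bases there.\<close>
  have "cmod ((x / 4) ^ m - (y / 4) ^ m) \<le> real m * cmod (x / 4 - y / 4)"
    using assms by (intro norm_power_diff) (auto simp: norm_divide)
  then have "4 ^ m * cmod ((x / 4) ^ m - (y / 4) ^ m) \<le> 4 ^ m * (real m * cmod (x / 4 - y / 4))"
    by (rule mult_left_mono) simp
  moreover have "4 ^ m * cmod ((x / 4) ^ m - (y / 4) ^ m) = cmod (x ^ m - y ^ m)"
  proof -
    have "x ^ m - y ^ m = 4 ^ m * ((x / 4) ^ m - (y / 4) ^ m)"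
      by (simp add: right_diff_distrib power_divide)
    then show ?thesis by (simp add: norm_mult norm_power)
  qed
  moreover have "cmod (x / 4 - y / 4) \<le> cmod (x - y)"
    by (simp add: diff_divide_distrib[symmetric] norm_divide)
  then have "4 ^ m * (real m * cmod (x / 4 - y / 4)) \<le> 4 ^ m * (real m * cmod (x - y))"
    by (intro mult_left_mono) auto
  ultimately show ?thesis by (simp add: mult_ac)
qed

text \<open>K - 1 and the reflected kernel minus 1 carry a factor z over a denominator of modulus at
  least |\<zeta> - z|, which gives the 4. The change in X^m is O(|z|), and 1 \<le> 2/|\<zeta> - z|
  brings it to the same form, which gives the 8 m.\<close>

lemma area_kernel_difference:
  assumes z: "cmod z \<le> 1" and \<zeta>: "cmod \<zeta> \<le> 1" "\<zeta> \<noteq> z" "\<zeta> \<noteq> 0"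
  shows "cmod (area_kernel F m z \<zeta> - area_kernel F m 0 \<zeta>) \<le>
    4 ^ m * (4 + 8 * real m) * (cmod (F \<zeta>) * (cmod z * (1 / cmod (\<zeta> - z))))"
proof -
  let ?d = "cmod (\<zeta> - z)" and ?X = "real_excess z \<zeta>" and ?Y = "real_excess 0 \<zeta>"
  have d: "?d > 0" using \<zeta> by simp
  have d2: "?d \<le> 2" using norm_triangle_ineq4[of \<zeta> z] z \<zeta> by linarith
  have k1: "schwarz_kernel z \<zeta> - 1 = 2 * z / (\<zeta> - z)"
    unfolding schwarz_kernel_def using \<zeta> by (simp add: field_simps)
  have n1: "cmod (schwarz_kernel z \<zeta> - 1) \<le> 2 * (cmod z * (1 / ?d))"
    unfolding k1 by (simp add: norm_divide norm_mult)
  have rd: "?d \<le> cmod (1 - z * cnj \<zeta>)" by (rule norm_reflected_denominator[OF z \<zeta>(1)])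
  then have nz: "1 - z * cnj \<zeta> \<noteq> 0" using d by auto
  have k2: "reflected_kernel z \<zeta> - 1 = 2 * (z * cnj \<zeta>) / (1 - z * cnj \<zeta>)"
    unfolding reflected_kernel_def using nz by (simp add: field_simps)
  have "cmod (reflected_kernel z \<zeta> - 1) \<le> 2 * cmod z / ?d"
    unfolding k2 norm_divide using rd d \<zeta>(1)
    by (intro frac_le) (auto simp: norm_mult mult_left_le)
  then have n2: "cmod (reflected_kernel z \<zeta> - 1) \<le> 2 * (cmod z * (1 / ?d))" by simp
  have one: "1 \<le> 2 * (1 / ?d)" using d d2 by (simp add: field_simps)
  have X: "cmod (?X ^ m) \<le> 4 ^ m"
    unfolding norm_power using norm_real_excess_le_4[OF z \<zeta>(1)] by (intro power_mono) auto
  have "?X - ?Y = - (z + cnj z)" by (simp add: real_excess_def)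
  then have "cmod (?X - ?Y) = cmod (z + cnj z)" by (simp only: norm_minus_cancel)
  also have "\<dots> \<le> 2 * cmod z" using norm_triangle_ineq[of z "cnj z"] by simp
  also have "\<dots> \<le> 2 * cmod z * (2 * (1 / ?d))" using mult_left_mono[OF one, of "2 * cmod z"] by simp
  finally have "cmod (?X - ?Y) \<le> 4 * (cmod z * (1 / ?d))" by simp
  then have XX: "cmod (?X ^ m - ?Y ^ m) \<le> real m * 4 ^ m * (4 * (cmod z * (1 / ?d)))"
    using norm_power_diff_scaled[OF norm_real_excess_le_4[OF z \<zeta>(1)] norm_real_excess_le_4[of 0, OF _ \<zeta>(1)], of m]
    by (smt (verit) mult_left_mono mult_nonneg_nonneg norm_zero of_nat_0_le_iff zero_le_power)
  have e: "area_kernel F m z \<zeta> - area_kernel F m 0 \<zeta> =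
      (F \<zeta> * (schwarz_kernel z \<zeta> - 1) + cnj (F \<zeta>) * (reflected_kernel z \<zeta> - 1)) * ?X ^ m +
      (F \<zeta> + cnj (F \<zeta>)) * (?X ^ m - ?Y ^ m)"
    using \<zeta>(3) by (simp add: area_kernel_def schwarz_kernel_def[of 0] reflected_kernel_def[of 0] algebra_simps)
  have a1: "cmod (F \<zeta> * (schwarz_kernel z \<zeta> - 1) + cnj (F \<zeta>) * (reflected_kernel z \<zeta> - 1)) \<le>
      cmod (F \<zeta>) * (2 * (cmod z * (1 / ?d))) + cmod (F \<zeta>) * (2 * (cmod z * (1 / ?d)))"
    by (intro order.trans[OF norm_triangle_ineq] add_mono; unfold norm_mult complex_mod_cnj; intro mult_left_mono n1 n2 norm_ge_zero)
  have a2: "cmod (F \<zeta> + cnj (F \<zeta>)) \<le> 2 * cmod (F \<zeta>)"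
    using norm_triangle_ineq[of "F \<zeta>" "cnj (F \<zeta>)"] by simp
  have "cmod (area_kernel F m z \<zeta> - area_kernel F m 0 \<zeta>) \<le>
      (cmod (F \<zeta>) * (2 * (cmod z * (1 / ?d))) + cmod (F \<zeta>) * (2 * (cmod z * (1 / ?d)))) * 4 ^ m +
      2 * cmod (F \<zeta>) * (real m * 4 ^ m * (4 * (cmod z * (1 / ?d))))"
    unfolding e
  proof (intro order.trans[OF norm_triangle_ineq] add_mono)
    show "cmod ((F \<zeta> * (schwarz_kernel z \<zeta> - 1) + cnj (F \<zeta>) * (reflected_kernel z \<zeta> - 1)) * ?X ^ m) \<le>
        (cmod (F \<zeta>) * (2 * (cmod z * (1 / ?d))) + cmod (F \<zeta>) * (2 * (cmod z * (1 / ?d)))) * 4 ^ m"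
      unfolding norm_mult[of _ "?X ^ m"] by (rule mult_mono[OF a1 X]) auto
    show "cmod ((F \<zeta> + cnj (F \<zeta>)) * (?X ^ m - ?Y ^ m)) \<le> 2 * cmod (F \<zeta>) * (real m * 4 ^ m * (4 * (cmod z * (1 / ?d))))"
      unfolding norm_mult[of "F \<zeta> + cnj (F \<zeta>)"] by (rule mult_mono[OF a2 XX]) auto
  qed
  also have "\<dots> = 4 ^ m * (4 + 8 * real m) * (cmod (F \<zeta>) * (cmod z * (1 / ?d)))"
    by (simp add: distrib_left distrib_right mult_ac)
  finally show ?thesis .
qed

text \<open>Up to a constant, the Riesz potential of order one of the disc of radius
  \<epsilon>.\<close>

definition cball_potential :: "real \<Rightarrow> complex \<Rightarrow> ennreal" where
  "cball_potential \<epsilon> \<zeta> = (\<integral>\<^sup>+z. ennreal (1 / cmod (\<zeta> - z)) * indicator (cball 0 \<epsilon>) z \<partial>lborel)"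

lemma cball_potential_measurable [measurable]: "cball_potential \<epsilon> \<in> borel_measurable borel"
proof -
  have [measurable]: "cball 0 \<epsilon> \<in> sets (borel :: complex measure)" by auto
  have "(\<lambda>\<zeta>. \<integral>\<^sup>+z. ennreal (1 / cmod (\<zeta> - z)) * indicator (cball 0 \<epsilon>) z \<partial>lborel) \<in> borel_measurable borel"
    by (rule lborel.borel_measurable_nn_integral) measurable
  then show ?thesis by (simp only: cball_potential_def[abs_def])
qed

text \<open>The choice \<delta> = \<epsilon> in \<open>nn_integral_inverse_norm_le\<close> makes
  both contributions linear in \<epsilon>. Uniformity in \<zeta> turns this into the majorant for
  letting \<epsilon> tend to 0.\<close>

lemma cball_potential_le:
  assumes "\<epsilon> > 0" shows "cball_potential \<epsilon> \<zeta> * ennreal (1 / \<epsilon>) \<le> ennreal (16 + pi)"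
proof -
  have [measurable]: "cball 0 \<epsilon> \<in> sets (borel :: complex measure)" by auto
  have "cball_potential \<epsilon> \<zeta> \<le> ennreal (16 * \<epsilon>) + ennreal (1 / \<epsilon>) * ennreal (pi * \<epsilon>\<^sup>2)"
    using nn_integral_inverse_norm_le[of "cball 0 \<epsilon>" \<epsilon> \<zeta>] assms
    by (simp add: cball_potential_def measure_lebesgue_cball_complex)
  also have "\<dots> = ennreal ((16 + pi) * \<epsilon>)"
    using assms by (simp add: ennreal_mult[symmetric] ennreal_plus[symmetric] power2_eq_square distrib_right del: ennreal_plus)
  finally have "cball_potential \<epsilon> \<zeta> * ennreal (1 / \<epsilon>) \<le> ennreal ((16 + pi) * \<epsilon>) * ennreal (1 / \<epsilon>)"
    by (rule mult_right_mono) simp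
  also have "\<dots> = ennreal (16 + pi)" using assms by (simp add: ennreal_mult[symmetric] del: ennreal_plus)
  finally show ?thesis .
qed

text \<open>For fixed \<zeta> \<noteq> 0 a small disc stays at distance at least |\<zeta>|/2 from
  \<zeta>, so the potential is of order \<epsilon>^2. This is the pointwise limit that goes with the
  uniform bound.\<close>

lemma cball_potential_le_far:
  assumes \<epsilon>: "\<epsilon> > 0" "2 * \<epsilon> \<le> cmod \<zeta>"
  shows "cball_potential \<epsilon> \<zeta> * ennreal (1 / \<epsilon>) \<le> ennreal (2 * pi / cmod \<zeta> * \<epsilon>)"
proof -
  have [measurable]: "cball 0 \<epsilon> \<in> sets (borel :: complex measure)" by auto
  have s: "cmod \<zeta> > 0" using \<epsilon> by linarith
  have "cball_potential \<epsilon> \<zeta> \<le> (\<integral>\<^sup>+z. ennreal (2 / cmod \<zeta>) * indicator (cball (0 :: complex) \<epsilon>) z \<partial>lborel)"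
    unfolding cball_potential_def
  proof (intro nn_integral_mono)
    fix z :: complex
    show "ennreal (1 / cmod (\<zeta> - z)) * indicator (cball 0 \<epsilon>) z \<le> ennreal (2 / cmod \<zeta>) * indicator (cball 0 \<epsilon>) z"
    proof (cases "z \<in> cball 0 \<epsilon>")
      case True
      then have "cmod (\<zeta> - z) \<ge> cmod \<zeta> / 2" using norm_triangle_ineq2[of \<zeta> z] \<epsilon> by simp
      then have "1 / cmod (\<zeta> - z) \<le> 1 / (cmod \<zeta> / 2)" using s by (intro divide_left_mono) (auto intro!: mult_pos_pos)
      then show ?thesis using True by (simp add: ennreal_leI)
    qed simp
  qed
  also have "\<dots> = ennreal (2 / cmod \<zeta>) * ennreal (pi * \<epsilon>\<^sup>2)"
    using \<epsilon>(1) by (subst nn_integral_cmult) (simp_all add: measure_lebesgue_cball_complex)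
  also have "\<dots> = ennreal (2 * pi / cmod \<zeta> * \<epsilon> * \<epsilon>)"
    by (simp add: ennreal_mult[symmetric] power2_eq_square)
  finally have "cball_potential \<epsilon> \<zeta> * ennreal (1 / \<epsilon>) \<le> ennreal (2 * pi / cmod \<zeta> * \<epsilon> * \<epsilon>) * ennreal (1 / \<epsilon>)"
    by (rule mult_right_mono) simp
  also have "\<dots> = ennreal (2 * pi / cmod \<zeta> * \<epsilon>)" using \<epsilon>(1) by (simp add: ennreal_mult[symmetric])
  finally show ?thesis .
qed

context area_density
begin

lemma area_kernel_origin_le: "cmod (area_kernel F m 0 \<zeta>) \<le> 2 * 4 ^ m * cmod (F \<zeta>)"
proof (cases "\<zeta> \<in> ball 0 1")
  case True
  have k: "cmod (schwarz_kernel 0 \<zeta>) \<le> 1" "reflected_kernel 0 \<zeta> = 1"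
    by (auto simp: schwarz_kernel_def reflected_kernel_def)
  have "cmod (F \<zeta> * schwarz_kernel 0 \<zeta> + cnj (F \<zeta>) * reflected_kernel 0 \<zeta>) \<le> cmod (F \<zeta>) * 1 + cmod (F \<zeta>) * 1"
    using k by (intro order.trans[OF norm_triangle_ineq] add_mono) (auto simp: norm_mult mult_left_le)
  moreover have "cmod (real_excess 0 \<zeta> ^ m) \<le> 4 ^ m"
    unfolding norm_power using True by (intro power_mono norm_real_excess_le_4) auto
  ultimately have "cmod (area_kernel F m 0 \<zeta>) \<le> (cmod (F \<zeta>) * 1 + cmod (F \<zeta>) * 1) * 4 ^ m"
    unfolding area_kernel_def norm_mult[of _ "real_excess 0 \<zeta> ^ m"] by (rule mult_mono) auto
  then show ?thesis by (simp add: mult_ac)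
next
  case False
  then show ?thesis by (simp add: area_kernel_outside)
qed

lemma area_kernel_origin_integrable: "integrable lborel (area_kernel F m 0)"
proof (rule Bochner_Integration.integrable_bound)
  show "integrable lborel (\<lambda>\<zeta>. of_real (2 * 4 ^ m) * F \<zeta>)" using F_integrable by (rule integrable_mult_right)
  show "area_kernel F m 0 \<in> borel_measurable lborel" by measurable
  show "AE \<zeta> in lborel. norm (area_kernel F m 0 \<zeta>) \<le> norm (of_real (2 * 4 ^ m) * F \<zeta>)"
    using area_kernel_origin_le[of m] by (intro AE_I2) (simp add: norm_mult norm_power)
qed

lemma Im_area_potential_origin: "Im (area_potential F m 0) = 0"
proof -
  have "Im (area_potential F m 0) = (LINT \<zeta>|lborel. Im (area_kernel F m 0 \<zeta>))"
    unfolding area_potential_def by (rule integral_Im[OF area_kernel_origin_integrable, symmetric])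
  also have "\<dots> = (LINT \<zeta>|(lborel :: complex measure). (0 :: real))"
  proof (rule Bochner_Integration.integral_cong_AE)
    \<comment> \<open>At \<zeta> = 0 the quotient \<zeta>/\<zeta> is 0 by convention instead of 1,
      so this point is left out.\<close>
    show "AE \<zeta> in lborel. Im (area_kernel F m 0 \<zeta>) = 0"
      using AE_lborel_singleton[of 0]
    proof eventually_elim
      case (elim \<zeta>)
      have "Im (real_excess 0 \<zeta> ^ m) = 0" by (rule Im_power_real) (simp add: real_excess_def)
      then show ?case using elim by (simp add: area_kernel_def schwarz_kernel_def reflected_kernel_def)
    qed
  qed measurable
  finally show ?thesis by simp
qed

text \<open>With an L^1 density the potential need not be continuous at 0. Averaging over the disc
  first replaces 1/|\<zeta> - z| by \<open>cball_potential\<close>, which divided by \<epsilon> is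
  bounded and tends to 0 for \<zeta> \<noteq> 0; dominated convergence against |F| then
  applies.\<close>

lemma lebesgue_point_area_potential: "lebesgue_point (area_potential F m) 0"
proof -
  let ?A = "area_potential F m"
  let ?C = "4 ^ m * (4 + 8 * real m)"
  let ?avg = "\<lambda>\<epsilon>. (LINT z:cball 0 \<epsilon>|lebesgue. cmod (?A z - ?A 0)) / measure lebesgue (cball (0 :: complex) \<epsilon>)"
  have [measurable]: "cball 0 \<epsilon> \<in> sets (borel :: complex measure)" for \<epsilon> by auto
  define Q where "Q \<epsilon> = (\<integral>\<^sup>+\<zeta>. ennreal (cmod (F \<zeta>)) * (cball_potential \<epsilon> \<zeta> * ennreal (1 / \<epsilon>)) \<partial>lborel)" for \<epsilon>
  have finF: "(\<integral>\<^sup>+\<zeta>. ennreal (cmod (F \<zeta>)) \<partial>lborel) < \<infinity>" using F_integrable by (simp add: integrable_iff_bounded)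
  have Q0: "(Q \<longlongrightarrow> 0) (at_right 0)"
    unfolding tendsto_at_iff_sequentially
  proof (intro allI impI)
    fix X :: "nat \<Rightarrow> real" assume X: "\<forall>i. X i \<in> {0<..} - {0}" "X \<longlonglongrightarrow> 0"
    have Xp: "X i > 0" for i using X(1) by auto
    have "(\<lambda>i. \<integral>\<^sup>+\<zeta>. ennreal (cmod (F \<zeta>)) * (cball_potential (X i) \<zeta> * ennreal (1 / X i)) \<partial>lborel) \<longlonglongrightarrow> (\<integral>\<^sup>+\<zeta>. 0 \<partial>(lborel :: complex measure))"
    proof (rule nn_integral_dominated_convergence[where w = "\<lambda>\<zeta>. ennreal (cmod (F \<zeta>)) * ennreal (16 + pi)"])
      show "AE \<zeta> in lborel. ennreal (cmod (F \<zeta>)) * (cball_potential (X i) \<zeta> * ennreal (1 / X i)) \<le> ennreal (cmod (F \<zeta>)) * ennreal (16 + pi)" for i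
        by (intro AE_I2 mult_left_mono cball_potential_le Xp) simp
      show "(\<integral>\<^sup>+\<zeta>. ennreal (cmod (F \<zeta>)) * ennreal (16 + pi) \<partial>lborel) < \<infinity>"
        using finF by (subst nn_integral_multc) (auto simp: ennreal_mult_less_top)
      show "AE \<zeta> in lborel. (\<lambda>i. ennreal (cmod (F \<zeta>)) * (cball_potential (X i) \<zeta> * ennreal (1 / X i))) \<longlonglongrightarrow> 0"
        using AE_lborel_singleton[of 0]
      proof eventually_elim
        case (elim \<zeta>)
        have "(\<lambda>i. cmod (F \<zeta>) * (2 * pi / cmod \<zeta> * X i)) \<longlonglongrightarrow> cmod (F \<zeta>) * (2 * pi / cmod \<zeta> * 0)"
          by (intro tendsto_intros X(2))
        then have up: "(\<lambda>i. ennreal (cmod (F \<zeta>) * (2 * pi / cmod \<zeta> * X i))) \<longlonglongrightarrow> 0"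
          using tendsto_ennrealI by fastforce
        have "\<forall>\<^sub>F i in sequentially. X i < cmod \<zeta> / 2"
          using X(2) elim by (intro order_tendstoD(2)) auto
        then have "\<forall>\<^sub>F i in sequentially. ennreal (cmod (F \<zeta>)) * (cball_potential (X i) \<zeta> * ennreal (1 / X i)) \<le> ennreal (cmod (F \<zeta>) * (2 * pi / cmod \<zeta> * X i))"
        proof eventually_elim
          case (elim i)
          then have "cball_potential (X i) \<zeta> * ennreal (1 / X i) \<le> ennreal (2 * pi / cmod \<zeta> * X i)"
            using Xp[of i] by (intro cball_potential_le_far) auto
          then have "ennreal (cmod (F \<zeta>)) * (cball_potential (X i) \<zeta> * ennreal (1 / X i)) \<le> ennreal (cmod (F \<zeta>)) * ennreal (2 * pi / cmod \<zeta> * X i)"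
            by (rule mult_left_mono) simp
          also have "\<dots> = ennreal (cmod (F \<zeta>) * (2 * pi / cmod \<zeta> * X i))"
            using Xp[of i] by (intro ennreal_mult[symmetric]) auto
          finally show ?case .
        qed
        then show ?case by (rule tendsto_sandwich[OF _ _ tendsto_const up, rotated]) simp
      qed
    qed measurable
    then show "(Q \<circ> X) \<longlonglongrightarrow> 0" by (simp add: o_def Q_def)
  qed
  \<comment> \<open>The difference of two potentials is the integral of the difference of the
    kernels only where the kernel is integrable; Fubini provides this for almost every z.\<close>
  have intA: "AE z in lborel. z \<in> ball 0 1 \<longrightarrow> integrable lborel (area_kernel F m z)"
  proof -
    have "integrable (lborel \<Otimes>\<^sub>M lborel) (\<lambda>(z, \<zeta>). area_kernel F m z \<zeta> * indicator (ball 0 1) z)"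
      by (intro area_kernel_joint_integrable[of _ 1]) (auto simp: indicator_def)
    from lborel_pair.AE_integrable_fst[OF this] show ?thesis
      by eventually_elim auto
  qed
  have main: "ennreal (?avg \<epsilon>) \<le> ennreal (?C / pi) * Q \<epsilon>" if \<epsilon>: "0 < \<epsilon>" "\<epsilon> < 1 / 2" for \<epsilon>
  proof -
    have pt: "AE z in lborel. ennreal (cmod (?A z - ?A 0)) * indicator (cball 0 \<epsilon>) z \<le>
        (\<integral>\<^sup>+\<zeta>. ennreal (?C * \<epsilon> * cmod (F \<zeta>)) * (ennreal (1 / cmod (\<zeta> - z)) * indicator (cball 0 \<epsilon>) z) \<partial>lborel)"
      using intA
    proof eventually_elim
      case (elim z)
      show ?case
      proof (cases "z \<in> cball 0 \<epsilon>")
        case True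
        then have z: "z \<in> ball 0 1" "cmod z \<le> 1" "cmod z \<le> \<epsilon>" using \<epsilon> by auto
        have iz: "integrable lborel (area_kernel F m z)" using elim z(1) by blast
        have "?A z - ?A 0 = (LINT \<zeta>|lborel. area_kernel F m z \<zeta> - area_kernel F m 0 \<zeta>)"
          unfolding area_potential_def by (rule Bochner_Integration.integral_diff[OF iz area_kernel_origin_integrable, symmetric])
        then have "ennreal (cmod (?A z - ?A 0)) \<le> (\<integral>\<^sup>+\<zeta>. norm (area_kernel F m z \<zeta> - area_kernel F m 0 \<zeta>) \<partial>lborel)"
          using integral_norm_bound_ennreal[OF Bochner_Integration.integrable_diff[OF iz area_kernel_origin_integrable]] by simp
        also have "\<dots> \<le> (\<integral>\<^sup>+\<zeta>. ennreal (?C * \<epsilon> * cmod (F \<zeta>)) * ennreal (1 / cmod (\<zeta> - z)) \<partial>lborel)"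
        proof (intro nn_integral_mono_AE)
          show "AE \<zeta> in lborel. ennreal (norm (area_kernel F m z \<zeta> - area_kernel F m 0 \<zeta>)) \<le>
              ennreal (?C * \<epsilon> * cmod (F \<zeta>)) * ennreal (1 / cmod (\<zeta> - z))"
            using AE_lborel_singleton[of 0] AE_lborel_singleton[of z]
          proof eventually_elim
            case (elim \<zeta>)
            show ?case
            proof (cases "\<zeta> \<in> ball 0 1")
              case True
              then have "cmod \<zeta> \<le> 1" by simp
              from area_kernel_difference[OF z(2) this elim(2,1), of F m]
              have "norm (area_kernel F m z \<zeta> - area_kernel F m 0 \<zeta>) \<le> ?C * (cmod (F \<zeta>) * (cmod z * (1 / cmod (\<zeta> - z))))" .
              also have "\<dots> \<le> ?C * (cmod (F \<zeta>) * (\<epsilon> * (1 / cmod (\<zeta> - z))))"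
                using z(3) by (intro mult_left_mono mult_right_mono) auto
              also have "\<dots> = (?C * \<epsilon> * cmod (F \<zeta>)) * (1 / cmod (\<zeta> - z))" by (simp only: mult_ac)
              finally have "norm (area_kernel F m z \<zeta> - area_kernel F m 0 \<zeta>) \<le> (?C * \<epsilon> * cmod (F \<zeta>)) * (1 / cmod (\<zeta> - z))" .
              then have "ennreal (norm (area_kernel F m z \<zeta> - area_kernel F m 0 \<zeta>)) \<le> ennreal ((?C * \<epsilon> * cmod (F \<zeta>)) * (1 / cmod (\<zeta> - z)))"
                by (rule ennreal_leI)
              also have "\<dots> = ennreal (?C * \<epsilon> * cmod (F \<zeta>)) * ennreal (1 / cmod (\<zeta> - z))"
                using \<epsilon> by (intro ennreal_mult) auto
              finally show ?thesis .
            next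
              case False
              then show ?thesis by (simp only: area_kernel_outside[OF False] diff_self norm_zero ennreal_0 zero_le)
            qed
          qed
        qed
        finally show ?thesis using True by simp
      next
        case False
        then show ?thesis by (simp add: indicator_def)
      qed
    qed
    have ind: "(LINT z:cball 0 \<epsilon>|lebesgue. cmod (?A z - ?A 0)) = (LINT z|lborel. cmod (?A z - ?A 0) * indicator (cball 0 \<epsilon>) z)"
    proof -
      have "(\<lambda>z. indicator (cball 0 \<epsilon>) z *\<^sub>R cmod (?A z - ?A 0)) \<in> borel_measurable lborel" by measurable
      from integral_completion[OF this] show ?thesis
        by (simp add: set_lebesgue_integral_def mult.commute)
    qed
    have iI: "integrable lborel (\<lambda>z. cmod (?A z - ?A 0) * indicator (cball 0 \<epsilon>) z)"
    proof -
      have "set_integrable lebesgue (cball 0 \<epsilon>) (\<lambda>z. cmod (?A z - ?A 0))"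
        using \<epsilon> by (intro locally_integrable_cball area_potential_locally_integrable) simp
      moreover have "(\<lambda>z. indicator (cball 0 \<epsilon>) z *\<^sub>R cmod (?A z - ?A 0)) \<in> borel_measurable lborel" by measurable
      ultimately show ?thesis unfolding set_integrable_def by (simp add: integrable_completion mult.commute)
    qed
    have "ennreal (LINT z:cball 0 \<epsilon>|lebesgue. cmod (?A z - ?A 0)) = (\<integral>\<^sup>+z. ennreal (cmod (?A z - ?A 0) * indicator (cball 0 \<epsilon>) z) \<partial>lborel)"
      unfolding ind by (rule nn_integral_eq_integral[OF iI, symmetric]) simp
    also have "\<dots> = (\<integral>\<^sup>+z. ennreal (cmod (?A z - ?A 0)) * indicator (cball 0 \<epsilon>) z \<partial>lborel)"
      by (intro nn_integral_cong) (simp add: indicator_def)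
    also have "\<dots> \<le> (\<integral>\<^sup>+z. \<integral>\<^sup>+\<zeta>. ennreal (?C * \<epsilon> * cmod (F \<zeta>)) * (ennreal (1 / cmod (\<zeta> - z)) * indicator (cball 0 \<epsilon>) z) \<partial>lborel \<partial>lborel)"
      by (rule nn_integral_mono_AE[OF pt])
    also have "\<dots> = (\<integral>\<^sup>+\<zeta>. \<integral>\<^sup>+z. ennreal (?C * \<epsilon> * cmod (F \<zeta>)) * (ennreal (1 / cmod (\<zeta> - z)) * indicator (cball 0 \<epsilon>) z) \<partial>lborel \<partial>lborel)"
      by (rule lborel_pair.Fubini'[symmetric]) measurable
    also have "\<dots> = (\<integral>\<^sup>+\<zeta>. ennreal (?C * \<epsilon> * cmod (F \<zeta>)) * cball_potential \<epsilon> \<zeta> \<partial>lborel)"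
      unfolding cball_potential_def by (intro nn_integral_cong nn_integral_cmult) measurable
    \<comment> \<open>One \<epsilon> comes from |z| \<le> \<epsilon> in the kernel difference. The
      second is borrowed to normalise the potential, so that \<epsilon> * \<epsilon> cancels against
      the area \<pi> \<epsilon>^2.\<close>
    also have "\<dots> = (\<integral>\<^sup>+\<zeta>. ennreal (?C * \<epsilon> * \<epsilon>) * (ennreal (cmod (F \<zeta>)) * (cball_potential \<epsilon> \<zeta> * ennreal (1 / \<epsilon>))) \<partial>lborel)"
    proof (intro nn_integral_cong)
      fix \<zeta>
      have C0: "0 \<le> ?C * \<epsilon> * \<epsilon>" "0 \<le> 1 / \<epsilon>" using \<epsilon> by auto
      have "?C * \<epsilon> * cmod (F \<zeta>) = ?C * \<epsilon> * \<epsilon> * (1 / \<epsilon>) * cmod (F \<zeta>)" using \<epsilon> by simp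
      then have "ennreal (?C * \<epsilon> * cmod (F \<zeta>)) = ennreal (?C * \<epsilon> * \<epsilon>) * ennreal (1 / \<epsilon>) * ennreal (cmod (F \<zeta>))"
        by (simp only: ennreal_mult[OF mult_nonneg_nonneg[OF C0] norm_ge_zero] ennreal_mult[OF C0])
      then show "ennreal (?C * \<epsilon> * cmod (F \<zeta>)) * cball_potential \<epsilon> \<zeta> = ennreal (?C * \<epsilon> * \<epsilon>) * (ennreal (cmod (F \<zeta>)) * (cball_potential \<epsilon> \<zeta> * ennreal (1 / \<epsilon>)))"
        by (simp only: mult.assoc mult.commute mult.left_commute)
    qed
    also have "\<dots> = ennreal (?C * \<epsilon> * \<epsilon>) * Q \<epsilon>"
      unfolding Q_def by (rule nn_integral_cmult) measurable
    finally have fin: "ennreal (LINT z:cball 0 \<epsilon>|lebesgue. cmod (?A z - ?A 0)) \<le> ennreal (?C * \<epsilon> * \<epsilon>) * Q \<epsilon>" .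
    have I0: "0 \<le> (LINT z:cball 0 \<epsilon>|lebesgue. cmod (?A z - ?A 0))" by (simp add: set_lebesgue_integral_def)
    have "ennreal (?avg \<epsilon>) = ennreal (LINT z:cball 0 \<epsilon>|lebesgue. cmod (?A z - ?A 0)) * ennreal (1 / (pi * \<epsilon>\<^sup>2))"
    proof -
      have "measure lebesgue (cball (0 :: complex) \<epsilon>) = pi * \<epsilon>\<^sup>2"
        using \<epsilon> by (simp only: measure_lebesgue_cball_complex less_imp_le)
      then have "?avg \<epsilon> = (LINT z:cball 0 \<epsilon>|lebesgue. cmod (?A z - ?A 0)) * (1 / (pi * \<epsilon>\<^sup>2))"
        by (simp only: times_divide_eq_right mult_1_right)
      then show ?thesis by (simp only: ennreal_mult[OF I0] divide_nonneg_nonneg mult_nonneg_nonneg zero_le_power2 pi_ge_zero zero_le_one)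
    qed
    also have "\<dots> \<le> ennreal (?C * \<epsilon> * \<epsilon>) * Q \<epsilon> * ennreal (1 / (pi * \<epsilon>\<^sup>2))" by (rule mult_right_mono[OF fin]) simp
    also have "\<dots> = (ennreal (?C * \<epsilon> * \<epsilon>) * ennreal (1 / (pi * \<epsilon>\<^sup>2))) * Q \<epsilon>" by (simp only: mult_ac)
    also have "ennreal (?C * \<epsilon> * \<epsilon>) * ennreal (1 / (pi * \<epsilon>\<^sup>2)) = ennreal (?C / pi)"
      using \<epsilon> by (simp add: ennreal_mult[symmetric] power2_eq_square)
    finally show ?thesis .
  qed
  have "((\<lambda>\<epsilon>. ennreal (?C / pi) * Q \<epsilon>) \<longlongrightarrow> ennreal (?C / pi) * 0) (at_right 0)"
    by (rule ennreal_tendsto_cmult[OF _ Q0]) simp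
  then have up: "((\<lambda>\<epsilon>. ennreal (?C / pi) * Q \<epsilon>) \<longlongrightarrow> 0) (at_right 0)" by simp
  have "((\<lambda>\<epsilon>. ennreal (?avg \<epsilon>)) \<longlongrightarrow> ennreal 0) (at_right 0)"
    unfolding ennreal_0
  proof (rule tendsto_sandwich[OF _ _ tendsto_const up])
    show "\<forall>\<^sub>F \<epsilon> in at_right 0. ennreal (?avg \<epsilon>) \<le> ennreal (?C / pi) * Q \<epsilon>"
      using eventually_small by eventually_elim (rule main, auto)
  qed auto
  then show ?thesis
    unfolding lebesgue_point_def
    by (rule tendsto_ennrealD) (auto intro!: always_eventually divide_nonneg_nonneg simp: set_lebesgue_integral_def)
qed

end

section \<open>The solution\<close>

text \<open>The factorials and signs are chosen so that the conjugate derivative of index m + 1 is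
  exactly index m, without constants to carry along.\<close>

definition boundary_term :: "circle_functional \<Rightarrow> real \<Rightarrow> nat \<Rightarrow> complex \<Rightarrow> complex" where
  "boundary_term h c m z = \<i> * (of_real c / fact m * (z + cnj z) ^ m) +
     (-1) ^ m / (2 * of_real pi * fact m) * schwarz_power h m z"

lemma has_dbar_on_boundary_term_0:
  assumes "schwarz_series h" shows "has_dbar_on (boundary_term h c 0) (\<lambda>z. 0) (ball 0 1)"
proof -
  have "has_dbar_on (\<lambda>z. \<i> * of_real c + 1 / (2 * of_real pi) * schwarz_power h 0 z)
      (\<lambda>z. 0 + 1 / (2 * of_real pi) * 0) (ball 0 1)"
    by (intro has_dbar_on_add has_dbar_on_const has_dbar_on_cmult has_dbar_on_schwarz_power_0 assms)
  then show ?thesis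
    by (rule has_dbar_on_cong) (simp_all add: boundary_term_def)
qed

lemma has_dbar_on_boundary_term_Suc:
  assumes "schwarz_series h"
  shows "has_dbar_on (boundary_term h c (Suc m)) (boundary_term h c m) (ball 0 1)"
proof -
  have "has_dbar_on (\<lambda>z. \<i> * (of_real c / fact (Suc m) * (z + cnj z) ^ Suc m) +
        (-1) ^ Suc m / (2 * of_real pi * fact (Suc m)) * schwarz_power h (Suc m) z)
      (\<lambda>z. \<i> * (of_real c / fact (Suc m) * (of_nat (Suc m) * (z + cnj z) ^ m)) +
        (-1) ^ Suc m / (2 * of_real pi * fact (Suc m)) * (- of_nat (Suc m) * schwarz_power h m z)) (ball 0 1)"
    by (intro has_dbar_on_add has_dbar_on_cmult has_dbar_on_add_cnj_power has_dbar_on_schwarz_power_Suc assms)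
  moreover have "x / fact (Suc m) * (of_nat (Suc m) * y) = x / fact m * y"
    "(-1) ^ Suc m / (2 * of_real pi * fact (Suc m)) * (- of_nat (Suc m) * y) = (-1) ^ m / (2 * of_real pi * fact m) * y" for x y :: complex
    by (simp_all add: fact_Suc del: of_nat_Suc)
  ultimately show ?thesis
    by (elim has_dbar_on_cong) (simp_all only: open_ball boundary_term_def)
qed

lemma Im_boundary_term_origin:
  assumes "test_real h" shows "Im (boundary_term h c m 0) = (if m = 0 then c else 0)"
proof -
  have K: "schwarz_kernel 0 (cis t) = 1" for t by (simp add: schwarz_kernel_def)
  have "Im (schwarz_power h m 0) = 0"
    using assms circle_test_power[OF circle_test_cis_excess, of 0 m]
    by (simp add: schwarz_power_def test_real_def K Im_power_real Im_cis_excess)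
  then have "Im (of_real ((-1) ^ m / (2 * pi * fact m)) * schwarz_power h m 0) = 0"
    by (simp only: Im_complex_of_real times_complex.sel mult_zero_left mult_zero_right add_0)
  then show ?thesis
    by (simp add: boundary_term_def power_0_left)
qed

lemma imaginary_bv_boundary_term:
  assumes "g holomorphic_on ball 0 1" "has_distr_bv g u"
  shows "imaginary_bv (boundary_term (Re_distr u) c (Suc m))"
proof -
  have "imaginary_bv (\<lambda>z. \<i> * (of_real c / fact (Suc m) * (z + cnj z) ^ Suc m) +
    of_real ((-1) ^ Suc m / (2 * pi * fact (Suc m))) * schwarz_power (Re_distr u) (Suc m) z)"
  proof (intro imaginary_bv_add imaginary_bv_scale imaginary_bv_schwarz_power[OF assms] imaginary_bv_continuous)
    fix z :: complex
    have "z + cnj z = of_real (2 * Re z)" by (simp add: complex_add_cnj)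
    then have "\<i> * (of_real c / fact (Suc m) * (z + cnj z) ^ Suc m) = \<i> * of_real (c / fact (Suc m) * (2 * Re z) ^ Suc m)"
      by simp
    then show "Re (\<i> * (of_real c / fact (Suc m) * (z + cnj z) ^ Suc m)) = 0" by (simp only: Re_i_times Im_complex_of_real neg_equal_zero minus_zero)
  qed (intro continuous_intros)
  then show ?thesis
    by (rule imaginary_bv_cong) (simp add: boundary_term_def)
qed

lemma boundary_term_0:
  assumes "g holomorphic_on ball 0 1" "has_distr_bv g u" "cmod z < 1"
  shows "boundary_term (Re_distr u) c 0 z = g z + \<i> * of_real (c - Im (g 0))"
  by (simp add: boundary_term_def schwarz_power_def Re_distr_schwarz_kernel[OF assms] right_diff_distrib)

text \<open>Normalised like \<open>boundary_term\<close>. The sign exponent m + 1 becomes n for m =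
  n - 1, and for m = 0 the factor is -1/(2\<pi>), which turns the point mass of the potential into
  f.\<close>

definition area_term :: "(complex \<Rightarrow> complex) \<Rightarrow> nat \<Rightarrow> complex \<Rightarrow> complex" where
  "area_term F m z = of_real ((-1) ^ Suc m / (2 * pi * fact m)) * area_potential F m z"

text \<open>Index 0 is treated like the others, with the real part of the boundary value of
  \<open>h0\<close> as its datum; \<open>schwarz_solution_eq\<close> reconciles this with the
  different shape of that term in the formula.\<close>

definition schwarz_derivative ::
  "nat \<Rightarrow> (nat \<Rightarrow> circle_functional) \<Rightarrow> (nat \<Rightarrow> real) \<Rightarrow> (complex \<Rightarrow> complex) \<Rightarrow> nat \<Rightarrow> complex \<Rightarrow> complex" where
  "schwarz_derivative n h c F k z =
     (\<Sum>j\<in>{k..<n}. boundary_term (h j) (c j) (j - k) z) + area_term F (n - 1 - k) z"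

lemma weak_dbar_boundary_sum:
  assumes "\<And>j. j < n \<Longrightarrow> schwarz_series (h j)" "k < n"
  shows "weak_dbar 1 (\<lambda>z. \<Sum>j\<in>{k..<n}. boundary_term (h j) (c j) (j - k) z)
    (\<lambda>z. \<Sum>j\<in>{Suc k..<n}. boundary_term (h j) (c j) (j - Suc k) z)"
proof -
  \<comment> \<open>The term j = k has exponent 0, is holomorphic and drops out; the others lower
    their index.\<close>
  have "has_dbar_on (\<lambda>z. boundary_term (h k) (c k) 0 z + (\<Sum>j\<in>{Suc k..<n}. boundary_term (h j) (c j) (Suc (j - Suc k)) z))
      (\<lambda>z. 0 + (\<Sum>j\<in>{Suc k..<n}. boundary_term (h j) (c j) (j - Suc k) z)) (ball 0 1)"
    by (intro has_dbar_on_add has_dbar_on_sum has_dbar_on_boundary_term_0 has_dbar_on_boundary_term_Suc)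
      (use assms in auto)
  then have "weak_dbar 1 (\<lambda>z. boundary_term (h k) (c k) 0 z + (\<Sum>j\<in>{Suc k..<n}. boundary_term (h j) (c j) (Suc (j - Suc k)) z))
      (\<lambda>z. 0 + (\<Sum>j\<in>{Suc k..<n}. boundary_term (h j) (c j) (j - Suc k) z))"
    by (rule weak_dbar_classical)
  moreover have "(\<Sum>j\<in>{k..<n}. boundary_term (h j) (c j) (j - k) z) =
      boundary_term (h k) (c k) 0 z + (\<Sum>j\<in>{Suc k..<n}. boundary_term (h j) (c j) (Suc (j - Suc k)) z)" for z
    unfolding sum.atLeast_Suc_lessThan[OF assms(2)]
    by (intro arg_cong2[of _ _ _ _ "(+)"] sum.cong) (simp_all add: Suc_diff_Suc)
  ultimately show ?thesis by simp
qed

lemma continuous_on_boundary_sum: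
  assumes "\<And>j. j < n \<Longrightarrow> schwarz_series (h j)"
  shows "continuous_on (ball 0 1) (\<lambda>z. \<Sum>j\<in>{k..<n}. boundary_term (h j) (c j) (j - k) z)"
proof (intro continuous_on_sum)
  fix j assume "j \<in> {k..<n}"
  then have s: "schwarz_series (h j)" using assms by simp
  show "continuous_on (ball 0 1) (boundary_term (h j) (c j) (j - k))"
    using has_dbar_on_continuous[OF has_dbar_on_boundary_term_0[OF s]]
      has_dbar_on_continuous[OF has_dbar_on_boundary_term_Suc[OF s]]
    by (cases "j - k") auto
qed

context area_density
begin

lemma weak_dbar_area_term_Suc: "weak_dbar 1 (area_term F (Suc m)) (area_term F m)"
proof -
  have "weak_dbar 1 (\<lambda>z. of_real ((-1) ^ Suc (Suc m) / (2 * pi * fact (Suc m))) * area_potential F (Suc m) z)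
      (\<lambda>z. of_real ((-1) ^ Suc (Suc m) / (2 * pi * fact (Suc m))) * (- of_nat (Suc m) * area_potential F m z))"
    by (intro weak_dbar_scale weak_dbar_area_potential_Suc)
  moreover have "(-1) ^ Suc (Suc m) / (2 * pi * fact (Suc m)) * - real (Suc m) = (-1) ^ Suc m / (2 * pi * fact m)"
    by (simp add: fact_Suc del: of_nat_Suc)
  then have "complex_of_real ((-1) ^ Suc (Suc m) / (2 * pi * fact (Suc m)) * - real (Suc m)) = of_real ((-1) ^ Suc m / (2 * pi * fact m))"
    by (rule arg_cong)
  then have "complex_of_real ((-1) ^ Suc (Suc m) / (2 * pi * fact (Suc m))) * - of_nat (Suc m) = of_real ((-1) ^ Suc m / (2 * pi * fact m))"
    unfolding of_real_mult of_real_minus of_real_of_nat_eq .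
  then have "of_real ((-1) ^ Suc (Suc m) / (2 * pi * fact (Suc m))) * (- of_nat (Suc m) * area_potential F m z) = area_term F m z" for z
    unfolding area_term_def mult.assoc[symmetric] by (rule arg_cong)
  ultimately show ?thesis
    by (simp only: area_term_def[abs_def])
qed

lemma weak_dbar_area_term_0:
  assumes "locally_integrable f" "AE z in lebesgue. z \<in> ball 0 1 \<longrightarrow> f z = z * F z"
  shows "weak_dbar 1 (area_term F 0) f"
proof -
  have "weak_dbar 1 (\<lambda>z. of_real ((-1) ^ Suc 0 / (2 * pi * fact 0)) * area_potential F 0 z)
      (\<lambda>z. of_real ((-1) ^ Suc 0 / (2 * pi * fact 0)) * ((- 2 * pi) * f z))"
    by (intro weak_dbar_scale weak_dbar_area_potential_0 assms)
  moreover have "of_real ((-1) ^ Suc 0 / (2 * pi * fact 0)) * ((- 2 * pi) * f z) = f z" for z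
    by simp
  ultimately show ?thesis
    by (simp only: area_term_def[abs_def])
qed

lemma area_term_properties:
  shows "imaginary_bv (area_term F m)" "lebesgue_point (area_term F m) 0"
    "Im (area_term F m 0) = 0" "locally_integrable (area_term F m)"
proof -
  show "imaginary_bv (area_term F m)"
    unfolding area_term_def[abs_def] by (intro imaginary_bv_scale imaginary_bv_area_potential)
  show "lebesgue_point (area_term F m) 0"
    unfolding area_term_def[abs_def] by (intro lebesgue_point_scale lebesgue_point_area_potential)
  show "Im (area_term F m 0) = 0"
    by (simp only: area_term_def times_complex.sel Im_complex_of_real Im_area_potential_origin
        mult_zero_left mult_zero_right add_0)
  show "locally_integrable (area_term F m)"
    unfolding area_term_def[abs_def] by (intro locally_integrable_scale area_potential_locally_integrable)
qed

lemma weak_dbar_schwarz_derivative: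
  assumes "\<And>j. j < n \<Longrightarrow> schwarz_series (h j)" "Suc k < n"
  shows "weak_dbar 1 (schwarz_derivative n h c F k) (schwarz_derivative n h c F (Suc k))"
proof -
  have "n - 1 - k = Suc (n - 1 - Suc k)" using assms(2) by simp
  then show ?thesis
    unfolding schwarz_derivative_def[abs_def]
    by (simp only:) (intro weak_dbar_add weak_dbar_boundary_sum weak_dbar_area_term_Suc; use assms in simp)
qed

lemma weak_dbar_schwarz_derivative_last:
  assumes "\<And>j. j < n \<Longrightarrow> schwarz_series (h j)" "Suc k = n"
    and "locally_integrable f" "AE z in lebesgue. z \<in> ball 0 1 \<longrightarrow> f z = z * F z"
  shows "weak_dbar 1 (schwarz_derivative n h c F k) f"
proof -
  have "weak_dbar 1 (\<lambda>z. (\<Sum>j\<in>{k..<n}. boundary_term (h j) (c j) (j - k) z) + area_term F 0 z)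
      (\<lambda>z. (\<Sum>j\<in>{Suc k..<n}. boundary_term (h j) (c j) (j - Suc k) z) + f z)"
    by (intro weak_dbar_add weak_dbar_boundary_sum weak_dbar_area_term_0 assms) (use assms(2) in simp_all)
  moreover have "n - 1 - k = 0" "{Suc k..<n} = {}" using assms(2) by auto
  ultimately show ?thesis by (simp add: schwarz_derivative_def[abs_def])
qed

lemma lebesgue_point_schwarz_derivative:
  assumes "\<And>j. j < n \<Longrightarrow> schwarz_series (h j)"
  shows "lebesgue_point (schwarz_derivative n h c F k) 0"
  unfolding schwarz_derivative_def[abs_def]
  by (intro lebesgue_point_add lebesgue_point_continuous locally_integrable_continuous
      continuous_on_boundary_sum area_term_properties assms)

lemma Im_schwarz_derivative_origin:
  assumes "\<And>j. j < n \<Longrightarrow> test_real (h j)" "k < n"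
  shows "Im (schwarz_derivative n h c F k 0) = c k"
proof -
  have "(\<Sum>j\<in>{k..<n}. Im (boundary_term (h j) (c j) (j - k) 0)) = (\<Sum>j\<in>{k..<n}. if j = k then c j else 0)"
    by (intro sum.cong) (use assms in \<open>auto simp: Im_boundary_term_origin\<close>)
  then show ?thesis
    using assms(2) by (simp add: schwarz_derivative_def area_term_properties(3))
qed

text \<open>By the Schwarz formula the term j = k equals \<open>g k\<close> plus an imaginary
  constant. Every other term has imaginary boundary value and does not affect the real part.\<close>

lemma has_distr_bv_schwarz_derivative:
  assumes g: "\<And>j. j < n \<Longrightarrow> g j holomorphic_on ball 0 1" and u: "\<And>j. j < n \<Longrightarrow> has_distr_bv (g j) (u j)"
    and k: "k < n"
  shows "\<exists>v. has_distr_bv (schwarz_derivative n (\<lambda>j. Re_distr (u j)) c F k) v \<and> Re_distr v = Re_distr (u k)"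
proof -
  let ?i = "\<i> * of_real (c k - Im (g k 0))"
  let ?S = "\<lambda>z. \<Sum>j\<in>{Suc k..<n}. boundary_term (Re_distr (u j)) (c j) (j - k) z"
  have "imaginary_bv (\<lambda>z. ?i + (?S z + area_term F (n - 1 - k) z))"
  proof (intro imaginary_bv_add imaginary_bv_sum area_term_properties(1))
    show "imaginary_bv (\<lambda>z. ?i)" by (intro imaginary_bv_continuous continuous_intros) simp
    fix j assume "j \<in> {Suc k..<n}"
    then obtain m where "j - k = Suc m" "j < n" by (metis Suc_diff_Suc atLeastLessThan_iff Suc_le_lessD)
    then show "imaginary_bv (boundary_term (Re_distr (u j)) (c j) (j - k))"
      using imaginary_bv_boundary_term[OF g u] by simp
  qed
  from imaginary_bv_perturbation[OF u[OF k] this]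
  obtain v where v: "has_distr_bv (\<lambda>z. g k z + (?i + (?S z + area_term F (n - 1 - k) z))) v" "Re_distr v = Re_distr (u k)"
    by blast
  have "g k z + (?i + (?S z + area_term F (n - 1 - k) z)) = schwarz_derivative n (\<lambda>j. Re_distr (u j)) c F k z"
    if "cmod z < 1" for z
    unfolding schwarz_derivative_def sum.atLeast_Suc_lessThan[OF k]
    by (simp add: boundary_term_0[OF g[OF k] u[OF k] that])
  with v show ?thesis using has_distr_bv_cong[OF v(1)] by blast
qed

end

text \<open>The given function is Lebesgue measurable only. Its real and imaginary parts, extended
  by zero, agree almost everywhere with Borel functions.\<close>

lemma area_density_representative:
  fixes q :: "complex \<Rightarrow> complex"
  assumes "set_integrable lebesgue (ball 0 1) q"
  obtains F where "area_density F" "AE z in lebesgue. z \<in> ball 0 1 \<longrightarrow> F z = q z"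
proof -
  let ?q = "\<lambda>z. indicator (ball 0 1) z *\<^sub>R q z"
  have i: "integrable lebesgue ?q" using assms by (simp add: set_integrable_def)
  then have "(\<lambda>z. Re (?q z)) \<in> borel_measurable lebesgue" "(\<lambda>z. Im (?q z)) \<in> borel_measurable lebesgue"
    using borel_measurable_integrable[OF i] unfolding borel_measurable_complex_iff by blast+
  from completion_ex_borel_measurable_real[OF this(1)] completion_ex_borel_measurable_real[OF this(2)]
  obtain a b where [measurable]: "a \<in> borel_measurable lborel" "b \<in> borel_measurable lborel"
    and ab: "AE z in lborel. Re (?q z) = a z" "AE z in lborel. Im (?q z) = b z"
    by blast
  define F where "F z = indicator (ball 0 1) z * (of_real (a z) + \<i> * of_real (b z))" for z
  have "(\<lambda>z. of_real (a z) + \<i> * of_real (b z)) \<in> borel_measurable lborel"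
    unfolding borel_measurable_complex_iff by simp
  then have F: "F \<in> borel_measurable lborel"
    unfolding F_def by (intro borel_measurable_times borel_measurable_indicator) auto
  have "AE z in lborel. ?q z = F z"
    using ab by eventually_elim (auto simp: F_def complex_eq_iff indicator_def)
  then have ae: "AE z in lebesgue. ?q z = F z" by (rule AE_completion)
  have "integrable lebesgue F"
    using i ae F by (subst integrable_cong_AE[of _ _ ?q]) (auto intro: measurable_completion)
  then have "integrable lborel F" using integrable_completion[OF F] by simp
  then have "area_density F" by unfold_locales (auto simp: F_def)
  moreover have "AE z in lebesgue. z \<in> ball 0 1 \<longrightarrow> F z = q z"
    using ae by eventually_elim auto
  ultimately show thesis by (rule that)
qed

lemma area_integral_eq_area_potential:
  assumes "area_density F" "set_integrable lebesgue (ball 0 1) q" "AE \<zeta> in lebesgue. \<zeta> \<in> ball 0 1 \<longrightarrow> F \<zeta> = q \<zeta>"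
  shows "(LINT \<zeta>:ball 0 1|lebesgue. area_kernel q m z \<zeta>) = area_potential F m z"
proof -
  interpret area_density F by fact
  let ?q = "\<lambda>\<zeta>. indicator (ball 0 1) \<zeta> *\<^sub>R q \<zeta>"
  have [measurable]: "?q \<in> borel_measurable lebesgue"
    using assms(2) unfolding set_integrable_def by auto
  have K: "(\<lambda>\<zeta>. schwarz_kernel z \<zeta>) \<in> borel_measurable lborel" "(\<lambda>\<zeta>. reflected_kernel z \<zeta>) \<in> borel_measurable lborel"
    "(\<lambda>\<zeta>. real_excess z \<zeta>) \<in> borel_measurable lborel"
    unfolding schwarz_kernel_def reflected_kernel_def real_excess_def by measurable
  note [measurable] = K[THEN measurable_completion]
  have e: "indicator (ball 0 1) \<zeta> *\<^sub>R area_kernel q m z \<zeta> =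
      (?q \<zeta> * schwarz_kernel z \<zeta> + cnj (?q \<zeta>) * reflected_kernel z \<zeta>) * real_excess z \<zeta> ^ m" for \<zeta>
    by (simp add: area_kernel_def indicator_def)
  have [measurable]: "(\<lambda>\<zeta>. cnj (?q \<zeta>)) \<in> borel_measurable lebesgue"
    by (rule measurable_compose[OF _ cnj_measurable]) measurable
  have A: "area_kernel F m z \<in> borel_measurable lborel" by measurable
  have "(LINT \<zeta>:ball 0 1|lebesgue. area_kernel q m z \<zeta>) = (LINT \<zeta>|lebesgue. area_kernel F m z \<zeta>)"
    unfolding set_lebesgue_integral_def
  proof (rule Bochner_Integration.integral_cong_AE)
    show "(\<lambda>\<zeta>. indicator (ball 0 1) \<zeta> *\<^sub>R area_kernel q m z \<zeta>) \<in> borel_measurable lebesgue"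
      unfolding e by measurable
    show "area_kernel F m z \<in> borel_measurable lebesgue" by (rule measurable_completion[OF A])
    show "AE \<zeta> in lebesgue. indicator (ball 0 1) \<zeta> *\<^sub>R area_kernel q m z \<zeta> = area_kernel F m z \<zeta>"
      using assms(3)
    proof eventually_elim
      case (elim \<zeta>)
      show ?case
      proof (cases "\<zeta> \<in> ball 0 1")
        case True
        with elim show ?thesis by (simp add: area_kernel_def)
      next
        case False
        then have "indicator (ball 0 1) \<zeta> = (0 :: real)" by (rule indicator_simps(2))
        then show ?thesis by (simp only: area_kernel_outside[OF False] scaleR_zero_left)
      qed
    qed
  qed
  also have "\<dots> = area_potential F m z"
    unfolding area_potential_def by (rule integral_completion[OF A])
  finally show ?thesis .
qed

lemma schwarz_solution_eq:
  fixes f g :: "complex \<Rightarrow> complex" and u :: circle_functional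
  assumes n: "n \<ge> 1" and g: "g holomorphic_on ball 0 1" and u: "has_distr_bv g u" and z: "cmod z < 1"
    and F: "area_density F" "set_integrable lebesgue (ball 0 1) (\<lambda>\<zeta>. f \<zeta> / \<zeta>)"
      "AE \<zeta> in lebesgue. \<zeta> \<in> ball 0 1 \<longrightarrow> F \<zeta> = f \<zeta> / \<zeta>"
  shows "schwarz_solution n f u h c z = schwarz_derivative n (h(0 := Re_distr u)) c F 0 z"
proof -
  note l = has_distr_bv_linear[OF u holomorphic_on_imp_continuous_on[OF g]]
  have u1: "u (\<lambda>t. 1) = 2 * pi * g 0" using bv_coefficient(1)[OF g u, of 0] by simp
  have I: "Im_distr u (\<lambda>t. 1) = of_real (2 * pi * Im (g 0))"
    using u1 test_linear_zero[OF l] by (simp add: Im_distr_def)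
  have "complex_of_real (Re x) = 1 / 2 * (x + cnj x)" for x
    by (simp add: complex_add_cnj)
  \<comment> \<open>The Poisson kernel is (K + cnj K) / 2. The values 2 g(z) - g(0) and g(0) add up,
    so pairing with it returns g itself, and the constant I of the formula then removes i Im
    g(0).\<close>
  then have "u (\<lambda>t. complex_of_real (poisson (cmod z) (Arg z - t))) =
      1 / 2 * (u (\<lambda>t. schwarz_kernel z (cis t)) + u (\<lambda>t. cnj (schwarz_kernel z (cis t))))"
    unfolding poisson_schwarz_kernel(2)[OF z]
    by (simp only: test_linear_scale[OF l] test_linear_add[OF l] circle_test_add circle_test_cnj circle_test_schwarz_kernel[OF z])
  then have P: "u (\<lambda>t. complex_of_real (poisson (cmod z) (Arg z - t))) = 2 * pi * g z"
    by (simp add: bv_schwarz_kernel[OF g u z] algebra_simps)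
  have B: "boundary_term (Re_distr u) (c 0) 0 z = \<i> * (of_real (c 0) / fact 0 * (z + cnj z) ^ 0)
      - \<i> / (2 * of_real pi) * Im_distr u (\<lambda>t. 1) + 1 / (2 * of_real pi) * u (\<lambda>t. complex_of_real (poisson (cmod z) (Arg z - t)))"
    unfolding I P boundary_term_0[OF g u z] by (simp add: algebra_simps)
  have r: "{0..n - 1} = insert 0 {1..n - 1}" "{0..<n} = insert 0 {1..n - 1}" using n by auto
  have S: "(\<Sum>j\<in>{0..<n}. boundary_term ((h(0 := Re_distr u)) j) (c j) (j - 0) z) =
      boundary_term (Re_distr u) (c 0) 0 z + (\<Sum>j\<in>{1..n - 1}. boundary_term (h j) (c j) j z)"
    unfolding r by simp
  have A: "(LINT \<zeta>:ball 0 1|lebesgue.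
            (f \<zeta> / \<zeta> * ((\<zeta> + z) / (\<zeta> - z)) +
             cnj (f \<zeta>) / cnj \<zeta> * ((1 + z * cnj \<zeta>) / (1 - z * cnj \<zeta>))) *
            (\<zeta> - z + cnj (\<zeta> - z)) ^ (n - 1)) = area_potential F (n - 1) z"
    using area_integral_eq_area_potential[OF F, of "n - 1" z]
    by (simp only: area_kernel_def schwarz_kernel_def reflected_kernel_def real_excess_def complex_cnj_divide)
  \<comment> \<open>Here n \<ge> 1 enters: it matches the sign exponent of \<open>area_term\<close>
    with that of the formula.\<close>
  have "Suc (n - 1) = n" using n by simp
  then have T: "area_term F (n - 1 - 0) z = (-1) ^ n / (2 * complex_of_real pi * fact (n - 1)) * area_potential F (n - 1) z"
    by (simp add: area_term_def)
  show ?thesis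
    unfolding schwarz_solution_def Let_def A poisson_schwarz_kernel(1)[OF z] schwarz_derivative_def S T B r(1)
    by (simp add: boundary_term_def schwarz_power_def cis_excess_def sum.distrib sum_distrib_left algebra_simps)
qed

lemma weak_dbar_cong:
  assumes "weak_dbar k w v" "\<And>z. z \<in> ball 0 1 \<Longrightarrow> w z = w' z"
  shows "weak_dbar k w' v"
proof -
  have "locally_integrable w'"
    using assms unfolding weak_dbar_def locally_integrable_def
    by (metis (no_types, lifting) set_integrable_cong subset_iff)
  moreover have "(LINT z:ball 0 1|lebesgue. w z * \<psi> z) = (LINT z:ball 0 1|lebesgue. w' z * \<psi> z)" for \<psi>
    by (intro set_lebesgue_integral_cong) (use assms(2) in auto)
  ultimately show ?thesis using assms(1) by (simp add: weak_dbar_def)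
qed

text \<open>The area integral has density f(\<zeta>)/\<zeta>, which for a merely integrable f can
  fail to be integrable at the origin; its integrability is assumed alongside that of f.\<close>

theorem theorem2p13:
  fixes n :: nat
    and f h0 :: "complex \<Rightarrow> complex"
    and h :: "nat \<Rightarrow> circle_functional"
    and p c :: "nat \<Rightarrow> real"
  assumes "n \<ge> 1"
    and "set_integrable lebesgue (ball 0 1) f"
    and "set_integrable lebesgue (ball 0 1) (\<lambda>\<zeta>. f \<zeta> / \<zeta>)"
    and "h0 \<in> H_b"
    and "\<And>k. k \<in> {1..n-1} \<Longrightarrow> 1/2 < p k \<and> p k \<le> 1"
    and "\<And>k. k \<in> {1..n-1} \<Longrightarrow> h k \<in> Re_distr ` boundary_values (hardy (p k))"
  shows "solves_schwarz_bvp n f (Re_distr (distr_bv h0)) h c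
           (schwarz_solution n f (distr_bv h0) h c)"
proof -
  obtain F where F: "area_density F" "AE \<zeta> in lebesgue. \<zeta> \<in> ball 0 1 \<longrightarrow> F \<zeta> = f \<zeta> / \<zeta>"
    using area_density_representative[OF assms(3)] .
  interpret area_density F by fact
  \<comment> \<open>At the origin f(\<zeta>)/\<zeta> is 0 by convention and f cannot be recovered
    from it.\<close>
  have "AE \<zeta> in lebesgue. \<zeta> \<noteq> (0 :: complex)" by (intro AE_completion AE_lborel_singleton)
  with F(2) have fF: "AE \<zeta> in lebesgue. \<zeta> \<in> ball 0 1 \<longrightarrow> f \<zeta> = \<zeta> * F \<zeta>"
    by eventually_elim simp
  have lf: "locally_integrable f"
    unfolding locally_integrable_def
    by (intro allI impI set_integrable_subset[OF assms(2)]) (auto intro: fmeasurableD lmeasurable_compact)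
  from assms(4) have h0: "h0 holomorphic_on ball 0 1" "has_distr_bv h0 (distr_bv h0)"
    unfolding H_b_def using distr_bv_eq by auto
  \<comment> \<open>The update at 0 puts the datum of \<open>h0\<close> among the
    \<open>h k\<close>, so that one family of holomorphic functions serves all indices.\<close>
  have "\<exists>g u. g holomorphic_on ball 0 1 \<and> has_distr_bv g u \<and> (h(0 := Re_distr (distr_bv h0))) j = Re_distr u"
    if "j < n" for j
  proof (cases "j = 0")
    case True
    with h0 show ?thesis by auto
  next
    case False
    with that have "h j \<in> Re_distr ` boundary_values (hardy (p j))" by (intro assms(6)) auto
    with False show ?thesis unfolding boundary_values_def hardy_def by auto
  qed
  then obtain g u where g: "\<And>j. j < n \<Longrightarrow> g j holomorphic_on ball 0 1"
    and u: "\<And>j. j < n \<Longrightarrow> has_distr_bv (g j) (u j)"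
    and hu: "\<And>j. j < n \<Longrightarrow> (h(0 := Re_distr (distr_bv h0))) j = Re_distr (u j)"
    by metis
  let ?D = "schwarz_derivative n (\<lambda>j. Re_distr (u j)) c F"
  let ?w = "schwarz_solution n f (distr_bv h0) h c"
  have s: "schwarz_series (Re_distr (u j))" "test_real (Re_distr (u j))" if "j < n" for j
    using schwarz_series_Re_distr[OF g u] Re_distr_real[OF has_distr_bv_linear[OF u holomorphic_on_imp_continuous_on[OF g]]] that
    by blast+
  have w: "?D 0 z = ?w z" if "z \<in> ball 0 1" for z
  proof -
    have "schwarz_derivative n (h(0 := Re_distr (distr_bv h0))) c F 0 z = ?D 0 z"
      unfolding schwarz_derivative_def using hu by (intro arg_cong2[of _ _ _ _ "(+)"] sum.cong) auto
    with schwarz_solution_eq[OF assms(1) h0 _ F(1) assms(3) F(2), of z h c] that show ?thesis by simp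
  qed
  \<comment> \<open>\<open>solves_schwarz_bvp\<close> asks for \<open>W 0 = w\<close> as functions
    on the whole plane, whereas \<open>?D 0\<close> is known to agree with the solution on the disc
    only.\<close>
  define W where "W k = (if k = 0 then ?w else ?D k)" for k
  have W: "?D k z = W k z" if "z \<in> ball 0 1" for k z
    using w that by (simp add: W_def)
  have step: "weak_dbar 1 (W k) (W (Suc k))" if "Suc k < n" for k
    using weak_dbar_cong[OF weak_dbar_schwarz_derivative[OF s(1) that] W] by (simp add: W_def)
  have last: "weak_dbar 1 (W (n - 1)) f"
    using weak_dbar_cong[OF weak_dbar_schwarz_derivative_last[OF s(1) _ lf fF] W] assms(1) by simp
  \<comment> \<open>Contained in the first weak derivative, which is \<open>last\<close> for n = 1
    and the first \<open>step\<close> otherwise.\<close>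
  have lw: "locally_integrable ?w"
    using last step[of 0] assms(1) by (cases "n = 1") (auto simp: weak_dbar_def W_def)
  have wd: "weak_dbar k ?w (W k)" if "k < n" for k
    using that
  proof (induction k)
    case 0
    then show ?case using lw by (simp add: weak_dbar_def W_def)
  next
    case (Suc k)
    then show ?case using weak_dbar_Suc step by simp
  qed
  have wn: "weak_dbar n ?w f"
    using weak_dbar_Suc[OF wd[of "n - 1"] last] assms(1) by simp
  have bv: "\<exists>v. has_distr_bv (W k) v \<and> Re_distr v = (h(0 := Re_distr (distr_bv h0))) k" if k: "k < n" for k
  proof -
    obtain v where v: "has_distr_bv (?D k) v" "Re_distr v = Re_distr (u k)"
      using has_distr_bv_schwarz_derivative[where g = g and u = u, OF g u k] by blast
    with hu[OF k] show ?thesis using has_distr_bv_cong[OF v(1), of "W k"] W by auto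
  qed
  have "lebesgue_point (W k) 0 \<and> Im (W k 0) = c k" if "k < n" for k
    using lebesgue_point_cong[OF lebesgue_point_schwarz_derivative[OF s(1)] W]
      Im_schwarz_derivative_origin[where h = "\<lambda>j. Re_distr (u j)" and n = n and c = c, OF s(2) that] W[of 0 k] by simp
  moreover have "\<exists>v. has_distr_bv ?w v \<and> Re_distr v = Re_distr (distr_bv h0)"
    using bv[of 0] assms(1) by (simp add: W_def)
  moreover have "\<exists>v. has_distr_bv (W k) v \<and> Re_distr v = h k" if "k \<in> {1..n-1}" for k
    using bv[of k] that by auto
  moreover have "W 0 = ?w" by (simp add: W_def)
  ultimately show ?thesis
    unfolding solves_schwarz_bvp_def using wn wd by blast
qed

end
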